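(* Let $d\ge1$ and $a\in\mathbb{C}$, and let $Z_c$ be the Poisson algebra given by the center of the rational Cherednik algebra at $t=0$ of the dihedral group of order $2d$ with constant parameter $a$. If $0\le i<j\le d$, there exists a polynomial $\Phi_{i,j}\in\mathbb{C}[T,T',T'']$, homogeneous of degree $d-3$, such that $$\{\boldsymbol{a}_i,\boldsymbol{a}_j\}=\Pi_{i,j}(\boldsymbol{eu},q,Q)+a^2\,\Phi_{i,j}(\boldsymbol{eu},q,Q).$$
   Context: Let $\zeta\in\mathbb{C}$ be a primitive $d$-th root of unity, $V=\mathbb{C}^2$ with canonical basis $(x,y)$, and $(X,Y)$ the dual basis of $V^*$. For $i\in\mathbb{Z}/d\mathbb{Z}$ let $s_i=\begin{pmatrix}0&\zeta^i\\ \zeta^{-i}&0\end{pmatrix}\in \mathrm{GL}_2(\mathbb{C})$ and $W=\langle s_0,s_1\rangle$, the dihedral group of order $2d$, whose reflections are the $s_i$. It acts by $s_i(x)=\zeta^{-i}y$, $s_i(y)=\zeta^i x$, $s_i(X)=\zeta^iY$, $s_i(Y)=\zeta^{-i}X$. For $\hbar$ an indeterminate, let $H_{\hbar,c}$ be the $\mathbb{C}[\hbar]$-algebra quotient of $\mathbb{C}[\hbar]\otimes(T(V\oplus V^* )\rtimes W)$ by the relations $[x,y]=[X,Y]=0$, $[x,X]=[y,Y]=\hbar-a\sum_i s_i$, $[x,Y]=a\sum_i\zeta^{-i}s_i$, $[y,X]=a\sum_i\zeta^i s_i$ (sums over $i\in\mathbb{Z}/d\mathbb{Z}$), and let $H_c=H_{\hbar,c}/\hbar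 H_{\hbar,c}$. $Z_c$ is the center of $H_c$, with Poisson bracket $\{z,z'\}=\big(\hbar^{-1}[\hat z,\hat z']\big)\bmod \hbar$ for any lifts $\hat z,\hat z'\in H_{\hbar,c}$ of $z,z'\in Z_c$. Multiplication gives a vector space isomorphism $\mathbb{C}[x,y]\otimes\mathbb{C}[X,Y]\otimes\mathbb{C}W\simeq H_c$; identify $\mathbb{C}[x,y]\otimes\mathbb{C}[X,Y]$ with $\mathbb{C}[V\times V^*]$. Let $\mathrm{Trunc}_c:H_c\to\mathbb{C}[V\times V^*]$ be the linear map with $\mathrm{Trunc}_c(fw)=f$ if $w=1$ and $0$ if $w\in W\setminus\{1\}$, for $f\in\mathbb{C}[V\times V^*]$. It is known that $\mathrm{Trunc}_c$ restricts to a linear isomorphism $Z_c\to\mathbb{C}[V\times V^*]^W$, linear over $\mathbb{C}[V]^W\otimes\mathbb{C}[V^*]^W\subset Z_c$. Set $q=xy$, $Q=XY$ (central in $H_c$). The elements $\boldsymbol{eu},\boldsymbol{a}_0,\dots,\boldsymbol{a}_d\in Z_c$ are the unique elements of $Z_c$ with $\mathrm{Trunc}_c(\boldsymbol{eu})=xX+yY$ and $\mathrm{Trunc}_c(\boldsymbol{a}_j)=x^{d-j}Y^j+y^{d-j}X^j$ for $0\le j\le d$. Definition of $\Pi_{i,j}$: on $\mathbb{C}[V\times V^*]=\mathbb{C}[x,y,X,Y]$ take the Poisson bracket with $\{x,X\}=\{y,Y\}=1$ and $\{x,y\}=\{X,Y\}=\{x,Y\}=\{y,X\}=0$. Put $\mathbf{eu}_0=xX+yY$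 and $\mathbf{a}_{i,0}=x^{d-i}Y^i+y^{d-i}X^i$. Then $\Pi_{i,j}\in\mathbb{C}[T,T',T'']$ is the unique polynomial (it is homogeneous of degree $d-1$) with $\{\mathbf{a}_{i,0},\mathbf{a}_{j,0}\}=\Pi_{i,j}(\mathbf{eu}_0,xy,XY)$ in $\mathbb{C}[V\times V^*]$. Equivalently, for $0\le i<j\le d$, $\Pi_{i,j}(\mathbf{eu}_0,q,Q)=j(d-i)q^{d-j}Q^i\,\mathbf{eu}_0^{(j-i-1)}-i(d-j)q^{d-j-1}Q^{i-1}\,\mathbf{eu}_0^{(j-i+1)}$ in $\mathbb{C}[V\times V^*]$, where $\mathbf{eu}_0^{(k)}=(xX)^k+(yY)^k$ (a term with zero coefficient being read as $0$). Polynomials are homogeneous for the grading with $T,T',T''$ of degree $1$; the zero polynomial is homogeneous of every degree (and is the only one of negative degree). *)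

theory Defs
  imports
    "HOL-Analysis.Determinants"
    "HOL-Library.Poly_Mapping"
    "HOL-Library.FuncSet"
    "HOL-Computational_Algebra.Polynomial"
    "HOL-Algebra.Generated_Groups"
    "HOL-Algebra.QuotRing"
begin

section \<open>Polynomials in several variables\<close>

type_synonym 'v mpoly = "('v \<Rightarrow>\<^sub>0 nat) \<Rightarrow>\<^sub>0 complex"

definition const :: "complex \<Rightarrow> 'v mpoly" where
  "const c = Poly_Mapping.single 0 c"

definition var :: "'v \<Rightarrow> 'v mpoly" where
  "var v = Poly_Mapping.single (Poly_Mapping.single v 1) 1"

text \<open>The degree is an integer: for \<open>n < 0\<close> only the zero polynomial is homogeneous of degree
  \<open>n\<close>.\<close>

definition homogeneous :: "int \<Rightarrow> 'v::finite mpoly \<Rightarrow> bool" where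
  "homogeneous n P \<longleftrightarrow>
     (\<forall>m \<in> Poly_Mapping.keys P. int (\<Sum>v\<in>UNIV. Poly_Mapping.lookup m v) = n)"

definition pderiv_var :: "'v \<Rightarrow> 'v mpoly \<Rightarrow> 'v mpoly" where
  "pderiv_var v f = (\<Sum>m \<in> Poly_Mapping.keys f.
     Poly_Mapping.single (m - Poly_Mapping.single v 1)
       (of_nat (Poly_Mapping.lookup m v) * Poly_Mapping.lookup f m))"

section \<open>The Poisson algebra of polynomial functions on \<open>V \<times> V\<^sup>*\<close>\<close>

text \<open>\<open>cx, cy\<close> is the canonical basis \<open>(x, y)\<close> of \<open>V\<close>, and \<open>cX, cY\<close> is its dual basis
  \<open>(X, Y)\<close>.\<close>

datatype coord = cx | cy | cX | cY

definition poisson0 :: "coord mpoly \<Rightarrow> coord mpoly \<Rightarrow> coord mpoly" where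
  "poisson0 f g =
     (pderiv_var cx f * pderiv_var cX g - pderiv_var cX f * pderiv_var cx g)
   + (pderiv_var cy f * pderiv_var cY g - pderiv_var cY f * pderiv_var cy g)"

definition eu0 :: "coord mpoly" where
  "eu0 = var cx * var cX + var cy * var cY"

definition a0 :: "nat \<Rightarrow> nat \<Rightarrow> coord mpoly" where
  "a0 d i = var cx ^ (d - i) * var cY ^ i + var cy ^ (d - i) * var cX ^ i"

text \<open>\<open>T0, T1, T2\<close> are the indeterminates \<open>T, T', T''\<close>.\<close>

datatype tvar = T0 | T1 | T2

lemma UNIV_tvar: "(UNIV :: tvar set) = {T0, T1, T2}"
  using tvar.exhaust by auto

instance tvar :: finite
  by standard (simp add: UNIV_tvar)

definition eval0 ::
  "tvar mpoly \<Rightarrow> coord mpoly \<Rightarrow> coord mpoly \<Rightarrow> coord mpoly \<Rightarrow> coord mpoly" where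
  "eval0 P u v w = (\<Sum>m \<in> Poly_Mapping.keys P.
     const (Poly_Mapping.lookup P m)
       * u ^ Poly_Mapping.lookup m T0 * v ^ Poly_Mapping.lookup m T1
       * w ^ Poly_Mapping.lookup m T2)"

definition Pi_poly :: "nat \<Rightarrow> nat \<Rightarrow> nat \<Rightarrow> tvar mpoly" where
  "Pi_poly d i j =
     (THE P. poisson0 (a0 d i) (a0 d j) = eval0 P eu0 (var cx * var cy) (var cX * var cY))"

section \<open>The dihedral group\<close>

type_synonym mat2 = "complex^2^2"

definition GL2 :: "mat2 monoid" where
  "GL2 = \<lparr>carrier = {A. invertible A}, mult = (**), one = mat 1\<rparr>"

definition primitive_root_of_unity :: "nat \<Rightarrow> complex \<Rightarrow> bool" where
  "primitive_root_of_unity d \<zeta> \<longleftrightarrow> 0 < d \<and> \<zeta> ^ d = 1 \<and> (\<forall>k. 0 < k \<and> k < d \<longrightarrow> \<zeta> ^ k \<noteq> 1)"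

definition reflection :: "complex \<Rightarrow> nat \<Rightarrow> mat2" where
  "reflection \<zeta> i = vector [vector [0, \<zeta> ^ i], vector [inverse (\<zeta> ^ i), 0]]"

definition dihedral :: "complex \<Rightarrow> mat2 set" where
  "dihedral \<zeta> = generate GL2 {reflection \<zeta> 0, reflection \<zeta> 1}"

section \<open>The algebra \<open>\<complex>[\<hbar>] \<otimes> (T(V \<oplus> V\<^sup>*) \<rtimes> W)\<close>\<close>

text \<open>Words form a monoid under concatenation, so that the convolution product of
  \<open>Poly_Mapping\<close> makes finitely supported functions on words a free algebra.\<close>

instantiation list :: (type) monoid_add
begin

definition zero_list :: "'a list" where "zero_list = []"

definition plus_list :: "'a list \<Rightarrow> 'a list \<Rightarrow> 'a list" where "plus_list = (@)"

instance
  by standard (simp_all add: zero_list_def plus_list_def)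

end

text \<open>\<open>\<complex>[\<hbar>] \<otimes> T(V \<oplus> V\<^sup>*)\<close>, the tensor algebra being the free algebra on the basis
  \<open>x, y, X, Y\<close>, and the indeterminate of \<open>complex poly\<close> being \<open>\<hbar>\<close>.\<close>

type_synonym tensor = "coord list \<Rightarrow>\<^sub>0 complex poly"

definition tconst :: "complex poly \<Rightarrow> tensor" where
  "tconst p = Poly_Mapping.single [] p"

definition tword :: "coord list \<Rightarrow> tensor" where
  "tword u = Poly_Mapping.single u 1"

text \<open>The group acts on \<open>V\<close> through matrices acting on columns, and on \<open>V\<^sup>*\<close> by the contragredient
  action \<open>w(\<xi>) = \<xi> \<circ> w\<inverse>\<close>.\<close>

fun act_gen :: "mat2 \<Rightarrow> coord \<Rightarrow> tensor" where
  "act_gen w cx = tconst [:w$1$1:] * tword [cx] + tconst [:w$2$1:] * tword [cy]"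
| "act_gen w cy = tconst [:w$1$2:] * tword [cx] + tconst [:w$2$2:] * tword [cy]"
| "act_gen w cX = (let v = matrix_inv w in
     tconst [:v$1$1:] * tword [cX] + tconst [:v$1$2:] * tword [cY])"
| "act_gen w cY = (let v = matrix_inv w in
     tconst [:v$2$1:] * tword [cX] + tconst [:v$2$2:] * tword [cY])"

lemma tconst_0: "tconst 0 = 0"
  by (simp add: tconst_def)

lemma matrix_inv_reflection:
  assumes "\<zeta> \<noteq> 0"
  shows "matrix_inv (reflection \<zeta> i) = reflection \<zeta> i"
proof -
  let ?s = "reflection \<zeta> i"
  have sq: "?s ** ?s = mat 1"
    using assms by (simp add: reflection_def matrix_matrix_mult_def mat_def vec_eq_iff sum_2 forall_2
      vector_def)
  have inv: "?s ** matrix_inv ?s = mat 1 \<and> matrix_inv ?s ** ?s = mat 1"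
    unfolding matrix_inv_def
    by (rule someI[of "\<lambda>A. ?s ** A = mat 1 \<and> A ** ?s = mat 1", OF conjI[OF sq sq]])
  have "matrix_inv ?s = matrix_inv ?s ** (?s ** ?s)"
    by (simp only: sq matrix_mul_rid)
  also have "\<dots> = ?s"
    by (simp only: matrix_mul_assoc inv matrix_mul_lid)
  finally show ?thesis .
qed

lemma act_gen_reflection:
  assumes "\<zeta> \<noteq> 0"
  shows "act_gen (reflection \<zeta> i) cx = tconst [:inverse (\<zeta> ^ i):] * tword [cy]"
    and "act_gen (reflection \<zeta> i) cy = tconst [:\<zeta> ^ i:] * tword [cx]"
    and "act_gen (reflection \<zeta> i) cX = tconst [:\<zeta> ^ i:] * tword [cY]"
    and "act_gen (reflection \<zeta> i) cY = tconst [:inverse (\<zeta> ^ i):] * tword [cX]"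
  by (simp_all add: matrix_inv_reflection[OF assms] Let_def)
     (simp_all add: reflection_def tconst_0)

definition act :: "mat2 \<Rightarrow> tensor \<Rightarrow> tensor" where
  "act w f = (\<Sum>u \<in> Poly_Mapping.keys f.
     tconst (Poly_Mapping.lookup f u) * prod_list (map (act_gen w) u))"

text \<open>An element \<open>F\<close> of the semidirect product stands for \<open>\<Sum>w\<in>W. F w \<cdot> w\<close>; the product is
  determined by \<open>(f w) (g v) = f w(g) w v\<close>.\<close>

definition smash :: "complex \<Rightarrow> (mat2 \<Rightarrow> tensor) ring" where
  "smash \<zeta> =
     \<lparr>carrier = {F. \<forall>w. w \<notin> dihedral \<zeta> \<longrightarrow> F w = 0},
      mult = (\<lambda>F G u. \<Sum>(w, v) \<in> {(w, v). w \<in> dihedral \<zeta> \<and> v \<in> dihedral \<zeta> \<and> w ** v = u}.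
                F w * act w (G v)),
      one = (\<lambda>u. if u = mat 1 then 1 else 0),
      zero = (\<lambda>_. 0),
      add = (\<lambda>F G u. F u + G u)\<rparr>"

definition sm :: "tensor \<Rightarrow> mat2 \<Rightarrow> (mat2 \<Rightarrow> tensor)" where
  "sm f w = (\<lambda>u. if u = w then f else 0)"

section \<open>The rational Cherednik algebras\<close>

definition commutator :: "('r, 'm) ring_scheme \<Rightarrow> 'r \<Rightarrow> 'r \<Rightarrow> 'r" where
  "commutator R u v = u \<otimes>\<^bsub>R\<^esub> v \<ominus>\<^bsub>R\<^esub> v \<otimes>\<^bsub>R\<^esub> u"

definition refl_sum :: "nat \<Rightarrow> complex \<Rightarrow> (nat \<Rightarrow> complex) \<Rightarrow> (mat2 \<Rightarrow> tensor)" where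
  "refl_sum d \<zeta> k = (\<Oplus>\<^bsub>smash \<zeta>\<^esub> i \<in> {..<d}. sm (tconst [:k i:]) (reflection \<zeta> i))"

text \<open>The relation \<open>u = v\<close> is encoded as the element \<open>u - v\<close>.\<close>

definition cherednik_relations :: "nat \<Rightarrow> complex \<Rightarrow> complex \<Rightarrow> (mat2 \<Rightarrow> tensor) set" where
  "cherednik_relations d \<zeta> a =
     (let R = smash \<zeta>;
          x = sm (tword [cx]) (mat 1); y = sm (tword [cy]) (mat 1);
          X = sm (tword [cX]) (mat 1); Y = sm (tword [cY]) (mat 1);
          h = sm (tconst [:0, 1:]) (mat 1)
      in {commutator R x y,
          commutator R X Y,
          commutator R x X \<ominus>\<^bsub>R\<^esub> (h \<ominus>\<^bsub>R\<^esub> refl_sum d \<zeta> (\<lambda>i. a)),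
          commutator R y Y \<ominus>\<^bsub>R\<^esub> (h \<ominus>\<^bsub>R\<^esub> refl_sum d \<zeta> (\<lambda>i. a)),
          commutator R x Y \<ominus>\<^bsub>R\<^esub> refl_sum d \<zeta> (\<lambda>i. a * inverse (\<zeta> ^ i)),
          commutator R y X \<ominus>\<^bsub>R\<^esub> refl_sum d \<zeta> (\<lambda>i. a * \<zeta> ^ i)})"

definition cherednik_ideal :: "nat \<Rightarrow> complex \<Rightarrow> complex \<Rightarrow> (mat2 \<Rightarrow> tensor) set" where
  "cherednik_ideal d \<zeta> a = genideal (smash \<zeta>) (cherednik_relations d \<zeta> a)"

definition Hh :: "nat \<Rightarrow> complex \<Rightarrow> complex \<Rightarrow> (mat2 \<Rightarrow> tensor) set ring" where
  "Hh d \<zeta> a = smash \<zeta> Quot cherednik_ideal d \<zeta> a"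

definition to_Hh ::
  "nat \<Rightarrow> complex \<Rightarrow> complex \<Rightarrow> (mat2 \<Rightarrow> tensor) \<Rightarrow> (mat2 \<Rightarrow> tensor) set" where
  "to_Hh d \<zeta> a F = cherednik_ideal d \<zeta> a +>\<^bsub>smash \<zeta>\<^esub> F"

definition hbar :: "nat \<Rightarrow> complex \<Rightarrow> complex \<Rightarrow> (mat2 \<Rightarrow> tensor) set" where
  "hbar d \<zeta> a = to_Hh d \<zeta> a (sm (tconst [:0, 1:]) (mat 1))"

definition hbar_ideal :: "nat \<Rightarrow> complex \<Rightarrow> complex \<Rightarrow> (mat2 \<Rightarrow> tensor) set set" where
  "hbar_ideal d \<zeta> a = (\<lambda>h. hbar d \<zeta> a \<otimes>\<^bsub>Hh d \<zeta> a\<^esub> h) ` carrier (Hh d \<zeta> a)"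

definition Hc :: "nat \<Rightarrow> complex \<Rightarrow> complex \<Rightarrow> (mat2 \<Rightarrow> tensor) set set ring" where
  "Hc d \<zeta> a = Hh d \<zeta> a Quot hbar_ideal d \<zeta> a"

definition mod_hbar ::
  "nat \<Rightarrow> complex \<Rightarrow> complex \<Rightarrow> (mat2 \<Rightarrow> tensor) set \<Rightarrow> (mat2 \<Rightarrow> tensor) set set" where
  "mod_hbar d \<zeta> a h = hbar_ideal d \<zeta> a +>\<^bsub>Hh d \<zeta> a\<^esub> h"

definition to_Hc ::
  "nat \<Rightarrow> complex \<Rightarrow> complex \<Rightarrow> (mat2 \<Rightarrow> tensor) \<Rightarrow> (mat2 \<Rightarrow> tensor) set set" where
  "to_Hc d \<zeta> a F = mod_hbar d \<zeta> a (to_Hh d \<zeta> a F)"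

definition scalar :: "nat \<Rightarrow> complex \<Rightarrow> complex \<Rightarrow> complex \<Rightarrow> (mat2 \<Rightarrow> tensor) set set" where
  "scalar d \<zeta> a c = to_Hc d \<zeta> a (sm (tconst [:c:]) (mat 1))"

definition gen :: "nat \<Rightarrow> complex \<Rightarrow> complex \<Rightarrow> coord \<Rightarrow> (mat2 \<Rightarrow> tensor) set set" where
  "gen d \<zeta> a v = to_Hc d \<zeta> a (sm (tword [v]) (mat 1))"

section \<open>The center and its Poisson bracket\<close>

definition Zc :: "nat \<Rightarrow> complex \<Rightarrow> complex \<Rightarrow> (mat2 \<Rightarrow> tensor) set set set" where
  "Zc d \<zeta> a = {z \<in> carrier (Hc d \<zeta> a).
     \<forall>h \<in> carrier (Hc d \<zeta> a). z \<otimes>\<^bsub>Hc d \<zeta> a\<^esub> h = h \<otimes>\<^bsub>Hc d \<zeta> a\<^esub> z}"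

text \<open>\<open>h\<close> below is \<open>\<hbar>\<inverse> [z, z']\<close> for lifts of the two arguments; the class of \<open>h\<close> modulo
  \<open>\<hbar>\<close> does not depend on the lifts.\<close>

definition poisson :: "nat \<Rightarrow> complex \<Rightarrow> complex \<Rightarrow>
    (mat2 \<Rightarrow> tensor) set set \<Rightarrow> (mat2 \<Rightarrow> tensor) set set \<Rightarrow> (mat2 \<Rightarrow> tensor) set set" where
  "poisson d \<zeta> a z z' = (THE p. \<exists>l \<in> carrier (Hh d \<zeta> a). \<exists>l' \<in> carrier (Hh d \<zeta> a).
     \<exists>h \<in> carrier (Hh d \<zeta> a).
       mod_hbar d \<zeta> a l = z \<and> mod_hbar d \<zeta> a l' = z' \<and>
       hbar d \<zeta> a \<otimes>\<^bsub>Hh d \<zeta> a\<^esub> h = commutator (Hh d \<zeta> a) l l' \<and>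
       p = mod_hbar d \<zeta> a h)"

section \<open>Truncation\<close>

text \<open>\<open>pbw d \<zeta> a f w\<close> is the image of \<open>f \<otimes> w\<close> under the multiplication map
  \<open>\<complex>[x,y] \<otimes> \<complex>[X,Y] \<otimes> \<complex>W \<rightarrow> H\<^sub>c\<close>.\<close>

definition ordered_word :: "(coord \<Rightarrow>\<^sub>0 nat) \<Rightarrow> coord list" where
  "ordered_word m =
     replicate (Poly_Mapping.lookup m cx) cx @ replicate (Poly_Mapping.lookup m cy) cy @
     replicate (Poly_Mapping.lookup m cX) cX @ replicate (Poly_Mapping.lookup m cY) cY"

definition pbw ::
  "nat \<Rightarrow> complex \<Rightarrow> complex \<Rightarrow> coord mpoly \<Rightarrow> mat2 \<Rightarrow> (mat2 \<Rightarrow> tensor) set set" where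
  "pbw d \<zeta> a f w = to_Hc d \<zeta> a (sm
     (\<Sum>m \<in> Poly_Mapping.keys f. tconst [:Poly_Mapping.lookup f m:] * tword (ordered_word m)) w)"

text \<open>\<open>extensional\<close> fixes the values outside the carrier, where a linear map on \<open>H\<^sub>c\<close> is not
  determined.\<close>

definition Trunc :: "nat \<Rightarrow> complex \<Rightarrow> complex \<Rightarrow> (mat2 \<Rightarrow> tensor) set set \<Rightarrow> coord mpoly" where
  "Trunc d \<zeta> a = (THE t. t \<in> extensional (carrier (Hc d \<zeta> a)) \<and>
     (\<forall>h \<in> carrier (Hc d \<zeta> a). \<forall>h' \<in> carrier (Hc d \<zeta> a).
        t (h \<oplus>\<^bsub>Hc d \<zeta> a\<^esub> h') = t h + t h') \<and>
     (\<forall>c. \<forall>h \<in> carrier (Hc d \<zeta> a).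
        t (scalar d \<zeta> a c \<otimes>\<^bsub>Hc d \<zeta> a\<^esub> h) = const c * t h) \<and>
     (\<forall>f. \<forall>w \<in> dihedral \<zeta>. t (pbw d \<zeta> a f w) = (if w = mat 1 then f else 0)))"

section \<open>Distinguished central elements\<close>

definition qelt :: "nat \<Rightarrow> complex \<Rightarrow> complex \<Rightarrow> (mat2 \<Rightarrow> tensor) set set" where
  "qelt d \<zeta> a = gen d \<zeta> a cx \<otimes>\<^bsub>Hc d \<zeta> a\<^esub> gen d \<zeta> a cy"

definition Qelt :: "nat \<Rightarrow> complex \<Rightarrow> complex \<Rightarrow> (mat2 \<Rightarrow> tensor) set set" where
  "Qelt d \<zeta> a = gen d \<zeta> a cX \<otimes>\<^bsub>Hc d \<zeta> a\<^esub> gen d \<zeta> a cY"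

definition eu :: "nat \<Rightarrow> complex \<Rightarrow> complex \<Rightarrow> (mat2 \<Rightarrow> tensor) set set" where
  "eu d \<zeta> a = (THE z. z \<in> Zc d \<zeta> a \<and> Trunc d \<zeta> a z = eu0)"

definition aelt :: "nat \<Rightarrow> complex \<Rightarrow> complex \<Rightarrow> nat \<Rightarrow> (mat2 \<Rightarrow> tensor) set set" where
  "aelt d \<zeta> a j = (THE z. z \<in> Zc d \<zeta> a \<and> Trunc d \<zeta> a z = a0 d j)"

definition evalc :: "nat \<Rightarrow> complex \<Rightarrow> complex \<Rightarrow> tvar mpoly \<Rightarrow>
    (mat2 \<Rightarrow> tensor) set set \<Rightarrow> (mat2 \<Rightarrow> tensor) set set \<Rightarrow> (mat2 \<Rightarrow> tensor) set set \<Rightarrow>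
    (mat2 \<Rightarrow> tensor) set set" where
  "evalc d \<zeta> a P u v w = (\<Oplus>\<^bsub>Hc d \<zeta> a\<^esub> m \<in> Poly_Mapping.keys P.
     scalar d \<zeta> a (Poly_Mapping.lookup P m)
       \<otimes>\<^bsub>Hc d \<zeta> a\<^esub> u [^]\<^bsub>Hc d \<zeta> a\<^esub> Poly_Mapping.lookup m T0
       \<otimes>\<^bsub>Hc d \<zeta> a\<^esub> v [^]\<^bsub>Hc d \<zeta> a\<^esub> Poly_Mapping.lookup m T1
       \<otimes>\<^bsub>Hc d \<zeta> a\<^esub> w [^]\<^bsub>Hc d \<zeta> a\<^esub> Poly_Mapping.lookup m T2)"

end

theory Submission
  imports Defs
begin

text \<open>\<open>H\<^sub>c\<close> and its deformation over \<open>\<complex>[\<hbar>]\<close> act on a free module with basis the PBW monomials: \<open>x, y\<close>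
  and the group act as multiplication in the semidirect product, \<open>X, Y\<close> are forced by the
  commutation relations. This action is faithful, \<open>Trunc\<close> is read off from the value at the vector
  \<open>1\<close>, and commutators of operators give the Poisson bracket.

  Up to binomial factors the \<open>a_j\<close> are the coefficients of \<open>(x + t Y)^d + (y + t X)^d\<close>, so
  \<open>{\<cdot>, Q}\<close> and \<open>{q, \<cdot>}\<close> raise and lower the index \<open>j\<close>. Comparing degrees, weights and
  leading terms, and using an automorphism that changes the sign of every \<open>a_j\<close> and fixes \<open>eu, q, Q\<close>,
  one finds \<open>eu a_i = q a_(i+1) + Q a_(i-1)\<close> and
  \<open>a_0 a_2 - a_1^2 = (eu^2 - 4qQ + \<kappa>) q^(d-2)\<close> with a constant \<open>\<kappa>\<close> that vanishes for \<open>a = 0\<close>.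
  Together with \<open>{a_0, a_1} = 2d q^(d-1)\<close> these relations determine all \<open>{a_i, a_j}\<close> by a recursion
  whose solution is affine in \<open>\<kappa>\<close>. The undeformed \<open>a_{i,0}\<close> satisfy the same relations with
  \<open>\<kappa> = 0\<close>, so the constant part is \<open>\<Pi>_{i,j}\<close> and the linear part, of degree \<open>d - 3\<close>, gives
  \<open>\<Phi>_{i,j}\<close> after division of \<open>\<kappa>\<close> by \<open>a^2\<close>.\<close>

section \<open>Evaluation of finitely supported functions\<close>

text \<open>The objects of the statement are cosets of cosets picked out by \<open>THE\<close>. A
  faithful representation in a type with a ring instance makes them computable; faithfulness is the
  PBW theorem, and it also gives the existence and uniqueness behind \<open>Trunc\<close>, the
  division by \<open>\<hbar>\<close>, \<open>eu\<close> and \<open>aelt\<close>. Under the bracket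
  q, eu, Q span a copy of sl_2, and the a_j form one string starting at a_0, which {q, -}
  annihilates. So a relation is verified at one end of the string: bracketing with Q carries it
  along, and bracketing with q removes corrections that survive counting. The counting works because
  a correction has fewer letters X, Y than the leading term, while the number of x, y minus the
  number of X, Y is fixed; its total degree is therefore smaller. The sign automorphism, together
  with the swap of x and y, then leaves only one or two free coefficients. The constant \<kappa> is
  never computed: its vanishing for a = 0 is all that division by a^2 requires. It stands where the
  recursion has the quadratic Casimir eu^2 - 4qQ, whence degree d - 3 in place of d - 1.\<close>

lemma poly_mapping_sum_single:
  fixes f :: "'i \<Rightarrow>\<^sub>0 'c::comm_monoid_add"
  assumes "finite A" "Poly_Mapping.keys f \<subseteq> A"
  shows "f = (\<Sum>k\<in>A. Poly_Mapping.single k (Poly_Mapping.lookup f k))"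
proof (rule poly_mapping_eqI)
  fix i
  have "Poly_Mapping.lookup f i = (\<Sum>k\<in>A. (Poly_Mapping.lookup f k when k = i))"
  proof (cases "i \<in> A")
    case True
    then have "(\<Sum>k\<in>A. (Poly_Mapping.lookup f k when k = i)) = (Poly_Mapping.lookup f i)"
      using assms(1) by (simp add: when_def sum.delta)
    then show ?thesis by simp
  next
    case False
    then have "Poly_Mapping.lookup f i = 0"
      using assms(2) by (metis in_keys_iff subsetD)
    moreover have "(\<Sum>k\<in>A. (Poly_Mapping.lookup f k when k = i)) = 0"
      by (rule sum.neutral) (use False in \<open>auto simp: when_def\<close>)
    ultimately show ?thesis by simp
  qed
  then show "Poly_Mapping.lookup f i
      = Poly_Mapping.lookup (\<Sum>k\<in>A. Poly_Mapping.single k (Poly_Mapping.lookup f k)) i"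
    by (simp add: lookup_sum lookup_single)
qed

lemma poly_mapping_induct_single [case_names zero single add]:
  fixes f :: "'i \<Rightarrow>\<^sub>0 'c::comm_monoid_add"
  assumes "P 0" "\<And>k c. P (Poly_Mapping.single k c)" "\<And>f g. P f \<Longrightarrow> P g \<Longrightarrow> P (f + g)"
  shows "P f"
proof -
  have "P (\<Sum>k\<in>A. Poly_Mapping.single k (Poly_Mapping.lookup f k))" if "finite A" for A
    using that by induction (auto intro: assms)
  then show ?thesis
    by (metis finite_keys order_refl poly_mapping_sum_single)
qed

text \<open>The linear extension of a map on the basis. Its instances are the group action on the
  tensor algebra, the representation by operators, PBW expansions and the evaluation of polynomials.
  Under \<open>pm_hom\<close> it is multiplicative; there only coefficients and basis elements have
  to commute with each other, so the target may be noncommutative.\<close>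

definition pm_eval :: "('c::zero \<Rightarrow> 'r::semiring_1) \<Rightarrow> ('i \<Rightarrow> 'r) \<Rightarrow> ('i \<Rightarrow>\<^sub>0 'c) \<Rightarrow> 'r" where
  "pm_eval s m f = (\<Sum>k\<in>Poly_Mapping.keys f. s (Poly_Mapping.lookup f k) * m k)"

locale pm_additive =
  fixes s :: "'c::comm_monoid_add \<Rightarrow> 'r::ring_1" and m :: "'i \<Rightarrow> 'r"
  assumes s_zero [simp]: "s 0 = 0" and s_add: "s (c + c') = s c + s c'"
begin

lemma pm_eval_superset:
  assumes "finite A" "Poly_Mapping.keys f \<subseteq> A"
  shows "pm_eval s m f = (\<Sum>k\<in>A. s (Poly_Mapping.lookup f k) * m k)"
  unfolding pm_eval_def
  by (rule sum.mono_neutral_left) (use assms in \<open>auto simp: in_keys_iff\<close>)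

lemma pm_eval_zero [simp]: "pm_eval s m 0 = 0"
  by (simp add: pm_eval_def)

lemma pm_eval_single [simp]: "pm_eval s m (Poly_Mapping.single k c) = s c * m k"
  by (cases "c = 0") (simp_all add: pm_eval_def)

lemma pm_eval_add: "pm_eval s m (f + g) = pm_eval s m f + pm_eval s m g"
proof -
  let ?A = "Poly_Mapping.keys f \<union> Poly_Mapping.keys g"
  have "finite ?A" "Poly_Mapping.keys (f + g) \<subseteq> ?A" "Poly_Mapping.keys f \<subseteq> ?A" "Poly_Mapping.keys g \<subseteq> ?A"
    using Poly_Mapping.keys_add[of f g] by auto
  then show ?thesis
    by (simp add: pm_eval_superset[of ?A] lookup_add s_add distrib_right sum.distrib)
qed

end

locale pm_hom = pm_additive s m
  for s :: "'c::semiring_1 \<Rightarrow> 'r::ring_1" and m :: "'i::monoid_add \<Rightarrow> 'r" +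
  assumes s_one [simp]: "s 1 = 1" and s_mult: "s (c * c') = s c * s c'"
    and m_zero [simp]: "m 0 = 1" and m_add: "m (i + j) = m i * m j"
    and s_m_commute: "m i * s c = s c * m i"
begin

lemma pm_eval_one [simp]: "pm_eval s m 1 = 1"
  by (simp flip: single_one)

lemma pm_eval_mult: "pm_eval s m (f * g) = pm_eval s m f * pm_eval s m g"
proof (induction f rule: poly_mapping_induct_single)
  case (single k c)
  show ?case
  proof (induction g rule: poly_mapping_induct_single)
    case (single l e)
    show ?case
      by (simp add: mult_single s_mult m_add mult.assoc)
        (simp add: mult.assoc[symmetric] s_m_commute)
  qed (simp_all add: distrib_left pm_eval_add)
qed (simp_all add: distrib_right pm_eval_add)

lemma pm_eval_power: "pm_eval s m (f ^ n) = pm_eval s m f ^ n"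
  by (induction n) (simp_all add: pm_eval_mult)

end

section \<open>Polynomials in several variables\<close>

lemma const_add: "const (b + c) = const b + const c"
  by (simp add: const_def single_add)

lemma const_mult: "const (b * c) = const b * const c"
  by (simp add: const_def mult_single)

lemma const_0 [simp]: "const 0 = 0"
  by (simp add: const_def)

lemma const_1 [simp]: "const 1 = 1"
  by (simp add: const_def)

lemma var_power: "var v ^ n = Poly_Mapping.single (Poly_Mapping.single v n) 1"
proof (induction n)
  case 0
  then show ?case by simp
next
  case (Suc n)
  then show ?case by (simp add: var_def mult_single flip: single_add)
qed

lemma mpoly_induct [case_names const var add mult]:
  fixes P :: "'v mpoly \<Rightarrow> bool"
  assumes const: "\<And>c. P (const c)" and var: "\<And>v. P (var v)"
    and add: "\<And>f g. P f \<Longrightarrow> P g \<Longrightarrow> P (f + g)" and mult: "\<And>f g. P f \<Longrightarrow> P g \<Longrightarrow> P (f * g)"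
  shows "P f"
proof (induction f rule: poly_mapping_induct_single)
  case zero
  show ?case using const[of 0] by simp
next
  case (single k c)
  have mono: "P (Poly_Mapping.single k 1)" for k :: "'v \<Rightarrow>\<^sub>0 nat"
  proof (induction k rule: poly_mapping_induct_single)
    case zero
    show ?case using const[of 1] by simp
  next
    case (single v n)
    have "P (var v ^ n)"
      by (induction n) (use const[of 1] var mult in auto)
    then show ?case by (simp add: var_power)
  next
    case (add e e')
    then show ?case using mult[of "Poly_Mapping.single e 1" "Poly_Mapping.single e' 1"]
      by (simp add: mult_single)
  qed
  show ?case
    using mult[OF const mono, of c k] by (simp add: const_def mult_single)
next
  case (add f g)
  then show ?case by (rule assms(3))
qed

subsection \<open>Partial derivatives\<close>

lemma pderiv_var_superset:
  assumes "finite A" "Poly_Mapping.keys f \<subseteq> A"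
  shows "pderiv_var v f = (\<Sum>m\<in>A. Poly_Mapping.single (m - Poly_Mapping.single v 1)
       (of_nat (Poly_Mapping.lookup m v) * Poly_Mapping.lookup f m))"
  unfolding pderiv_var_def
  by (rule sum.mono_neutral_left) (use assms in \<open>auto simp: in_keys_iff\<close>)

lemma pderiv_var_add: "pderiv_var v (f + g) = pderiv_var v f + pderiv_var v g"
proof -
  let ?A = "Poly_Mapping.keys f \<union> Poly_Mapping.keys g"
  have "finite ?A" "Poly_Mapping.keys (f + g) \<subseteq> ?A" "Poly_Mapping.keys f \<subseteq> ?A" "Poly_Mapping.keys g \<subseteq> ?A"
    using Poly_Mapping.keys_add[of f g] by auto
  then show ?thesis
    by (simp add: pderiv_var_superset[of ?A] lookup_add distrib_left single_add sum.distrib)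
qed

lemma pderiv_var_single:
  "pderiv_var v (Poly_Mapping.single m c)
    = Poly_Mapping.single (m - Poly_Mapping.single v 1) (of_nat (Poly_Mapping.lookup m v) * c)"
  by (cases "c = 0") (simp_all add: pderiv_var_def)

lemma pderiv_var_const [simp]: "pderiv_var v (const c) = 0"
  by (simp add: const_def pderiv_var_single)

lemma pderiv_var_0 [simp]: "pderiv_var v 0 = 0"
  using pderiv_var_const[of v 0] by simp

lemma pderiv_var_1 [simp]: "pderiv_var v 1 = 0"
  using pderiv_var_const[of v 1] by simp

lemma pderiv_var_var: "pderiv_var v (var w) = (if v = w then 1 else 0)"
  by (auto simp: var_def pderiv_var_single lookup_single when_def)

lemma pderiv_var_mult: "pderiv_var v (f * g) = pderiv_var v f * g + f * pderiv_var v g"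
proof (induction f rule: poly_mapping_induct_single)
  case (single k c)
  show ?case
  proof (induction g rule: poly_mapping_induct_single)
    case (single l e)
    have shift: "i + j - Poly_Mapping.single v 1 = i - Poly_Mapping.single v 1 + j"
      if "Poly_Mapping.lookup i v \<noteq> 0" for i j :: "'a \<Rightarrow>\<^sub>0 nat"
      by (rule poly_mapping_eqI)
        (use that in \<open>auto simp: lookup_add lookup_minus lookup_single when_def\<close>)
    have drop: "Poly_Mapping.single (i + j - Poly_Mapping.single v 1) (of_nat (Poly_Mapping.lookup i v) * x)
       = Poly_Mapping.single (i - Poly_Mapping.single v 1 + j) (of_nat (Poly_Mapping.lookup i v) * x)"
      for i j :: "'a \<Rightarrow>\<^sub>0 nat" and x :: complex
      using shift[of i j] by (cases "Poly_Mapping.lookup i v = 0") (simp, metis)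
    have "pderiv_var v (Poly_Mapping.single k c * Poly_Mapping.single l e)
       = Poly_Mapping.single (k + l - Poly_Mapping.single v 1) (of_nat (Poly_Mapping.lookup k v) * (c * e))
       + Poly_Mapping.single (l + k - Poly_Mapping.single v 1) (of_nat (Poly_Mapping.lookup l v) * (c * e))"
      by (simp add: mult_single pderiv_var_single lookup_add distrib_right single_add add.commute)
    also have "\<dots> = pderiv_var v (Poly_Mapping.single k c) * Poly_Mapping.single l e
        + Poly_Mapping.single k c * pderiv_var v (Poly_Mapping.single l e)"
      unfolding drop by (simp add: pderiv_var_single mult_single mult_ac add.commute)
    finally show ?case .
  qed (simp_all add: distrib_left pderiv_var_add)
qed (simp_all add: distrib_right pderiv_var_add)

lemma pderiv_var_commute: "pderiv_var u (pderiv_var v f) = pderiv_var v (pderiv_var u f)"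
  by (induction f rule: mpoly_induct)
    (auto simp: pderiv_var_add pderiv_var_mult pderiv_var_var)

lemma pderiv_var_diff: "pderiv_var v (f - g) = pderiv_var v f - pderiv_var v g"
  using pderiv_var_add[of v "f - g" g] by simp

lemma pderiv_var_power:
  "pderiv_var v (f ^ n) = of_nat n * f ^ (n - 1) * pderiv_var v f"
proof (induction n)
  case (Suc n)
  then show ?case
    by (cases n) (simp_all add: pderiv_var_mult algebra_simps)
qed simp

subsection \<open>Homogeneity\<close>

lemma homogeneous_0 [simp]: "homogeneous n 0"
  by (simp add: homogeneous_def)

lemma homogeneous_add: "homogeneous n f \<Longrightarrow> homogeneous n g \<Longrightarrow> homogeneous n (f + g)"
  using Poly_Mapping.keys_add[of f g] by (auto simp: homogeneous_def)

lemma homogeneous_mult: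
  assumes "homogeneous m f" "homogeneous n g"
  shows "homogeneous (m + n) (f * g)"
  unfolding homogeneous_def
proof
  fix k assume "k \<in> Poly_Mapping.keys (f * g)"
  then obtain i j where "k = i + j" "i \<in> Poly_Mapping.keys f" "j \<in> Poly_Mapping.keys g"
    using Poly_Mapping.keys_mult[of f g] by auto
  then show "int (\<Sum>v\<in>UNIV. Poly_Mapping.lookup k v) = m + n"
    using assms by (simp add: homogeneous_def lookup_add sum.distrib)
qed

lemma homogeneous_const: "homogeneous 0 (const c)"
  by (simp add: homogeneous_def const_def)

lemma homogeneous_const_mult: "homogeneous n f \<Longrightarrow> homogeneous n (const c * f)"
  using homogeneous_mult[OF homogeneous_const] by force

lemma homogeneous_var: "homogeneous 1 (var v)"
  by (simp add: homogeneous_def var_def lookup_single when_def)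

lemma homogeneous_var_power: "homogeneous (int n) (var v ^ n)"
  by (simp add: homogeneous_def var_power lookup_single when_def)

lemma homogeneous_diff:
  assumes "homogeneous n f" "homogeneous n g"
  shows "homogeneous n (f - g)"
proof -
  have "f - g = f + const (-1) * g"
    by (simp add: const_def single_uminus)
  then show ?thesis using assms by (simp only: homogeneous_add homogeneous_const_mult)
qed

lemma homogeneous_sum: "(\<And>i. i \<in> A \<Longrightarrow> homogeneous n (f i)) \<Longrightarrow> homogeneous n (sum f A)"
  by (induction A rule: infinite_finite_induct) (auto intro: homogeneous_add)

lemma homogeneous_pderiv_var:
  assumes "homogeneous n f"
  shows "homogeneous (n - 1) (pderiv_var v f)"
proof -
  have "homogeneous (n - 1) (Poly_Mapping.single (m - Poly_Mapping.single v 1)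
      (of_nat (Poly_Mapping.lookup m v) * Poly_Mapping.lookup f m))"
    if "m \<in> Poly_Mapping.keys f" for m
  proof (cases "Poly_Mapping.lookup m v = 0")
    case False
    then have "m = (m - Poly_Mapping.single v 1) + Poly_Mapping.single v 1"
      by (intro poly_mapping_eqI) (auto simp: lookup_add lookup_minus lookup_single when_def)
    then have "(\<Sum>u\<in>UNIV. Poly_Mapping.lookup m u)
        = (\<Sum>u\<in>UNIV. Poly_Mapping.lookup (m - Poly_Mapping.single v 1) u) + (\<Sum>u\<in>UNIV. 1 when v = u)"
      by (metis (no_types, lifting) lookup_add lookup_single sum.cong sum.distrib)
    moreover have "int (\<Sum>u\<in>UNIV. Poly_Mapping.lookup m u) = n"
      using that assms by (simp add: homogeneous_def)
    ultimately show ?thesis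
      by (auto simp: homogeneous_def when_def)
  qed simp
  then show ?thesis
    unfolding pderiv_var_def by (rule homogeneous_sum)
qed

section \<open>The dihedral group\<close>

text \<open>A group of matrices larger than \<open>W\<close>: it also contains the rotation
  \<open>diag_mat \<eta>\<close> with \<open>\<eta>\<^sup>2 = \<zeta>\<close>, which normalizes
  \<open>W\<close> and yields the sign automorphism.\<close>

definition monomial_mat :: "mat2 \<Rightarrow> bool" where
  "monomial_mat u \<longleftrightarrow> (u$1$1 = 0 \<and> u$2$2 = 0 \<and> u$1$2 * u$2$1 = 1) \<or>
     (u$1$2 = 0 \<and> u$2$1 = 0 \<and> u$1$1 * u$2$2 = 1)"

definition diag_mat :: "complex \<Rightarrow> mat2" where
  "diag_mat \<alpha> = vector [vector [\<alpha>, 0], vector [0, inverse \<alpha>]]"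

definition refl_mat :: "complex \<Rightarrow> mat2" where
  "refl_mat \<beta> = vector [vector [0, \<beta>], vector [inverse \<beta>, 0]]"

lemma reflection_eq: "reflection \<zeta> i = refl_mat (\<zeta> ^ i)"
  by (simp add: reflection_def refl_mat_def)

lemma mat2_eq_iff: "(u :: mat2) = v \<longleftrightarrow> u$1$1 = v$1$1 \<and> u$1$2 = v$1$2 \<and> u$2$1 = v$2$1 \<and> u$2$2 = v$2$2"
  by (auto simp: vec_eq_iff forall_2)

lemma mat2_entries [simp]:
  "diag_mat \<alpha> $1$1 = \<alpha>" "diag_mat \<alpha> $1$2 = 0" "diag_mat \<alpha> $2$1 = 0" "diag_mat \<alpha> $2$2 = inverse \<alpha>"
  "refl_mat \<beta> $1$1 = 0" "refl_mat \<beta> $1$2 = \<beta>" "refl_mat \<beta> $2$1 = inverse \<beta>" "refl_mat \<beta> $2$2 = 0"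
  by (simp_all add: diag_mat_def refl_mat_def)

lemma mat2_mult_entries:
  "((u :: mat2) ** (v :: mat2))$i$j = u$i$1 * v$1$j + u$i$2 * v$2$j"
  by (simp add: matrix_matrix_mult_def sum_2)

lemma mat2_one_entries [simp]:
  "(mat 1 :: mat2)$1$1 = 1" "(mat 1 :: mat2)$1$2 = 0" "(mat 1 :: mat2)$2$1 = 0" "(mat 1 :: mat2)$2$2 = 1"
  by (simp_all add: mat_def)

lemma monomial_cases:
  assumes "monomial_mat u"
  obtains (diag) \<alpha> where "\<alpha> \<noteq> 0" "u = diag_mat \<alpha>" | (refl) \<beta> where "\<beta> \<noteq> 0" "u = refl_mat \<beta>"
proof (cases "u$1$1 = 0")
  case True
  then have "u = refl_mat (u$1$2)" "u$1$2 \<noteq> 0"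
    using assms by (auto simp: monomial_mat_def mat2_eq_iff inverse_unique)
  then show ?thesis using that by metis
next
  case False
  then have "u = diag_mat (u$1$1)"
    using assms by (auto simp: monomial_mat_def mat2_eq_iff inverse_unique)
  then show ?thesis using that False by metis
qed

lemma monomial_diag [simp]: "\<alpha> \<noteq> 0 \<Longrightarrow> monomial_mat (diag_mat \<alpha>)"
  and monomial_refl [simp]: "\<beta> \<noteq> 0 \<Longrightarrow> monomial_mat (refl_mat \<beta>)"
  and monomial_one [simp]: "monomial_mat (mat 1)"
  by (simp_all add: monomial_mat_def)

lemma mat2_products [simp]:
  "diag_mat \<alpha> ** diag_mat \<alpha>' = diag_mat (\<alpha> * \<alpha>')"
  "diag_mat \<alpha> ** refl_mat \<beta> = refl_mat (\<alpha> * \<beta>)"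
  "refl_mat \<beta> ** diag_mat \<alpha> = refl_mat (\<beta> / \<alpha>)"
  "refl_mat \<beta> ** refl_mat \<beta>' = diag_mat (\<beta> / \<beta>')"
  by (simp_all add: mat2_eq_iff mat2_mult_entries divide_inverse mult.commute)

lemma diag_mat_1 [simp]: "diag_mat 1 = mat 1"
  by (simp add: mat2_eq_iff)

lemma mat2_inject [simp]: "diag_mat \<alpha> = diag_mat \<alpha>' \<longleftrightarrow> \<alpha> = \<alpha>'" "refl_mat \<beta> = refl_mat \<beta>' \<longleftrightarrow> \<beta> = \<beta>'"
  "\<beta> \<noteq> 0 \<Longrightarrow> diag_mat \<alpha> \<noteq> refl_mat \<beta>" "\<beta> \<noteq> 0 \<Longrightarrow> refl_mat \<beta> \<noteq> diag_mat \<alpha>"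
  "diag_mat \<alpha> = mat 1 \<longleftrightarrow> \<alpha> = 1" "refl_mat \<beta> \<noteq> mat 1"
  by (auto simp: mat2_eq_iff)

lemma matrix_inv_unique:
  fixes u v :: mat2
  assumes "u ** v = mat 1" "v ** u = mat 1"
  shows "matrix_inv u = v"
proof -
  have inv: "u ** matrix_inv u = mat 1 \<and> matrix_inv u ** u = mat 1"
    unfolding matrix_inv_def
    by (rule someI[of "\<lambda>A. u ** A = mat 1 \<and> A ** u = mat 1", OF conjI[OF assms]])
  have "matrix_inv u = matrix_inv u ** (u ** v)"
    by (simp only: assms matrix_mul_rid)
  also have "\<dots> = v"
    by (simp only: matrix_mul_assoc inv matrix_mul_lid)
  finally show ?thesis .
qed

lemma matrix_inv_diag [simp]: "\<alpha> \<noteq> 0 \<Longrightarrow> matrix_inv (diag_mat \<alpha>) = diag_mat (inverse \<alpha>)"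
  and matrix_inv_refl [simp]: "\<beta> \<noteq> 0 \<Longrightarrow> matrix_inv (refl_mat \<beta>) = refl_mat \<beta>"
  by (rule matrix_inv_unique; simp)+

lemma matrix_inv_one [simp]: "matrix_inv (mat 1) = (mat 1 :: mat2)"
  by (rule matrix_inv_unique) simp_all

definition unity_roots :: "nat \<Rightarrow> complex set" where
  "unity_roots d = {\<beta>. \<beta> ^ d = 1}"

locale dihedral_setting =
  fixes d :: nat and \<zeta> :: complex
  assumes d_pos: "d \<ge> 1" and primitive: "primitive_root_of_unity d \<zeta>"
begin

abbreviation "B \<equiv> unity_roots d"
abbreviation "W \<equiv> dihedral \<zeta>"

lemma \<zeta>_pow_d: "\<zeta> ^ d = 1"
  using primitive by (simp add: primitive_root_of_unity_def)

lemma \<zeta>_nonzero: "\<zeta> \<noteq> 0"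
  using \<zeta>_pow_d d_pos by (auto simp: power_0_left)

lemma finite_B: "finite B"
  using d_pos finite_roots_unity[of d, where 'a = complex] by (simp add: unity_roots_def)

lemma B_nonzero: "\<beta> \<in> B \<Longrightarrow> \<beta> \<noteq> 0"
  using d_pos by (auto simp: unity_roots_def power_0_left)

lemma B_1 [simp]: "1 \<in> B"
  by (simp add: unity_roots_def)

lemma B_mult: "\<beta> \<in> B \<Longrightarrow> \<gamma> \<in> B \<Longrightarrow> \<beta> * \<gamma> \<in> B"
  and B_divide: "\<beta> \<in> B \<Longrightarrow> \<gamma> \<in> B \<Longrightarrow> \<beta> / \<gamma> \<in> B"
  by (simp_all add: unity_roots_def power_mult_distrib power_divide)

lemma \<zeta>_power_in_B: "\<zeta> ^ i \<in> B"
  using \<zeta>_pow_d by (simp add: unity_roots_def) (metis mult.commute power_mult power_one)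

lemma inj_on_\<zeta>_power: "inj_on (\<lambda>i. \<zeta> ^ i) {..<d}"
proof -
  have "\<zeta> ^ i \<noteq> \<zeta> ^ j" if "i < j" "j < d" for i j
  proof
    assume "\<zeta> ^ i = \<zeta> ^ j"
    also have "\<zeta> ^ j = \<zeta> ^ i * \<zeta> ^ (j - i)"
      using that by (simp flip: power_add)
    finally have "\<zeta> ^ (j - i) = 1"
      using \<zeta>_nonzero by simp
    then show False
      using primitive that by (auto simp: primitive_root_of_unity_def)
  qed
  then show ?thesis
    by (intro linorder_inj_onI') auto
qed

text \<open>The first \<open>d\<close> powers of a primitive root are distinct, and there are at
  most \<open>d\<close> roots of unity.\<close>

lemma B_eq: "B = (\<lambda>i. \<zeta> ^ i) ` {..<d}"
proof (rule card_seteq[symmetric])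
  show "finite B" by (rule finite_B)
  show "(\<lambda>i. \<zeta> ^ i) ` {..<d} \<subseteq> B" using \<zeta>_power_in_B by auto
  have "card B \<le> d"
    using card_roots_unity[of d, where 'a = complex] d_pos by (simp add: unity_roots_def)
  then show "card B \<le> card ((\<lambda>i. \<zeta> ^ i) ` {..<d})"
    by (simp add: card_image inj_on_\<zeta>_power)
qed

lemma refl_in_carrier: "\<beta> \<noteq> 0 \<Longrightarrow> refl_mat \<beta> \<in> carrier GL2"
  unfolding GL2_def invertible_def
  by (auto intro!: exI[of _ "refl_mat \<beta>"])

lemma group_GL2: "group GL2"
proof (rule groupI)
  show "\<exists>v\<in>carrier GL2. v \<otimes>\<^bsub>GL2\<^esub> u = \<one>\<^bsub>GL2\<^esub>" if "u \<in> carrier GL2" for u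
    using that unfolding GL2_def invertible_def by auto
qed (auto simp: GL2_def matrix_mul_assoc invertible_mult, auto simp: invertible_def)

lemma W_eq: "W = diag_mat ` B \<union> refl_mat ` B"
proof
  have inv_refl: "inv\<^bsub>GL2\<^esub> refl_mat \<beta> = refl_mat \<beta>" if "\<beta> \<noteq> 0" for \<beta>
    by (rule group.inv_equality[OF group_GL2])
      (use that refl_in_carrier in \<open>auto simp: GL2_def\<close>)
  show "W \<subseteq> diag_mat ` B \<union> refl_mat ` B"
  proof
    fix w assume "w \<in> W"
    then show "w \<in> diag_mat ` B \<union> refl_mat ` B"
      unfolding dihedral_def
    proof (induction rule: generate.induct)
      case one
      show ?case by (auto simp: GL2_def image_iff intro!: bexI[of _ 1])
    next
      case (incl h)
      then show ?case using \<zeta>_power_in_B[of 1] by (auto simp: reflection_eq)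
    next
      case (inv h)
      then show ?case using \<zeta>_power_in_B[of 1] \<zeta>_nonzero by (auto simp: reflection_eq inv_refl)
    next
      case (eng h1 h2)
      then show ?case by (auto simp: GL2_def intro: B_mult B_divide)
    qed
  qed
  have mult: "u ** v \<in> W" if "u \<in> W" "v \<in> W" for u v
    using generate.eng[OF that[unfolded dihedral_def]] by (simp add: dihedral_def GL2_def)
  have gens: "refl_mat 1 \<in> W" "refl_mat \<zeta> \<in> W" "mat 1 \<in> W"
    using generate.incl[of "reflection \<zeta> 0" "{reflection \<zeta> 0, reflection \<zeta> 1}" GL2]
      generate.incl[of "reflection \<zeta> 1" "{reflection \<zeta> 0, reflection \<zeta> 1}" GL2]
      generate.one[of GL2 "{reflection \<zeta> 0, reflection \<zeta> 1}"]
    by (auto simp: dihedral_def GL2_def reflection_eq)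
  have rot: "diag_mat (\<zeta> ^ i) \<in> W" for i
  proof (induction i)
    case (Suc i)
    have "diag_mat \<zeta> \<in> W" using mult[OF gens(2,1)] by simp
    from mult[OF this Suc] show ?case by simp
  qed (use gens in simp)
  have "refl_mat (\<zeta> ^ i) \<in> W" for i
    using mult[OF rot gens(1)] by simp
  with rot show "diag_mat ` B \<union> refl_mat ` B \<subseteq> W"
    by (auto simp: B_eq)
qed

lemma W_mult: "u \<in> W \<Longrightarrow> v \<in> W \<Longrightarrow> u ** v \<in> W"
  by (auto simp: W_eq intro: B_mult B_divide)

lemma W_one [simp]: "mat 1 \<in> W"
  using B_1 by (force simp: W_eq simp flip: diag_mat_1)

lemma refl_in_W: "\<beta> \<in> B \<Longrightarrow> refl_mat \<beta> \<in> W"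
  by (auto simp: W_eq)

lemma reflection_in_W: "reflection \<zeta> i \<in> W"
  by (simp add: reflection_eq refl_in_W \<zeta>_power_in_B)

lemma finite_W: "finite W"
  by (simp add: W_eq finite_B)

lemma W_monomial: "w \<in> W \<Longrightarrow> monomial_mat w"
  by (auto simp: W_eq B_nonzero)

text \<open>Every rotation in \<open>W\<close> is a product of two reflections, so reflections
  suffice as generators.\<close>

lemma W_induct [consumes 1, case_names one refl mult]:
  assumes "w \<in> W" "P (mat 1)" "\<And>\<beta>. \<beta> \<in> B \<Longrightarrow> P (refl_mat \<beta>)"
    "\<And>u v. u \<in> W \<Longrightarrow> v \<in> W \<Longrightarrow> P u \<Longrightarrow> P v \<Longrightarrow> P (u ** v)"
  shows "P w"
proof -
  have "P (diag_mat \<beta>)" if "\<beta> \<in> B" for \<beta>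
  proof -
    have "diag_mat \<beta> = refl_mat \<beta> ** refl_mat 1" by simp
    then show ?thesis using assms(3,4) refl_in_W that B_1 by metis
  qed
  then show ?thesis using assms by (auto simp: W_eq)
qed

text \<open>Source of the sign automorphism. Conjugation by \<open>diag_mat \<eta>\<close>
  multiplies the parameter of a reflection by \<open>\<eta>\<^sup>2 = \<zeta>\<close>, so it
  permutes the reflections. The exact order 2d of \<eta> later turns equations between powers of
  \<eta> into constraints on exponents.\<close>

lemma obtain_sqrt:
  obtains \<eta> where "\<eta> ^ 2 = \<zeta>" "\<eta> ^ d = -1" "\<And>k. \<eta> ^ k = 1 \<Longrightarrow> 2 * d dvd k"
proof -
  have ord: "d dvd k" if "\<zeta> ^ k = 1" for k
  proof (rule ccontr)
    assume "\<not> d dvd k"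
    then have "0 < k mod d" "k mod d < d" using d_pos by (auto simp: mod_greater_zero_iff_not_dvd)
    moreover have "\<zeta> ^ (k mod d) = 1"
      using that \<zeta>_pow_d by (metis div_mult_mod_eq mult_1 power_add power_mult power_one mult.commute)
    ultimately show False using primitive by (auto simp: primitive_root_of_unity_def)
  qed
  have "\<exists>\<eta>. \<eta> ^ 2 = \<zeta> \<and> \<eta> ^ d = -1"
  proof -
    define \<eta> where "\<eta> = csqrt \<zeta>"
    have sq: "\<eta> ^ 2 = \<zeta>" by (simp add: \<eta>_def)
    have "(\<eta> ^ d) ^ 2 = 1" using sq \<zeta>_pow_d by (metis power_mult mult.commute)
    then consider "\<eta> ^ d = -1" | "\<eta> ^ d = 1" by (auto simp: power2_eq_1_iff)
    then show ?thesis
    proof cases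
      case 1 then show ?thesis using sq by blast
    next
      case 2
      \<comment> \<open>For even \<open>d\<close> the root of unity \<zeta> would have order at most
        d/2. For odd \<open>d\<close> the other square root has the required sign.\<close>
      have "odd d"
      proof
        assume "even d"
        then obtain m where m: "d = 2 * m" by auto
        then have "\<zeta> ^ m = 1" using 2 sq by (metis power_mult)
        then show False using ord[of m] m d_pos by (auto dest: dvd_imp_le)
      qed
      then have "(- \<eta>) ^ 2 = \<zeta> \<and> (- \<eta>) ^ d = -1" using 2 sq by simp
      then show ?thesis by blast
    qed
  qed
  then obtain \<eta> where \<eta>: "\<eta> ^ 2 = \<zeta>" "\<eta> ^ d = -1" by blast
  have "2 * d dvd k" if "\<eta> ^ k = 1" for k
  proof -
    have "\<zeta> ^ k = 1" using \<eta>(1) that by (metis power_mult mult.commute power_one)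
    then obtain l where l: "k = d * l" using ord by blast
    then have "(-1 :: complex) ^ l = 1" using that \<eta>(2) by (metis power_mult)
    then have "even l" by (metis neg_one_odd_power one_neq_neg_one)
    then show ?thesis using l by auto
  qed
  with \<eta> show ?thesis using that by blast
qed

end

section \<open>The semidirect product\<close>

lemma tconst_add: "tconst (p + r) = tconst p + tconst r"
  by (simp add: tconst_def single_add)

lemma tconst_1 [simp]: "tconst 1 = 1"
  unfolding tconst_def single_one[symmetric] zero_list_def ..

lemma tconst_mult: "tconst (p * r) = tconst p * tconst r"
  by (simp add: tconst_def mult_single plus_list_def)

lemma tword_append: "tword (u @ v) = tword u * tword v"
  by (simp add: tword_def mult_single plus_list_def)

lemma tword_Nil [simp]: "tword [] = 1"
  unfolding tword_def single_one[symmetric] zero_list_def ..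

lemma single_eq_tconst_tword: "Poly_Mapping.single u p = tconst p * tword u"
  by (simp add: tconst_def tword_def mult_single plus_list_def)

lemma tword_eq_prod_list: "tword u = prod_list (map (\<lambda>c. tword [c]) u)"
proof (induction u)
  case (Cons c u)
  then show ?case using tword_append[of "[c]" u] by simp
qed simp

lemma tconst_central: "f * tconst p = tconst p * f"
proof (induction f rule: poly_mapping_induct_single)
  case (single k c)
  show ?case by (simp add: tconst_def mult_single plus_list_def mult.commute[of c p])
qed (simp_all add: distrib_left distrib_right)

lemma pm_hom_tconst: "pm_hom tconst (\<lambda>u. prod_list (map g u) :: tensor)"
  by (unfold_locales; (rule tconst_central)?)
    (simp_all add: tconst_0 tconst_add tconst_mult zero_list_def plus_list_def)

lemma act_eq_pm_eval: "act w f = pm_eval tconst (\<lambda>u. prod_list (map (act_gen w) u)) f"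
  by (simp add: act_def pm_eval_def)

lemma act_add: "act w (f + g) = act w f + act w g"
  and act_mult: "act w (f * g) = act w f * act w g"
  and act_0 [simp]: "act w 0 = 0"
  and act_1 [simp]: "act w 1 = 1"
proof -
  interpret pm_hom tconst "\<lambda>u. prod_list (map (act_gen w) u)" by (rule pm_hom_tconst)
  show "act w (f + g) = act w f + act w g" "act w (f * g) = act w f * act w g" "act w 0 = 0" "act w 1 = 1"
    by (simp_all add: act_eq_pm_eval pm_eval_add pm_eval_mult)
qed

lemma act_sum: "act w (\<Sum>i\<in>A. f i) = (\<Sum>i\<in>A. act w (f i))"
  by (induction A rule: infinite_finite_induct) (simp_all add: act_add)

lemma act_prod_list: "act w (prod_list fs) = prod_list (map (act w) fs)"
  by (induction fs) (simp_all add: act_mult)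

lemma act_single: "act w (Poly_Mapping.single u p) = tconst p * prod_list (map (act_gen w) u)"
proof -
  interpret pm_hom tconst "\<lambda>u. prod_list (map (act_gen w) u)" by (rule pm_hom_tconst)
  show ?thesis by (simp add: act_eq_pm_eval)
qed

lemma act_tconst [simp]: "act w (tconst p) = tconst p"
  using act_single[of w "[]" p] by (simp add: tconst_def)

lemma act_letter [simp]: "act w (tword [c]) = act_gen w c"
  by (simp add: tword_def act_single)

lemma act_gen_one: "act_gen (mat 1) = (\<lambda>c. tword [c])"
proof
  show "act_gen (mat 1) c = tword [c]" for c
    by (cases c) (simp_all add: tconst_0 flip: one_pCons)
qed

lemma act_one [simp]: "act (mat 1) f = f"
  by (induction f rule: poly_mapping_induct_single)
    (simp_all add: act_add act_single act_gen_one flip: tword_eq_prod_list, simp add: single_eq_tconst_tword)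

lemma tconst_tconst: "tconst p * (tconst r * f) = tconst (p * r) * f"
  by (simp add: tconst_mult mult.assoc)

lemma tconst_const_add: "tconst [:a + b:] = tconst [:a:] + tconst [:b:]"
  by (simp flip: tconst_add)

lemma act_gen_mult:
  assumes "monomial_mat u" "monomial_mat v"
  shows "act u (act_gen v c) = act_gen (u ** v) c"
proof -
  have inv: "matrix_inv (u ** v) = matrix_inv v ** matrix_inv u"
    using assms by (elim monomial_cases) (auto simp: divide_inverse mult.commute)
  show ?thesis
    by (cases c) (simp_all add: inv Let_def act_add act_mult mat2_mult_entries distrib_left tconst_tconst
        algebra_simps tconst_const_add)
qed

lemma act_act:
  assumes "monomial_mat u" "monomial_mat v"
  shows "act u (act v f) = act (u ** v) f"
  by (induction f rule: poly_mapping_induct_single)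
    (simp_all add: act_add act_single act_mult act_prod_list comp_def act_gen_mult[OF assms])

context dihedral_setting
begin

abbreviation "R \<equiv> smash \<zeta>"

lemma smash_carrier: "F \<in> carrier R \<longleftrightarrow> (\<forall>w. w \<notin> W \<longrightarrow> F w = 0)"
  by (simp add: smash_def)

lemma smash_add: "(F \<oplus>\<^bsub>R\<^esub> G) u = F u + G u"
  and smash_zero: "\<zero>\<^bsub>R\<^esub> u = 0"
  and smash_one: "\<one>\<^bsub>R\<^esub> = sm 1 (mat 1)"
  by (simp_all add: smash_def sm_def fun_eq_iff)

lemma smash_mult:
  "(F \<otimes>\<^bsub>R\<^esub> G) u = (\<Sum>w\<in>W. \<Sum>v\<in>W. if w ** v = u then F w * act w (G v) else 0)"
proof -
  have "(F \<otimes>\<^bsub>R\<^esub> G) u = (\<Sum>p\<in>{p \<in> W \<times> W. fst p ** snd p = u}. F (fst p) * act (fst p) (G (snd p)))"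
    by (auto simp: smash_def intro!: sum.cong)
  also have "\<dots> = (\<Sum>p\<in>W \<times> W. if fst p ** snd p = u then F (fst p) * act (fst p) (G (snd p)) else 0)"
    by (rule sum.inter_filter) (simp add: finite_W)
  finally show ?thesis
    by (simp add: sum.cartesian_product case_prod_beta)
qed

text \<open>Both sides equal the sum of \<open>?t\<close> over all triples in \<open>W\<close> with
  product \<open>u\<close>; the delta sums remove or introduce the product of two neighbouring group
  elements.\<close>

lemma smash_mult_assoc:
  assumes "F \<in> carrier R" "G \<in> carrier R" "K \<in> carrier R"
  shows "(F \<otimes>\<^bsub>R\<^esub> G) \<otimes>\<^bsub>R\<^esub> K = F \<otimes>\<^bsub>R\<^esub> (G \<otimes>\<^bsub>R\<^esub> K)"
proof
  fix u
  let ?t = "\<lambda>w1 w2 v. if w1 ** w2 ** v = u then F w1 * act w1 (G w2) * act (w1 ** w2) (K v) else 0"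
  have "((F \<otimes>\<^bsub>R\<^esub> G) \<otimes>\<^bsub>R\<^esub> K) u
      = (\<Sum>w\<in>W. \<Sum>v\<in>W. \<Sum>w1\<in>W. \<Sum>w2\<in>W. if w1 ** w2 = w then ?t w1 w2 v else 0)"
    unfolding smash_mult[of "F \<otimes>\<^bsub>R\<^esub> G"]
    by (intro sum.cong refl) (auto simp: smash_mult sum_distrib_right intro!: sum.cong sum.neutral)
  also have "\<dots> = (\<Sum>v\<in>W. \<Sum>w1\<in>W. \<Sum>w2\<in>W. \<Sum>w\<in>W. if w1 ** w2 = w then ?t w1 w2 v else 0)"
    by (rule trans[OF sum.swap], rule sum.cong[OF refl], rule trans[OF sum.swap],
        rule sum.cong[OF refl], rule sum.swap)
  also have "\<dots> = (\<Sum>v\<in>W. \<Sum>w1\<in>W. \<Sum>w2\<in>W. ?t w1 w2 v)"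
    by (intro sum.cong refl) (simp only: sum.delta'[OF finite_W] W_mult if_True)
  also have "\<dots> = (\<Sum>w1\<in>W. \<Sum>w2\<in>W. \<Sum>v\<in>W. ?t w1 w2 v)"
    by (rule trans[OF sum.swap], rule sum.cong[OF refl], rule sum.swap)
  also have "\<dots> = (\<Sum>w1\<in>W. \<Sum>w2\<in>W. \<Sum>v\<in>W. \<Sum>v'\<in>W. if w2 ** v = v' then
      (if w1 ** v' = u then F w1 * act w1 (G w2 * act w2 (K v)) else 0) else 0)"
    by (intro sum.cong refl)
      (simp add: sum.delta'[OF finite_W] W_mult act_mult act_act W_monomial mult.assoc matrix_mul_assoc
        cong: if_cong)
  also have "\<dots> = (\<Sum>w1\<in>W. \<Sum>v'\<in>W. \<Sum>w2\<in>W. \<Sum>v\<in>W. if w2 ** v = v' then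
      (if w1 ** v' = u then F w1 * act w1 (G w2 * act w2 (K v)) else 0) else 0)"
    by (rule sum.cong[OF refl], rule trans[OF sum.cong[OF refl sum.swap]], rule sum.swap)
  also have "\<dots> = (F \<otimes>\<^bsub>R\<^esub> (G \<otimes>\<^bsub>R\<^esub> K)) u"
    unfolding smash_mult[of F]
    by (intro sum.cong refl) (auto simp: smash_mult act_sum sum_distrib_left intro!: sum.cong sum.neutral)
  finally show "((F \<otimes>\<^bsub>R\<^esub> G) \<otimes>\<^bsub>R\<^esub> K) u = (F \<otimes>\<^bsub>R\<^esub> (G \<otimes>\<^bsub>R\<^esub> K)) u" .
qed

lemma sm_carrier [simp]: "w \<in> W \<Longrightarrow> sm f w \<in> carrier R"
  by (auto simp: smash_carrier sm_def)

lemma sm_mult: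
  assumes "w \<in> W" "v \<in> W"
  shows "sm f w \<otimes>\<^bsub>R\<^esub> sm g v = sm (f * act w g) (w ** v)"
proof
  fix u
  have "(sm f w \<otimes>\<^bsub>R\<^esub> sm g v) u = (\<Sum>w'\<in>W. if w' = w then
      (\<Sum>v'\<in>W. if v' = v then (if w ** v = u then f * act w g else 0) else 0) else 0)"
    unfolding smash_mult by (intro sum.cong refl) (auto simp: sm_def intro!: sum.cong sum.neutral)
  then show "(sm f w \<otimes>\<^bsub>R\<^esub> sm g v) u = sm (f * act w g) (w ** v) u"
    using assms by (simp add: sum.delta[OF finite_W] sm_def)
qed

lemma smash_mult_closed: "F \<otimes>\<^bsub>R\<^esub> G \<in> carrier R"
  unfolding smash_carrier smash_mult
  by (intro allI impI sum.neutral ballI) (use W_mult in auto)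

lemma ring_smash: "ring R"
proof (rule ringI)
  show "abelian_group R"
  proof (rule abelian_groupI)
    show "\<exists>G\<in>carrier R. G \<oplus>\<^bsub>R\<^esub> F = \<zero>\<^bsub>R\<^esub>" if "F \<in> carrier R" for F
      by (rule bexI[of _ "\<lambda>u. - F u"]) (use that in \<open>auto simp: smash_def\<close>)
  qed (auto simp: smash_def add.assoc add.commute)
  show "Group.monoid R"
  proof (rule Group.monoidI)
    show "\<one>\<^bsub>R\<^esub> \<otimes>\<^bsub>R\<^esub> F = F" if "F \<in> carrier R" for F
    proof
      fix u
      have "(\<one>\<^bsub>R\<^esub> \<otimes>\<^bsub>R\<^esub> F) u = (\<Sum>w\<in>W. if w = mat 1 then (\<Sum>v\<in>W. if v = u then F u else 0) else 0)"
        unfolding smash_mult smash_one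
        by (intro sum.cong refl) (auto simp: sm_def intro!: sum.cong sum.neutral)
      then show "(\<one>\<^bsub>R\<^esub> \<otimes>\<^bsub>R\<^esub> F) u = F u"
        using that by (auto simp: sum.delta[OF finite_W] smash_carrier)
    qed
    show "F \<otimes>\<^bsub>R\<^esub> \<one>\<^bsub>R\<^esub> = F" if "F \<in> carrier R" for F
    proof
      fix u
      have "(F \<otimes>\<^bsub>R\<^esub> \<one>\<^bsub>R\<^esub>) u = (\<Sum>w\<in>W. if w = u then (\<Sum>v\<in>W. if v = mat 1 then F u else 0) else 0)"
        unfolding smash_mult smash_one
        by (intro sum.cong refl) (auto simp: sm_def intro!: sum.cong sum.neutral)
      then show "(F \<otimes>\<^bsub>R\<^esub> \<one>\<^bsub>R\<^esub>) u = F u"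
        using that by (auto simp: sum.delta[OF finite_W] smash_carrier)
    qed
  qed (auto simp: smash_mult_assoc smash_mult_closed smash_one)
  show "(F \<oplus>\<^bsub>R\<^esub> G) \<otimes>\<^bsub>R\<^esub> K = F \<otimes>\<^bsub>R\<^esub> K \<oplus>\<^bsub>R\<^esub> G \<otimes>\<^bsub>R\<^esub> K" for F G K
    by (rule ext) (auto simp: smash_mult smash_add distrib_right simp flip: sum.distrib intro!: sum.cong)
  show "K \<otimes>\<^bsub>R\<^esub> (F \<oplus>\<^bsub>R\<^esub> G) = K \<otimes>\<^bsub>R\<^esub> F \<oplus>\<^bsub>R\<^esub> K \<otimes>\<^bsub>R\<^esub> G" for F G K
    by (rule ext) (auto simp: smash_mult smash_add act_add distrib_left simp flip: sum.distrib intro!: sum.cong)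
qed

lemma smash_uminus:
  assumes "F \<in> carrier R"
  shows "(\<ominus>\<^bsub>R\<^esub> F) = (\<lambda>u. - F u)"
proof -
  interpret ring R by (rule ring_smash)
  show ?thesis
    by (rule minus_equality) (use assms in \<open>auto simp: smash_def fun_eq_iff\<close>)
qed

lemma smash_minus:
  assumes "G \<in> carrier R"
  shows "(F \<ominus>\<^bsub>R\<^esub> G) u = F u - G u"
  using assms by (simp add: a_minus_def smash_add smash_uminus)

lemma smash_induct [consumes 1, case_names scalar letter group add mult]:
  assumes "F \<in> carrier R"
    and scalar: "\<And>p. P (sm (tconst p) (mat 1))"
    and letter: "\<And>c. P (sm (tword [c]) (mat 1))"
    and group: "\<And>w. w \<in> W \<Longrightarrow> P (sm 1 w)"
    and add: "\<And>F G. F \<in> carrier R \<Longrightarrow> G \<in> carrier R \<Longrightarrow> P F \<Longrightarrow> P G \<Longrightarrow> P (F \<oplus>\<^bsub>R\<^esub> G)"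
    and mult: "\<And>F G. F \<in> carrier R \<Longrightarrow> G \<in> carrier R \<Longrightarrow> P F \<Longrightarrow> P G \<Longrightarrow> P (F \<otimes>\<^bsub>R\<^esub> G)"
  shows "P F"
proof -
  have word: "P (sm (tword u) (mat 1))" for u
  proof (induction u)
    case Nil
    then show ?case using scalar[of 1] by simp
  next
    case (Cons c u)
    have "sm (tword (c # u)) (mat 1) = sm (tword [c]) (mat 1) \<otimes>\<^bsub>R\<^esub> sm (tword u) (mat 1)"
      using tword_append[of "[c]" u] by (simp add: sm_mult)
    then show ?case using mult[OF _ _ letter Cons] by simp
  qed
  have tensor: "P (sm f (mat 1))" for f
  proof (induction f rule: poly_mapping_induct_single)
    case zero
    then show ?case using scalar[of 0] by (simp add: tconst_0)
  next
    case (single k c)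
    have "sm (Poly_Mapping.single k c) (mat 1) = sm (tconst c) (mat 1) \<otimes>\<^bsub>R\<^esub> sm (tword k) (mat 1)"
      by (simp add: sm_mult single_eq_tconst_tword)
    then show ?case using mult[OF _ _ scalar word] by simp
  next
    case (add f g)
    have "sm (f + g) (mat 1) = sm f (mat 1) \<oplus>\<^bsub>R\<^esub> sm g (mat 1)"
      by (auto simp: sm_def smash_add)
    then show ?case using assms(5)[OF _ _ add] by simp
  qed
  have sm: "P (sm f w)" if "w \<in> W" for f w
  proof -
    have "sm f w = sm f (mat 1) \<otimes>\<^bsub>R\<^esub> sm 1 w"
      using that by (simp add: sm_mult)
    then show ?thesis using mult[OF _ _ tensor group] that by simp
  qed
  have "P (\<lambda>u. if u \<in> A then F u else 0)" if "A \<subseteq> W" for A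
    using finite_subset[OF that finite_W] that
  proof (induction A rule: finite_induct)
    case empty
    then show ?case using scalar[of 0] by (simp add: tconst_0 sm_def)
  next
    case (insert w A)
    have "(\<lambda>u. if u \<in> insert w A then F u else 0) = sm (F w) w \<oplus>\<^bsub>R\<^esub> (\<lambda>u. if u \<in> A then F u else 0)"
      using insert.hyps by (auto simp: sm_def smash_add fun_eq_iff)
    moreover have "(\<lambda>u. if u \<in> A then F u else 0) \<in> carrier R"
      using assms(1) by (auto simp: smash_carrier)
    ultimately show ?case using add[OF _ _ sm] insert by simp
  qed
  from this[of W] have "P (\<lambda>u. if u \<in> W then F u else 0)" by simp
  moreover have "(\<lambda>u. if u \<in> W then F u else 0) = F"
    using assms(1) by (auto simp: smash_carrier fun_eq_iff)
  ultimately show ?thesis by simp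
qed

end

section \<open>Operators on a free module\<close>

text \<open>The index \<open>(m, n, p, r, w)\<close> stands for the PBW monomial \<open>x^m y^n X^p Y^r w\<close>, and an operator is
  the family of its values on the basis.\<close>

type_synonym pbw_index = "nat \<times> nat \<times> nat \<times> nat \<times> mat2"

typedef (overloaded) 'k operator = "UNIV :: (pbw_index \<Rightarrow> pbw_index \<Rightarrow>\<^sub>0 'k::zero) set"
  morphisms col Operator ..

declare Operator_inverse [OF UNIV_I, simp]

lemma operator_eqI: "(\<And>b. col e b = col f b) \<Longrightarrow> e = f"
  by (metis col_inject ext)

definition smult_pm :: "'k::mult_zero \<Rightarrow> ('i \<Rightarrow>\<^sub>0 'k) \<Rightarrow> 'i \<Rightarrow>\<^sub>0 'k" where
  "smult_pm c m = Poly_Mapping.map ((*) c) m"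

lemma lookup_smult_pm [simp]: "Poly_Mapping.lookup (smult_pm c m) i = c * Poly_Mapping.lookup m i"
  by (simp add: smult_pm_def Poly_Mapping.map.rep_eq when_def)

lemma smult_pm_simps [simp]:
  fixes c :: "'k::comm_ring_1"
  shows "smult_pm c 0 = 0" "smult_pm 0 m = 0" "smult_pm 1 m = m"
    "smult_pm c (smult_pm e m) = smult_pm (c * e) m"
    "smult_pm c (Poly_Mapping.single i e) = Poly_Mapping.single i (c * e)"
  by (auto intro!: poly_mapping_eqI simp: mult.assoc lookup_single when_def)

lemma smult_pm_add:
  fixes c :: "'k::comm_ring_1"
  shows "smult_pm (c + e) m = smult_pm c m + smult_pm e m"
    "smult_pm c (m + n) = smult_pm c m + smult_pm c n"
    "smult_pm c (- m) = - smult_pm c m"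
    "smult_pm c (m - n) = smult_pm c m - smult_pm c n"
  by (auto intro!: poly_mapping_eqI simp: lookup_add lookup_minus algebra_simps)

definition app :: "'k::comm_ring_1 operator \<Rightarrow> (pbw_index \<Rightarrow>\<^sub>0 'k) \<Rightarrow> pbw_index \<Rightarrow>\<^sub>0 'k" where
  "app e m = (\<Sum>b\<in>Poly_Mapping.keys m. smult_pm (Poly_Mapping.lookup m b) (col e b))"

lemma app_superset:
  assumes "finite A" "Poly_Mapping.keys m \<subseteq> A"
  shows "app e m = (\<Sum>b\<in>A. smult_pm (Poly_Mapping.lookup m b) (col e b))"
  unfolding app_def by (rule sum.mono_neutral_left) (use assms in \<open>auto simp: in_keys_iff\<close>)

lemma app_single [simp]: "app e (Poly_Mapping.single b c) = smult_pm c (col e b)"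
  by (cases "c = 0") (simp_all add: app_def)

lemma app_0 [simp]: "app e 0 = 0"
  by (simp add: app_def)

lemma app_add: "app e (m + n) = app e m + app e n"
proof -
  let ?A = "Poly_Mapping.keys m \<union> Poly_Mapping.keys n"
  have "finite ?A" "Poly_Mapping.keys (m + n) \<subseteq> ?A" "Poly_Mapping.keys m \<subseteq> ?A" "Poly_Mapping.keys n \<subseteq> ?A"
    using Poly_Mapping.keys_add[of m n] by auto
  then show ?thesis
    by (simp add: app_superset[of ?A] lookup_add smult_pm_add sum.distrib)
qed

lemma app_diff: "app e (m - n) = app e m - app e n"
  using app_add[of e "m - n" n] by simp

lemma app_smult: "app e (smult_pm c m) = smult_pm c (app e m)"
  by (induction m rule: poly_mapping_induct_single) (simp_all add: app_add smult_pm_add)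

text \<open>The ring instance lets computations in the algebra proceed by type class simplification,
  without the carrier conditions of the quotient rings.\<close>

instantiation operator :: (comm_ring_1) ring_1
begin

definition zero_operator :: "'a operator" where "0 = Operator (\<lambda>b. 0)"
definition one_operator :: "'a operator" where "1 = Operator (\<lambda>b. Poly_Mapping.single b 1)"
definition plus_operator :: "'a operator \<Rightarrow> 'a operator \<Rightarrow> 'a operator" where
  "e + f = Operator (\<lambda>b. col e b + col f b)"
definition minus_operator :: "'a operator \<Rightarrow> 'a operator \<Rightarrow> 'a operator" where
  "e - f = Operator (\<lambda>b. col e b - col f b)"
definition uminus_operator :: "'a operator \<Rightarrow> 'a operator" where
  "- e = Operator (\<lambda>b. - col e b)"
definition times_operator :: "'a operator \<Rightarrow> 'a operator \<Rightarrow> 'a operator" where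
  "e * f = Operator (\<lambda>b. app e (col f b))"

lemma col_simps [simp]:
  "col (0 :: 'a operator) b = 0" "col (1 :: 'a operator) b = Poly_Mapping.single b 1"
  "col (e + f :: 'a operator) b = col e b + col f b" "col (e - f :: 'a operator) b = col e b - col f b"
  "col (- e :: 'a operator) b = - col e b" "col (e * f :: 'a operator) b = app e (col f b)"
  by (simp_all add: zero_operator_def one_operator_def plus_operator_def minus_operator_def
      uminus_operator_def times_operator_def)

lemma app_simps [simp]:
  "app (e * f :: 'a operator) m = app e (app f m)" "app (e + f :: 'a operator) m = app e m + app f m"
  "app (1 :: 'a operator) m = m" "app (0 :: 'a operator) m = 0"
  by (induction m rule: poly_mapping_induct_single; simp add: app_add smult_pm_add app_smult algebra_simps)+

instance
proof
  fix e f g :: "'a operator"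
  show "e * f * g = e * (f * g)" "(e + f) * g = e * g + f * g" "e * (f + g) = e * f + e * g"
    "1 * e = e" "e * 1 = e"
    by (auto intro!: operator_eqI simp: app_add)
  have "col (0 :: 'a operator) (0, 0, 0, 0, mat 1) \<noteq> col 1 (0, 0, 0, 0, mat 1)"
    by (metis col_simps(1,2) lookup_single_eq lookup_zero zero_neq_one)
  then show "(0 :: 'a operator) \<noteq> 1" by metis
qed (auto intro!: operator_eqI)

end

lemma col_sum: "col (\<Sum>i\<in>A. f i) b = (\<Sum>i\<in>A. col (f i) b)"
  by (induction A rule: infinite_finite_induct) simp_all

definition sc :: "'k::comm_ring_1 \<Rightarrow> 'k operator" where
  "sc c = Operator (\<lambda>b. Poly_Mapping.single b c)"

lemma col_sc [simp]: "col (sc c) b = Poly_Mapping.single b c"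
  by (simp add: sc_def)

lemma app_sc [simp]: "app (sc c) m = smult_pm c m"
  by (induction m rule: poly_mapping_induct_single) (simp_all add: app_add smult_pm_add mult.commute)

lemma sc_0 [simp]: "sc 0 = 0" and sc_1 [simp]: "sc 1 = 1"
  and sc_add: "sc (b + c) = sc b + sc c" and sc_mult: "sc (b * c) = sc b * sc c"
  and sc_uminus: "sc (- c) = - sc c" and sc_diff: "sc (b - c) = sc b - sc c"
  by (auto intro!: operator_eqI simp: single_add mult.commute single_uminus single_diff)

lemma sc_central: "e * sc c = sc c * e"
  by (rule operator_eqI) simp

lemma sc_of_nat: "sc (of_nat n) = of_nat n"
  by (induction n) (simp_all add: sc_add)

subsection \<open>Reduction modulo the indeterminate\<close>

definition red_pm :: "('i \<Rightarrow>\<^sub>0 complex poly) \<Rightarrow> 'i \<Rightarrow>\<^sub>0 complex" where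
  "red_pm m = Poly_Mapping.map (\<lambda>p. poly p 0) m"

lemma lookup_red_pm [simp]: "Poly_Mapping.lookup (red_pm m) i = poly (Poly_Mapping.lookup m i) 0"
  by (simp add: red_pm_def Poly_Mapping.map.rep_eq when_def)

lemma red_pm_simps [simp]:
  "red_pm 0 = 0" "red_pm (m + n) = red_pm m + red_pm n" "red_pm (m - n) = red_pm m - red_pm n"
  "red_pm (- m) = - red_pm m" "red_pm (smult_pm p m) = smult_pm (poly p 0) (red_pm m)"
  "red_pm (Poly_Mapping.single i p) = Poly_Mapping.single i (poly p 0)"
  by (auto intro!: poly_mapping_eqI simp: lookup_add lookup_minus lookup_single when_def)

definition red :: "complex poly operator \<Rightarrow> complex operator" where
  "red e = Operator (\<lambda>b. red_pm (col e b))"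

lemma col_red [simp]: "col (red e) b = red_pm (col e b)"
  by (simp add: red_def)

lemma app_red: "app (red e) (red_pm m) = red_pm (app e m)"
  by (induction m rule: poly_mapping_induct_single) (simp_all add: app_add)

lemma red_simps [simp]:
  "red 0 = 0" "red 1 = 1" "red (e + f) = red e + red f" "red (e - f) = red e - red f"
  "red (- e) = - red e" "red (e * f) = red e * red f" "red (sc p) = sc (poly p 0)"
  by (auto intro!: operator_eqI simp: app_red)

lemma red_power [simp]: "red (e ^ n) = red e ^ n"
  by (induction n) simp_all

text \<open>The columns have coefficients in an integral domain. For the scalar \<hbar> this makes
  the quotient in the definition of the Poisson bracket unique.\<close>

lemma sc_cancel:
  assumes "sc p * e = sc p * f" "p \<noteq> 0"
  shows "e = (f :: complex poly operator)"
proof (rule operator_eqI, rule poly_mapping_eqI)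
  fix b i
  have "smult_pm p (col e b) = smult_pm p (col f b)"
    using assms(1) by (metis app_sc col_simps(6))
  then have "p * Poly_Mapping.lookup (col e b) i = p * Poly_Mapping.lookup (col f b) i"
    by (metis lookup_smult_pm)
  then show "Poly_Mapping.lookup (col e b) i = Poly_Mapping.lookup (col f b) i"
    using assms(2) by simp
qed

subsection \<open>Multiplication and group operators\<close>

definition op_x :: "'k::comm_ring_1 operator" where
  "op_x = Operator (\<lambda>(m, n, p, r, w). Poly_Mapping.single (Suc m, n, p, r, w) 1)"
definition op_y :: "'k::comm_ring_1 operator" where
  "op_y = Operator (\<lambda>(m, n, p, r, w). Poly_Mapping.single (m, Suc n, p, r, w) 1)"

definition lam :: "mat2 \<Rightarrow> complex" where "lam u = u$1$1 + u$2$1"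
definition mu :: "mat2 \<Rightarrow> complex" where "mu u = u$1$2 + u$2$2"

text \<open>A monomial matrix \<open>u\<close> maps \<open>x\<close> to \<open>lam u\<close> times \<open>x\<close> or \<open>y\<close> and \<open>y\<close> to \<open>mu u\<close> times the other
  one; since \<open>lam u * mu u = 1\<close>, the dual basis vectors \<open>X\<close> and \<open>Y\<close> are scaled by \<open>mu u\<close> and
  \<open>lam u\<close>.\<close>

definition op_g :: "mat2 \<Rightarrow> complex poly operator" where
  "op_g u = Operator (\<lambda>(m, n, p, r, w). Poly_Mapping.single
     (if u$1$1 = 0 then (n, m, r, p, u ** w) else (m, n, p, r, u ** w))
     [:lam u ^ (m + r) * mu u ^ (n + p):])"

lemma lam_mu_simps [simp]:
  "lam (diag_mat \<alpha>) = \<alpha>" "mu (diag_mat \<alpha>) = inverse \<alpha>"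
  "lam (refl_mat \<beta>) = inverse \<beta>" "mu (refl_mat \<beta>) = \<beta>" "lam (mat 1) = 1" "mu (mat 1) = 1"
  by (simp_all add: lam_def mu_def)

lemma col_op_x [simp]: "col op_x (m, n, p, r, w) = Poly_Mapping.single (Suc m, n, p, r, w) 1"
  and col_op_y [simp]: "col op_y (m, n, p, r, w) = Poly_Mapping.single (m, Suc n, p, r, w) 1"
  by (simp_all add: op_x_def op_y_def)

lemma col_op_g_diag [simp]: "\<alpha> \<noteq> 0 \<Longrightarrow> col (op_g (diag_mat \<alpha>)) (m, n, p, r, w)
    = Poly_Mapping.single (m, n, p, r, diag_mat \<alpha> ** w) [:\<alpha> ^ (m + r) * inverse \<alpha> ^ (n + p):]"
  and col_op_g_refl [simp]: "col (op_g (refl_mat \<beta>)) (m, n, p, r, w)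
    = Poly_Mapping.single (n, m, r, p, refl_mat \<beta> ** w) [:inverse \<beta> ^ (m + r) * \<beta> ^ (n + p):]"
  by (simp_all add: op_g_def)

lemma op_g_one [simp]: "op_g (mat 1) = 1"
  by (auto intro!: operator_eqI simp: op_g_def simp flip: one_pCons)

lemma op_g_mult:
  assumes "monomial_mat u" "monomial_mat v"
  shows "op_g (u ** v) = op_g u * op_g v"
proof (rule operator_eqI)
  fix b :: pbw_index
  obtain m n p r w where b: "b = (m, n, p, r, w)" by (cases b)
  from assms show "col (op_g (u ** v)) b = col (op_g u * op_g v) b"
    unfolding b
    by (elim monomial_cases)
      (simp_all add: matrix_mul_assoc power_mult_distrib power_divide power_inverse divide_simps mult_ac
         power_add)
qed

lemma op_xy_commute: "op_x * op_y = op_y * op_x"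
  by (rule operator_eqI) auto

lemma op_g_x:
  "\<alpha> \<noteq> 0 \<Longrightarrow> op_g (diag_mat \<alpha>) * op_x = sc [:\<alpha>:] * op_x * op_g (diag_mat \<alpha>)"
  "op_g (refl_mat \<beta>) * op_x = sc [:inverse \<beta>:] * op_y * op_g (refl_mat \<beta>)"
  and op_g_y:
  "\<alpha> \<noteq> 0 \<Longrightarrow> op_g (diag_mat \<alpha>) * op_y = sc [:inverse \<alpha>:] * op_y * op_g (diag_mat \<alpha>)"
  "op_g (refl_mat \<beta>) * op_y = sc [:\<beta>:] * op_x * op_g (refl_mat \<beta>)"
  by (auto intro!: operator_eqI simp: mult_ac)

section \<open>The regular representation\<close>

abbreviation hb :: "complex poly operator" where "hb \<equiv> sc [:0, 1:]"
abbreviation cc :: "complex \<Rightarrow> complex poly operator" where "cc c \<equiv> sc [:c:]"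

lemma cc_mult: "cc b * cc c = cc (b * c)" "cc b * (cc c * e) = cc (b * c) * e"
  by (simp_all add: mult.commute flip: sc_mult mult.assoc)

lemma cc_1 [simp]: "cc 1 = 1"
  by (simp flip: one_pCons)

text \<open>The column of \<open>X\<close> (or \<open>Y\<close>) at \<open>x^m y^n b\<close> is found by moving \<open>X\<close> through \<open>x^m y^n\<close> one letter at
  a time; \<open>k1\<close> and \<open>k2\<close> are its commutators with \<open>x\<close> and \<open>y\<close>.\<close>

fun dunkl :: "'k::comm_ring_1 operator \<Rightarrow> 'k operator \<Rightarrow> (pbw_index \<Rightarrow>\<^sub>0 'k) \<Rightarrow> nat \<times> nat \<times> mat2 \<Rightarrow>
    nat \<Rightarrow> nat \<Rightarrow> pbw_index \<Rightarrow>\<^sub>0 'k" where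
  "dunkl k1 k2 t b 0 0 = t"
| "dunkl k1 k2 t b 0 (Suc n) = app op_y (dunkl k1 k2 t b 0 n) - col k2 (0, n, b)"
| "dunkl k1 k2 t b (Suc m) n = app op_x (dunkl k1 k2 t b m n) - col k1 (m, n, b)"

definition dunkl_op ::
  "'k::comm_ring_1 operator \<Rightarrow> 'k operator \<Rightarrow> (nat \<times> nat \<times> mat2 \<Rightarrow> pbw_index \<Rightarrow>\<^sub>0 'k) \<Rightarrow> 'k operator" where
  "dunkl_op k1 k2 t = Operator (\<lambda>(m, n, b). dunkl k1 k2 (t b) b m n)"

lemma col_dunkl_op [simp]: "col (dunkl_op k1 k2 t) (m, n, b) = dunkl k1 k2 (t b) b m n"
  by (simp add: dunkl_op_def)

lemma col_op_x' [simp]: "col op_x (m, n, b) = Poly_Mapping.single (Suc m, n, b) 1"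
  and col_op_y' [simp]: "col op_y (m, n, b) = Poly_Mapping.single (m, Suc n, b) 1"
  by (cases b; simp)+

lemma dunkl_op_x: "op_x * dunkl_op k1 k2 t = dunkl_op k1 k2 t * op_x + k1"
  by (rule operator_eqI) auto

text \<open>The construction imposes the relation with x everywhere, but the relation with y only on
  monomials without x. The hypothesis is the Jacobi identity for x, y and the new operator (x and y
  commute); it carries the relation with y through the induction on the exponent of x.\<close>

lemma dunkl_op_y:
  assumes "op_x * k2 - k2 * op_x = op_y * k1 - k1 * op_y"
  shows "op_y * dunkl_op k1 k2 t = dunkl_op k1 k2 t * op_y + k2"
proof -
  have "app op_y (dunkl k1 k2 u b m n) = dunkl k1 k2 u b m (Suc n) + col k2 (m, n, b)" for u b m n
  proof (induction m)
    case (Suc m)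
    have "col (op_x * k2 - k2 * op_x) (m, n, b) = col (op_y * k1 - k1 * op_y) (m, n, b)"
      using assms by simp
    then have compat: "app op_x (col k2 (m, n, b)) - col k2 (Suc m, n, b)
        = app op_y (col k1 (m, n, b)) - col k1 (m, Suc n, b)"
      by simp
    have "app op_y (dunkl k1 k2 u b (Suc m) n)
        = app op_x (app op_y (dunkl k1 k2 u b m n)) - app op_y (col k1 (m, n, b))"
      by (simp add: app_diff op_xy_commute flip: app_simps(1))
    also have "\<dots> = app op_x (dunkl k1 k2 u b m (Suc n))
        + (app op_x (col k2 (m, n, b)) - app op_y (col k1 (m, n, b)))"
      unfolding Suc app_add by simp
    also have "\<dots> = dunkl k1 k2 u b (Suc m) (Suc n) + col k2 (Suc m, n, b)"
      using compat by (simp add: algebra_simps)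
    finally show ?case .
  qed simp
  then show ?thesis
    by (intro operator_eqI) auto
qed

lemma op_g_xy_assoc:
  "\<alpha> \<noteq> 0 \<Longrightarrow> op_g (diag_mat \<alpha>) * (op_x * e) = cc \<alpha> * (op_x * (op_g (diag_mat \<alpha>) * e))"
  "op_g (refl_mat \<beta>) * (op_x * e) = cc (inverse \<beta>) * (op_y * (op_g (refl_mat \<beta>) * e))"
  "\<alpha> \<noteq> 0 \<Longrightarrow> op_g (diag_mat \<alpha>) * (op_y * e) = cc (inverse \<alpha>) * (op_y * (op_g (diag_mat \<alpha>) * e))"
  "op_g (refl_mat \<beta>) * (op_y * e) = cc \<beta> * (op_x * (op_g (refl_mat \<beta>) * e))"
  by (simp_all add: op_g_x op_g_y flip: mult.assoc)

text \<open>Under these relations an operator is determined by its columns at monomials without x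
  and y. Applied to the difference of two sides, this proves the relations of X and Y with each
  other and with the group.\<close>

lemma operator_zeroI:
  fixes e :: "'k::comm_ring_1 operator"
  assumes "e * op_x = f * e" "e * op_y = g * e" "\<And>b. col e (0, 0, b) = 0"
  shows "e = 0"
proof -
  have "col e (0, n, b) = 0" for n b
  proof (induction n)
    case (Suc n)
    have "col (e * op_y) (0, n, b) = col (g * e) (0, n, b)" using assms by simp
    then show ?case by (simp add: Suc)
  qed (use assms in simp)
  then have "col e (m, n, b) = 0" for m n b
  proof (induction m)
    case (Suc m)
    have "col (e * op_x) (m, n, b) = col (f * e) (m, n, b)" using assms by simp
    then show ?case by (simp add: Suc)
  qed simp
  then show ?thesis by (intro operator_eqI) auto
qed

locale cherednik = dihedral_setting +
  fixes a :: complex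
begin

abbreviation s :: "complex \<Rightarrow> complex poly operator" where "s \<beta> \<equiv> op_g (refl_mat \<beta>)"

definition refl_op :: "(complex \<Rightarrow> complex) \<Rightarrow> complex poly operator" where
  "refl_op k = (\<Sum>\<beta>\<in>B. cc (k \<beta>) * s \<beta>)"

abbreviation "S0 \<equiv> refl_op (\<lambda>\<beta>. 1)"
abbreviation "Sm \<equiv> refl_op (\<lambda>\<beta>. inverse \<beta>)"
abbreviation "Sp \<equiv> refl_op (\<lambda>\<beta>. \<beta>)"

definition op_X :: "complex poly operator" where
  "op_X = dunkl_op (hb - cc a * S0) (cc a * Sp) (\<lambda>(p, r, w). Poly_Mapping.single (0, 0, Suc p, r, w) 1)"
definition op_Y :: "complex poly operator" where
  "op_Y = dunkl_op (cc a * Sm) (hb - cc a * S0) (\<lambda>(p, r, w). Poly_Mapping.single (0, 0, p, Suc r, w) 1)"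

lemmas sc_left = sc_central[of op_x] sc_central[of op_y] sc_central[of op_X] sc_central[of op_Y]
  sc_central[of "op_g u" for u] sc_central[of "refl_op k" for k]

lemma sc_left_assoc:
  "op_x * (sc c * e) = sc c * (op_x * e)" "op_y * (sc c * e) = sc c * (op_y * e)"
  "op_X * (sc c * e) = sc c * (op_X * e)" "op_Y * (sc c * e) = sc c * (op_Y * e)"
  "op_g u * (sc c * e) = sc c * (op_g u * e)" "refl_op k * (sc c * e) = sc c * (refl_op k * e)"
  by (simp_all add: sc_central flip: mult.assoc)

lemmas sc_simps = sc_left sc_left_assoc cc_mult

lemma refl_op_left: "e * refl_op k = (\<Sum>\<beta>\<in>B. cc (k \<beta>) * (e * s \<beta>))"
  by (simp add: refl_op_def sum_distrib_left flip: mult.assoc) (simp add: sc_central)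

lemma refl_op_right: "refl_op k * e = (\<Sum>\<beta>\<in>B. cc (k \<beta>) * (s \<beta> * e))"
  by (simp add: refl_op_def sum_distrib_right mult.assoc)

text \<open>Moving a letter through a reflection exchanges x and y and changes the weight by a root
  of unity. These are the compatibility conditions of \<open>dunkl_op_y\<close>, and they are also
  why the reflection terms cancel in commutators with q.\<close>

lemma refl_op_x: "op_x * Sp = S0 * op_y" "Sp * op_x = op_y * S0"
    "Sm * op_y = op_x * S0" "op_y * Sm = S0 * op_x"
  unfolding refl_op_left refl_op_right
  by (auto intro!: sum.cong simp: op_g_x op_g_y B_nonzero mult.assoc cc_mult)

lemma op_x_X: "op_x * op_X = op_X * op_x + (hb - cc a * S0)"
  and op_x_Y: "op_x * op_Y = op_Y * op_x + cc a * Sm"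
  by (simp_all add: op_X_def op_Y_def dunkl_op_x)

lemma op_y_X: "op_y * op_X = op_X * op_y + cc a * Sp"
  unfolding op_X_def
  by (rule dunkl_op_y)
    (simp add: algebra_simps sc_simps refl_op_x sc_central[of op_y])

lemma op_y_Y: "op_y * op_Y = op_Y * op_y + (hb - cc a * S0)"
  unfolding op_Y_def
  by (rule dunkl_op_y)
    (simp add: algebra_simps sc_simps refl_op_x sc_central[of op_x])

lemma move:
  "op_X * op_x = op_x * op_X - (hb - cc a * S0)" "op_X * op_y = op_y * op_X - cc a * Sp"
  "op_Y * op_x = op_x * op_Y - cc a * Sm" "op_Y * op_y = op_y * op_Y - (hb - cc a * S0)"
  "op_X * (op_x * e) = op_x * (op_X * e) - (hb - cc a * S0) * e"
  "op_X * (op_y * e) = op_y * (op_X * e) - cc a * Sp * e"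
  "op_Y * (op_x * e) = op_x * (op_Y * e) - cc a * Sm * e"
  "op_Y * (op_y * e) = op_y * (op_Y * e) - (hb - cc a * S0) * e"
proof -
  show xX: "op_X * op_x = op_x * op_X - (hb - cc a * S0)" and yX: "op_X * op_y = op_y * op_X - cc a * Sp"
    and xY: "op_Y * op_x = op_x * op_Y - cc a * Sm" and yY: "op_Y * op_y = op_y * op_Y - (hb - cc a * S0)"
    by (simp_all add: op_x_X op_y_X op_x_Y op_y_Y)
  show "op_X * (op_x * e) = op_x * (op_X * e) - (hb - cc a * S0) * e"
    "op_X * (op_y * e) = op_y * (op_X * e) - cc a * Sp * e"
    "op_Y * (op_x * e) = op_x * (op_Y * e) - cc a * Sm * e"
    "op_Y * (op_y * e) = op_y * (op_Y * e) - (hb - cc a * S0) * e"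
    using xX yX xY yY by (metis mult.assoc left_diff_distrib)+
qed

lemma col_op_X_base [simp]: "col op_X (0, 0, p, r, w) = Poly_Mapping.single (0, 0, Suc p, r, w) 1"
  and col_op_Y_base [simp]: "col op_Y (0, 0, p, r, w) = Poly_Mapping.single (0, 0, p, Suc r, w) 1"
  by (simp_all add: op_X_def op_Y_def)

section \<open>Commutation of the group operators with X and Y\<close>

lemma refl_refl_op:
  assumes "\<gamma> \<in> B"
  shows "s \<gamma> * refl_op k = refl_op (\<lambda>\<beta>. k (\<gamma>\<^sup>2 / \<beta>)) * s \<gamma>"
  unfolding refl_op_left refl_op_right
  by (rule sum.reindex_bij_witness[of _ "\<lambda>\<beta>. \<gamma>\<^sup>2 / \<beta>" "\<lambda>\<beta>. \<gamma>\<^sup>2 / \<beta>"])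
    (use assms in \<open>auto simp: B_nonzero power2_eq_square B_mult B_divide simp flip: op_g_mult\<close>)

text \<open>Conjugation by \<open>diag_mat \<eta>\<close> multiplies the parameter of a reflection
  by \<open>\<eta>\<^sup>2\<close>. The hypothesis is on this square, which admits the rotation
  outside \<open>W\<close> behind the sign automorphism.\<close>

lemma diag_refl_op:
  assumes "\<eta>\<^sup>2 \<in> B"
  shows "op_g (diag_mat \<eta>) * refl_op k = refl_op (\<lambda>\<beta>. k (\<beta> / \<eta>\<^sup>2)) * op_g (diag_mat \<eta>)"
proof -
  have "\<eta> \<noteq> 0" using B_nonzero[OF assms] by auto
  then show ?thesis
    unfolding refl_op_left refl_op_right
    by (intro sum.reindex_bij_witness[of _ "\<lambda>\<beta>. \<beta> / \<eta>\<^sup>2" "\<lambda>\<beta>. \<eta>\<^sup>2 * \<beta>"])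
      (use assms B_mult[OF assms] B_divide[OF _ assms] in
        \<open>auto simp: B_nonzero power2_eq_square simp flip: op_g_mult\<close>)
qed

lemma refl_op_smult: "refl_op (\<lambda>\<beta>. c * k \<beta>) = cc c * refl_op k"
  by (simp add: refl_op_def sum_distrib_left cc_mult)

lemma refl_S:
  assumes "\<gamma> \<in> B"
  shows "s \<gamma> * S0 = S0 * s \<gamma>" "s \<gamma> * Sp = cc (\<gamma>\<^sup>2) * (Sm * s \<gamma>)"
    "s \<gamma> * Sm = cc (inverse (\<gamma>\<^sup>2)) * (Sp * s \<gamma>)"
  using refl_op_smult[of "\<gamma>\<^sup>2" inverse] refl_op_smult[of "inverse (\<gamma>\<^sup>2)" "\<lambda>\<beta>. \<beta>"]
  by (simp_all add: refl_refl_op[OF assms] divide_inverse mult.assoc)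

lemma diag_S:
  assumes "\<eta>\<^sup>2 \<in> B"
  shows "op_g (diag_mat \<eta>) * S0 = S0 * op_g (diag_mat \<eta>)"
    "op_g (diag_mat \<eta>) * Sp = cc (inverse (\<eta>\<^sup>2)) * (Sp * op_g (diag_mat \<eta>))"
    "op_g (diag_mat \<eta>) * Sm = cc (\<eta>\<^sup>2) * (Sm * op_g (diag_mat \<eta>))"
  using refl_op_smult[of "\<eta>\<^sup>2" inverse] refl_op_smult[of "inverse (\<eta>\<^sup>2)" "\<lambda>\<beta>. \<beta>"]
  by (simp_all add: diag_refl_op[OF assms] divide_inverse mult.assoc mult.commute)

lemma refl_X:
  assumes "\<gamma> \<in> B"
  shows "s \<gamma> * op_X = cc \<gamma> * op_Y * s \<gamma>"
proof -
  have [simp]: "\<gamma> \<noteq> 0" using assms by (rule B_nonzero)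
  have [simp]: "\<gamma> * (a * inverse \<gamma>) = a" by simp
  \<comment> \<open>The defect of the claimed relation. Passing x through the reflection turns it
    into a multiple of y and conversely, which supplies the left factors for
    \<open>operator_zeroI\<close>.\<close>
  define e where "e = s \<gamma> * op_X - cc \<gamma> * op_Y * s \<gamma>"
  have "e = 0"
  proof (rule operator_zeroI)
    have "e * op_x = s \<gamma> * (op_X * op_x) - cc \<gamma> * op_Y * (s \<gamma> * op_x)"
      by (simp add: e_def algebra_simps)
    also have "\<dots> = (s \<gamma> * op_x) * op_X - s \<gamma> * (hb - cc a * S0) - (op_Y * op_y) * s \<gamma>"
      by (simp add: move op_g_x op_g_xy_assoc algebra_simps sc_simps)
    also have "\<dots> = (cc (inverse \<gamma>) * op_y) * e"
      by (simp add: move op_g_x op_g_xy_assoc algebra_simps sc_simps refl_S[OF assms] e_def)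
    finally show "e * op_x = (cc (inverse \<gamma>) * op_y) * e" .
    have "e * op_y = s \<gamma> * (op_X * op_y) - cc \<gamma> * op_Y * (s \<gamma> * op_y)"
      by (simp add: e_def algebra_simps)
    also have "\<dots> = (s \<gamma> * op_y) * op_X - s \<gamma> * (cc a * Sp) - cc (\<gamma>\<^sup>2) * (op_Y * op_x) * s \<gamma>"
      by (simp add: move op_g_y op_g_xy_assoc algebra_simps sc_simps power2_eq_square)
    also have "\<dots> = (cc \<gamma> * op_x) * e"
      by (simp add: move op_g_y op_g_xy_assoc algebra_simps sc_simps refl_S[OF assms] e_def power2_eq_square)
    finally show "e * op_y = (cc \<gamma> * op_x) * e" .
    show "col e (0, 0, b) = 0" for b
      by (cases b) (simp add: e_def mult_ac)
  qed
  then show ?thesis by (simp add: e_def)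
qed

lemma refl_Y:
  assumes "\<gamma> \<in> B"
  shows "s \<gamma> * op_Y = cc (inverse \<gamma>) * op_X * s \<gamma>"
proof -
  have [simp]: "\<gamma> \<noteq> 0" using assms by (rule B_nonzero)
  have sq: "s \<gamma> * s \<gamma> = 1" by (simp flip: op_g_mult)
  have "s \<gamma> * (s \<gamma> * op_X) * s \<gamma> = op_X * s \<gamma>"
    by (simp add: sq flip: mult.assoc)
  moreover have "s \<gamma> * (s \<gamma> * op_X) * s \<gamma> = cc \<gamma> * (s \<gamma> * op_Y)"
    by (simp add: refl_X[OF assms] sc_simps mult.assoc sq)
  ultimately have "cc (inverse \<gamma>) * (op_X * s \<gamma>) = cc (inverse \<gamma>) * (cc \<gamma> * (s \<gamma> * op_Y))"
    by simp
  then show ?thesis by (simp add: cc_mult mult.assoc)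
qed

lemma diag_XY:
  assumes "\<eta>\<^sup>2 \<in> B"
  shows "op_g (diag_mat \<eta>) * op_X = cc (inverse \<eta>) * op_X * op_g (diag_mat \<eta>)" (is "?g * _ = _")
    and "op_g (diag_mat \<eta>) * op_Y = cc \<eta> * op_Y * op_g (diag_mat \<eta>)"
proof -
  have [simp]: "\<eta> \<noteq> 0" using B_nonzero[OF assms] by auto
  have [simp]: "\<eta> * (a * inverse \<eta>) = a" by simp
  define e where "e = ?g * op_X - cc (inverse \<eta>) * op_X * ?g"
  have "e = 0"
  proof (rule operator_zeroI)
    have "e * op_x = ?g * (op_X * op_x) - cc (inverse \<eta>) * op_X * (?g * op_x)"
      by (simp add: e_def algebra_simps)
    also have "\<dots> = (?g * op_x) * op_X - ?g * (hb - cc a * S0) - (op_X * op_x) * ?g"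
      by (simp add: move op_g_x op_g_xy_assoc algebra_simps sc_simps)
    also have "\<dots> = (cc \<eta> * op_x) * e"
      by (simp add: move op_g_x op_g_xy_assoc algebra_simps sc_simps diag_S[OF assms] e_def)
    finally show "e * op_x = (cc \<eta> * op_x) * e" .
    have "e * op_y = ?g * (op_X * op_y) - cc (inverse \<eta>) * op_X * (?g * op_y)"
      by (simp add: e_def algebra_simps)
    also have "\<dots> = (?g * op_y) * op_X - ?g * (cc a * Sp) - cc (inverse (\<eta>\<^sup>2)) * (op_X * op_y) * ?g"
      by (simp add: move op_g_y op_g_xy_assoc algebra_simps sc_simps power2_eq_square)
    also have "\<dots> = (cc (inverse \<eta>) * op_y) * e"
      by (simp add: move op_g_y op_g_xy_assoc algebra_simps sc_simps diag_S[OF assms] e_def power2_eq_square)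
    finally show "e * op_y = (cc (inverse \<eta>) * op_y) * e" .
    show "col e (0, 0, b) = 0" for b
      by (cases b) (simp add: e_def mult_ac)
  qed
  then show "?g * op_X = cc (inverse \<eta>) * op_X * ?g" by (simp add: e_def)
  define f where "f = ?g * op_Y - cc \<eta> * op_Y * ?g"
  have "f = 0"
  proof (rule operator_zeroI)
    have "f * op_x = ?g * (op_Y * op_x) - cc \<eta> * op_Y * (?g * op_x)"
      by (simp add: f_def algebra_simps)
    also have "\<dots> = (?g * op_x) * op_Y - ?g * (cc a * Sm) - cc (\<eta>\<^sup>2) * (op_Y * op_x) * ?g"
      by (simp add: move op_g_x op_g_xy_assoc algebra_simps sc_simps power2_eq_square)
    also have "\<dots> = (cc \<eta> * op_x) * f"
      by (simp add: move op_g_x op_g_xy_assoc algebra_simps sc_simps diag_S[OF assms] f_def power2_eq_square)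
    finally show "f * op_x = (cc \<eta> * op_x) * f" .
    have "f * op_y = ?g * (op_Y * op_y) - cc \<eta> * op_Y * (?g * op_y)"
      by (simp add: f_def algebra_simps)
    also have "\<dots> = (?g * op_y) * op_Y - ?g * (hb - cc a * S0) - (op_Y * op_y) * ?g"
      by (simp add: move op_g_y op_g_xy_assoc algebra_simps sc_simps)
    also have "\<dots> = (cc (inverse \<eta>) * op_y) * f"
      by (simp add: move op_g_y op_g_xy_assoc algebra_simps sc_simps diag_S[OF assms] f_def)
    finally show "f * op_y = (cc (inverse \<eta>) * op_y) * f" .
    show "col f (0, 0, b) = 0" for b
      by (cases b) (simp add: f_def mult_ac)
  qed
  then show "?g * op_Y = cc \<eta> * op_Y * ?g" by (simp add: f_def)
qed

lemma refl_op_X: "op_X * Sm = S0 * op_Y" "Sm * op_X = op_Y * S0"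
    "Sp * op_Y = op_X * S0" "op_Y * Sp = S0 * op_X"
  unfolding refl_op_left refl_op_right
  by (auto intro!: sum.cong simp: refl_X refl_Y B_nonzero mult.assoc cc_mult)

text \<open>By \<open>refl_op_X\<close> the reflection terms cancel, so the commutator of X and Y
  commutes with x and y; it vanishes on monomials without x and y.\<close>

lemma op_XY_commute: "op_X * op_Y = op_Y * op_X"
proof -
  have "op_X * op_Y - op_Y * op_X = 0"
  proof (rule operator_zeroI)
    show "(op_X * op_Y - op_Y * op_X) * op_x = op_x * (op_X * op_Y - op_Y * op_X)"
      by (simp add: algebra_simps move sc_simps refl_op_X)
    show "(op_X * op_Y - op_Y * op_X) * op_y = op_y * (op_X * op_Y - op_Y * op_X)"
      by (simp add: algebra_simps move sc_simps refl_op_X)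
    show "col (op_X * op_Y - op_Y * op_X) (0, 0, b) = 0" for b
      by (cases b) simp
  qed
  then show ?thesis by simp
qed

section \<open>The representation of the semidirect product\<close>

fun op_letter :: "coord \<Rightarrow> complex poly operator" where
  "op_letter cx = op_x"
| "op_letter cy = op_y"
| "op_letter cX = op_X"
| "op_letter cY = op_Y"

definition tensor_op :: "tensor \<Rightarrow> complex poly operator" where
  "tensor_op = pm_eval sc (\<lambda>u. prod_list (map op_letter u))"

definition phi :: "(mat2 \<Rightarrow> tensor) \<Rightarrow> complex poly operator" where
  "phi F = (\<Sum>w\<in>W. tensor_op (F w) * op_g w)"

lemma pm_hom_tensor_op: "pm_hom sc (\<lambda>u. prod_list (map op_letter u))"
  by (unfold_locales; (rule sc_central)?) (simp_all add: sc_add sc_mult zero_list_def plus_list_def)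

lemma tensor_op_simps [simp]:
  "tensor_op 0 = 0" "tensor_op 1 = 1" "tensor_op (f + g) = tensor_op f + tensor_op g"
  "tensor_op (f * g) = tensor_op f * tensor_op g"
  "tensor_op (Poly_Mapping.single u p) = sc p * prod_list (map op_letter u)"
proof -
  interpret pm_hom sc "\<lambda>u. prod_list (map op_letter u)" by (rule pm_hom_tensor_op)
  show "tensor_op 0 = 0" "tensor_op 1 = 1" "tensor_op (f + g) = tensor_op f + tensor_op g"
    "tensor_op (f * g) = tensor_op f * tensor_op g"
    "tensor_op (Poly_Mapping.single u p) = sc p * prod_list (map op_letter u)"
    by (simp_all add: tensor_op_def pm_eval_add pm_eval_mult)
qed

lemma tensor_op_sum: "tensor_op (\<Sum>i\<in>A. f i) = (\<Sum>i\<in>A. tensor_op (f i))"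
  by (induction A rule: infinite_finite_induct) simp_all

lemma tensor_op_tconst [simp]: "tensor_op (tconst p) = sc p"
  by (simp add: tconst_def)

lemma tensor_op_tword [simp]: "tensor_op (tword u) = prod_list (map op_letter u)"
  by (simp add: tword_def)

lemma op_g_letter:
  assumes "w \<in> W"
  shows "op_g w * op_letter c = tensor_op (act_gen w c) * op_g w"
proof -
  from assms consider \<beta> where "\<beta> \<in> B" "w = diag_mat \<beta>" | \<beta> where "\<beta> \<in> B" "w = refl_mat \<beta>"
    by (auto simp: W_eq)
  then show ?thesis
  proof cases
    case 1
    then have "\<beta> \<noteq> 0" "\<beta>\<^sup>2 \<in> B" by (auto simp: B_nonzero power2_eq_square B_mult)
    with 1 show ?thesis
      by (cases c) (simp_all add: op_g_x op_g_y diag_XY tconst_0)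
  next
    case 2
    then have "\<beta> \<noteq> 0" by (auto simp: B_nonzero)
    with 2 show ?thesis
      by (cases c) (simp_all add: op_g_x op_g_y refl_X refl_Y tconst_0)
  qed
qed

lemma op_g_tensor:
  assumes "w \<in> W"
  shows "op_g w * tensor_op f = tensor_op (act w f) * op_g w"
proof (induction f rule: poly_mapping_induct_single)
  case (single k c)
  have "op_g w * prod_list (map op_letter k) = tensor_op (prod_list (map (act_gen w) k)) * op_g w"
  proof (induction k)
    case (Cons c k)
    have "op_g w * prod_list (map op_letter (c # k))
        = tensor_op (act_gen w c) * (op_g w * prod_list (map op_letter k))"
      by (simp add: op_g_letter[OF assms] flip: mult.assoc)
    then show ?case by (simp add: Cons mult.assoc)
  qed simp
  then show ?case
    by (simp add: act_single mult.assoc sc_left_assoc)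
qed (simp_all add: act_add distrib_left distrib_right)

lemma phi_sm [simp]: "w \<in> W \<Longrightarrow> phi (sm f w) = tensor_op f * op_g w"
proof -
  assume "w \<in> W"
  have "phi (sm f w) = (\<Sum>v\<in>W. if v = w then tensor_op f * op_g w else 0)"
    unfolding phi_def by (intro sum.cong) (auto simp: sm_def)
  with \<open>w \<in> W\<close> show ?thesis by (simp add: finite_W)
qed

lemma phi_one [simp]: "phi \<one>\<^bsub>R\<^esub> = 1"
  by (simp add: smash_one)

lemma phi_add [simp]: "phi (F \<oplus>\<^bsub>R\<^esub> G) = phi F + phi G"
  by (simp add: phi_def smash_add distrib_right sum.distrib)

lemma phi_zero [simp]: "phi \<zero>\<^bsub>R\<^esub> = 0"
  by (simp add: phi_def smash_zero)

lemma phi_minus [simp]: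
  assumes "F \<in> carrier R" "G \<in> carrier R"
  shows "phi (F \<ominus>\<^bsub>R\<^esub> G) = phi F - phi G"
proof -
  interpret ring R by (rule ring_smash)
  have "phi ((F \<ominus>\<^bsub>R\<^esub> G) \<oplus>\<^bsub>R\<^esub> G) = phi F"
    using assms by (simp add: a_minus_def a_assoc l_neg del: phi_add)
  then show ?thesis by (simp add: algebra_simps)
qed

lemma phi_mult [simp]: "phi (F \<otimes>\<^bsub>R\<^esub> G) = phi F * phi G"
proof -
  let ?t = "\<lambda>w v. tensor_op (F w) * tensor_op (act w (G v))"
  have "phi (F \<otimes>\<^bsub>R\<^esub> G) = (\<Sum>u\<in>W. \<Sum>w\<in>W. \<Sum>v\<in>W. if w ** v = u then ?t w v * op_g (w ** v) else 0)"
    unfolding phi_def smash_mult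
    by (intro sum.cong refl) (auto simp: tensor_op_sum sum_distrib_right intro!: sum.cong)
  also have "\<dots> = (\<Sum>w\<in>W. \<Sum>v\<in>W. \<Sum>u\<in>W. if w ** v = u then ?t w v * op_g (w ** v) else 0)"
    by (rule trans[OF sum.swap], rule sum.cong[OF refl], rule sum.swap)
  also have "\<dots> = (\<Sum>w\<in>W. \<Sum>v\<in>W. ?t w v * op_g (w ** v))"
    by (intro sum.cong refl) (simp add: sum.delta'[OF finite_W] W_mult)
  also have "\<dots> = (\<Sum>w\<in>W. \<Sum>v\<in>W. (tensor_op (F w) * op_g w) * (tensor_op (G v) * op_g v))"
  proof (intro sum.cong refl)
    fix w v assume "w \<in> W" "v \<in> W"
    have "(tensor_op (F w) * op_g w) * (tensor_op (G v) * op_g v)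
        = tensor_op (F w) * (op_g w * tensor_op (G v)) * op_g v"
      by (simp add: mult.assoc)
    also have "\<dots> = ?t w v * op_g (w ** v)"
      using \<open>w \<in> W\<close> \<open>v \<in> W\<close> by (simp add: op_g_tensor op_g_mult W_monomial mult.assoc)
    finally show "?t w v * op_g (w ** v) = (tensor_op (F w) * op_g w) * (tensor_op (G v) * op_g v)" ..
  qed
  also have "\<dots> = phi F * phi G"
    by (simp add: phi_def sum_product)
  finally show ?thesis .
qed

lemma phi_finsum:
  assumes "finite A" "\<And>i. i \<in> A \<Longrightarrow> F i \<in> carrier R"
  shows "phi (\<Oplus>\<^bsub>R\<^esub>i\<in>A. F i) = (\<Sum>i\<in>A. phi (F i))"
proof -
  interpret ring R by (rule ring_smash)
  show ?thesis using assms
    by (induction A rule: finite_induct) (simp_all add: finsum_insert Pi_def)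
qed

section \<open>The Cherednik relations and the descent to the quotient\<close>

abbreviation "rel_refl k \<equiv> refl_sum d \<zeta> (\<lambda>i. k (\<zeta> ^ i))"

lemma rel_refl_carrier [simp]: "refl_sum d \<zeta> k \<in> carrier R"
proof -
  interpret ring R by (rule ring_smash)
  show ?thesis unfolding refl_sum_def
    by (rule finsum_closed) (auto simp: reflection_in_W)
qed

lemma phi_rel_refl [simp]: "phi (rel_refl k) = refl_op k"
proof -
  have "phi (rel_refl k) = (\<Sum>i<d. cc (k (\<zeta> ^ i)) * s (\<zeta> ^ i))"
    unfolding refl_sum_def
    by (subst phi_finsum) (auto simp: refl_in_W \<zeta>_power_in_B reflection_eq intro!: sum.cong)
  also have "\<dots> = refl_op k"
    unfolding refl_op_def B_eq by (simp add: sum.reindex inj_on_\<zeta>_power)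
  finally show ?thesis .
qed

abbreviation "lx \<equiv> sm (tword [cx]) (mat 1)"
abbreviation "ly \<equiv> sm (tword [cy]) (mat 1)"
abbreviation "lX \<equiv> sm (tword [cX]) (mat 1)"
abbreviation "lY \<equiv> sm (tword [cY]) (mat 1)"
abbreviation "lc p \<equiv> sm (tconst p) (mat 1)"
abbreviation "lh \<equiv> lc [:0, 1:]"

abbreviation "K0 \<equiv> lh \<ominus>\<^bsub>R\<^esub> rel_refl (\<lambda>_. a)"
abbreviation "Km \<equiv> rel_refl (\<lambda>\<beta>. a * inverse \<beta>)"
abbreviation "Kp \<equiv> rel_refl (\<lambda>\<beta>. a * \<beta>)"

lemma relations_eq: "cherednik_relations d \<zeta> a =
  {commutator R lx ly, commutator R lX lY, commutator R lx lX \<ominus>\<^bsub>R\<^esub> K0, commutator R ly lY \<ominus>\<^bsub>R\<^esub> K0,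
   commutator R lx lY \<ominus>\<^bsub>R\<^esub> Km, commutator R ly lX \<ominus>\<^bsub>R\<^esub> Kp}"
  by (simp add: cherednik_relations_def Let_def)

lemma refl_op_cmult: "refl_op (\<lambda>_. a) = cc a * S0"
  using refl_op_smult[of a "\<lambda>_. 1"] by simp

lemma phi_K [simp]: "phi K0 = hb - cc a * S0" "phi Km = cc a * Sm" "phi Kp = cc a * Sp"
  using phi_rel_refl[of "\<lambda>_. a"] phi_rel_refl[of "\<lambda>\<beta>. a * inverse \<beta>"] phi_rel_refl[of "\<lambda>\<beta>. a * \<beta>"]
    refl_op_smult[of a "\<lambda>\<beta>. \<beta>"]
  by (simp_all add: refl_op_cmult refl_op_smult)

lemma relations_carrier: "cherednik_relations d \<zeta> a \<subseteq> carrier R"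
proof -
  interpret ring R by (rule ring_smash)
  show ?thesis by (simp add: relations_eq commutator_def)
qed

lemma phi_relations: "F \<in> cherednik_relations d \<zeta> a \<Longrightarrow> phi F = 0"
proof -
  interpret ring R by (rule ring_smash)
  assume "F \<in> cherednik_relations d \<zeta> a"
  then show ?thesis
    by (auto simp: relations_eq commutator_def op_xy_commute op_XY_commute op_x_X op_x_Y op_y_X op_y_Y
        refl_op_smult[of a "\<lambda>\<beta>. \<beta>"])
qed

abbreviation "I \<equiv> cherednik_ideal d \<zeta> a"
abbreviation "H \<equiv> Hh d \<zeta> a"
abbreviation "\<pi> \<equiv> to_Hh d \<zeta> a"

lemma ideal_I: "ideal I R"
  unfolding cherednik_ideal_def
  by (rule ring.genideal_ideal[OF ring_smash relations_carrier])

text \<open>The kernel of \<open>phi\<close> is a two-sided ideal that contains the relations, so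
  the representation descends to \<open>H\<close>.\<close>

lemma phi_ideal: "F \<in> I \<Longrightarrow> phi F = 0"
proof -
  interpret ring R by (rule ring_smash)
  have "ideal {F \<in> carrier R. phi F = 0} R"
  proof (rule idealI[OF ring_smash])
    show "subgroup {F \<in> carrier R. phi F = 0} (add_monoid R)"
    proof (rule add.subgroupI)
      show "{F \<in> carrier R. phi F = 0} \<noteq> {}" using phi_zero by blast
      show "\<ominus>\<^bsub>R\<^esub> F \<in> {F \<in> carrier R. phi F = 0}" if "F \<in> {F \<in> carrier R. phi F = 0}" for F
        using that phi_minus[of "\<zero>\<^bsub>R\<^esub>" F] by (simp add: a_minus_def)
    qed auto
  qed auto
  then have "I \<subseteq> {F \<in> carrier R. phi F = 0}"
    unfolding cherednik_ideal_def
    by (rule genideal_minimal) (use phi_relations relations_carrier in auto)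
  then show "F \<in> I \<Longrightarrow> phi F = 0" by auto
qed

lemma ring_H: "ring H"
  unfolding Hh_def by (rule ideal.quotient_is_ring[OF ideal_I])

lemma \<pi>_ring_hom: "\<pi> \<in> ring_hom R H"
  using ideal.rcos_ring_hom[OF ideal_I] unfolding Hh_def to_Hh_def[abs_def] .

lemma \<pi>_simps [simp]:
  assumes "F \<in> carrier R" "G \<in> carrier R"
  shows "\<pi> (F \<oplus>\<^bsub>R\<^esub> G) = \<pi> F \<oplus>\<^bsub>H\<^esub> \<pi> G" "\<pi> (F \<otimes>\<^bsub>R\<^esub> G) = \<pi> F \<otimes>\<^bsub>H\<^esub> \<pi> G"
    "\<pi> (F \<ominus>\<^bsub>R\<^esub> G) = \<pi> F \<ominus>\<^bsub>H\<^esub> \<pi> G"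
proof -
  interpret ring_hom_ring R H \<pi>
    by (rule ring_hom_ringI2[OF ring_smash ring_H \<pi>_ring_hom])
  show "\<pi> (F \<oplus>\<^bsub>R\<^esub> G) = \<pi> F \<oplus>\<^bsub>H\<^esub> \<pi> G" "\<pi> (F \<otimes>\<^bsub>R\<^esub> G) = \<pi> F \<otimes>\<^bsub>H\<^esub> \<pi> G"
    using assms by simp_all
  show "\<pi> (F \<ominus>\<^bsub>R\<^esub> G) = \<pi> F \<ominus>\<^bsub>H\<^esub> \<pi> G"
    using assms by (simp add: a_minus_def)
qed

lemma \<pi>_closed [simp]: "F \<in> carrier R \<Longrightarrow> \<pi> F \<in> carrier H"
  by (rule ring_hom_closed[OF \<pi>_ring_hom])

lemma \<pi>_surj:
  assumes "h \<in> carrier H"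
  obtains F where "F \<in> carrier R" "h = \<pi> F"
proof -
  interpret ideal I R by (rule ideal_I)
  show ?thesis
    using assms that unfolding Hh_def to_Hh_def by (auto simp: FactRing_simps A_RCOSETS_def' a_r_coset_def)
qed

lemma \<pi>_eq_iff:
  assumes "F \<in> carrier R" "G \<in> carrier R"
  shows "\<pi> F = \<pi> G \<longleftrightarrow> F \<ominus>\<^bsub>R\<^esub> G \<in> I"
  unfolding to_Hh_def
  using ring.quotient_eq_iff_same_a_r_cos[OF ring_smash ideal_I assms] by simp

lemma phi_cong:
  assumes "F \<in> carrier R" "G \<in> carrier R" "\<pi> F = \<pi> G"
  shows "phi F = phi G"
  using phi_ideal[of "F \<ominus>\<^bsub>R\<^esub> G"] assms by (simp add: \<pi>_eq_iff)

text \<open>The defining relations as rewriting rules towards the order x, y, X, Y. They drive the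
  proof that the PBW monomials span.\<close>

lemma \<pi>_relations:
  "\<pi> (ly \<otimes>\<^bsub>R\<^esub> lx) = \<pi> (lx \<otimes>\<^bsub>R\<^esub> ly)" "\<pi> (lY \<otimes>\<^bsub>R\<^esub> lX) = \<pi> (lX \<otimes>\<^bsub>R\<^esub> lY)"
  "\<pi> (lX \<otimes>\<^bsub>R\<^esub> lx) = \<pi> (lx \<otimes>\<^bsub>R\<^esub> lX \<ominus>\<^bsub>R\<^esub> K0)" "\<pi> (lY \<otimes>\<^bsub>R\<^esub> ly) = \<pi> (ly \<otimes>\<^bsub>R\<^esub> lY \<ominus>\<^bsub>R\<^esub> K0)"
  "\<pi> (lY \<otimes>\<^bsub>R\<^esub> lx) = \<pi> (lx \<otimes>\<^bsub>R\<^esub> lY \<ominus>\<^bsub>R\<^esub> Km)" "\<pi> (lX \<otimes>\<^bsub>R\<^esub> ly) = \<pi> (ly \<otimes>\<^bsub>R\<^esub> lX \<ominus>\<^bsub>R\<^esub> Kp)"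
proof -
  interpret ring R by (rule ring_smash)
  interpret H: ring H by (rule ring_H)
  have mem: "F \<in> I" if "F \<in> cherednik_relations d \<zeta> a" for F
    using genideal_self[OF relations_carrier] that by (auto simp: cherednik_ideal_def)
  have zero: "\<pi> F = \<zero>\<^bsub>H\<^esub>" if "F \<in> cherednik_relations d \<zeta> a" for F
  proof -
    have F: "F \<in> carrier R" using relations_carrier that by auto
    then have "\<pi> F = \<pi> \<zero>\<^bsub>R\<^esub>"
      using mem[OF that] by (simp add: \<pi>_eq_iff a_minus_def)
    also have "\<dots> = \<zero>\<^bsub>H\<^esub>"
      by (rule ring_hom_zero[OF \<pi>_ring_hom ring_smash ring_H])
    finally show ?thesis .
  qed
  have swap0: "v = u" if "u \<ominus>\<^bsub>H\<^esub> v = \<zero>\<^bsub>H\<^esub>" "u \<in> carrier H" "v \<in> carrier H" for u v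
    using that by (metis H.a_inv_closed H.minus_equality H.minus_minus a_minus_def)
  have swap: "v = u \<ominus>\<^bsub>H\<^esub> k" if "u \<ominus>\<^bsub>H\<^esub> v \<ominus>\<^bsub>H\<^esub> k = \<zero>\<^bsub>H\<^esub>"
    "u \<in> carrier H" "v \<in> carrier H" "k \<in> carrier H" for u v k
  proof -
    have "v = u \<ominus>\<^bsub>H\<^esub> (u \<ominus>\<^bsub>H\<^esub> v)" using that(2,3) by (simp add: a_minus_def H.minus_add H.r_neg1 H.r_neg2)
    moreover have "u \<ominus>\<^bsub>H\<^esub> v = k"
      using swap0[OF that(1)] that(2-4) by simp
    ultimately show ?thesis by simp
  qed
  have z: "\<pi> (commutator R lx ly) = \<zero>\<^bsub>H\<^esub>" "\<pi> (commutator R lX lY) = \<zero>\<^bsub>H\<^esub>"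
    "\<pi> (commutator R lx lX \<ominus>\<^bsub>R\<^esub> K0) = \<zero>\<^bsub>H\<^esub>" "\<pi> (commutator R ly lY \<ominus>\<^bsub>R\<^esub> K0) = \<zero>\<^bsub>H\<^esub>"
    "\<pi> (commutator R lx lY \<ominus>\<^bsub>R\<^esub> Km) = \<zero>\<^bsub>H\<^esub>" "\<pi> (commutator R ly lX \<ominus>\<^bsub>R\<^esub> Kp) = \<zero>\<^bsub>H\<^esub>"
    by (rule zero; simp add: relations_eq)+
  show "\<pi> (ly \<otimes>\<^bsub>R\<^esub> lx) = \<pi> (lx \<otimes>\<^bsub>R\<^esub> ly)"
    by (rule swap0) (use z(1) in \<open>simp_all add: commutator_def\<close>)
  show "\<pi> (lY \<otimes>\<^bsub>R\<^esub> lX) = \<pi> (lX \<otimes>\<^bsub>R\<^esub> lY)"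
    by (rule swap0) (use z(2) in \<open>simp_all add: commutator_def\<close>)
  have "\<pi> (lX \<otimes>\<^bsub>R\<^esub> lx) = \<pi> (lx \<otimes>\<^bsub>R\<^esub> lX) \<ominus>\<^bsub>H\<^esub> \<pi> K0" "\<pi> (lY \<otimes>\<^bsub>R\<^esub> ly) = \<pi> (ly \<otimes>\<^bsub>R\<^esub> lY) \<ominus>\<^bsub>H\<^esub> \<pi> K0"
    "\<pi> (lY \<otimes>\<^bsub>R\<^esub> lx) = \<pi> (lx \<otimes>\<^bsub>R\<^esub> lY) \<ominus>\<^bsub>H\<^esub> \<pi> Km" "\<pi> (lX \<otimes>\<^bsub>R\<^esub> ly) = \<pi> (ly \<otimes>\<^bsub>R\<^esub> lX) \<ominus>\<^bsub>H\<^esub> \<pi> Kp"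
    by (rule swap; use z(3-6) in \<open>simp add: commutator_def\<close>)+
  then show "\<pi> (lX \<otimes>\<^bsub>R\<^esub> lx) = \<pi> (lx \<otimes>\<^bsub>R\<^esub> lX \<ominus>\<^bsub>R\<^esub> K0)" "\<pi> (lY \<otimes>\<^bsub>R\<^esub> ly) = \<pi> (ly \<otimes>\<^bsub>R\<^esub> lY \<ominus>\<^bsub>R\<^esub> K0)"
    "\<pi> (lY \<otimes>\<^bsub>R\<^esub> lx) = \<pi> (lx \<otimes>\<^bsub>R\<^esub> lY \<ominus>\<^bsub>R\<^esub> Km)" "\<pi> (lX \<otimes>\<^bsub>R\<^esub> ly) = \<pi> (ly \<otimes>\<^bsub>R\<^esub> lX \<ominus>\<^bsub>R\<^esub> Kp)"
    by simp_all
qed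

end

section \<open>The PBW theorem\<close>

fun grp :: "pbw_index \<Rightarrow> mat2" where "grp (m, n, p, r, w) = w"

fun pbw_word :: "pbw_index \<Rightarrow> coord list" where
  "pbw_word (m, n, p, r, w) = replicate m cx @ replicate n cy @ replicate p cX @ replicate r cY"

context cherednik
begin

text \<open>The basis of the free module is indexed with arbitrary matrices, which leaves room for
  group elements outside \<open>W\<close>; this selects the vectors that come from the
  algebra.\<close>

definition Wsup :: "(pbw_index \<Rightarrow>\<^sub>0 'k::zero) \<Rightarrow> bool" where
  "Wsup \<mu> \<longleftrightarrow> (\<forall>b\<in>Poly_Mapping.keys \<mu>. grp b \<in> W)"

text \<open>The element of the semidirect product with prescribed PBW coefficients. By
  \<open>phi_pbw_elt\<close> it is a section of the map that takes \<open>F\<close> to the value of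
  its operator at \<open>b0\<close>.\<close>

definition pbw_elt :: "(pbw_index \<Rightarrow>\<^sub>0 complex poly) \<Rightarrow> mat2 \<Rightarrow> tensor" where
  "pbw_elt \<mu> u = pm_eval tconst (\<lambda>b. if grp b = u then tword (pbw_word b) else 0) \<mu>"

abbreviation bas :: "pbw_index \<Rightarrow> pbw_index \<Rightarrow>\<^sub>0 'k::zero_neq_one" where
  "bas b \<equiv> Poly_Mapping.single b 1"

lemma Wsup_iff: "Wsup \<mu> \<longleftrightarrow> (\<forall>b. grp b \<notin> W \<longrightarrow> Poly_Mapping.lookup \<mu> b = 0)"
  by (simp add: Wsup_def in_keys_iff Ball_def del: split_paired_All) blast

lemma Wsup_add: "Wsup \<mu> \<Longrightarrow> Wsup \<nu> \<Longrightarrow> Wsup (\<mu> + \<nu>)"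
  using Poly_Mapping.keys_add[of \<mu> \<nu>] by (auto simp: Wsup_def)

lemma Wsup_diff:
  fixes \<mu> \<nu> :: "pbw_index \<Rightarrow>\<^sub>0 'k::ab_group_add"
  shows "Wsup \<mu> \<Longrightarrow> Wsup \<nu> \<Longrightarrow> Wsup (\<mu> - \<nu>)"
  by (simp add: Wsup_iff lookup_minus del: split_paired_All)

lemma Wsup_smult: "Wsup \<mu> \<Longrightarrow> Wsup (smult_pm c \<mu>)"
  by (auto simp: Wsup_def in_keys_iff)

lemma Wsup_0 [simp]: "Wsup 0"
  by (simp add: Wsup_def)

lemma Wsup_single [simp]: "grp b \<in> W \<Longrightarrow> Wsup (Poly_Mapping.single b c)"
  by (simp add: Wsup_def)

lemma pm_additive_tconst: "pm_additive tconst"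
  by unfold_locales (simp_all add: tconst_0 tconst_add)

lemma pbw_elt_add: "pbw_elt (\<mu> + \<nu>) = pbw_elt \<mu> \<oplus>\<^bsub>R\<^esub> pbw_elt \<nu>"
  by (simp add: fun_eq_iff pbw_elt_def smash_add pm_additive.pm_eval_add[OF pm_additive_tconst])

lemma pbw_elt_0: "pbw_elt 0 = \<zero>\<^bsub>R\<^esub>"
  by (simp add: fun_eq_iff pbw_elt_def smash_zero pm_additive.pm_eval_zero[OF pm_additive_tconst])

lemma pbw_elt_single:
  "pbw_elt (Poly_Mapping.single (m, n, p, r, w) c) = sm (tconst c * tword (pbw_word (m, n, p, r, w))) w"
  by (auto simp: fun_eq_iff pbw_elt_def sm_def pm_additive.pm_eval_single[OF pm_additive_tconst])

lemma pbw_elt_carrier [simp]: "Wsup \<mu> \<Longrightarrow> pbw_elt \<mu> \<in> carrier R"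
  unfolding smash_carrier pbw_elt_def pm_eval_def
  by (intro allI impI sum.neutral) (auto simp: Wsup_def)

lemma lc_mult: "lc p \<otimes>\<^bsub>R\<^esub> F = (\<lambda>u. tconst p * F u)" if "F \<in> carrier R"
proof
  fix u
  have "(lc p \<otimes>\<^bsub>R\<^esub> F) u = (\<Sum>w\<in>W. if w = mat 1 then (\<Sum>v\<in>W. if v = u then tconst p * F u else 0) else 0)"
    unfolding smash_mult by (intro sum.cong refl) (auto simp: sm_def intro!: sum.cong sum.neutral)
  then show "(lc p \<otimes>\<^bsub>R\<^esub> F) u = tconst p * F u"
    using that by (auto simp: sum.delta[OF finite_W] smash_carrier)
qed

lemma mult_lc: "F \<otimes>\<^bsub>R\<^esub> lc p = (\<lambda>u. tconst p * F u)" if "F \<in> carrier R"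
proof
  fix u
  have "(F \<otimes>\<^bsub>R\<^esub> lc p) u = (\<Sum>w\<in>W. if w = u then (\<Sum>v\<in>W. if v = mat 1 then tconst p * F u else 0) else 0)"
    unfolding smash_mult
    by (intro sum.cong refl) (auto simp: sm_def tconst_central intro!: sum.cong sum.neutral)
  then show "(F \<otimes>\<^bsub>R\<^esub> lc p) u = tconst p * F u"
    using that by (auto simp: sum.delta[OF finite_W] smash_carrier)
qed

lemma lc_commute: "F \<in> carrier R \<Longrightarrow> F \<otimes>\<^bsub>R\<^esub> lc p = lc p \<otimes>\<^bsub>R\<^esub> F"
  by (simp add: lc_mult mult_lc)

lemma pbw_elt_smult: "pbw_elt (smult_pm p \<mu>) = (\<lambda>u. tconst p * pbw_elt \<mu> u)"
proof (induction \<mu> rule: poly_mapping_induct_single)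
  case (single b c)
  then show ?case
    by (cases b) (simp add: pbw_elt_single sm_def fun_eq_iff tconst_mult mult.assoc)
qed (auto simp: pbw_elt_0 smash_zero pbw_elt_add smash_add smult_pm_add fun_eq_iff distrib_left)

lemma pbw_elt_smult': "Wsup \<mu> \<Longrightarrow> pbw_elt (smult_pm p \<mu>) = lc p \<otimes>\<^bsub>R\<^esub> pbw_elt \<mu>"
  by (simp add: pbw_elt_smult lc_mult)

subsection \<open>Left multiplication on PBW monomials\<close>

text \<open>Left multiplication by \<open>F\<close> on a PBW monomial, computed in \<open>H\<close>,
  is described by the operator \<open>phi F\<close>. Once this holds for all \<open>F\<close>, every
  element of \<open>H\<close> has a normal form read off from its operator.\<close>

definition TW :: "(mat2 \<Rightarrow> tensor) \<Rightarrow> pbw_index \<Rightarrow> bool" where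
  "TW F b \<longleftrightarrow> Wsup (col (phi F) b) \<and> \<pi> (F \<otimes>\<^bsub>R\<^esub> pbw_elt (bas b)) = \<pi> (pbw_elt (col (phi F) b))"

lemma TW_grp: "TW F b \<Longrightarrow> b' \<in> Poly_Mapping.keys (col (phi F) b) \<Longrightarrow> grp b' \<in> W"
  by (auto simp: TW_def Wsup_def)

lemma TW_app:
  assumes F: "F \<in> carrier R" and \<mu>: "Wsup \<mu>" and TW: "\<And>b. b \<in> Poly_Mapping.keys \<mu> \<Longrightarrow> TW F b"
  shows "Wsup (app (phi F) \<mu>)" "\<pi> (F \<otimes>\<^bsub>R\<^esub> pbw_elt \<mu>) = \<pi> (pbw_elt (app (phi F) \<mu>))"
proof -
  interpret ring R by (rule ring_smash)
  interpret H: ring H by (rule ring_H)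
  define c where "c = Poly_Mapping.lookup \<mu>"
  have "Wsup (app (phi F) (\<Sum>b\<in>A. Poly_Mapping.single b (c b))) \<and> Wsup (\<Sum>b\<in>A. Poly_Mapping.single b (c b)) \<and>
      \<pi> (F \<otimes>\<^bsub>R\<^esub> pbw_elt (\<Sum>b\<in>A. Poly_Mapping.single b (c b)))
      = \<pi> (pbw_elt (app (phi F) (\<Sum>b\<in>A. Poly_Mapping.single b (c b))))"
    if "finite A" "A \<subseteq> Poly_Mapping.keys \<mu>" for A
    using that
  proof (induction A rule: finite_induct)
    case empty
    then show ?case using F by (simp add: pbw_elt_0)
  next
    case (insert b A)
    define \<nu> where "\<nu> = (\<Sum>b\<in>A. Poly_Mapping.single b (c b))"
    have IH: "Wsup (app (phi F) \<nu>)" "Wsup \<nu>" "\<pi> (F \<otimes>\<^bsub>R\<^esub> pbw_elt \<nu>) = \<pi> (pbw_elt (app (phi F) \<nu>))"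
      using insert by (auto simp: \<nu>_def)
    have b: "grp b \<in> W" "TW F b" using insert.prems \<mu> TW by (auto simp: Wsup_def)
    have sup: "Wsup (smult_pm (c b) (col (phi F) b))"
      using b(2) by (auto simp: TW_def intro: Wsup_smult)
    have "F \<otimes>\<^bsub>R\<^esub> pbw_elt (Poly_Mapping.single b (c b)) = F \<otimes>\<^bsub>R\<^esub> (lc (c b) \<otimes>\<^bsub>R\<^esub> pbw_elt (bas b))"
      using pbw_elt_smult'[of "bas b" "c b"] b(1) by simp
    also have "\<dots> = lc (c b) \<otimes>\<^bsub>R\<^esub> (F \<otimes>\<^bsub>R\<^esub> pbw_elt (bas b))"
      using F b(1) by (simp add: lc_commute[OF F] flip: m_assoc)
    finally have "\<pi> (F \<otimes>\<^bsub>R\<^esub> pbw_elt (Poly_Mapping.single b (c b))) = \<pi> (lc (c b)) \<otimes>\<^bsub>H\<^esub> \<pi> (pbw_elt (col (phi F) b))"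
      using b F by (simp add: TW_def)
    also have "\<dots> = \<pi> (pbw_elt (smult_pm (c b) (col (phi F) b)))"
      using b(2) by (simp add: TW_def pbw_elt_smult')
    finally have eq: "\<pi> (F \<otimes>\<^bsub>R\<^esub> pbw_elt (Poly_Mapping.single b (c b))) = \<pi> (pbw_elt (smult_pm (c b) (col (phi F) b)))" .
    have "\<pi> (F \<otimes>\<^bsub>R\<^esub> pbw_elt (Poly_Mapping.single b (c b) + \<nu>))
        = \<pi> (F \<otimes>\<^bsub>R\<^esub> pbw_elt (Poly_Mapping.single b (c b))) \<oplus>\<^bsub>H\<^esub> \<pi> (F \<otimes>\<^bsub>R\<^esub> pbw_elt \<nu>)"
      using F IH b by (simp add: pbw_elt_add r_distr H.r_distr)
    also have "\<dots> = \<pi> (pbw_elt (app (phi F) (Poly_Mapping.single b (c b) + \<nu>)))"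
      using sup IH by (simp add: eq app_add pbw_elt_add)
    finally show ?case
      using insert.hyps IH sup b by (simp add: app_add Wsup_add \<nu>_def[symmetric])
  qed
  from this[of "Poly_Mapping.keys \<mu>"] show "Wsup (app (phi F) \<mu>)"
    "\<pi> (F \<otimes>\<^bsub>R\<^esub> pbw_elt \<mu>) = \<pi> (pbw_elt (app (phi F) \<mu>))"
    using poly_mapping_sum_single[of "Poly_Mapping.keys \<mu>" \<mu>] by (simp_all add: c_def)
qed

lemma TW_mult:
  assumes "F \<in> carrier R" "G \<in> carrier R" "grp b \<in> W" "TW G b"
    "\<And>b'. b' \<in> Poly_Mapping.keys (col (phi G) b) \<Longrightarrow> TW F b'"
  shows "TW (F \<otimes>\<^bsub>R\<^esub> G) b"
proof -
  interpret ring R by (rule ring_smash)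
  interpret H: ring H by (rule ring_H)
  have sup: "Wsup (col (phi G) b)" using assms(4) by (simp add: TW_def)
  have "\<pi> (F \<otimes>\<^bsub>R\<^esub> G \<otimes>\<^bsub>R\<^esub> pbw_elt (bas b)) = \<pi> F \<otimes>\<^bsub>H\<^esub> \<pi> (pbw_elt (col (phi G) b))"
    using assms(1-4) by (simp add: TW_def H.m_assoc)
  also have "\<dots> = \<pi> (pbw_elt (app (phi F) (col (phi G) b)))"
    using TW_app(2)[OF assms(1) sup assms(5)] assms(1) sup by simp
  finally show ?thesis
    using TW_app(1)[OF assms(1) sup assms(5)] by (simp add: TW_def)
qed

lemma TW_add:
  assumes "F \<in> carrier R" "G \<in> carrier R" "grp b \<in> W" "TW F b" "TW G b"
  shows "TW (F \<oplus>\<^bsub>R\<^esub> G) b"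
proof -
  interpret ring R by (rule ring_smash)
  interpret H: ring H by (rule ring_H)
  show ?thesis using assms by (simp add: TW_def Wsup_add pbw_elt_add H.l_distr)
qed

lemma pbw_elt_uminus: "pbw_elt (- \<mu>) = (\<lambda>u. - pbw_elt \<mu> u)"
proof
  fix u
  have "(pbw_elt \<mu> \<oplus>\<^bsub>R\<^esub> pbw_elt (- \<mu>)) u = 0"
    by (simp add: pbw_elt_0 smash_zero flip: pbw_elt_add)
  then show "pbw_elt (- \<mu>) u = - pbw_elt \<mu> u"
    by (simp add: smash_add eq_neg_iff_add_eq_0 add.commute)
qed

lemma pbw_elt_diff: "Wsup \<nu> \<Longrightarrow> pbw_elt (\<mu> - \<nu>) = pbw_elt \<mu> \<ominus>\<^bsub>R\<^esub> pbw_elt \<nu>"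
  using pbw_elt_add[of \<mu> "- \<nu>"]
  by (simp add: fun_eq_iff smash_minus smash_add pbw_elt_uminus)

lemma TW_minus:
  assumes "F \<in> carrier R" "G \<in> carrier R" "grp b \<in> W" "TW F b" "TW G b"
  shows "TW (F \<ominus>\<^bsub>R\<^esub> G) b"
proof -
  interpret ring R by (rule ring_smash)
  interpret H: ring H by (rule ring_H)
  show ?thesis using assms
    by (simp add: TW_def Wsup_diff pbw_elt_diff H.minus_eq H.l_distr H.l_minus)
qed

lemma TW_finsum:
  assumes "finite A" "\<And>i. i \<in> A \<Longrightarrow> F i \<in> carrier R" "grp b \<in> W" "\<And>i. i \<in> A \<Longrightarrow> TW (F i) b"
  shows "TW (\<Oplus>\<^bsub>R\<^esub>i\<in>A. F i) b"
proof -
  interpret ring R by (rule ring_smash)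
  have zero: "TW \<zero>\<^bsub>R\<^esub> b" using assms(3) by (simp add: TW_def pbw_elt_0)
  show ?thesis using assms zero
    by (induction A rule: finite_induct) (auto simp: finsum_insert Pi_def intro!: TW_add)
qed

lemma TW_cong:
  assumes "F \<in> carrier R" "G \<in> carrier R" "\<pi> F = \<pi> G" "TW G b" "grp b \<in> W"
  shows "TW F b"
  using assms by (simp add: TW_def phi_cong[OF assms(1-3)])

lemma letter_pbw_elt:
  assumes "w \<in> W"
  shows "sm (tword [c]) (mat 1) \<otimes>\<^bsub>R\<^esub> pbw_elt (bas (m, n, p, r, w)) = sm (tword (c # pbw_word (m, n, p, r, w))) w"
  using assms by (simp add: pbw_elt_single sm_mult del: pbw_word.simps flip: tword_append)

lemma shift:
  assumes "w \<in> W"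
  shows "lx \<otimes>\<^bsub>R\<^esub> pbw_elt (bas (m, n, p, r, w)) = pbw_elt (bas (Suc m, n, p, r, w))"
    "ly \<otimes>\<^bsub>R\<^esub> pbw_elt (bas (0, n, p, r, w)) = pbw_elt (bas (0, Suc n, p, r, w))"
    "lX \<otimes>\<^bsub>R\<^esub> pbw_elt (bas (0, 0, p, r, w)) = pbw_elt (bas (0, 0, Suc p, r, w))"
    "lY \<otimes>\<^bsub>R\<^esub> pbw_elt (bas (0, 0, 0, r, w)) = pbw_elt (bas (0, 0, 0, Suc r, w))"
  using assms by (simp_all add: letter_pbw_elt) (simp_all add: pbw_elt_single)

text \<open>Prepending the leading letter to an ordered word is exact already in the semidirect
  product. So the claim for \<open>F\<close> on a longer monomial follows from the claim for
  \<open>F\<close> times that letter on a shorter one.\<close>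

lemma TW_shift:
  assumes F: "F \<in> carrier R" and w: "w \<in> W"
  shows "TW (F \<otimes>\<^bsub>R\<^esub> lx) (m, n, p, r, w) \<Longrightarrow> TW F (Suc m, n, p, r, w)"
    "TW (F \<otimes>\<^bsub>R\<^esub> ly) (0, n, p, r, w) \<Longrightarrow> TW F (0, Suc n, p, r, w)"
    "TW (F \<otimes>\<^bsub>R\<^esub> lX) (0, 0, p, r, w) \<Longrightarrow> TW F (0, 0, Suc p, r, w)"
    "TW (F \<otimes>\<^bsub>R\<^esub> lY) (0, 0, 0, r, w) \<Longrightarrow> TW F (0, 0, 0, Suc r, w)"
proof -
  interpret ring R by (rule ring_smash)
  note assoc = m_assoc[OF F sm_carrier[OF W_one] pbw_elt_carrier]
  show "TW (F \<otimes>\<^bsub>R\<^esub> lx) (m, n, p, r, w) \<Longrightarrow> TW F (Suc m, n, p, r, w)"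
    "TW (F \<otimes>\<^bsub>R\<^esub> ly) (0, n, p, r, w) \<Longrightarrow> TW F (0, Suc n, p, r, w)"
    "TW (F \<otimes>\<^bsub>R\<^esub> lX) (0, 0, p, r, w) \<Longrightarrow> TW F (0, 0, Suc p, r, w)"
    "TW (F \<otimes>\<^bsub>R\<^esub> lY) (0, 0, 0, r, w) \<Longrightarrow> TW F (0, 0, 0, Suc r, w)"
    using w by (simp_all add: TW_def assoc shift)
qed

lemma TW_x: "w \<in> W \<Longrightarrow> TW lx (m, n, p, r, w)"
  by (simp add: TW_def shift)

lemma TW_y: "w \<in> W \<Longrightarrow> TW ly (m, n, p, r, w)"
proof (induction m)
  case 0
  then show ?case by (simp add: TW_def shift)
next
  case (Suc m)
  interpret ring R by (rule ring_smash)
  have "TW (lx \<otimes>\<^bsub>R\<^esub> ly) (m, n, p, r, w)"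
    by (rule TW_mult) (use Suc TW_x in auto)
  then have "TW (ly \<otimes>\<^bsub>R\<^esub> lx) (m, n, p, r, w)"
    by (rule TW_cong[rotated 3]) (use Suc \<pi>_relations in auto)
  then show ?case using Suc.prems by (intro TW_shift) auto
qed

lemma TW_X_base: "w \<in> W \<Longrightarrow> TW lX (0, 0, p, r, w)"
  by (simp add: TW_def shift)

lemma TW_Y_base: "w \<in> W \<Longrightarrow> TW lY (0, 0, p, r, w)"
proof (induction p)
  case 0
  then show ?case by (simp add: TW_def shift)
next
  case (Suc p)
  interpret ring R by (rule ring_smash)
  have "TW (lX \<otimes>\<^bsub>R\<^esub> lY) (0, 0, p, r, w)"
    by (rule TW_mult) (use Suc TW_X_base in auto)
  then have "TW (lY \<otimes>\<^bsub>R\<^esub> lX) (0, 0, p, r, w)"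
    by (rule TW_cong[rotated 3]) (use Suc \<pi>_relations in auto)
  then show ?case using Suc.prems by (intro TW_shift) auto
qed

lemma TW_scalar: "grp b \<in> W \<Longrightarrow> TW (lc p) b"
  using pbw_elt_smult'[of "bas b" p] by (simp add: TW_def)

lemma refl_letter:
  assumes "\<beta> \<in> B"
  shows "sm 1 (refl_mat \<beta>) \<otimes>\<^bsub>R\<^esub> lx = lc [:inverse \<beta>:] \<otimes>\<^bsub>R\<^esub> (ly \<otimes>\<^bsub>R\<^esub> sm 1 (refl_mat \<beta>))"
    "sm 1 (refl_mat \<beta>) \<otimes>\<^bsub>R\<^esub> ly = lc [:\<beta>:] \<otimes>\<^bsub>R\<^esub> (lx \<otimes>\<^bsub>R\<^esub> sm 1 (refl_mat \<beta>))"
    "sm 1 (refl_mat \<beta>) \<otimes>\<^bsub>R\<^esub> lX = lc [:\<beta>:] \<otimes>\<^bsub>R\<^esub> (lY \<otimes>\<^bsub>R\<^esub> sm 1 (refl_mat \<beta>))"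
    "sm 1 (refl_mat \<beta>) \<otimes>\<^bsub>R\<^esub> lY = lc [:inverse \<beta>:] \<otimes>\<^bsub>R\<^esub> (lX \<otimes>\<^bsub>R\<^esub> sm 1 (refl_mat \<beta>))"
  using assms refl_in_W[OF assms] B_nonzero[OF assms] by (simp_all add: sm_mult tconst_0 flip: one_pCons)

lemma TW_refl:
  assumes "\<beta> \<in> B" "w \<in> W"
  shows "TW (sm 1 (refl_mat \<beta>)) (m, n, p, r, w)"
proof -
  interpret ring R by (rule ring_smash)
  let ?s = "sm 1 (refl_mat \<beta>)"
  note [simp] = assms refl_in_W[OF assms(1)] W_mult[OF refl_in_W[OF assms(1)] assms(2)]
  have step: "TW (lc e \<otimes>\<^bsub>R\<^esub> (l \<otimes>\<^bsub>R\<^esub> ?s)) (m, n, p, r, w)"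
    if "TW ?s (m, n, p, r, w)" "l \<in> carrier R" "\<And>b. b \<in> Poly_Mapping.keys (col (phi ?s) (m, n, p, r, w)) \<Longrightarrow> TW l b" for e l m n p r
  proof -
    have ls: "TW (l \<otimes>\<^bsub>R\<^esub> ?s) (m, n, p, r, w)" using that by (intro TW_mult) auto
    then have "Wsup (col (phi (l \<otimes>\<^bsub>R\<^esub> ?s)) (m, n, p, r, w))" by (simp add: TW_def)
    then show ?thesis
      by (intro TW_mult) (use that ls in \<open>auto simp: Wsup_def intro: TW_scalar\<close>)
  qed
  \<comment> \<open>The monomial is built up from the right: first the exponent of Y, then those of
    X, y and x.\<close>
  have 1: "TW ?s (0, 0, 0, r, w)" for r
  proof (induction r)
    case 0
    show ?case by (simp add: TW_def pbw_elt_single sm_mult flip: one_pCons)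
  next
    case (Suc r)
    then have "TW (?s \<otimes>\<^bsub>R\<^esub> lY) (0, 0, 0, r, w)"
      unfolding refl_letter[OF assms(1)] by (rule step) (auto split: if_splits intro: TW_X_base)
    then show ?case by (intro TW_shift) auto
  qed
  have 2: "TW ?s (0, 0, p, r, w)" for p r
  proof (induction p)
    case (Suc p)
    then have "TW (?s \<otimes>\<^bsub>R\<^esub> lX) (0, 0, p, r, w)"
      unfolding refl_letter[OF assms(1)] by (rule step) (auto split: if_splits intro: TW_Y_base)
    then show ?case by (intro TW_shift) auto
  qed (rule 1)
  have 3: "TW ?s (0, n, p, r, w)" for n p r
  proof (induction n)
    case (Suc n)
    then have "TW (?s \<otimes>\<^bsub>R\<^esub> ly) (0, n, p, r, w)"
      unfolding refl_letter[OF assms(1)] by (rule step) (auto split: if_splits intro: TW_x)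
    then show ?case by (intro TW_shift) auto
  qed (rule 2)
  show ?thesis
  proof (induction m)
    case (Suc m)
    then have "TW (?s \<otimes>\<^bsub>R\<^esub> lx) (m, n, p, r, w)"
      unfolding refl_letter[OF assms(1)] by (rule step) (auto split: if_splits intro: TW_y)
    then show ?case by (intro TW_shift) auto
  qed (rule 3)
qed

lemma TW_rel_refl: "w \<in> W \<Longrightarrow> TW (refl_sum d \<zeta> k) (m, n, p, r, w)"
  unfolding refl_sum_def
proof (rule TW_finsum)
  fix i assume w: "w \<in> W"
  interpret ring R by (rule ring_smash)
  have "sm (tconst [:k i:]) (reflection \<zeta> i) = lc [:k i:] \<otimes>\<^bsub>R\<^esub> sm 1 (reflection \<zeta> i)"
    by (simp add: sm_mult reflection_in_W)
  moreover have "TW (lc [:k i:] \<otimes>\<^bsub>R\<^esub> sm 1 (reflection \<zeta> i)) (m, n, p, r, w)"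
  proof (rule TW_mult)
    show s: "TW (sm 1 (reflection \<zeta> i)) (m, n, p, r, w)"
      by (simp add: reflection_eq TW_refl \<zeta>_power_in_B w)
    show "TW (lc [:k i:]) b" if "b \<in> Poly_Mapping.keys (col (phi (sm 1 (reflection \<zeta> i))) (m, n, p, r, w))" for b
      by (rule TW_scalar[OF TW_grp[OF s that]])
  qed (use w reflection_in_W in auto)
  ultimately show "TW (sm (tconst [:k i:]) (reflection \<zeta> i)) (m, n, p, r, w)" by simp
qed (auto simp: reflection_in_W)

text \<open>Common to X and Y: moving \<open>l\<close> past x and y costs \<open>k\<close> and
  \<open>k'\<close>, elements on which the claim is already known.\<close>

lemma TW_XY:
  assumes w: "w \<in> W" and l: "l \<in> carrier R" and base: "TW l (0, 0, p, r, w)"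
    and x: "\<pi> (l \<otimes>\<^bsub>R\<^esub> lx) = \<pi> (lx \<otimes>\<^bsub>R\<^esub> l \<ominus>\<^bsub>R\<^esub> k)" and y: "\<pi> (l \<otimes>\<^bsub>R\<^esub> ly) = \<pi> (ly \<otimes>\<^bsub>R\<^esub> l \<ominus>\<^bsub>R\<^esub> k')"
    and k: "k \<in> carrier R" "k' \<in> carrier R"
    and TW: "\<And>m n. TW k (m, n, p, r, w)" "\<And>m n. TW k' (m, n, p, r, w)"
  shows "TW l (m, n, p, r, w)"
proof -
  interpret ring R by (rule ring_smash)
  have xy: "TW lx b" "TW ly b" if "grp b \<in> W" for b
    using that by (cases b; simp add: TW_x TW_y)+
  have y0: "TW l (0, n, p, r, w)" for n
  proof (induction n)
    case (Suc n)
    then have "Wsup (col (phi l) (0, n, p, r, w))" by (simp add: TW_def)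
    then have "TW (ly \<otimes>\<^bsub>R\<^esub> l \<ominus>\<^bsub>R\<^esub> k') (0, n, p, r, w)"
      by (intro TW_minus TW_mult) (use Suc w l k TW xy in \<open>auto simp: Wsup_def\<close>)
    then have "TW (l \<otimes>\<^bsub>R\<^esub> ly) (0, n, p, r, w)"
      by (rule TW_cong[rotated 3]) (use y w l k in auto)
    then show ?case using w l by (intro TW_shift) auto
  qed (rule base)
  show ?thesis
  proof (induction m)
    case (Suc m)
    then have "Wsup (col (phi l) (m, n, p, r, w))" by (simp add: TW_def)
    then have "TW (lx \<otimes>\<^bsub>R\<^esub> l \<ominus>\<^bsub>R\<^esub> k) (m, n, p, r, w)"
      by (intro TW_minus TW_mult) (use Suc w l k TW xy in \<open>auto simp: Wsup_def\<close>)
    then have "TW (l \<otimes>\<^bsub>R\<^esub> lx) (m, n, p, r, w)"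
      by (rule TW_cong[rotated 3]) (use x w l k in auto)
    then show ?case using w l by (intro TW_shift) auto
  qed (rule y0)
qed

lemma TW_all:
  assumes "F \<in> carrier R" "grp b \<in> W"
  shows "TW F b"
proof -
  interpret ring R by (rule ring_smash)
  have K0: "TW K0 (m, n, p, r, w)" if "w \<in> W" for m n p r w
    by (rule TW_minus) (use that TW_scalar TW_rel_refl in auto)
  have X: "TW lX (m, n, p, r, w)" if "w \<in> W" for m n p r w
    by (rule TW_XY[of _ _ _ _ K0 Kp]) (use that TW_X_base TW_rel_refl K0 \<pi>_relations in auto)
  have Y: "TW lY (m, n, p, r, w)" if "w \<in> W" for m n p r w
    by (rule TW_XY[of _ _ _ _ Km K0]) (use that TW_Y_base TW_rel_refl K0 \<pi>_relations in auto)
  show ?thesis using assms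
  proof (induction F arbitrary: b rule: smash_induct)
    case (scalar p)
    then show ?case by (rule TW_scalar)
  next
    case (letter c)
    then show ?case using X Y TW_x TW_y by (cases b; cases c) auto
  next
    case (group w)
    from group(1,2) show ?case
    proof (induction arbitrary: b rule: W_induct)
      case one
      then show ?case using TW_scalar[of b 1] by simp
    next
      case (refl \<beta>)
      then show ?case by (cases b) (simp add: TW_refl)
    next
      case (mult u v)
      have "TW (sm 1 u \<otimes>\<^bsub>R\<^esub> sm 1 v) b"
      proof (rule TW_mult)
        show v: "TW (sm 1 v) b" using mult by blast
        show "TW (sm 1 u) b'" if "b' \<in> Poly_Mapping.keys (col (phi (sm 1 v)) b)" for b'
          using mult TW_grp[OF v that] by blast
      qed (use mult in auto)
      then show ?case using mult by (simp add: sm_mult)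
    qed
  next
    case (add F G)
    then show ?case by (intro TW_add) auto
  next
    case (mult F G)
    show ?case
    proof (rule TW_mult)
      show G: "TW G b" using mult by blast
      show "TW F b'" if "b' \<in> Poly_Mapping.keys (col (phi G) b)" for b'
        using mult TW_grp[OF G that] by blast
    qed (use mult in auto)
  qed
qed

section \<open>Normal forms and faithfulness\<close>

abbreviation b0 :: pbw_index where "b0 \<equiv> (0, 0, 0, 0, mat 1)"

lemma Wsup_phi: "F \<in> carrier R \<Longrightarrow> grp b \<in> W \<Longrightarrow> Wsup (col (phi F) b)"
  using TW_all by (simp add: TW_def)

text \<open>The case of \<open>TW_all\<close> at the monomial 1. An element of \<open>H\<close> is
  recovered from the value of its operator at the single vector \<open>b0\<close>, which is
  faithfulness.\<close>

lemma \<pi>_normal_form: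
  assumes "F \<in> carrier R"
  shows "\<pi> F = \<pi> (pbw_elt (col (phi F) b0))"
proof -
  interpret ring R by (rule ring_smash)
  have "pbw_elt (bas b0) = \<one>\<^bsub>R\<^esub>" by (simp add: pbw_elt_single smash_one)
  then show ?thesis using TW_all[OF assms, of b0] assms by (simp add: TW_def)
qed

lemma \<pi>_eq_iff_phi:
  assumes "F \<in> carrier R" "G \<in> carrier R"
  shows "\<pi> F = \<pi> G \<longleftrightarrow> phi F = phi G"
  using \<pi>_normal_form assms phi_cong by metis

end

section \<open>The algebra \<open>H\<^sub>c\<close> as a ring of operators\<close>

context cherednik
begin

abbreviation "J \<equiv> hbar_ideal d \<zeta> a"
abbreviation "C \<equiv> Hc d \<zeta> a"
abbreviation "\<rho> \<equiv> to_Hc d \<zeta> a"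

lemma hbar_ideal_eq: "J = (\<lambda>F. \<pi> (lh \<otimes>\<^bsub>R\<^esub> F)) ` carrier R"
proof -
  have "carrier H = \<pi> ` carrier R" using \<pi>_surj \<pi>_closed by blast
  then show ?thesis unfolding hbar_ideal_def hbar_def by (auto simp: image_iff)
qed

lemma J_E:
  assumes "h \<in> J"
  obtains F where "F \<in> carrier R" "h = \<pi> (lh \<otimes>\<^bsub>R\<^esub> F)"
  using assms that unfolding hbar_ideal_eq by (auto simp del: \<pi>_simps)

lemma J_I: "F \<in> carrier R \<Longrightarrow> \<pi> (lh \<otimes>\<^bsub>R\<^esub> F) \<in> J"
  unfolding hbar_ideal_eq by (rule imageI)

lemma ideal_J: "ideal J H"
proof (rule idealI[OF ring_H])
  interpret R: ring R by (rule ring_smash)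
  interpret ring H by (rule ring_H)
  show "subgroup J (add_monoid H)"
  proof (rule add.subgroupI)
    show "J \<subseteq> carrier H" by (auto simp: hbar_ideal_eq)
    show "J \<noteq> {}" unfolding hbar_ideal_eq using R.zero_closed by blast
    show "\<ominus>\<^bsub>H\<^esub> h \<in> J" if hJ: "h \<in> J" for h
    proof -
      obtain F where F: "F \<in> carrier R" "h = \<pi> (lh \<otimes>\<^bsub>R\<^esub> F)" using hJ by (rule J_E)
      have zero: "\<pi> \<zero>\<^bsub>R\<^esub> = \<zero>\<^bsub>H\<^esub>" by (rule ring_hom_zero[OF \<pi>_ring_hom ring_smash ring_H])
      have "\<ominus>\<^bsub>H\<^esub> h = \<pi> (lh \<otimes>\<^bsub>R\<^esub> (\<zero>\<^bsub>R\<^esub> \<ominus>\<^bsub>R\<^esub> F))"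
        using F by (simp add: zero r_minus minus_eq)
      then show ?thesis using F by (simp only: J_I R.ring_simprules)
    qed
    show "h \<oplus>\<^bsub>H\<^esub> h' \<in> J" if hJ: "h \<in> J" "h' \<in> J" for h h'
    proof -
      obtain F G where F: "F \<in> carrier R" "h = \<pi> (lh \<otimes>\<^bsub>R\<^esub> F)" "G \<in> carrier R" "h' = \<pi> (lh \<otimes>\<^bsub>R\<^esub> G)"
        using hJ by (elim J_E)
      then have "h \<oplus>\<^bsub>H\<^esub> h' = \<pi> (lh \<otimes>\<^bsub>R\<^esub> (F \<oplus>\<^bsub>R\<^esub> G))" by (simp add: r_distr)
      then show ?thesis using F by (simp only: J_I R.ring_simprules)
    qed
  qed
  show "h \<otimes>\<^bsub>H\<^esub> j \<in> J" "j \<otimes>\<^bsub>H\<^esub> h \<in> J" if hJ: "j \<in> J" "h \<in> carrier H" for j h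
  proof -
    obtain F where F: "F \<in> carrier R" "j = \<pi> (lh \<otimes>\<^bsub>R\<^esub> F)" using hJ(1) by (rule J_E)
    obtain G where G: "G \<in> carrier R" "h = \<pi> G" using hJ(2) by (rule \<pi>_surj)
    have "h \<otimes>\<^bsub>H\<^esub> j = \<pi> (G \<otimes>\<^bsub>R\<^esub> (lh \<otimes>\<^bsub>R\<^esub> F))" using F G by simp
    also have "G \<otimes>\<^bsub>R\<^esub> (lh \<otimes>\<^bsub>R\<^esub> F) = lh \<otimes>\<^bsub>R\<^esub> (G \<otimes>\<^bsub>R\<^esub> F)"
      using F G by (simp add: lc_commute[OF G(1)] flip: R.m_assoc)
    finally show "h \<otimes>\<^bsub>H\<^esub> j \<in> J" using F G by (simp only: J_I R.ring_simprules)
    have "j \<otimes>\<^bsub>H\<^esub> h = \<pi> (lh \<otimes>\<^bsub>R\<^esub> (F \<otimes>\<^bsub>R\<^esub> G))" using F G by (simp add: m_assoc)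
    then show "j \<otimes>\<^bsub>H\<^esub> h \<in> J" using F G by (simp only: J_I R.ring_simprules)
  qed
qed

lemma ring_C: "ring C"
  unfolding Hc_def by (rule ideal.quotient_is_ring[OF ideal_J])

lemma mod_hbar_hom: "mod_hbar d \<zeta> a \<in> ring_hom H C"
  using ideal.rcos_ring_hom[OF ideal_J] unfolding Hc_def mod_hbar_def[abs_def] .

lemma mod_hbar_\<pi>: "mod_hbar d \<zeta> a (\<pi> F) = \<rho> F"
  by (simp add: to_Hc_def)

lemma \<rho>_hom: "\<rho> \<in> ring_hom R C"
  using ring_hom_trans[OF \<pi>_ring_hom mod_hbar_hom] by (simp add: to_Hc_def[abs_def] comp_def)

lemma \<rho>_simps [simp]:
  assumes "F \<in> carrier R" "G \<in> carrier R"
  shows "\<rho> (F \<oplus>\<^bsub>R\<^esub> G) = \<rho> F \<oplus>\<^bsub>C\<^esub> \<rho> G" "\<rho> (F \<otimes>\<^bsub>R\<^esub> G) = \<rho> F \<otimes>\<^bsub>C\<^esub> \<rho> G"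
  using assms \<rho>_hom by (auto simp: ring_hom_def)

lemma \<rho>_one [simp]: "\<rho> \<one>\<^bsub>R\<^esub> = \<one>\<^bsub>C\<^esub>"
  by (rule ring_hom_one[OF \<rho>_hom])

lemma \<rho>_closed [simp]: "F \<in> carrier R \<Longrightarrow> \<rho> F \<in> carrier C"
  by (rule ring_hom_closed[OF \<rho>_hom])

lemma \<rho>_surj:
  assumes "c \<in> carrier C"
  obtains F where "F \<in> carrier R" "c = \<rho> F"
proof -
  interpret ideal J H by (rule ideal_J)
  obtain h where "h \<in> carrier H" "c = mod_hbar d \<zeta> a h"
    using assms unfolding Hc_def mod_hbar_def by (auto simp: FactRing_simps A_RCOSETS_def' a_r_coset_def)
  then show ?thesis using that \<pi>_surj mod_hbar_\<pi> by metis
qed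

text \<open>Freeness over the polynomials in \<hbar>: if the operator vanishes at \<hbar> = 0, all
  PBW coefficients of the normal form are divisible by \<hbar>, and \<open>G\<close> is obtained by
  dividing them.\<close>

lemma red_phi_zero:
  assumes "F \<in> carrier R" "red (phi F) = 0"
  obtains G where "G \<in> carrier R" "\<pi> F = \<pi> (lh \<otimes>\<^bsub>R\<^esub> G)" "phi F = hb * phi G"
proof -
  interpret R: ring R by (rule ring_smash)
  define \<mu> where "\<mu> = col (phi F) b0"
  define \<nu> where "\<nu> = Poly_Mapping.map (\<lambda>p. p div [:0, 1:]) \<mu>"
  have sup: "Wsup \<mu>" using Wsup_phi[OF assms(1)] by (simp add: \<mu>_def)
  have root: "poly (Poly_Mapping.lookup \<mu> b) 0 = 0" for b
    using arg_cong[OF assms(2), of "\<lambda>e. Poly_Mapping.lookup (col e b0) b"] by (simp add: \<mu>_def)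
  then have "[:0, 1:] * (Poly_Mapping.lookup \<mu> b div [:0, 1:]) = Poly_Mapping.lookup \<mu> b" for b
    using poly_eq_0_iff_dvd[of "Poly_Mapping.lookup \<mu> b" 0] by (intro dvd_mult_div_cancel) simp
  then have \<mu>: "\<mu> = smult_pm [:0, 1:] \<nu>"
    by (intro poly_mapping_eqI)
      (simp only: lookup_smult_pm \<nu>_def Poly_Mapping.map.rep_eq comp_def, simp add: when_def)
  have sup': "Wsup \<nu>"
    using sup by (auto simp: Wsup_def \<nu>_def in_keys_iff Poly_Mapping.map.rep_eq when_def split: if_splits)
  have "pbw_elt \<mu> = lh \<otimes>\<^bsub>R\<^esub> pbw_elt \<nu>"
    by (subst \<mu>) (rule pbw_elt_smult'[OF sup'])
  then have "\<pi> F = \<pi> (lh \<otimes>\<^bsub>R\<^esub> pbw_elt \<nu>)"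
    using \<pi>_normal_form[OF assms(1)] by (simp only: \<mu>_def)
  moreover from this have "phi F = hb * phi (pbw_elt \<nu>)"
    using phi_cong[of F "lh \<otimes>\<^bsub>R\<^esub> pbw_elt \<nu>"] assms(1) sup' by simp
  ultimately show ?thesis using that pbw_elt_carrier[OF sup'] by blast
qed

text \<open>An element lies in the ideal generated by \<hbar> exactly when its operator vanishes at
  \<hbar> = 0. So \<open>H\<^sub>c\<close> is identified with a ring of reduced operators.\<close>

lemma \<rho>_eq_iff:
  assumes "F \<in> carrier R" "G \<in> carrier R"
  shows "\<rho> F = \<rho> G \<longleftrightarrow> red (phi F) = red (phi G)"
proof -
  interpret R: ring R by (rule ring_smash)
  have iff: "\<rho> F = \<rho> G \<longleftrightarrow> \<pi> (F \<ominus>\<^bsub>R\<^esub> G) \<in> J"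
    using ring.quotient_eq_iff_same_a_r_cos[OF ring_H ideal_J, of "\<pi> F" "\<pi> G"] assms
    by (simp add: to_Hc_def mod_hbar_def)
  show ?thesis
  proof
    assume "\<rho> F = \<rho> G"
    then obtain K where K: "K \<in> carrier R" "\<pi> (F \<ominus>\<^bsub>R\<^esub> G) = \<pi> (lh \<otimes>\<^bsub>R\<^esub> K)"
      unfolding iff by (rule J_E)
    then have "phi (F \<ominus>\<^bsub>R\<^esub> G) = phi (lh \<otimes>\<^bsub>R\<^esub> K)"
      using assms by (intro phi_cong) auto
    then have "phi F - phi G = hb * phi K" using assms by simp
    then have "red (phi F - phi G) = red (hb * phi K)" by simp
    then show "red (phi F) = red (phi G)" by simp
  next
    assume "red (phi F) = red (phi G)"
    then have "red (phi (F \<ominus>\<^bsub>R\<^esub> G)) = 0" using assms by simp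
    then obtain K where "K \<in> carrier R" "\<pi> (F \<ominus>\<^bsub>R\<^esub> G) = \<pi> (lh \<otimes>\<^bsub>R\<^esub> K)"
      using red_phi_zero[of "F \<ominus>\<^bsub>R\<^esub> G"] assms by auto
    then show "\<rho> F = \<rho> G" unfolding iff by (simp only: J_I)
  qed
qed

text \<open>The embedding of \<open>H\<^sub>c\<close> into the operators; by
  \<open>\<rho>_eq_iff\<close> the chosen representative does not matter.\<close>

definition Psi :: "(mat2 \<Rightarrow> tensor) set set \<Rightarrow> complex operator" where
  "Psi c = red (phi (SOME F. F \<in> carrier R \<and> c = \<rho> F))"

lemma Psi_\<rho> [simp]:
  assumes "F \<in> carrier R"
  shows "Psi (\<rho> F) = red (phi F)"
proof -
  let ?G = "SOME G. G \<in> carrier R \<and> \<rho> F = \<rho> G"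
  have "?G \<in> carrier R \<and> \<rho> F = \<rho> ?G" by (rule someI[of _ F]) (use assms in simp)
  then have "red (phi F) = red (phi ?G)" using \<rho>_eq_iff[OF assms, of ?G] by simp
  then show ?thesis by (simp add: Psi_def)
qed

lemma Psi_inj:
  assumes "c \<in> carrier C" "c' \<in> carrier C" "Psi c = Psi c'"
  shows "c = c'"
proof -
  obtain F G where "F \<in> carrier R" "c = \<rho> F" "G \<in> carrier R" "c' = \<rho> G"
    using assms(1,2) by (metis \<rho>_surj)
  then show ?thesis using assms(3) \<rho>_eq_iff[of F G] by simp
qed

lemma Psi_add: "c \<in> carrier C \<Longrightarrow> c' \<in> carrier C \<Longrightarrow> Psi (c \<oplus>\<^bsub>C\<^esub> c') = Psi c + Psi c'"
  and Psi_mult: "c \<in> carrier C \<Longrightarrow> c' \<in> carrier C \<Longrightarrow> Psi (c \<otimes>\<^bsub>C\<^esub> c') = Psi c * Psi c'"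
proof -
  interpret R: ring R by (rule ring_smash)
  assume "c \<in> carrier C" "c' \<in> carrier C"
  then obtain F G where "F \<in> carrier R" "c = \<rho> F" "G \<in> carrier R" "c' = \<rho> G"
    by (metis \<rho>_surj)
  then show "Psi (c \<oplus>\<^bsub>C\<^esub> c') = Psi c + Psi c'" "Psi (c \<otimes>\<^bsub>C\<^esub> c') = Psi c * Psi c'"
    by (simp_all flip: \<rho>_simps)
qed

lemma Psi_one: "Psi \<one>\<^bsub>C\<^esub> = 1"
proof -
  interpret R: ring R by (rule ring_smash)
  show ?thesis by (simp flip: \<rho>_one)
qed

lemma Psi_zero: "Psi \<zero>\<^bsub>C\<^esub> = 0"
proof -
  interpret ring C by (rule ring_C)
  have "Psi (\<zero>\<^bsub>C\<^esub> \<oplus>\<^bsub>C\<^esub> \<zero>\<^bsub>C\<^esub>) = Psi \<zero>\<^bsub>C\<^esub> + Psi \<zero>\<^bsub>C\<^esub>" by (rule Psi_add) auto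
  then show ?thesis by simp
qed

lemma Psi_pow:
  assumes "c \<in> carrier C"
  shows "Psi (c [^]\<^bsub>C\<^esub> (n::nat)) = Psi c ^ n"
proof -
  interpret ring C by (rule ring_C)
  show ?thesis
    by (induction n) (simp_all add: Psi_one Psi_mult assms power_commutes)
qed

lemma Psi_finsum:
  assumes "finite A" "\<And>i. i \<in> A \<Longrightarrow> f i \<in> carrier C"
  shows "Psi (\<Oplus>\<^bsub>C\<^esub>i\<in>A. f i) = (\<Sum>i\<in>A. Psi (f i))"
proof -
  interpret ring C by (rule ring_C)
  show ?thesis using assms
    by (induction A rule: finite_induct) (simp_all add: finsum_insert Pi_def Psi_zero Psi_add)
qed

subsection \<open>Truncation\<close>

definition exps :: "(coord \<Rightarrow>\<^sub>0 nat) \<Rightarrow> mat2 \<Rightarrow> pbw_index" where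
  "exps e w = (Poly_Mapping.lookup e cx, Poly_Mapping.lookup e cy, Poly_Mapping.lookup e cX,
     Poly_Mapping.lookup e cY, w)"

text \<open>\<open>map_key\<close> pulls back along the embedding of the monomials with group part
  1, so all other coefficients are dropped.\<close>

definition trunc :: "(pbw_index \<Rightarrow>\<^sub>0 complex) \<Rightarrow> coord mpoly" where
  "trunc \<mu> = Poly_Mapping.map_key (\<lambda>e. exps e (mat 1)) \<mu>"

lemma exps_inj: "exps e w = exps e' w' \<longleftrightarrow> e = e' \<and> w = w'"
proof
  assume eq: "exps e w = exps e' w'"
  have "Poly_Mapping.lookup e c = Poly_Mapping.lookup e' c" for c
    using eq by (cases c) (auto simp: exps_def)
  then show "e = e' \<and> w = w'" using eq by (auto simp: exps_def intro!: poly_mapping_eqI)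
qed simp

lemma exps_surj: obtains e where "b = exps e (grp b)"
proof -
  obtain m n p r w where b: "b = (m, n, p, r, w)" by (cases b)
  define e where "e = Poly_Mapping.single cx m + Poly_Mapping.single cy n + Poly_Mapping.single cX p
    + Poly_Mapping.single cY r"
  have "b = exps e (grp b)" by (simp add: b exps_def e_def lookup_add lookup_single)
  then show ?thesis by (rule that)
qed

lemma grp_exps [simp]: "grp (exps e w) = w"
  by (simp add: exps_def)

lemma lookup_trunc [simp]: "Poly_Mapping.lookup (trunc \<mu>) e = Poly_Mapping.lookup \<mu> (exps e (mat 1))"
  unfolding trunc_def by (subst map_key.rep_eq) (auto simp: inj_def exps_inj)

lemma trunc_add: "trunc (\<mu> + \<nu>) = trunc \<mu> + trunc \<nu>"
  by (rule poly_mapping_eqI) (simp add: lookup_add)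

lemma trunc_0 [simp]: "trunc 0 = 0"
  by (rule poly_mapping_eqI) simp

lemma trunc_smult: "trunc (smult_pm c \<mu>) = const c * trunc \<mu>"
proof -
  have "const c * trunc \<mu> = smult_pm c (trunc \<mu>)"
    by (simp add: const_def smult_pm_def mult_map_scale_conv_mult)
  then show ?thesis by (intro poly_mapping_eqI) simp
qed

lemma trunc_single: "trunc (Poly_Mapping.single (exps e w) c) = (if w = mat 1 then Poly_Mapping.single e c else 0)"
  by (rule poly_mapping_eqI) (auto simp: lookup_single when_def exps_inj)

lemma col_power_base:
  "col (op_Y ^ r) (0, 0, 0, 0, w) = bas (0, 0, 0, r, w)"
  "col (op_X ^ p) (0, 0, 0, r, w) = bas (0, 0, p, r, w)"
  "col (op_y ^ n) (0, 0, p, r, w) = bas (0, n, p, r, w)"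
  "col (op_x ^ m) (0, n, p, r, w) = bas (m, n, p, r, w)"
proof -
  show "col (op_Y ^ r) (0, 0, 0, 0, w) = bas (0, 0, 0, r, w)" by (induction r) simp_all
  show "col (op_X ^ p) (0, 0, 0, r, w) = bas (0, 0, p, r, w)" by (induction p) simp_all
  show "col (op_y ^ n) (0, 0, p, r, w) = bas (0, n, p, r, w)" by (induction n) (simp_all add: op_y_def)
  show "col (op_x ^ m) (0, n, p, r, w) = bas (m, n, p, r, w)" by (induction m) (simp_all add: op_x_def)
qed

definition pbw_op :: "pbw_index \<Rightarrow> complex poly operator" where
  "pbw_op b = prod_list (map op_letter (pbw_word b)) * op_g (grp b)"

lemma pbw_op_eq: "pbw_op (m, n, p, r, w) = op_x ^ m * op_y ^ n * op_X ^ p * op_Y ^ r * op_g w"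
  by (simp add: pbw_op_def prod_list_replicate mult.assoc)

lemma col_op_g_b0: "monomial_mat w \<Longrightarrow> col (op_g w) b0 = bas (0, 0, 0, 0, w)"
  by (elim monomial_cases) (simp_all flip: one_pCons)

text \<open>The operators of the PBW monomials take distinct basis vectors as values at
  \<open>b0\<close>: the independence half of the PBW theorem.\<close>

lemma col_pbw_op:
  assumes "grp b \<in> W"
  shows "col (pbw_op b) b0 = bas b"
proof -
  obtain m n p r w where b: "b = (m, n, p, r, w)" by (cases b)
  have "w \<in> W" using assms by (simp add: b)
  then show ?thesis
    by (simp add: b pbw_op_eq col_op_g_b0[OF W_monomial] col_power_base del: col_op_x col_op_y)
qed

lemma phi_pbw_elt_single: "grp b \<in> W \<Longrightarrow> phi (pbw_elt (Poly_Mapping.single b c)) = sc c * pbw_op b"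
  by (cases b) (simp add: pbw_elt_single pbw_op_def mult.assoc del: pbw_word.simps)

lemma Wsup_induct [consumes 1, case_names zero single add]:
  assumes "Wsup \<mu>" "P 0" "\<And>b c. grp b \<in> W \<Longrightarrow> P (Poly_Mapping.single b c)"
    "\<And>\<mu> \<nu>. Wsup \<mu> \<Longrightarrow> Wsup \<nu> \<Longrightarrow> P \<mu> \<Longrightarrow> P \<nu> \<Longrightarrow> P (\<mu> + \<nu>)"
  shows "P (\<mu> :: pbw_index \<Rightarrow>\<^sub>0 'k::comm_monoid_add)"
proof -
  define c where "c = Poly_Mapping.lookup \<mu>"
  have "P (\<Sum>b\<in>A. Poly_Mapping.single b (c b)) \<and> Wsup (\<Sum>b\<in>A. Poly_Mapping.single b (c b))"
    if "finite A" "A \<subseteq> Poly_Mapping.keys \<mu>" for A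
    using that
  proof (induction A rule: finite_induct)
    case (insert b A)
    then have "grp b \<in> W" using assms(1) by (auto simp: Wsup_def)
    then show ?case using insert assms by (auto intro!: Wsup_add)
  qed (use assms in auto)
  from this[of "Poly_Mapping.keys \<mu>"] show ?thesis
    using poly_mapping_sum_single[of "Poly_Mapping.keys \<mu>" \<mu>] by (simp add: c_def)
qed

lemma pbw_elt_pm:
  assumes "w \<in> W"
  shows "sm (\<Sum>m \<in> Poly_Mapping.keys f. tconst [:Poly_Mapping.lookup f m:] * tword (ordered_word m)) w
    = pbw_elt (\<Sum>m \<in> Poly_Mapping.keys f. Poly_Mapping.single (exps m w) [:Poly_Mapping.lookup f m:])"
proof -
  have single: "pbw_elt (Poly_Mapping.single (exps m w) c) = sm (tconst c * tword (ordered_word m)) w" for m c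
    by (simp add: exps_def pbw_elt_single ordered_word_def)
  have "sm (\<Sum>m \<in> A. tconst [:c m:] * tword (ordered_word m)) w
      = pbw_elt (\<Sum>m \<in> A. Poly_Mapping.single (exps m w) [:c m:])" if "finite A" for A and c :: "_ \<Rightarrow> complex"
    using that
  proof (induction A rule: finite_induct)
    case empty
    then show ?case by (simp add: pbw_elt_0 smash_zero sm_def fun_eq_iff)
  next
    case (insert m A)
    then show ?case by (simp add: pbw_elt_add single flip: insert.IH) (auto simp: fun_eq_iff sm_def smash_add)
  qed
  then show ?thesis by simp
qed

lemma phi_pbw_elt:
  assumes "Wsup \<mu>"
  shows "col (phi (pbw_elt \<mu>)) b0 = \<mu>"
  using assms
  by (induction \<mu> rule: Wsup_induct)
    (simp_all add: pbw_elt_0 pbw_elt_add phi_pbw_elt_single col_pbw_op)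

lemma pbw_carrier: "w \<in> W \<Longrightarrow> pbw d \<zeta> a f w \<in> carrier C"
  by (simp add: pbw_def)

lemma Wsup_sum: "(\<And>i. i \<in> A \<Longrightarrow> Wsup (f i)) \<Longrightarrow> Wsup (\<Sum>i\<in>A. f i)"
  by (induction A rule: infinite_finite_induct) (auto intro: Wsup_add)

lemma red_pm_sum: "red_pm (\<Sum>i\<in>A. f i) = (\<Sum>i\<in>A. red_pm (f i))"
  by (induction A rule: infinite_finite_induct) simp_all

lemma trunc_sum: "trunc (\<Sum>i\<in>A. f i) = (\<Sum>i\<in>A. trunc (f i))"
  by (induction A rule: infinite_finite_induct) (simp_all add: trunc_add)

lemma trunc_pbw:
  assumes "w \<in> W"
  shows "trunc (col (Psi (pbw d \<zeta> a f w)) b0) = (if w = mat 1 then f else 0)"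
proof -
  let ?\<mu> = "\<Sum>m \<in> Poly_Mapping.keys f. Poly_Mapping.single (exps m w) [:Poly_Mapping.lookup f m:]"
  have sup: "Wsup ?\<mu>" by (rule Wsup_sum) (simp add: assms)
  then have "trunc (col (Psi (pbw d \<zeta> a f w)) b0) = trunc (red_pm ?\<mu>)"
    unfolding pbw_def pbw_elt_pm[OF assms] by (simp add: phi_pbw_elt)
  also have "\<dots> = (\<Sum>m \<in> Poly_Mapping.keys f. if w = mat 1 then Poly_Mapping.single m (Poly_Mapping.lookup f m) else 0)"
    by (simp add: red_pm_sum trunc_sum trunc_single)
  also have "\<dots> = (if w = mat 1 then f else 0)"
    using poly_mapping_sum_single[of "Poly_Mapping.keys f" f] by simp
  finally show ?thesis .
qed

lemma scalar_carrier [simp]: "scalar d \<zeta> a c \<in> carrier C"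
  by (simp add: scalar_def)

lemma Psi_scalar [simp]: "Psi (scalar d \<zeta> a c) = sc c"
  by (simp add: scalar_def)

lemma \<rho>_normal_form:
  assumes "F \<in> carrier R"
  shows "\<rho> F = \<rho> (pbw_elt (col (phi F) b0))"
  using \<pi>_normal_form[OF assms] by (simp add: to_Hc_def)

lemma \<rho>_pbw_elt_single:
  assumes "w \<in> W"
  shows "\<rho> (pbw_elt (Poly_Mapping.single (exps e w) p)) = pbw d \<zeta> a (Poly_Mapping.single e (poly p 0)) w"
proof (rule Psi_inj)
  interpret R: ring R by (rule ring_smash)
  show "\<rho> (pbw_elt (Poly_Mapping.single (exps e w) p)) \<in> carrier C"
    "pbw d \<zeta> a (Poly_Mapping.single e (poly p 0)) w \<in> carrier C"
    using assms by (simp_all add: pbw_carrier)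
  show "Psi (\<rho> (pbw_elt (Poly_Mapping.single (exps e w) p))) = Psi (pbw d \<zeta> a (Poly_Mapping.single e (poly p 0)) w)"
    using assms unfolding pbw_def pbw_elt_pm[OF assms]
    by (cases "poly p 0 = 0") (simp_all add: phi_pbw_elt_single pbw_elt_0)
qed

text \<open>Resolves the definite description. The explicit formula has the required properties by
  \<open>trunc_pbw\<close>; uniqueness holds because an additive map is determined by its values on
  the spanning elements \<open>pbw\<close>.\<close>

lemma Trunc_eq:
  assumes "c \<in> carrier C"
  shows "Trunc d \<zeta> a c = trunc (col (Psi c) b0)"
proof -
  interpret C: ring C by (rule ring_C)
  let ?P = "\<lambda>t. t \<in> extensional (carrier C) \<and>
     (\<forall>h \<in> carrier C. \<forall>h' \<in> carrier C. t (h \<oplus>\<^bsub>C\<^esub> h') = t h + t h') \<and>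
     (\<forall>c. \<forall>h \<in> carrier C. t (scalar d \<zeta> a c \<otimes>\<^bsub>C\<^esub> h) = const c * t h) \<and>
     (\<forall>f. \<forall>w \<in> dihedral \<zeta>. t (pbw d \<zeta> a f w) = (if w = mat 1 then f else 0))"
  let ?t = "restrict (\<lambda>h. trunc (col (Psi h) b0)) (carrier C)"
  have t: "?P ?t"
    by (auto simp: Psi_add Psi_mult trunc_add trunc_smult pbw_carrier trunc_pbw)
  have "t = ?t" if P: "?P t" for t
  proof (rule extensionalityI[of _ "carrier C"])
    show "t \<in> extensional (carrier C)" "?t \<in> extensional (carrier C)" using P by auto
    fix c assume "c \<in> carrier C"
    then obtain F where F: "F \<in> carrier R" "c = \<rho> F" by (rule \<rho>_surj)
    have "t (\<rho> (pbw_elt \<mu>)) = ?t (\<rho> (pbw_elt \<mu>))" if "Wsup \<mu>" for \<mu>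
      using that
    proof (induction \<mu> rule: Wsup_induct)
      case zero
      have "pbw_elt 0 = pbw_elt (Poly_Mapping.single (exps 0 (mat 1)) 0)" by simp
      then show ?case using P t \<rho>_pbw_elt_single[of "mat 1" 0 0] by simp
    next
      case (single b p)
      obtain e where e: "b = exps e (grp b)" by (rule exps_surj)
      have eq: "\<rho> (pbw_elt (Poly_Mapping.single b p)) = pbw d \<zeta> a (Poly_Mapping.single e (poly p 0)) (grp b)"
        by (subst e) (rule \<rho>_pbw_elt_single[OF single])
      have "t (pbw d \<zeta> a (Poly_Mapping.single e (poly p 0)) (grp b))
          = (if grp b = mat 1 then Poly_Mapping.single e (poly p 0) else 0)"
        using P single by blast
      then show ?case unfolding eq using single by (simp add: pbw_carrier trunc_pbw)
    next
      case (add \<mu> \<nu>)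
      then show ?case using P t by (simp add: pbw_elt_add)
    qed
    then show "t c = ?t c"
      using \<rho>_normal_form[OF F(1)] Wsup_phi[OF F(1), of b0] F(2) by simp
  qed
  then have "Trunc d \<zeta> a = ?t"
    unfolding Trunc_def by (intro the_equality t) auto
  then show ?thesis using assms by simp
qed

end

section \<open>Degrees and symbols\<close>

fun zdeg :: "pbw_index \<Rightarrow> int" where "zdeg (m, n, p, r, w) = int m + int n - int p - int r"
fun xdeg :: "pbw_index \<Rightarrow> int" where "xdeg (m, n, p, r, w) = int p + int r"

text \<open>\<open>D\<close> is an exact degree, since commuting X past x preserves the grading.
  \<open>k\<close> is only a bound: a commutator replaces a pair such as xX by \<hbar> and group
  elements and so lowers the number of letters X, Y.\<close>

definition filt :: "int \<Rightarrow> int \<Rightarrow> 'k::zero operator \<Rightarrow> bool" where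
  "filt D k e \<longleftrightarrow> (\<forall>b b'. b' \<in> Poly_Mapping.keys (col e b) \<longrightarrow>
     zdeg b' = zdeg b + D \<and> xdeg b' \<le> xdeg b + k)"

lemma keys_smult_pm: "Poly_Mapping.keys (smult_pm c \<mu>) \<subseteq> Poly_Mapping.keys \<mu>"
  by (auto simp: in_keys_iff simp del: split_paired_All)

lemma keys_sum_subset: "Poly_Mapping.keys (\<Sum>i\<in>A. f i) \<subseteq> (\<Union>i\<in>A. Poly_Mapping.keys (f i))"
proof (induction A rule: infinite_finite_induct)
  case (insert i A)
  then show ?case using Poly_Mapping.keys_add[of "f i" "sum f A"] by auto
qed auto

lemma keys_app: "Poly_Mapping.keys (app e \<mu>) \<subseteq> (\<Union>b\<in>Poly_Mapping.keys \<mu>. Poly_Mapping.keys (col e b))"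
  unfolding app_def using keys_sum_subset keys_smult_pm by fastforce

lemma keys_minus_subset:
  "Poly_Mapping.keys (f - g :: 'i \<Rightarrow>\<^sub>0 'k::ab_group_add) \<subseteq> Poly_Mapping.keys f \<union> Poly_Mapping.keys g"
proof
  fix i assume "i \<in> Poly_Mapping.keys (f - g)"
  then have "Poly_Mapping.lookup f i \<noteq> 0 \<or> Poly_Mapping.lookup g i \<noteq> 0"
    by (auto simp: in_keys_iff lookup_minus)
  then show "i \<in> Poly_Mapping.keys f \<union> Poly_Mapping.keys g" by (auto simp: in_keys_iff)
qed

lemma filt_D:
  assumes "filt D k e" "b' \<in> Poly_Mapping.keys (col e b)"
  shows "zdeg b' = zdeg b + D \<and> xdeg b' \<le> xdeg b + k"
  using assms unfolding filt_def by blast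

lemma filt_add:
  assumes "filt D k e" "filt D k f"
  shows "filt D k (e + f :: 'k::comm_ring_1 operator)"
  unfolding filt_def
proof (intro allI impI)
  fix b b' assume "b' \<in> Poly_Mapping.keys (col (e + f) b)"
  then have "b' \<in> Poly_Mapping.keys (col e b) \<or> b' \<in> Poly_Mapping.keys (col f b)"
    using Poly_Mapping.keys_add[of "col e b" "col f b"] by auto
  then show "zdeg b' = zdeg b + D \<and> xdeg b' \<le> xdeg b + k"
    using filt_D assms by metis
qed

lemma filt_diff:
  assumes "filt D k e" "filt D k f"
  shows "filt D k (e - f :: 'k::comm_ring_1 operator)"
  unfolding filt_def
proof (intro allI impI)
  fix b b' assume "b' \<in> Poly_Mapping.keys (col (e - f) b)"
  then have "b' \<in> Poly_Mapping.keys (col e b) \<or> b' \<in> Poly_Mapping.keys (col f b)"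
    using keys_minus_subset[of "col e b" "col f b"] by auto
  then show "zdeg b' = zdeg b + D \<and> xdeg b' \<le> xdeg b + k"
    using filt_D assms by metis
qed

lemma filt_0 [simp]: "filt D k (0 :: 'k::comm_ring_1 operator)"
  by (simp add: filt_def)

lemma filt_sum: "(\<And>i. i \<in> A \<Longrightarrow> filt D k (f i)) \<Longrightarrow> filt D k (\<Sum>i\<in>A. f i :: 'k::comm_ring_1 operator)"
  by (induction A rule: infinite_finite_induct) (auto intro: filt_add)

lemma filt_mult:
  assumes "filt D k e" "filt D' k' f"
  shows "filt (D + D') (k + k') (e * f :: 'k::comm_ring_1 operator)"
  unfolding filt_def
proof (intro allI impI)
  fix b b' assume "b' \<in> Poly_Mapping.keys (col (e * f) b)"
  then obtain b'' where b'': "b'' \<in> Poly_Mapping.keys (col f b)" "b' \<in> Poly_Mapping.keys (col e b'')"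
    using keys_app[of e "col f b"] by auto
  have "zdeg b'' = zdeg b + D' \<and> xdeg b'' \<le> xdeg b + k'" "zdeg b' = zdeg b'' + D \<and> xdeg b' \<le> xdeg b'' + k"
    using filt_D[OF assms(2) b''(1)] filt_D[OF assms(1) b''(2)] by blast+
  then show "zdeg b' = zdeg b + (D + D') \<and> xdeg b' \<le> xdeg b + (k + k')" by simp
qed

lemma filt_mono:
  assumes "filt D k e" "k \<le> k'"
  shows "filt D k' e"
  unfolding filt_def using filt_D[OF assms(1)] assms(2) by fastforce

lemma filt_sc [simp]: "filt 0 0 (sc c)"
  by (auto simp: filt_def)

lemma filt_xy: "filt 1 0 (op_x :: 'k::comm_ring_1 operator)" "filt 1 0 (op_y :: 'k::comm_ring_1 operator)"
  by (auto simp: filt_def)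

lemma filt_g: "filt 0 0 (op_g u)"
  by (auto simp: filt_def op_g_def split: if_splits)

lemma filt_red: "filt D k e \<Longrightarrow> filt D k (red e)"
  unfolding filt_def by (auto simp: in_keys_iff) (metis poly_0)+

text \<open>The operators of multiplication by \<open>\<complex>[x, y, X, Y]\<close> in its commutative structure.\<close>

definition shift_op :: "(coord \<Rightarrow>\<^sub>0 nat) \<Rightarrow> 'k::comm_ring_1 operator" where
  "shift_op e = Operator (\<lambda>(m, n, p, r, w). Poly_Mapping.single
     (m + Poly_Mapping.lookup e cx, n + Poly_Mapping.lookup e cy,
      p + Poly_Mapping.lookup e cX, r + Poly_Mapping.lookup e cY, w) 1)"

lemma col_shift_op [simp]: "col (shift_op e) (m, n, p, r, w) = Poly_Mapping.single
     (m + Poly_Mapping.lookup e cx, n + Poly_Mapping.lookup e cy,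
      p + Poly_Mapping.lookup e cX, r + Poly_Mapping.lookup e cY, w) 1"
  by (simp add: shift_op_def)

definition mult_op :: "coord mpoly \<Rightarrow> complex operator" where
  "mult_op = pm_eval sc shift_op"

lemma pm_hom_shift: "pm_hom sc (shift_op :: _ \<Rightarrow> complex operator)"
  by (unfold_locales; (rule sc_central)?)
    (auto intro!: operator_eqI simp: sc_add sc_mult lookup_add add_ac)

lemma mult_op_simps [simp]:
  "mult_op 0 = 0" "mult_op 1 = 1" "mult_op (f + g) = mult_op f + mult_op g" "mult_op (f * g) = mult_op f * mult_op g"
  "mult_op (Poly_Mapping.single e c) = sc c * shift_op e" "mult_op (f ^ n) = mult_op f ^ n"
proof -
  interpret pm_hom sc "shift_op :: _ \<Rightarrow> complex operator" by (rule pm_hom_shift)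
  show "mult_op 0 = 0" "mult_op 1 = 1" "mult_op (f + g) = mult_op f + mult_op g" "mult_op (f * g) = mult_op f * mult_op g"
    "mult_op (Poly_Mapping.single e c) = sc c * shift_op e" "mult_op (f ^ n) = mult_op f ^ n"
    by (simp_all add: mult_op_def pm_eval_add pm_eval_mult pm_eval_power)
qed

lemma mult_op_diff [simp]: "mult_op (f - g) = mult_op f - mult_op g"
  by (metis add_diff_cancel_right' diff_add_cancel mult_op_simps(3))

lemma mult_op_const [simp]: "mult_op (const c) = sc c"
proof -
  have "shift_op 0 = (1 :: complex operator)"
    by (rule operator_eqI) auto
  then show ?thesis by (simp add: const_def)
qed

lemma mult_op_xy [simp]: "mult_op (var cx) = op_x" "mult_op (var cy) = op_y"
  by (auto intro!: operator_eqI simp: var_def lookup_single)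

lemma mult_op_XY: "mult_op (var cX) = shift_op (Poly_Mapping.single cX (Suc 0))"
    "mult_op (var cY) = shift_op (Poly_Mapping.single cY (Suc 0))"
  by (simp_all add: var_def)

lemma red_xy [simp]: "red op_x = op_x" "red op_y = op_y"
  by (auto intro!: operator_eqI)

context cherednik
begin

abbreviation "SX \<equiv> shift_op (Poly_Mapping.single cX (Suc 0))"
abbreviation "SY \<equiv> shift_op (Poly_Mapping.single cY (Suc 0))"

lemma shift_xy: "SX * op_x = op_x * (SX :: 'k::comm_ring_1 operator)" "SX * op_y = op_y * (SX :: 'k operator)"
  "SY * op_x = op_x * (SY :: 'k operator)" "SY * op_y = op_y * (SY :: 'k operator)"
  by (auto intro!: operator_eqI)

text \<open>Meant for \<open>op_X - SX\<close> and \<open>op_Y - SY\<close>. The error against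
  commutative multiplication arises from commutator terms, which contain no letters X, Y, so it
  gains none where X itself gains one. The induction runs over the exponents of y and then of
  x.\<close>

lemma filt_lower:
  fixes e :: "'k::comm_ring_1 operator"
  assumes "e * op_x = op_x * e - k1" "e * op_y = op_y * e - k2" "\<And>b. col e (0, 0, b) = 0"
    "filt 0 0 k1" "filt 0 0 k2"
  shows "filt (-1) 0 e"
proof -
  have step: "zdeg b' = zdeg b + 1 + (-1) \<and> xdeg b' \<le> xdeg b"
    if "b' \<in> Poly_Mapping.keys (app z (col e b) - col k b)" "filt 1 0 z" "filt 0 0 k"
      "\<And>b'. b' \<in> Poly_Mapping.keys (col e b) \<Longrightarrow> zdeg b' = zdeg b + (-1) \<and> xdeg b' \<le> xdeg b" for b b' z k
  proof -
    note key = that(1)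
    from key consider b'' where "b'' \<in> Poly_Mapping.keys (col e b)" "b' \<in> Poly_Mapping.keys (col z b'')"
      | "b' \<in> Poly_Mapping.keys (col k b)"
      using keys_minus_subset[of "app z (col e b)" "col k b"] keys_app[of z "col e b"] by blast
    then show ?thesis
    proof cases
      case 1
      have "zdeg b'' = zdeg b + (-1) \<and> xdeg b'' \<le> xdeg b" using 1 that(4) by blast
      moreover have "zdeg b' = zdeg b'' + 1 \<and> xdeg b' \<le> xdeg b'' + 0"
        using filt_D[OF that(2)] 1 by blast
      ultimately show ?thesis by simp
    next
      case 2
      then show ?thesis using filt_D[OF that(3)] by fastforce
    qed
  qed
  have y: "zdeg b' = zdeg (0, n, b) + (-1) \<and> xdeg b' \<le> xdeg (0, n, b)"
    if "b' \<in> Poly_Mapping.keys (col e (0, n, b))" for b' n b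
    using that
  proof (induction n arbitrary: b')
    case (Suc n)
    obtain p r w where b: "b = (p, r, w)" by (cases b)
    have "col e (0, Suc n, b) = app op_y (col e (0, n, b)) - col k2 (0, n, b)"
      using arg_cong[OF assms(2), of "\<lambda>e. col e (0, n, b)"] by (simp add: b)
    from step[OF Suc.prems[unfolded this] filt_xy(2) assms(5) Suc.IH] show ?case by (simp add: b)
  qed (simp add: assms(3))
  have "zdeg b' = zdeg (m, n, b) + (-1) \<and> xdeg b' \<le> xdeg (m, n, b)"
    if "b' \<in> Poly_Mapping.keys (col e (m, n, b))" for b' m n b
    using that
  proof (induction m arbitrary: b')
    case (Suc m)
    obtain p r w where b: "b = (p, r, w)" by (cases b)
    have "col e (Suc m, n, b) = app op_x (col e (m, n, b)) - col k1 (m, n, b)"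
      using arg_cong[OF assms(1), of "\<lambda>e. col e (m, n, b)"] by (simp add: b)
    from step[OF Suc.prems[unfolded this] filt_xy(1) assms(4) Suc.IH] show ?case by (simp add: b)
  qed (rule y)
  then show ?thesis unfolding filt_def by auto
qed

lemma filt_refl_op: "filt 0 0 (refl_op k)"
  unfolding refl_op_def
  by (rule filt_sum) (use filt_mult[OF filt_sc filt_g] in simp)

lemma filt_K: "filt 0 0 (hb - cc a * S0)" "filt 0 0 (cc a * Sm)" "filt 0 0 (cc a * Sp)"
  using filt_mult[OF filt_sc filt_refl_op] by (auto intro!: filt_diff)

lemma filt_X_lower: "filt (-1) 0 (op_X - SX)"
  by (rule filt_lower[OF _ _ _ filt_K(1) filt_K(3)])
    (auto simp: left_diff_distrib right_diff_distrib move shift_xy lookup_single)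

lemma filt_Y_lower: "filt (-1) 0 (op_Y - SY)"
  by (rule filt_lower[OF _ _ _ filt_K(2) filt_K(1)])
    (auto simp: left_diff_distrib right_diff_distrib move shift_xy lookup_single)

lemma red_shift [simp]: "red (shift_op e) = shift_op e"
  by (rule operator_eqI) auto

text \<open>\<open>sym D k f e\<close>: the element \<open>e\<close> is homogeneous of degree \<open>D\<close> for the grading with \<open>x, y\<close> of degree
  \<open>1\<close> and \<open>X, Y\<close> of degree \<open>-1\<close>, and agrees with \<open>f\<close> up to terms with less than \<open>k\<close> letters \<open>X, Y\<close>,
  which are absent if \<open>a = 0\<close>.\<close>

definition sym :: "int \<Rightarrow> int \<Rightarrow> coord mpoly \<Rightarrow> complex operator \<Rightarrow> bool" where
  "sym D k f e \<longleftrightarrow> filt D k (mult_op f) \<and> filt D (k - 1) (e - mult_op f) \<and> (a = 0 \<longrightarrow> e = mult_op f)"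

lemma sym_filt: "sym D k f e \<Longrightarrow> filt D k e"
  unfolding sym_def using filt_add[of D k "mult_op f" "e - mult_op f"] filt_mono[of D "k - 1" "e - mult_op f" k] by simp

lemma sym_add: "sym D k f e \<Longrightarrow> sym D k f' e' \<Longrightarrow> sym D k (f + f') (e + e')"
  unfolding sym_def using filt_add[of D "k-1" "e - mult_op f" "e' - mult_op f'"]
  by (auto intro: filt_add simp: algebra_simps)

lemma sym_diff: "sym D k f e \<Longrightarrow> sym D k f' e' \<Longrightarrow> sym D k (f - f') (e - e')"
  unfolding sym_def using filt_diff[of D "k-1" "e - mult_op f" "e' - mult_op f'"]
  by (auto intro: filt_diff simp: algebra_simps)

lemma sym_mult:
  assumes "sym D k f e" "sym D' k' f' e'"
  shows "sym (D + D') (k + k') (f * f') (e * e')"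
proof -
  have "e * e' - mult_op f * mult_op f' = (e - mult_op f) * e' + mult_op f * (e' - mult_op f')"
    by (simp add: algebra_simps)
  moreover have "filt (D + D') (k - 1 + k') ((e - mult_op f) * e')" "filt (D + D') (k + (k' - 1)) (mult_op f * (e' - mult_op f'))"
    using filt_mult[OF _ sym_filt[OF assms(2)], of D "k - 1" "e - mult_op f"]
      filt_mult[of D k "mult_op f" D' "k' - 1" "e' - mult_op f'"] assms by (auto simp: sym_def)
  ultimately have "filt (D + D') (k + k' - 1) (e * e' - mult_op f * mult_op f')"
    using filt_add[of "D + D'" "k + k' - 1" "(e - mult_op f) * e'" "mult_op f * (e' - mult_op f')"]
    by (simp add: add_diff_eq diff_add_eq)
  moreover have "filt (D + D') (k + k') (mult_op f * mult_op f')"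
    using assms by (intro filt_mult) (simp_all add: sym_def)
  ultimately show ?thesis using assms by (auto simp: sym_def)
qed

lemma sym_sc: "sym 0 0 (const c) (sc c)"
  by (simp add: sym_def)

lemma sym_one: "sym 0 0 1 1"
  using sym_sc[of 1] by simp

lemma sym_power: "sym D k f e \<Longrightarrow> sym (int n * D) (int n * k) (f ^ n) (e ^ n)"
proof (induction n)
  case (Suc n)
  then show ?case using sym_mult[of D k f e "int n * D" "int n * k" "f ^ n" "e ^ n"] by (simp add: algebra_simps)
qed (simp add: sym_one)

lemma sym_x: "sym 1 0 (var cx) op_x" and sym_y: "sym 1 0 (var cy) op_y"
  by (simp_all add: sym_def filt_xy)

lemma filt_shift_XY: "filt (-1) 1 (SX :: 'k::comm_ring_1 operator)" "filt (-1) 1 (SY :: 'k operator)"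
  by (auto simp: filt_def lookup_single)

text \<open>At a = 0 and \<hbar> = 0 all commutators of letters vanish. This is what records in
  \<open>sym\<close> that corrections are absent for a = 0.\<close>

lemma red_eq_shift:
  assumes "a = 0"
  shows "red op_X = SX" "red op_Y = SY"
proof -
  have z: "red (k - cc a * e) = red k" for k e using assms by simp
  have "red (op_X - SX) = 0"
  proof (rule operator_zeroI)
    have "(op_X - SX) * op_x = op_x * (op_X - SX) - (hb - cc a * S0)" "(op_X - SX) * op_y = op_y * (op_X - SX) - cc a * Sp"
      by (auto simp: left_diff_distrib right_diff_distrib move shift_xy)
    then have "red ((op_X - SX) * op_x) = red (op_x * (op_X - SX) - (hb - cc a * S0))"
      "red ((op_X - SX) * op_y) = red (op_y * (op_X - SX) - cc a * Sp)" by simp_all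
    then show "red (op_X - SX) * op_x = op_x * red (op_X - SX)" "red (op_X - SX) * op_y = op_y * red (op_X - SX)"
      using assms by simp_all
  qed (auto simp: lookup_single)
  then show "red op_X = SX" by simp
  have "red (op_Y - SY) = 0"
  proof (rule operator_zeroI)
    have "(op_Y - SY) * op_x = op_x * (op_Y - SY) - cc a * Sm" "(op_Y - SY) * op_y = op_y * (op_Y - SY) - (hb - cc a * S0)"
      by (auto simp: left_diff_distrib right_diff_distrib move shift_xy)
    then have "red ((op_Y - SY) * op_x) = red (op_x * (op_Y - SY) - cc a * Sm)"
      "red ((op_Y - SY) * op_y) = red (op_y * (op_Y - SY) - (hb - cc a * S0))" by simp_all
    then show "red (op_Y - SY) * op_x = op_x * red (op_Y - SY)" "red (op_Y - SY) * op_y = op_y * red (op_Y - SY)"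
      using assms by simp_all
  qed (auto simp: lookup_single)
  then show "red op_Y = SY" by simp
qed

lemma sym_X: "sym (-1) 1 (var cX) (red op_X)" and sym_Y: "sym (-1) 1 (var cY) (red op_Y)"
  using filt_red[OF filt_X_lower] filt_red[OF filt_Y_lower] red_eq_shift
  by (simp_all add: sym_def mult_op_XY filt_shift_XY)

lemma trunc_mult_op: "trunc (col (mult_op f) b0) = f"
proof (induction f rule: poly_mapping_induct_single)
  case (single e c)
  show ?case using trunc_single[of e "mat 1" c] by (simp add: exps_def)
qed (simp_all add: trunc_add)

subsection \<open>Elements of \<open>H\<^sub>c\<close> and their leading terms\<close>

definition SS :: "complex operator set" where
  "SS = red ` phi ` carrier R"

lemma SS_expand:
  assumes "e \<in> SS"
  shows "Wsup (col e b0)" "e = pm_eval sc (\<lambda>b. red (pbw_op b)) (col e b0)"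
proof -
  obtain F where F: "F \<in> carrier R" "e = red (phi F)" using assms by (auto simp: SS_def)
  define \<nu> where "\<nu> = col (phi F) b0"
  have sup: "Wsup \<nu>" using Wsup_phi[OF F(1), of b0] by (simp add: \<nu>_def)
  then show "Wsup (col e b0)"
    by (auto simp: F(2) \<nu>_def Wsup_iff simp del: split_paired_All)
  interpret pm_additive sc "\<lambda>b. red (pbw_op b)" by unfold_locales (simp_all add: sc_add)
  have "e = red (phi (pbw_elt \<nu>))"
    using phi_cong[OF F(1) pbw_elt_carrier[OF sup]] \<pi>_normal_form[OF F(1)] F(2) by (simp add: \<nu>_def)
  also have "\<dots> = pm_eval sc (\<lambda>b. red (pbw_op b)) (red_pm \<nu>)"
    using sup by (induction \<nu> rule: Wsup_induct)
      (simp_all add: pbw_elt_0 pbw_elt_add phi_pbw_elt_single pm_eval_add)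
  also have "red_pm \<nu> = col e b0"
    by (simp add: F(2) \<nu>_def)
  finally show "e = pm_eval sc (\<lambda>b. red (pbw_op b)) (col e b0)" .
qed

text \<open>Coefficient extraction: by hypothesis, among the PBW monomials of \<open>e\<close> only
  \<open>b1\<close> can reach the coordinate \<open>b'\<close> from \<open>c\<close>.\<close>

lemma lookup_col_SS:
  assumes e: "e \<in> SS" and "\<And>b. b \<in> Poly_Mapping.keys (col e b0) \<Longrightarrow>
    Poly_Mapping.lookup (col (red (pbw_op b)) c) b' = (if b = b1 then g else 0)"
  shows "Poly_Mapping.lookup (col e c) b' = Poly_Mapping.lookup (col e b0) b1 * g"
proof -
  let ?\<mu> = "col e b0"
  have "col e c = (\<Sum>b\<in>Poly_Mapping.keys ?\<mu>. smult_pm (Poly_Mapping.lookup ?\<mu> b) (col (red (pbw_op b)) c))"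
    by (subst SS_expand(2)[OF e]) (simp add: pm_eval_def col_sum)
  then have "Poly_Mapping.lookup (col e c) b'
      = (\<Sum>b\<in>Poly_Mapping.keys ?\<mu>. Poly_Mapping.lookup ?\<mu> b * Poly_Mapping.lookup (col (red (pbw_op b)) c) b')"
    by (simp add: lookup_sum)
  also have "\<dots> = (\<Sum>b\<in>Poly_Mapping.keys ?\<mu>. if b = b1 then Poly_Mapping.lookup ?\<mu> b1 * g else 0)"
  proof (rule sum.cong[OF refl])
    fix b assume "b \<in> Poly_Mapping.keys ?\<mu>"
    from assms(2)[OF this] show "Poly_Mapping.lookup ?\<mu> b * Poly_Mapping.lookup (col (red (pbw_op b)) c) b'
        = (if b = b1 then Poly_Mapping.lookup ?\<mu> b1 * g else 0)"
      by (simp only:) (cases "b = b1"; simp)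
  qed
  also have "\<dots> = Poly_Mapping.lookup ?\<mu> b1 * g"
    by (simp add: in_keys_iff)
  finally show ?thesis .
qed

lemma col_op_g_base:
  assumes "monomial_mat w"
  shows "col (op_g w) (0, 0, 0, 0, u) = bas (0, 0, 0, 0, w ** u)"
  using assms by (elim monomial_cases) (simp_all flip: one_pCons)

lemma col_pbw_op_group:
  assumes "w \<in> W"
  shows "col (red (pbw_op (m, n, p, r, w))) (0, 0, 0, 0, u) = bas (m, n, p, r, w ** u)"
proof -
  have "col (pbw_op (m, n, p, r, w)) (0, 0, 0, 0, u) = bas (m, n, p, r, w ** u)"
    using W_monomial[OF assms] by (simp add: pbw_op_eq col_op_g_base col_power_base del: col_op_x col_op_y)
  then show ?thesis by simp
qed

lemma monomial_cancel:
  assumes "monomial_mat u"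
  shows "v ** u = w ** u \<longleftrightarrow> v = w" "u ** v = u ** w \<longleftrightarrow> v = w"
proof -
  have "\<exists>u'. u ** u' = mat 1 \<and> u' ** u = mat 1"
    using assms
  proof (cases rule: monomial_cases)
    case (diag \<alpha>)
    then show ?thesis by (intro exI[of _ "diag_mat (inverse \<alpha>)"]) simp
  next
    case (refl \<beta>)
    then show ?thesis by (intro exI[of _ "refl_mat \<beta>"]) simp
  qed
  then obtain u' where u': "u ** u' = mat 1" "u' ** u = mat 1" by blast
  show "v ** u = w ** u \<longleftrightarrow> v = w" using u'(1) by (metis matrix_mul_assoc matrix_mul_rid)
  show "u ** v = u ** w \<longleftrightarrow> v = w" using u'(2) by (metis matrix_mul_assoc matrix_mul_lid)
qed

text \<open>At the vector of a group element \<open>u\<close>, possibly outside \<open>W\<close>,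
  one sees \<open>e\<close> multiplied by \<open>u\<close> on the right. This translates commutation
  with \<open>op_g u\<close> into conditions on the PBW coefficients of \<open>e\<close>.\<close>

lemma lookup_col_group:
  assumes "e \<in> SS" "monomial_mat u"
  shows "Poly_Mapping.lookup (col e (0, 0, 0, 0, u)) (m, n, p, r, u) = Poly_Mapping.lookup (col e b0) (m, n, p, r, mat 1)"
proof -
  have "Poly_Mapping.lookup (col (red (pbw_op b)) (0, 0, 0, 0, u)) (m, n, p, r, u) = (if b = (m, n, p, r, mat 1) then 1 else 0)"
    if b: "b \<in> Poly_Mapping.keys (col e b0)" for b
  proof -
    obtain m' n' p' r' w where [simp]: "b = (m', n', p', r', w)" by (cases b)
    have "w \<in> W" using SS_expand(1)[OF assms(1)] b by (auto simp: Wsup_def)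
    then show ?thesis
      using monomial_cancel(1)[OF assms(2), of w "mat 1"]
      by (auto simp: col_pbw_op_group lookup_single when_def simp del: col_red)
  qed
  then show ?thesis by (subst lookup_col_SS[OF assms(1)]) auto
qed

lemma lookup_app_diag:
  assumes "\<eta> \<noteq> 0"
  shows "Poly_Mapping.lookup (app (red (op_g (diag_mat \<eta>))) \<mu>) (m, n, p, r, diag_mat \<eta>)
    = \<eta> ^ (m + r) * inverse \<eta> ^ (n + p) * Poly_Mapping.lookup \<mu> (m, n, p, r, mat 1)"
proof (induction \<mu> rule: poly_mapping_induct_single)
  case (single b c)
  obtain m' n' p' r' w where [simp]: "b = (m', n', p', r', w)" by (cases b)
  show ?case using assms monomial_cancel(2)[of "diag_mat \<eta>" w "mat 1"]
    by (auto simp: lookup_single when_def mult_ac)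
qed (simp_all add: app_add lookup_add algebra_simps)

lemma lookup_app_refl:
  "Poly_Mapping.lookup (app (red (op_g (refl_mat 1))) \<mu>) (m, n, p, r, refl_mat 1)
    = Poly_Mapping.lookup \<mu> (n, m, r, p, mat 1)"
proof (induction \<mu> rule: poly_mapping_induct_single)
  case (single b c)
  obtain m' n' p' r' w where [simp]: "b = (m', n', p', r', w)" by (cases b)
  show ?case using monomial_cancel(2)[of "refl_mat 1" w "mat 1"]
    by (auto simp: lookup_single when_def)
qed (simp_all add: app_add lookup_add)

text \<open>Both sides of the commutation relation are applied to \<open>b0\<close> and compared in
  coordinates with group part \<open>diag_mat \<eta>\<close>. There conjugation acts diagonally: x
  and Y have eigenvalue \<eta>, y and X have its inverse.\<close>

lemma weight_of_eigen:
  assumes e: "e \<in> SS" and \<eta>: "\<eta> \<noteq> 0" and comm: "red (op_g (diag_mat \<eta>)) * e = sc \<epsilon> * e * red (op_g (diag_mat \<eta>))"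
    and key: "Poly_Mapping.lookup (col e b0) (m, n, p, r, mat 1) \<noteq> 0"
  shows "\<eta> ^ (m + r) * inverse \<eta> ^ (n + p) = \<epsilon>"
proof -
  let ?G = "red (op_g (diag_mat \<eta>))"
  have "col ?G b0 = bas (0, 0, 0, 0, diag_mat \<eta>)" using \<eta> by (simp flip: one_pCons)
  then have "col (sc \<epsilon> * e * ?G) b0 = smult_pm \<epsilon> (col e (0, 0, 0, 0, diag_mat \<eta>))" by simp
  then have "app ?G (col e b0) = smult_pm \<epsilon> (col e (0, 0, 0, 0, diag_mat \<eta>))"
    using comm by (metis col_simps(6))
  then have "Poly_Mapping.lookup (app ?G (col e b0)) (m, n, p, r, diag_mat \<eta>)
      = Poly_Mapping.lookup (smult_pm \<epsilon> (col e (0, 0, 0, 0, diag_mat \<eta>))) (m, n, p, r, diag_mat \<eta>)" by simp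
  then show ?thesis
    using key lookup_app_diag[OF \<eta>] lookup_col_group[OF e monomial_diag[OF \<eta>]] by simp
qed

lemma swap_symmetric:
  assumes e: "e \<in> SS" and comm: "red (op_g (refl_mat 1)) * e = e * red (op_g (refl_mat 1))"
  shows "Poly_Mapping.lookup (col e b0) (m, n, p, r, mat 1) = Poly_Mapping.lookup (col e b0) (n, m, r, p, mat 1)"
proof -
  let ?G = "red (op_g (refl_mat 1))"
  have "col ?G b0 = bas (0, 0, 0, 0, refl_mat 1)" by (simp flip: one_pCons)
  then have "col (e * ?G) b0 = col e (0, 0, 0, 0, refl_mat 1)" by simp
  then have "app ?G (col e b0) = col e (0, 0, 0, 0, refl_mat 1)"
    using comm by (metis col_simps(6))
  then show ?thesis
    using lookup_app_refl[of "col e b0" m n p r] lookup_col_group[OF e, of "refl_mat 1" m n p r] by simp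
qed

subsection \<open>Injectivity of the truncation on the center\<close>

text \<open>In the top number of letters X, Y, a monomial f w applied to x yields f w(x) as in the
  commutative algebra; all corrections have fewer such letters.\<close>

lemma pbw_op_x_leading:
  assumes "w \<in> W" "xdeg b' \<ge> int p + int r"
  shows "Poly_Mapping.lookup (col (red (pbw_op (m, n, p, r, w))) (1, 0, 0, 0, mat 1)) b' =
    (if b' = (if w$1$1 = 0 then (m, Suc n, p, r, w) else (Suc m, n, p, r, w)) then lam w else 0)"
proof -
  let ?f = "var cx ^ m * var cy ^ n * var cX ^ p * var cY ^ r"
  let ?e = "op_x ^ m * op_y ^ n * red op_X ^ p * red op_Y ^ r"
  let ?t = "if w$1$1 = 0 then (0, 1, 0, 0, w) else (1, 0, 0, 0, w)"
  have "sym (int m * 1 + int n * 1 + int p * (-1) + int r * (-1)) (int m * 0 + int n * 0 + int p * 1 + int r * 1) ?f ?e"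
    by (intro sym_mult sym_power sym_x sym_y sym_X sym_Y)
  then have filt: "filt (int m + int n - int p - int r) (int p + int r - 1) (?e - mult_op ?f)"
    by (simp add: sym_def)
  have "col (red (op_g w)) (1, 0, 0, 0, mat 1) = Poly_Mapping.single ?t (lam w)"
    using W_monomial[OF assms(1)] by (elim monomial_cases) simp_all
  then have "col (red (pbw_op (m, n, p, r, w))) (1, 0, 0, 0, mat 1) = smult_pm (lam w) (col ?e ?t)"
    by (simp add: pbw_op_eq)
  moreover have "Poly_Mapping.lookup (col (?e - mult_op ?f) ?t) b' = 0"
  proof (rule ccontr)
    assume "Poly_Mapping.lookup (col (?e - mult_op ?f) ?t) b' \<noteq> 0"
    then have "xdeg b' \<le> xdeg ?t + (int p + int r - 1)"
      using filt_D[OF filt] by (metis in_keys_iff)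
    then show False using assms(2) by (simp split: if_splits)
  qed
  moreover have "col (mult_op ?f) ?t = bas (if w$1$1 = 0 then (m, Suc n, p, r, w) else (Suc m, n, p, r, w))"
    by (simp add: var_power mult_single lookup_add lookup_single flip: mult_op_simps(6) mult_op_simps(4) mult_op_xy)
  ultimately show ?thesis
    by (auto simp: lookup_minus lookup_single when_def)
qed

lemma lookup_op_x:
  "Poly_Mapping.lookup (app op_x \<mu>) (m, n, p, r, w)
    = (if m = 0 then 0 else Poly_Mapping.lookup \<mu> (m - 1, n, p, r, w))"
proof (induction \<mu> rule: poly_mapping_induct_single)
  case (single b c)
  obtain m' n' p' r' w where "b = (m', n', p', r', w)" by (cases b)
  then show ?case by (auto simp: lookup_single when_def)
qed (simp_all add: app_add lookup_add)

text \<open>Commutation with x is compared on the terms f w with the most letters X, Y. A rotation w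
  multiplies x by a factor other than 1 unless w = 1, so its coefficients vanish. A reflection sends
  x to a multiple of y, which relates coefficients with different exponents of y and kills them
  recursively. The group part 1 is excluded by the vanishing truncation.\<close>

lemma central_trunc_zero:
  assumes e: "e \<in> SS" and comm: "e * op_x = op_x * e" and zero: "trunc (col e b0) = 0"
  shows "e = 0"
proof -
  define \<mu> where "\<mu> = col e b0"
  have sup: "Wsup \<mu>" using SS_expand(1)[OF e] by (simp add: \<mu>_def)
  have "\<mu> = 0"
  proof (rule ccontr)
    assume "\<mu> \<noteq> 0"
    then have ne: "Poly_Mapping.keys \<mu> \<noteq> {}" by simp
    define k where "k = Max (xdeg ` Poly_Mapping.keys \<mu>)"
    have le: "xdeg b \<le> k" if "b \<in> Poly_Mapping.keys \<mu>" for b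
      using that by (simp add: k_def)
    have "k \<in> xdeg ` Poly_Mapping.keys \<mu>" unfolding k_def by (rule Max_in) (use ne in auto)
    then obtain b where b: "b \<in> Poly_Mapping.keys \<mu>" "xdeg b = k" by auto
    obtain m n p r w where bb: "b = (m, n, p, r, w)" by (cases b)
    have w: "w \<in> W" using sup b by (auto simp: Wsup_def bb)
    have k: "k = int p + int r" using b by (simp add: bb)
    have lead: "Poly_Mapping.lookup (col e (1, 0, 0, 0, mat 1)) b' = Poly_Mapping.lookup \<mu> b1 * lam w"
      if "b' = (case b1 of (m, n, p, r, w) \<Rightarrow> if w$1$1 = 0 then (m, Suc n, p, r, w) else (Suc m, n, p, r, w))"
        "grp b1 = w" "xdeg b' = k" for b' b1
      unfolding \<mu>_def
    proof (rule lookup_col_SS[OF e])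
      fix b2 assume b2: "b2 \<in> Poly_Mapping.keys (col e b0)"
      obtain m2 n2 p2 r2 w2 where bb2: "b2 = (m2, n2, p2, r2, w2)" by (cases b2)
      obtain m1 n1 p1 r1 w1 where bb1: "b1 = (m1, n1, p1, r1, w1)" by (cases b1)
      have "w2 \<in> W" using sup b2 by (auto simp: Wsup_def bb2 \<mu>_def)
      moreover have "int p2 + int r2 \<le> k" using le[of b2] b2 by (simp add: bb2 \<mu>_def)
      ultimately show "Poly_Mapping.lookup (col (red (pbw_op b2)) (1, 0, 0, 0, mat 1)) b' = (if b2 = b1 then lam w else 0)"
        unfolding bb2 using that by (subst pbw_op_x_leading) (auto simp: bb1 split: if_splits)
    qed
    have "app op_x \<mu> = col (op_x * e) b0" by (simp add: \<mu>_def)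
    also have "\<dots> = col e (1, 0, 0, 0, mat 1)" by (simp flip: comm)
    finally have eq: "Poly_Mapping.lookup (col e (1, 0, 0, 0, mat 1)) (m', n', p, r, w)
        = (if m' = 0 then 0 else Poly_Mapping.lookup \<mu> (m' - 1, n', p, r, w))" for m' n'
      by (metis lookup_op_x)
    from W_monomial[OF w] have "Poly_Mapping.lookup \<mu> (m, n, p, r, w) = 0"
    proof (cases rule: monomial_cases)
      case (diag \<alpha>)
      show ?thesis
      proof (cases "\<alpha> = 1")
        case True
        obtain e' where "exps e' (mat 1) = (m, n, p, r, mat 1)"
          using exps_surj[of "(m, n, p, r, mat 1)"] by (metis grp.simps)
        then show ?thesis
          using arg_cong[OF zero, of "\<lambda>f. Poly_Mapping.lookup f e'"] diag True by (simp add: \<mu>_def)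
      next
        case False
        have "Poly_Mapping.lookup (col e (1, 0, 0, 0, mat 1)) (Suc m, n, p, r, w) = Poly_Mapping.lookup \<mu> (m, n, p, r, w) * lam w"
          by (rule lead) (use diag k in auto)
        then show ?thesis using eq[of "Suc m" n] diag False by simp
      qed
    next
      case (refl \<beta>)
      have "Poly_Mapping.lookup \<mu> (m', n', p, r, w) = 0" for m' n'
      proof (induction n' arbitrary: m')
        case 0
        \<comment> \<open>Since a reflection turns x into a multiple of y, a top-degree term with
          this group part always has a positive exponent of y.\<close>
        have "Poly_Mapping.lookup (col e (1, 0, 0, 0, mat 1)) (Suc m', 0, p, r, w) = 0 * (0 :: complex)"
        proof -
          have "Poly_Mapping.lookup (col e (1, 0, 0, 0, mat 1)) (Suc m', 0, p, r, w)
              = Poly_Mapping.lookup (col e b0) b0 * 0"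
          proof (rule lookup_col_SS[OF e])
            fix b2 assume b2: "b2 \<in> Poly_Mapping.keys (col e b0)"
            obtain m2 n2 p2 r2 w2 where bb2: "b2 = (m2, n2, p2, r2, w2)" by (cases b2)
            have "w2 \<in> W" using sup b2 by (auto simp: Wsup_def bb2 \<mu>_def)
            moreover have "int p2 + int r2 \<le> k" using le[of b2] b2 by (simp add: bb2 \<mu>_def)
            ultimately show "Poly_Mapping.lookup (col (red (pbw_op b2)) (1, 0, 0, 0, mat 1)) (Suc m', 0, p, r, w)
                = (if b2 = b0 then 0 else 0)"
              unfolding bb2 using k refl by (subst pbw_op_x_leading) (auto split: if_splits)
          qed
          then show ?thesis by simp
        qed
        then show ?case using eq[of "Suc m'" 0] by simp
      next
        case (Suc n')
        have "Poly_Mapping.lookup (col e (1, 0, 0, 0, mat 1)) (Suc m', Suc n', p, r, w)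
            = Poly_Mapping.lookup \<mu> (Suc m', n', p, r, w) * lam w"
          by (rule lead) (use refl k in auto)
        then show ?case using eq[of "Suc m'" "Suc n'"] Suc by simp
      qed
      then show ?thesis .
    qed
    then show False using b by (simp add: bb in_keys_iff)
  qed
  then show ?thesis
    using SS_expand(2)[OF e] by (simp add: \<mu>_def pm_eval_def)
qed

end

section \<open>The Poisson bracket\<close>

lemma commute_mult:
  fixes e u v :: "'r::semigroup_mult"
  assumes "e * u = u * e" "e * v = v * e"
  shows "e * (u * v) = u * v * e"
  using assms by (metis mult.assoc)

abbreviation comm :: "'r::ring_1 \<Rightarrow> 'r \<Rightarrow> 'r" where "comm e f \<equiv> e * f - f * e"

context cherednik
begin

text \<open>The algebra over the polynomials in \<hbar> as a ring of operators; \<open>SS\<close> is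
  its reduction.\<close>

definition Sh :: "complex poly operator set" where
  "Sh = phi ` carrier R"

lemma SS_eq: "SS = red ` Sh"
  by (simp add: SS_def Sh_def)

lemma Sh_closed [intro]:
  "e \<in> Sh \<Longrightarrow> f \<in> Sh \<Longrightarrow> e + f \<in> Sh" "e \<in> Sh \<Longrightarrow> f \<in> Sh \<Longrightarrow> e * f \<in> Sh"
  "e \<in> Sh \<Longrightarrow> f \<in> Sh \<Longrightarrow> e - f \<in> Sh"
proof -
  interpret ring R by (rule ring_smash)
  show "e \<in> Sh \<Longrightarrow> f \<in> Sh \<Longrightarrow> e + f \<in> Sh" "e \<in> Sh \<Longrightarrow> f \<in> Sh \<Longrightarrow> e * f \<in> Sh"
    "e \<in> Sh \<Longrightarrow> f \<in> Sh \<Longrightarrow> e - f \<in> Sh"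
    unfolding Sh_def by (auto simp flip: phi_add phi_mult phi_minus)
qed

lemma Sh_gens [intro]: "sc p \<in> Sh" "op_x \<in> Sh" "op_y \<in> Sh" "op_X \<in> Sh" "op_Y \<in> Sh" "\<beta> \<in> B \<Longrightarrow> s \<beta> \<in> Sh"
proof -
  have "phi (sm f w) \<in> Sh" if "w \<in> W" for f w
    using that unfolding Sh_def by (intro imageI) simp
  from this[of "mat 1" "tconst p"] this[of "mat 1" "tword [cx]"] this[of "mat 1" "tword [cy]"]
    this[of "mat 1" "tword [cX]"] this[of "mat 1" "tword [cY]"] this[of "refl_mat \<beta>" 1]
  show "sc p \<in> Sh" "op_x \<in> Sh" "op_y \<in> Sh" "op_X \<in> Sh" "op_Y \<in> Sh" "\<beta> \<in> B \<Longrightarrow> s \<beta> \<in> Sh"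
    by (simp_all add: refl_in_W)
qed

lemma Sh_one [intro]: "1 \<in> Sh"
  using Sh_gens(1)[of 1] by simp

lemma Sh_power [intro]: "e \<in> Sh \<Longrightarrow> e ^ n \<in> Sh"
  by (induction n) auto

lemma Sh_red_zero:
  assumes "l \<in> Sh" "red l = 0"
  obtains k where "k \<in> Sh" "l = hb * k"
proof -
  obtain F where F: "F \<in> carrier R" "l = phi F" using assms(1) by (auto simp: Sh_def)
  then have "red (phi F) = 0" using assms(2) by simp
  from red_phi_zero[OF F(1) this] obtain G
    where G: "G \<in> carrier R" "\<pi> F = \<pi> (lh \<otimes>\<^bsub>R\<^esub> G)" "phi F = hb * phi G" .
  show ?thesis by (rule that[of "phi G"]) (use F G in \<open>auto simp: Sh_def\<close>)
qed

lemma hb_cancel: "hb * e = hb * f \<Longrightarrow> e = f"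
  by (erule sc_cancel) simp

lemma hb_central: "e * hb = hb * e" "e * (hb * f) = hb * (e * f)"
  by (simp_all add: sc_central flip: mult.assoc)

section \<open>The center and its Poisson bracket on the level of operators\<close>

definition Z0 :: "complex operator set" where
  "Z0 = {z \<in> SS. \<forall>e\<in>SS. z * e = e * z}"

lemma Z0_SS: "z \<in> Z0 \<Longrightarrow> z \<in> SS"
  by (simp add: Z0_def)

lemma Z0_commute: "z \<in> Z0 \<Longrightarrow> e \<in> SS \<Longrightarrow> z * e = e * z"
  by (simp add: Z0_def)

lemma SS_closed [intro]:
  "e \<in> SS \<Longrightarrow> f \<in> SS \<Longrightarrow> e + f \<in> SS" "e \<in> SS \<Longrightarrow> f \<in> SS \<Longrightarrow> e * f \<in> SS"
  "e \<in> SS \<Longrightarrow> f \<in> SS \<Longrightarrow> e - f \<in> SS" "sc c \<in> SS"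
proof -
  show "e \<in> SS \<Longrightarrow> f \<in> SS \<Longrightarrow> e + f \<in> SS" "e \<in> SS \<Longrightarrow> f \<in> SS \<Longrightarrow> e * f \<in> SS" "e \<in> SS \<Longrightarrow> f \<in> SS \<Longrightarrow> e - f \<in> SS"
    unfolding SS_eq by (auto simp flip: red_simps)
  show "sc c \<in> SS" unfolding SS_eq using image_eqI[of "sc c" red "cc c" Sh] by (simp add: Sh_gens)
qed

lemma Z0_closed [intro]:
  assumes "z \<in> Z0" "z' \<in> Z0"
  shows "z + z' \<in> Z0" "z * z' \<in> Z0" "z - z' \<in> Z0"
proof -
  have "z * z' * e = e * (z * z')" if "e \<in> SS" for e
    using Z0_commute[OF assms(1) that] Z0_commute[OF assms(2) that] by (metis mult.assoc)
  then show "z * z' \<in> Z0"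
    unfolding Z0_def using SS_closed(2)[OF Z0_SS[OF assms(1)] Z0_SS[OF assms(2)]] by blast
  have "(z + z') * e = e * (z + z')" "(z - z') * e = e * (z - z')" if "e \<in> SS" for e
    using Z0_commute[OF assms(1) that] Z0_commute[OF assms(2) that] by (simp_all add: algebra_simps)
  then show "z + z' \<in> Z0" "z - z' \<in> Z0"
    unfolding Z0_def using SS_closed(1,3)[OF Z0_SS[OF assms(1)] Z0_SS[OF assms(2)]] by blast+
qed

lemma Z0_sc [intro]: "sc c \<in> Z0"
  by (auto simp: Z0_def sc_central)

lemma Z0_one [intro]: "1 \<in> Z0"
  using Z0_sc[of 1] by simp

lemma Z0_power [intro]: "z \<in> Z0 \<Longrightarrow> z ^ n \<in> Z0"
  by (induction n) auto

lemma central_comm: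
  assumes "l \<in> Sh" "red l \<in> Z0" "m \<in> Sh"
  obtains k where "k \<in> Sh" "comm l m = hb * k"
proof -
  have "red m \<in> SS" using assms(3) by (auto simp: SS_eq)
  then have "red (comm l m) = 0" using Z0_commute[OF assms(2)] by simp
  then show ?thesis using Sh_red_zero[of "comm l m"] assms that by blast
qed

definition pb_rel :: "complex operator \<Rightarrow> complex operator \<Rightarrow> complex operator \<Rightarrow> bool" where
  "pb_rel z z' p \<longleftrightarrow> (\<exists>l\<in>Sh. \<exists>l'\<in>Sh. \<exists>k\<in>Sh. red l = z \<and> red l' = z' \<and> hb * k = comm l l' \<and> p = red k)"

definition pb :: "complex operator \<Rightarrow> complex operator \<Rightarrow> complex operator" where
  "pb z z' = (THE p. pb_rel z z' p)"

text \<open>Two lifts differ by a multiple of \<hbar>. The quotient by \<hbar> then changes by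
  commutators with lifts of central elements, which vanish at \<hbar> = 0, and by a multiple of
  \<hbar>.\<close>

lemma pb_rel_unique:
  assumes "l \<in> Sh" "l' \<in> Sh" "k \<in> Sh" "red l \<in> Z0" "red l' \<in> Z0" "hb * k = comm l l'"
    and "pb_rel (red l) (red l') p"
  shows "p = red k"
proof -
  obtain m m' k' where m: "m \<in> Sh" "m' \<in> Sh" "k' \<in> Sh" "red m = red l" "red m' = red l'"
    "hb * k' = comm m m'" "p = red k'"
    using assms(7) by (auto simp: pb_rel_def)
  obtain u where u: "u \<in> Sh" "m - l = hb * u" using Sh_red_zero[of "m - l"] m assms by auto
  obtain u' where u': "u' \<in> Sh" "m' - l' = hb * u'" using Sh_red_zero[of "m' - l'"] m assms by auto
  have ml: "m = l + hb * u" "m' = l' + hb * u'" using u u' by (simp_all add: algebra_simps)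
  have "hb * k' = comm l l' + hb * (comm u l' + comm l u' + hb * comm u u')"
    unfolding m(6) ml by (simp add: algebra_simps hb_central[of l] hb_central[of l'] hb_central[of u] hb_central[of u'])
  also have "\<dots> = hb * (k + (comm u l' + comm l u' + hb * comm u u'))"
    by (simp only: assms(6)[symmetric] distrib_left)
  finally have "k' = k + (comm u l' + comm l u' + hb * comm u u')" by (rule hb_cancel)
  moreover have "red (comm u l') = 0" "red (comm l u') = 0"
    using Z0_commute[OF assms(4), of "red u'"] Z0_commute[OF assms(5), of "red u"] u(1) u'(1) by (simp_all add: SS_eq)
  ultimately show ?thesis using m(7) by simp
qed

lemma pb_eqI:
  assumes "l \<in> Sh" "l' \<in> Sh" "k \<in> Sh" "red l \<in> Z0" "red l' \<in> Z0" "comm l l' = hb * k"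
  shows "pb (red l) (red l') = red k"
  unfolding pb_def
proof (rule the_equality)
  show "pb_rel (red l) (red l') (red k)"
    using assms unfolding pb_rel_def by (metis)
  show "p = red k" if "pb_rel (red l) (red l') p" for p
    by (rule pb_rel_unique[OF assms(1-5) assms(6)[symmetric] that])
qed

lemma Z0_lift:
  assumes "z \<in> Z0"
  obtains l where "l \<in> Sh" "red l = z"
  using Z0_SS[OF assms] by (auto simp: SS_eq)

lemma pb_lift:
  assumes "z \<in> Z0" "z' \<in> Z0" "l \<in> Sh" "red l = z" "l' \<in> Sh" "red l' = z'"
  obtains k where "k \<in> Sh" "comm l l' = hb * k" "pb z z' = red k"
proof -
  obtain k where k: "k \<in> Sh" "comm l l' = hb * k"
    using central_comm[of l l'] assms by blast
  moreover have "pb z z' = red k" using pb_eqI[of l l' k] assms k by simp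
  ultimately show ?thesis by (rule that)
qed

lemma pb_closed [intro]:
  assumes z: "z \<in> Z0" and z': "z' \<in> Z0"
  shows "pb z z' \<in> Z0"
proof -
  obtain l where l: "l \<in> Sh" "red l = z" using z by (rule Z0_lift)
  obtain l' where l': "l' \<in> Sh" "red l' = z'" using z' by (rule Z0_lift)
  obtain k where k: "k \<in> Sh" "comm l l' = hb * k" "pb z z' = red k"
    using pb_lift[OF z z' l l'] .
  have cent: "red l \<in> Z0" "red l' \<in> Z0" using l l' z z' by simp_all
  have "red k * e = e * red k" if "e \<in> red ` Sh" for e
  proof -
    from that obtain m where m: "m \<in> Sh" "e = red m" by blast
    obtain u where u: "u \<in> Sh" "comm l m = hb * u" using central_comm[OF l(1) cent(1) m(1)] .
    obtain v where v: "v \<in> Sh" "comm l' m = hb * v" using central_comm[OF l'(1) cent(2) m(1)] .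
    have "hb * comm k m = comm (hb * k) m" by (simp add: algebra_simps hb_central[of m])
    also have "\<dots> = comm (comm l l') m" by (simp add: k(2))
    also have "\<dots> = comm (comm l m) l' + comm l (comm l' m)" by (simp add: algebra_simps)
    also have "\<dots> = hb * (comm u l' + comm l v)" unfolding u(2) v(2) by (simp add: algebra_simps hb_central[of l] hb_central[of l'])
    finally have "comm k m = comm u l' + comm l v" by (rule hb_cancel)
    then have "red (comm k m) = red (comm u l') + red (comm l v)" by simp
    moreover have "red (comm u l') = 0" "red (comm l v) = 0"
      using Z0_commute[OF z, of "red v"] Z0_commute[OF z', of "red u"] u(1) v(1) l l' by (simp_all add: SS_eq)
    ultimately show ?thesis by (simp add: m(2))
  qed
  then show ?thesis using k by (auto simp: Z0_def SS_eq)
qed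

lemma pb_add:
  assumes z: "z \<in> Z0" and w: "w \<in> Z0" and z': "z' \<in> Z0"
  shows "pb (z + w) z' = pb z z' + pb w z'"
proof -
  obtain l where l: "l \<in> Sh" "red l = z" using z by (rule Z0_lift)
  obtain m where m: "m \<in> Sh" "red m = w" using w by (rule Z0_lift)
  obtain l' where l': "l' \<in> Sh" "red l' = z'" using z' by (rule Z0_lift)
  obtain k where k: "k \<in> Sh" "comm l l' = hb * k" "pb z z' = red k" using pb_lift[OF z z' l l'] .
  obtain u where u: "u \<in> Sh" "comm m l' = hb * u" "pb w z' = red u" using pb_lift[OF w z' m l'] .
  have "comm (l + m) l' = hb * (k + u)"
    using k(2) u(2) by (simp add: algebra_simps)
  then have "pb (red (l + m)) (red l') = red (k + u)"
    using l m l' k u assms by (intro pb_eqI) (auto simp: Z0_closed)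
  then show ?thesis using l m l' k u by simp
qed

lemma pb_mult:
  assumes z: "z \<in> Z0" and w: "w \<in> Z0" and z': "z' \<in> Z0"
  shows "pb (z * w) z' = z * pb w z' + pb z z' * w"
proof -
  obtain l where l: "l \<in> Sh" "red l = z" using z by (rule Z0_lift)
  obtain m where m: "m \<in> Sh" "red m = w" using w by (rule Z0_lift)
  obtain l' where l': "l' \<in> Sh" "red l' = z'" using z' by (rule Z0_lift)
  obtain k where k: "k \<in> Sh" "comm l l' = hb * k" "pb z z' = red k" using pb_lift[OF z z' l l'] .
  obtain u where u: "u \<in> Sh" "comm m l' = hb * u" "pb w z' = red u" using pb_lift[OF w z' m l'] .
  have "comm (l * m) l' = l * comm m l' + comm l l' * m" by (simp add: algebra_simps)
  also have "\<dots> = hb * (l * u + k * m)" unfolding k(2) u(2) by (simp add: algebra_simps hb_central[of l])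
  finally have "pb (red (l * m)) (red l') = red (l * u + k * m)"
    using l m l' k u assms by (intro pb_eqI) (auto simp: Z0_closed)
  then show ?thesis using l m l' k u by simp
qed

lemma pb_anti:
  assumes z: "z \<in> Z0" and z': "z' \<in> Z0"
  shows "pb z' z = - pb z z'"
proof -
  obtain l where l: "l \<in> Sh" "red l = z" using z by (rule Z0_lift)
  obtain l' where l': "l' \<in> Sh" "red l' = z'" using z' by (rule Z0_lift)
  obtain k where k: "k \<in> Sh" "comm l l' = hb * k" "pb z z' = red k" using pb_lift[OF z z' l l'] .
  have "comm l' l = hb * (sc (-1) * k)"
    using k(2) by (simp add: sc_uminus algebra_simps)
  then have "pb (red l') (red l) = red (sc (-1) * k)"
    using l l' k(1) assms by (intro pb_eqI) auto
  then show ?thesis using l l' k by (simp add: sc_uminus)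
qed

lemma pb_sc:
  assumes "z \<in> Z0"
  shows "pb (sc c) z = 0"
proof -
  obtain l where l: "l \<in> Sh" "red l = z" using assms by (rule Z0_lift)
  have "pb (red (cc c)) (red l) = red (sc 0)"
    using l assms sc_central[of l "[:c:]"] by (intro pb_eqI) (auto simp: Z0_sc simp del: sc_0, simp)
  then show ?thesis using l by simp
qed

text \<open>The Jacobi identity of commutators, divided by \<hbar> twice.\<close>

lemma pb_jacobi:
  assumes z: "z \<in> Z0" and z': "z' \<in> Z0" and w: "w \<in> Z0"
  shows "pb (pb z z') w = pb (pb z w) z' + pb z (pb z' w)"
proof -
  obtain l where l: "l \<in> Sh" "red l = z" using z by (rule Z0_lift)
  obtain m where m: "m \<in> Sh" "red m = w" using w by (rule Z0_lift)
  obtain l' where l': "l' \<in> Sh" "red l' = z'" using z' by (rule Z0_lift)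
  obtain k where k: "k \<in> Sh" "comm l l' = hb * k" "pb z z' = red k" using pb_lift[OF z z' l l'] .
  obtain u where u: "u \<in> Sh" "comm l m = hb * u" "pb z w = red u" using pb_lift[OF z w l m] .
  obtain v where v: "v \<in> Sh" "comm l' m = hb * v" "pb z' w = red v" using pb_lift[OF z' w l' m] .
  have cent: "red k \<in> Z0" "red u \<in> Z0" "red v \<in> Z0"
    using k u v pb_closed[OF z z'] pb_closed[OF z w] pb_closed[OF z' w] by auto
  obtain e where e: "e \<in> Sh" "comm k m = hb * e" "pb (pb z z') w = red e"
    using pb_lift[OF cent(1) w k(1) refl m] k(3) by auto
  obtain f where f: "f \<in> Sh" "comm u l' = hb * f" "pb (pb z w) z' = red f"
    using pb_lift[OF cent(2) z' u(1) refl l'] u(3) by auto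
  obtain g where g: "g \<in> Sh" "comm l v = hb * g" "pb z (pb z' w) = red g"
    using pb_lift[OF z cent(3) l v(1) refl] v(3) by auto
  have "hb * (hb * e) = hb * comm k m" by (simp add: e(2))
  also have "\<dots> = comm (hb * k) m" by (simp add: algebra_simps hb_central[of m])
  also have "\<dots> = comm (comm l l') m" by (simp add: k(2))
  also have "\<dots> = comm (comm l m) l' + comm l (comm l' m)" by (simp add: algebra_simps)
  also have "\<dots> = hb * (comm u l' + comm l v)" unfolding u(2) v(2) by (simp add: algebra_simps hb_central[of l] hb_central[of l'])
  also have "\<dots> = hb * (hb * (f + g))" unfolding f(2) g(2) by (simp add: distrib_left)
  finally have "e = f + g" by (rule hb_cancel[OF hb_cancel])
  then show ?thesis using e f g by simp
qed

lemma pb_diff: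
  assumes "z \<in> Z0" "w \<in> Z0" "z' \<in> Z0"
  shows "pb (z - w) z' = pb z z' - pb w z'"
  using pb_add[of "z - w" w z'] assms by (simp add: Z0_closed)

lemma pb_right:
  assumes "z \<in> Z0" "w \<in> Z0" "z' \<in> Z0"
  shows "pb z' (z + w) = pb z' z + pb z' w" "pb z' (z - w) = pb z' z - pb z' w"
    "pb z' (z * w) = z * pb z' w + pb z' z * w"
proof -
  have cl: "z + w \<in> Z0" "z - w \<in> Z0" "z * w \<in> Z0" using assms by auto
  show "pb z' (z + w) = pb z' z + pb z' w" "pb z' (z - w) = pb z' z - pb z' w"
    "pb z' (z * w) = z * pb z' w + pb z' z * w"
    using assms pb_anti[OF cl(1) assms(3)] pb_anti[OF cl(2) assms(3)] pb_anti[OF cl(3) assms(3)]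
      pb_anti[OF assms(1,3)] pb_anti[OF assms(2,3)]
    by (simp_all add: pb_add pb_diff pb_mult)
qed

lemma pb_self:
  assumes "z \<in> Z0"
  shows "pb z z = 0"
proof -
  obtain l where l: "l \<in> Sh" "red l = z" using assms by (rule Z0_lift)
  have "pb (red l) (red l) = red (sc 0)"
    using l assms by (intro pb_eqI) (auto simp del: sc_0, simp)
  then show ?thesis using l by simp
qed

section \<open>Comparison with the center and the bracket of \<open>H\<^sub>c\<close>\<close>

lemma Zc_iff:
  "c \<in> Zc d \<zeta> a \<longleftrightarrow> c \<in> carrier C \<and> Psi c \<in> Z0"
proof -
  interpret C: ring C by (rule ring_C)
  have SS_Psi: "SS = Psi ` carrier C"
  proof
    show "SS \<subseteq> Psi ` carrier C"
    proof
      fix e assume "e \<in> SS"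
      then obtain F where "F \<in> carrier R" "e = red (phi F)" by (auto simp: SS_def)
      then show "e \<in> Psi ` carrier C" by (intro image_eqI[of _ _ "\<rho> F"]) simp_all
    qed
    show "Psi ` carrier C \<subseteq> SS"
    proof
      fix e assume "e \<in> Psi ` carrier C"
      then obtain c where c: "c \<in> carrier C" "e = Psi c" by blast
      from c(1) obtain F where "F \<in> carrier R" "c = \<rho> F" by (rule \<rho>_surj)
      then show "e \<in> SS" unfolding c(2) SS_def by auto
    qed
  qed
  have "c \<otimes>\<^bsub>C\<^esub> h = h \<otimes>\<^bsub>C\<^esub> c \<longleftrightarrow> Psi c * Psi h = Psi h * Psi c" if "c \<in> carrier C" "h \<in> carrier C" for h
    using Psi_inj[of "c \<otimes>\<^bsub>C\<^esub> h" "h \<otimes>\<^bsub>C\<^esub> c"] Psi_mult[OF that] Psi_mult[OF that(2,1)]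
      C.m_closed[OF that] C.m_closed[OF that(2,1)] by metis
  then show ?thesis unfolding Zc_def Z0_def SS_Psi by auto
qed

lemma poisson_eq:
  assumes z: "z \<in> Zc d \<zeta> a" and z': "z' \<in> Zc d \<zeta> a"
  shows "poisson d \<zeta> a z z' \<in> carrier C" "Psi (poisson d \<zeta> a z z') = pb (Psi z) (Psi z')"
proof -
  interpret R: ring R by (rule ring_smash)
  interpret H: ring H by (rule ring_H)
  have carr: "z \<in> carrier C" "z' \<in> carrier C" using z z' by (simp_all add: Zc_iff)
  obtain L where L: "L \<in> carrier R" "z = \<rho> L" using carr(1) by (rule \<rho>_surj)
  obtain L' where L': "L' \<in> carrier R" "z' = \<rho> L'" using carr(2) by (rule \<rho>_surj)
  have cent: "red (phi L) \<in> Z0" "red (phi L') \<in> Z0" using z z' L L' by (auto simp: Zc_iff)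
  have Sh: "phi F \<in> Sh" if "F \<in> carrier R" for F using that by (auto simp: Sh_def)
  obtain k where k: "k \<in> Sh" "comm (phi L) (phi L') = hb * k" "pb (red (phi L)) (red (phi L')) = red k"
    using pb_lift[OF cent Sh[OF L(1)] refl Sh[OF L'(1)] refl] .
  obtain K where K: "K \<in> carrier R" "k = phi K" using k by (auto simp: Sh_def)
  have comm_iff: "hbar d \<zeta> a \<otimes>\<^bsub>H\<^esub> \<pi> K = commutator H (\<pi> L) (\<pi> L') \<longleftrightarrow> hb * phi K = comm (phi L) (phi L')"
    if "L \<in> carrier R" "L' \<in> carrier R" "K \<in> carrier R" for L L' K
  proof -
    have "hbar d \<zeta> a \<otimes>\<^bsub>H\<^esub> \<pi> K = \<pi> (lh \<otimes>\<^bsub>R\<^esub> K)"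
      "commutator H (\<pi> L) (\<pi> L') = \<pi> (L \<otimes>\<^bsub>R\<^esub> L' \<ominus>\<^bsub>R\<^esub> L' \<otimes>\<^bsub>R\<^esub> L)"
      using that by (simp_all add: hbar_def commutator_def)
    then show ?thesis
      using \<pi>_eq_iff_phi[of "lh \<otimes>\<^bsub>R\<^esub> K" "L \<otimes>\<^bsub>R\<^esub> L' \<ominus>\<^bsub>R\<^esub> L' \<otimes>\<^bsub>R\<^esub> L"] that by simp
  qed
  have "poisson d \<zeta> a z z' = \<rho> K"
    unfolding poisson_def
  proof (rule the_equality)
    show "\<exists>l\<in>carrier H. \<exists>l'\<in>carrier H. \<exists>h\<in>carrier H. mod_hbar d \<zeta> a l = z \<and> mod_hbar d \<zeta> a l' = z' \<and>
       hbar d \<zeta> a \<otimes>\<^bsub>H\<^esub> h = commutator H l l' \<and> \<rho> K = mod_hbar d \<zeta> a h"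
    proof (intro bexI conjI)
      show "hbar d \<zeta> a \<otimes>\<^bsub>H\<^esub> \<pi> K = commutator H (\<pi> L) (\<pi> L')"
        using comm_iff[OF L(1) L'(1) K(1)] k K by simp
    qed (use L L' K in \<open>simp_all add: mod_hbar_\<pi>\<close>)
    fix p assume "\<exists>l\<in>carrier H. \<exists>l'\<in>carrier H. \<exists>h\<in>carrier H. mod_hbar d \<zeta> a l = z \<and> mod_hbar d \<zeta> a l' = z' \<and>
       hbar d \<zeta> a \<otimes>\<^bsub>H\<^esub> h = commutator H l l' \<and> p = mod_hbar d \<zeta> a h"
    then obtain l l' h where h: "l \<in> carrier H" "l' \<in> carrier H" "h \<in> carrier H" "mod_hbar d \<zeta> a l = z"
      "mod_hbar d \<zeta> a l' = z'" "hbar d \<zeta> a \<otimes>\<^bsub>H\<^esub> h = commutator H l l'" "p = mod_hbar d \<zeta> a h" by blast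
    obtain M where M: "M \<in> carrier R" "l = \<pi> M" using h(1) by (rule \<pi>_surj)
    obtain M' where M': "M' \<in> carrier R" "l' = \<pi> M'" using h(2) by (rule \<pi>_surj)
    obtain N where N: "N \<in> carrier R" "h = \<pi> N" using h(3) by (rule \<pi>_surj)
    have "hb * phi N = comm (phi M) (phi M')" using comm_iff[OF M(1) M'(1) N(1)] h M M' N by simp
    moreover have "red (phi M) = red (phi L)" "red (phi M') = red (phi L')"
      using h(4,5) M M' L L' \<rho>_eq_iff by (simp_all add: mod_hbar_\<pi>)
    ultimately have "pb_rel (red (phi L)) (red (phi L')) (red (phi N))"
      unfolding pb_rel_def using Sh[OF M(1)] Sh[OF M'(1)] Sh[OF N(1)] by metis
    then have "red (phi N) = red k"
      by (rule pb_rel_unique[OF Sh[OF L(1)] Sh[OF L'(1)] k(1) cent k(2)[symmetric]])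
    then show "p = \<rho> K"
      using h(7) N K \<rho>_eq_iff[of N K] by (simp add: mod_hbar_\<pi>)
  qed
  then show "poisson d \<zeta> a z z' \<in> carrier C" "Psi (poisson d \<zeta> a z z') = pb (Psi z) (Psi z')"
    using K L L' k by simp_all
qed

lemma Z0_I:
  assumes e: "e \<in> SS" and "e * op_x = op_x * e" "e * op_y = op_y * e" "e * red op_X = red op_X * e"
    "e * red op_Y = red op_Y * e" "\<And>\<beta>. \<beta> \<in> B \<Longrightarrow> e * red (s \<beta>) = red (s \<beta>) * e"
  shows "e \<in> Z0"
proof -
  interpret R: ring R by (rule ring_smash)
  have "e * red (phi F) = red (phi F) * e" if "F \<in> carrier R" for F
    using that
  proof (induction F rule: smash_induct)
    case (scalar p)
    then show ?case by (simp add: sc_central)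
  next
    case (letter c)
    then show ?case using assms by (cases c) simp_all
  next
    case (group w)
    then show ?case
    proof (induction rule: W_induct)
      case (mult u v)
      have "e * (red (op_g u) * red (op_g v)) = red (op_g u) * red (op_g v) * e"
        by (rule commute_mult) (use mult in simp_all)
      then show ?case using mult by (simp add: op_g_mult W_monomial W_mult)
    qed (use assms refl_in_W in simp_all)
  next
    case (add F G)
    then show ?case by (simp add: algebra_simps)
  next
    case (mult F G)
    then show ?case by (simp add: commute_mult)
  qed
  then show ?thesis using e by (auto simp: Z0_def SS_def)
qed

end

section \<open>The distinguished central elements\<close>

text \<open>\<open>binom_op u v j n\<close> is the coefficient of \<open>t^j\<close> in \<open>(u + t v)^n\<close>, for \<open>u\<close> and \<open>v\<close> that need not
  commute.\<close>

fun binom_op :: "'r::ring_1 \<Rightarrow> 'r \<Rightarrow> nat \<Rightarrow> nat \<Rightarrow> 'r" where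
  "binom_op u v 0 0 = 1"
| "binom_op u v (Suc j) 0 = 0"
| "binom_op u v 0 (Suc n) = u * binom_op u v 0 n"
| "binom_op u v (Suc j) (Suc n) = u * binom_op u v (Suc j) n + v * binom_op u v j n"

lemma binom_op_0: "binom_op u v 0 n = u ^ n"
  by (induction n) simp_all

lemma binom_op_large: "n < j \<Longrightarrow> binom_op u v j n = 0"
  by (induction u v j n rule: binom_op.induct) auto

lemma binom_op_comm:
  fixes u v :: "'r::comm_ring_1"
  shows "binom_op u v j n = of_nat (n choose j) * u ^ (n - j) * v ^ j"
proof (induction u v j n rule: binom_op.induct)
  case (4 u v j n)
  show ?case
  proof (cases "Suc j \<le> n")
    case True
    then have "n - j = Suc (n - Suc j)" by simp
    then show ?thesis using 4 by (simp add: algebra_simps)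
  next
    case False
    then show ?thesis using 4 by (cases "j = n") (simp_all add: binomial_eq_0)
  qed
qed simp_all

lemma of_nat_left: "e * (of_nat k * f) = of_nat k * (e * f :: 'r::ring_1)"
  by (metis mult.assoc mult_of_nat_commute)

lemma comm_mult_left: "comm (e * f) g = e * comm f g + comm e g * f"
  and comm_mult_right: "comm g (e * f) = e * comm g f + comm g e * f"
  and comm_add_left: "comm (e + f) g = comm e g + comm f g"
  and comm_add_right: "comm g (e + f) = comm g e + comm g f"
  for e f g :: "'r::ring_1"
  by (simp_all add: algebra_simps)

text \<open>Up to the factor \<open>t\<close>, the commutator with \<open>Q\<close> is a derivation
  that sends u + s v to v, as d/ds does. So it acts on the powers of u + s v as d/ds, and the
  coefficient of s^j becomes j + 1 times the next one.\<close>

lemma comm_binom_left: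
  fixes t :: "'r::ring_1"
  assumes "comm u Q = t * v" "comm v Q = 0" "\<And>e. e * t = t * e"
  shows "comm (binom_op u v j n) Q = t * (of_nat (Suc j) * binom_op u v (Suc j) n)"
proof (induction n arbitrary: j)
  case 0
  show ?case by (cases j) simp_all
next
  case (Suc n)
  have t: "e * (t * f) = t * (e * f)" for e f by (metis assms(3) mult.assoc)
  show ?case
  proof (cases j)
    case 0
    show ?thesis
      unfolding 0 binom_op.simps comm_mult_left assms(1) Suc by (simp add: t[of u] algebra_simps)
  next
    case (Suc j')
    show ?thesis
      unfolding Suc binom_op.simps comm_mult_left comm_add_left assms(1,2) Suc.IH
      by (simp add: t[of u] t[of v] of_nat_left[of u] of_nat_left[of v] algebra_simps)
  qed
qed

text \<open>Up to the factor \<open>t\<close>, this derivation sends w = u + s v to s u = s w - s^2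
  dw/ds, hence w^n to n s w^n - s^2 d(w^n)/ds. The coefficient of s^(j+1) is n - j times that of
  s^j.\<close>

lemma comm_binom_right:
  fixes t :: "'r::ring_1"
  assumes "comm q u = 0" "comm q v = t * u" "\<And>e. e * t = t * e"
  shows "comm q (binom_op u v 0 n) = 0"
    "comm q (binom_op u v (Suc j) n) = t * (of_nat (n - j) * binom_op u v j n)"
proof -
  have t: "e * (t * f) = t * (e * f)" for e f by (metis assms(3) mult.assoc)
  show z: "comm q (binom_op u v 0 n) = 0" for n
  proof (induction n)
    case (Suc n)
    show ?case unfolding binom_op.simps comm_mult_right assms(1) Suc by simp
  qed simp
  show "comm q (binom_op u v (Suc j) n) = t * (of_nat (n - j) * binom_op u v j n)"
  proof (induction n arbitrary: j)
    case (Suc n)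
    show ?case
    proof (cases j)
      case 0
      show ?thesis
        unfolding 0 binom_op.simps comm_mult_right comm_add_right assms(1,2) Suc z
        by (simp add: t[of u] of_nat_left[of u] algebra_simps)
    next
      case (Suc j')
      have "of_nat (n - Suc j') * (u * binom_op u v (Suc j') n) + u * binom_op u v (Suc j') n
          = of_nat (n - j') * (u * binom_op u v (Suc j') n)"
      proof (cases "Suc j' \<le> n")
        case True
        then have "n - j' = Suc (n - Suc j')" by simp
        then show ?thesis by (simp add: algebra_simps)
      qed (simp add: binom_op_large)
      then have "t * (of_nat (n - Suc j') * (u * binom_op u v (Suc j') n)) + t * (u * binom_op u v (Suc j') n)
          = t * (of_nat (n - j') * (u * binom_op u v (Suc j') n))"
        by (simp flip: distrib_left)
      then show ?thesis
        unfolding Suc binom_op.simps comm_mult_right comm_add_right assms(1,2) Suc.IH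
        by (simp add: t[of u] t[of v] of_nat_left[of u] of_nat_left[of v] algebra_simps)
    qed
  qed simp
qed

lemma comm_power: "comm (u ^ n) v = (\<Sum>k<n. u ^ k * comm u v * u ^ (n - Suc k))" for u v :: "'r::ring_1"
proof (induction n)
  case (Suc n)
  have "comm (u ^ Suc n) v = u ^ n * comm u v + comm (u ^ n) v * u"
    unfolding power_Suc2 comm_mult_left ..
  also have "comm (u ^ n) v * u = (\<Sum>k<n. u ^ k * comm u v * u ^ (Suc n - Suc k))"
    unfolding Suc sum_distrib_right
  proof (rule sum.cong[OF refl])
    fix k assume "k \<in> {..<n}"
    then have "Suc n - Suc k = Suc (n - Suc k)" by auto
    then show "u ^ k * comm u v * u ^ (n - Suc k) * u = u ^ k * comm u v * u ^ (Suc n - Suc k)"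
      by (simp only: power_Suc2 mult.assoc)
  qed
  finally show ?case by (simp add: add.commute)
qed simp

context cherednik
begin

definition el_q :: "complex poly operator" where "el_q = op_x * op_y"
definition el_Q :: "complex poly operator" where "el_Q = op_X * op_Y"
text \<open>With Y to the left of y this is exactly the commutator of q and Q divided by \<hbar>,
  including its \<hbar> and reflection terms.\<close>

definition el_eu :: "complex poly operator" where "el_eu = op_x * op_X + op_Y * op_y"
text \<open>Expanding a power over noncommuting letters sums all orders of the words. Thanks to this
  symmetrization the commutators with Q and q shift \<open>j\<close> without correction terms. The
  scalar factor normalizes the truncation.\<close>

definition el_a :: "nat \<Rightarrow> complex poly operator" where
  "el_a j = cc (1 / of_nat (d choose j)) * (binom_op op_x op_Y j d + binom_op op_y op_X j d)"

lemma el_Sh [intro]: "el_q \<in> Sh" "el_Q \<in> Sh" "el_eu \<in> Sh" "el_a j \<in> Sh"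
proof -
  show "el_q \<in> Sh" "el_Q \<in> Sh" "el_eu \<in> Sh" unfolding el_q_def el_Q_def el_eu_def by (intro Sh_closed Sh_gens)+
  have "binom_op u v j n \<in> Sh" if "u \<in> Sh" "v \<in> Sh" for u v n
    using that by (induction u v j n rule: binom_op.induct) (auto simp: Sh_gens(1)[of 0, simplified])
  then show "el_a j \<in> Sh" unfolding el_a_def by (intro Sh_closed Sh_gens) auto
qed

lemma comm_letters:
  "comm op_x op_X = hb - cc a * S0" "comm op_x op_Y = cc a * Sm"
  "comm op_y op_X = cc a * Sp" "comm op_y op_Y = hb - cc a * S0"
  by (simp_all add: op_x_X op_x_Y op_y_X op_y_Y)

text \<open>By the Leibniz rule the reflection terms of [q, X] are x Sp - S0 y up to the factor a,
  and they cancel by \<open>refl_op_x\<close>; likewise for Y. Hence q is central modulo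
  \<hbar>.\<close>

lemma comm_q: "comm el_q op_X = hb * op_y" "comm el_q op_Y = hb * op_x"
  "comm el_q op_x = 0" "comm el_q op_y = 0"
  unfolding el_q_def comm_mult_left comm_letters
  by (simp_all add: algebra_simps sc_simps refl_op_x sc_central[of op_x] op_xy_commute)

lemma comm_Q: "comm op_x el_Q = hb * op_Y" "comm op_y el_Q = hb * op_X"
  "comm op_X el_Q = 0" "comm op_Y el_Q = 0"
  unfolding el_Q_def comm_mult_right comm_letters
  by (simp_all add: algebra_simps sc_simps refl_op_X sc_central[of op_X] op_XY_commute)

lemma comm_elements: "comm el_q el_Q = hb * el_eu" "comm el_eu el_Q = hb * (2 * el_Q)"
  "comm el_q el_eu = hb * (2 * el_q)"
proof -
  have "comm el_q el_Q = op_x * comm op_y el_Q + comm op_x el_Q * op_y"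
    unfolding el_q_def comm_mult_left ..
  also have "\<dots> = hb * el_eu" unfolding comm_Q by (simp add: el_eu_def sc_simps algebra_simps)
  finally show "comm el_q el_Q = hb * el_eu" .
  have "comm el_eu el_Q = hb * op_Y * op_X + op_Y * (hb * op_X)"
    unfolding el_eu_def comm_add_left comm_mult_left comm_Q by simp
  also have "\<dots> = hb * (2 * el_Q)" by (simp add: el_Q_def sc_simps algebra_simps op_XY_commute mult_2)
  finally show "comm el_eu el_Q = hb * (2 * el_Q)" .
  have "comm el_q el_eu = op_x * (hb * op_y) + hb * op_x * op_y"
    unfolding el_eu_def comm_add_right comm_mult_right comm_q by simp
  also have "\<dots> = hb * (2 * el_q)" by (simp add: el_q_def sc_simps algebra_simps mult_2)
  finally show "comm el_q el_eu = hb * (2 * el_q)" .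
qed

lemma cc_of_nat: "cc (of_nat n) = of_nat n"
  by (simp flip: sc_of_nat of_nat_poly)

lemma cc_hb_of_nat: "cc c * (hb * (of_nat n * e)) = hb * (cc (c * of_nat n) * e)"
proof -
  have e: "of_nat n * e = cc (of_nat n) * e" by (simp only: cc_of_nat)
  show ?thesis unfolding e by (simp only: hb_central(2)[of "cc c"] cc_mult)
qed

lemma comm_sc: "comm (sc c * e) f = sc c * comm e f" "comm f (sc c * e) = sc c * comm f e"
proof -
  have "f * (sc c * e) = sc c * (f * e)" by (metis sc_central mult.assoc)
  then show "comm (sc c * e) f = sc c * comm e f" "comm f (sc c * e) = sc c * comm f e"
    by (simp_all add: right_diff_distrib mult.assoc)
qed

text \<open>The factor j + 1 of \<open>comm_binom_left\<close> becomes d - j because (j + 1) C(d, j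
  + 1) = (d - j) C(d, j). At j = d both sides vanish.\<close>

lemma comm_a_Q:
  assumes "j \<le> d"
  shows "comm (el_a j) el_Q = hb * (cc (of_nat (d - j)) * el_a (Suc j))"
proof -
  let ?b = "binom_op op_x op_Y (Suc j) d + binom_op op_y op_X (Suc j) d"
  have "comm (el_a j) el_Q = cc (1 / of_nat (d choose j)) * (hb * (of_nat (Suc j) * ?b))"
    unfolding el_a_def comm_sc comm_add_left
      comm_binom_left[OF comm_Q(1,4) sc_central] comm_binom_left[OF comm_Q(2,3) sc_central]
    by (simp only: distrib_left)
  also have "\<dots> = hb * (cc (1 / of_nat (d choose j) * of_nat (Suc j)) * ?b)"
    by (rule cc_hb_of_nat)
  also have "cc (1 / of_nat (d choose j) * of_nat (Suc j)) * ?b = cc (of_nat (d - j)) * el_a (Suc j)"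
  proof (cases "j = d")
    case True
    then show ?thesis by (simp add: binom_op_large)
  next
    case False
    then have "of_nat (d choose j) \<noteq> (0 :: complex)" "of_nat (d choose Suc j) \<noteq> (0 :: complex)"
      using assms by (simp_all add: zero_less_binomial)
    moreover have "of_nat (Suc j * (d choose Suc j)) = (of_nat ((d - j) * (d choose j)) :: complex)"
      using binomial_absorb_comp[of d j] binomial_absorption[of j "d - 1"] d_pos False assms
      by (metis Suc_times_binomial_eq binomial_absorption mult.commute Suc_diff_1 less_le_trans zero_less_one)
    ultimately have "1 / of_nat (d choose j) * of_nat (Suc j) = of_nat (d - j) * (1 / of_nat (d choose Suc j) :: complex)"
      by (simp add: field_simps)
    then show ?thesis by (simp only: el_a_def cc_mult)
  qed
  finally show ?thesis .
qed

lemma comm_q_a: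
  assumes "j \<le> d"
  shows "comm el_q (el_a 0) = 0" "j > 0 \<Longrightarrow> comm el_q (el_a j) = hb * (cc (of_nat j) * el_a (j - 1))"
proof -
  note r1 = comm_binom_right[OF comm_q(3,2) sc_central] and r2 = comm_binom_right[OF comm_q(4,1) sc_central]
  show "comm el_q (el_a 0) = 0"
    unfolding el_a_def comm_sc comm_add_right r1 r2 by simp
  assume "j > 0"
  then obtain i where i: "j = Suc i" by (cases j) auto
  let ?b = "binom_op op_x op_Y i d + binom_op op_y op_X i d"
  have "comm el_q (el_a j) = cc (1 / of_nat (d choose j)) * (hb * (of_nat (d - i) * ?b))"
    unfolding i el_a_def comm_sc comm_add_right r1 r2 by (simp only: distrib_left)
  also have "\<dots> = hb * (cc (1 / of_nat (d choose j) * of_nat (d - i)) * ?b)"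
    by (rule cc_hb_of_nat)
  also have "cc (1 / of_nat (d choose j) * of_nat (d - i)) = cc (of_nat j * (1 / of_nat (d choose i)))"
  proof -
    have "of_nat (d choose j) \<noteq> (0 :: complex)" "of_nat (d choose i) \<noteq> (0 :: complex)"
      using assms i by (simp_all add: zero_less_binomial)
    moreover have "of_nat (Suc i * (d choose Suc i)) = (of_nat ((d - i) * (d choose i)) :: complex)"
      using binomial_absorb_comp[of d i] d_pos
      by (metis Suc_times_binomial_eq binomial_absorption mult.commute Suc_diff_1 less_le_trans zero_less_one)
    ultimately have "1 / of_nat (d choose j) * of_nat (d - i) = of_nat j * (1 / of_nat (d choose i) :: complex)"
      by (simp add: field_simps i)
    then show ?thesis by simp
  qed
  finally show "comm el_q (el_a j) = hb * (cc (of_nat j) * el_a (j - 1))"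
    by (simp add: i el_a_def cc_mult)
qed

section \<open>The element x^d + y^d and its commutators\<close>

lemma refl_power: "s \<beta> * op_x ^ m = cc (inverse \<beta> ^ m) * (op_y ^ m * s \<beta>)"
  "s \<beta> * op_y ^ m = cc (\<beta> ^ m) * (op_x ^ m * s \<beta>)"
proof -
  show "s \<beta> * op_x ^ m = cc (inverse \<beta> ^ m) * (op_y ^ m * s \<beta>)"
  proof (induction m)
    case (Suc m)
    have "s \<beta> * op_x ^ Suc m = cc (inverse \<beta>) * (op_y * (s \<beta> * op_x ^ m))"
      by (simp add: op_g_xy_assoc)
    then show ?case by (simp add: Suc sc_simps mult.assoc)
  qed simp
  show "s \<beta> * op_y ^ m = cc (\<beta> ^ m) * (op_x ^ m * s \<beta>)"
  proof (induction m)
    case (Suc m)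
    have "s \<beta> * op_y ^ Suc m = cc \<beta> * (op_x * (s \<beta> * op_y ^ m))"
      by (simp add: op_g_xy_assoc)
    then show ?case by (simp add: Suc sc_simps mult.assoc)
  qed simp
qed

lemma power_xy_commute: "op_x ^ m * op_y ^ n = op_y ^ n * op_x ^ m"
  by (metis op_xy_commute power_commuting_commutes)

text \<open>With the reflections moved to the right, both sums run over x^k y^(d-1-k) times a
  reflection, the second one with \<open>k\<close> in reversed order; the hypothesis matches the
  coefficients.\<close>

lemma sum_refl_op:
  assumes "\<And>\<beta> k. \<beta> \<in> B \<Longrightarrow> k < d \<Longrightarrow> K1 \<beta> * inverse \<beta> ^ (d - Suc k) = K2 \<beta> * \<beta> ^ k"
  shows "(\<Sum>k<d. op_x ^ k * refl_op K1 * op_x ^ (d - Suc k)) = (\<Sum>k<d. op_y ^ k * refl_op K2 * op_y ^ (d - Suc k))"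
proof -
  define T where "T \<beta> k = op_x ^ k * (op_y ^ (d - Suc k) * s \<beta>)" for \<beta> k
  have pw: "op_x ^ k * (sc c * e) = sc c * (op_x ^ k * e)" "op_y ^ k * (sc c * e) = sc c * (op_y ^ k * e)" for k c e
    by (metis mult.assoc sc_central)+
  have "op_x ^ k * refl_op K1 * op_x ^ (d - Suc k) = (\<Sum>\<beta>\<in>B. cc (K1 \<beta> * inverse \<beta> ^ (d - Suc k)) * T \<beta> k)" for k
    by (simp add: mult.assoc refl_op_right refl_power sum_distrib_left pw cc_mult T_def)
  moreover have "op_y ^ (d - Suc k) * refl_op K2 * op_y ^ (d - Suc (d - Suc k)) = (\<Sum>\<beta>\<in>B. cc (K2 \<beta> * \<beta> ^ k) * T \<beta> k)"
    if "k < d" for k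
  proof -
    have k: "d - Suc (d - Suc k) = k" using that by simp
    have yx: "op_y ^ (d - Suc k) * (op_x ^ k * e) = op_x ^ k * (op_y ^ (d - Suc k) * e)" for e
      by (metis power_xy_commute mult.assoc)
    show ?thesis unfolding k
      by (simp add: mult.assoc refl_op_right refl_power sum_distrib_left pw cc_mult T_def yx)
  qed
  ultimately have "(\<Sum>k<d. op_x ^ k * refl_op K1 * op_x ^ (d - Suc k))
      = (\<Sum>k<d. op_y ^ (d - Suc k) * refl_op K2 * op_y ^ (d - Suc (d - Suc k)))"
    using assms by (auto intro!: sum.cong)
  then show ?thesis
    using sum.nat_diff_reindex[of "\<lambda>k. op_y ^ k * refl_op K2 * op_y ^ (d - Suc k)" d] by simp
qed

abbreviation "f0 \<equiv> op_x ^ d + op_y ^ d"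

text \<open>The reflection parts contributed by x^d and by y^d cancel each other, because the
  parameters of the reflections are d-th roots of unity.\<close>

lemma comm_f0: "comm f0 op_X = hb * (of_nat d * op_x ^ (d - 1))" "comm f0 op_Y = hb * (of_nat d * op_y ^ (d - 1))"
proof -
  have hbp: "op_x ^ k * hb = hb * op_x ^ k" "op_y ^ k * hb = hb * op_y ^ k" for k by (rule sc_central)+
  have pw: "op_x ^ k * (cc a * e) = cc a * (op_x ^ k * e)" "op_y ^ k * (cc a * e) = cc a * (op_y ^ k * e)" for k e
    by (metis mult.assoc sc_central)+
  have hs: "(\<Sum>k<d. u ^ k * hb * u ^ (d - Suc k)) = hb * (of_nat d * u ^ (d - 1))" for u :: "complex poly operator"
  proof -
    have "u ^ k * hb * u ^ (d - Suc k) = hb * u ^ (d - 1)" if "k < d" for k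
    proof -
      have "k + (d - Suc k) = d - 1" using that by simp
      then show ?thesis by (metis sc_central mult.assoc power_add)
    qed
    then have "(\<Sum>k<d. u ^ k * hb * u ^ (d - Suc k)) = (\<Sum>k<d. hb * u ^ (d - 1))" by (intro sum.cong) auto
    then show ?thesis by (simp add: of_nat_left)
  qed
  have root: "inverse \<beta> ^ (d - Suc k) = \<beta> ^ Suc k" if "\<beta> \<in> B" "k < d" for \<beta> k
  proof -
    have "\<beta> ^ Suc k * \<beta> ^ (d - Suc k) = \<beta> ^ (Suc k + (d - Suc k))" by (simp only: power_add)
    also have "\<dots> = 1" using that by (simp add: unity_roots_def)
    finally have "\<beta> ^ Suc k * \<beta> ^ (d - Suc k) = 1" .
    then show ?thesis by (simp add: power_inverse inverse_unique mult.commute)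
  qed
  have "(\<Sum>k<d. op_x ^ k * S0 * op_x ^ (d - Suc k)) = (\<Sum>k<d. op_y ^ k * Sp * op_y ^ (d - Suc k))"
    by (rule sum_refl_op) (simp add: root)
  then have X: "(\<Sum>k<d. op_x ^ k * (cc a * S0) * op_x ^ (d - Suc k)) = (\<Sum>k<d. op_y ^ k * (cc a * Sp) * op_y ^ (d - Suc k))"
    by (simp add: pw mult.assoc flip: sum_distrib_left)
  have "(\<Sum>k<d. op_x ^ k * Sm * op_x ^ (d - Suc k)) = (\<Sum>k<d. op_y ^ k * S0 * op_y ^ (d - Suc k))"
    by (rule sum_refl_op) (use B_nonzero in \<open>simp add: root\<close>)
  then have Y: "(\<Sum>k<d. op_x ^ k * (cc a * Sm) * op_x ^ (d - Suc k)) = (\<Sum>k<d. op_y ^ k * (cc a * S0) * op_y ^ (d - Suc k))"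
    by (simp add: pw mult.assoc flip: sum_distrib_left)
  show "comm f0 op_X = hb * (of_nat d * op_x ^ (d - 1))"
    unfolding comm_add_left comm_power comm_letters
    by (simp only: right_diff_distrib left_diff_distrib sum_subtractf hs X) simp
  show "comm f0 op_Y = hb * (of_nat d * op_y ^ (d - 1))"
    unfolding comm_add_left comm_power comm_letters
    by (simp only: right_diff_distrib left_diff_distrib sum_subtractf hs Y) simp
qed

lemma el_a_0: "el_a 0 = f0"
  by (simp add: el_a_def binom_op_0)

lemma comm_f0_xy: "comm f0 op_x = 0" "comm f0 op_y = 0"
  using power_xy_commute[of d 1] power_xy_commute[of 1 d, symmetric]
  by (simp_all add: comm_add_left power_commutes)

lemma comm_f0_eu: "comm (el_a 0) el_eu = hb * (cc (of_nat d) * el_a 0)"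
proof -
  have p: "u * u ^ (d - Suc 0) = u ^ d" "u ^ (d - Suc 0) * u = u ^ d" for u :: "complex poly operator"
    using d_pos by (simp_all flip: power_Suc power_Suc2)
  have "comm f0 el_eu = op_x * (hb * (of_nat d * op_x ^ (d - 1))) + hb * (of_nat d * op_y ^ (d - 1)) * op_y"
    unfolding el_eu_def comm_add_right comm_mult_right comm_f0 comm_f0_xy by simp
  also have "\<dots> = hb * (of_nat d * f0)"
    by (simp add: hb_central(2)[of op_x] of_nat_left[of op_x] p mult.assoc distrib_left)
  finally show ?thesis by (simp add: el_a_0 cc_of_nat)
qed

lemma comm_f0_q: "comm (el_a 0) el_q = 0"
  unfolding el_a_0 el_q_def comm_mult_right comm_f0_xy by simp

text \<open>Commutation with a_0 turns X and Y into multiples of x^(d-1) and y^(d-1). As a_1 is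
  linear in X, Y, only x and y remain; they commute, so all positions of X or Y in a word contribute
  the same term.\<close>

lemma comm_a0_a1: "comm (el_a 0) (el_a 1) = hb * (cc (of_nat (2 * d)) * el_q ^ (d - 1))"
proof -
  have z: "comm f0 (u ^ n) = 0" if "comm f0 u = 0" for u n
  proof (induction n)
    case (Suc n)
    show ?case unfolding power_Suc comm_mult_right Suc that by simp
  qed simp
  have gen: "comm f0 (binom_op u v (Suc 0) n) = hb * (of_nat (d * n) * (u ^ (n - 1) * w))"
    if u: "comm f0 u = 0" and v: "comm f0 v = hb * (of_nat d * w)" and uw: "u * w = w * u" for u v w n
  proof (induction n)
    case (Suc n)
    have wu: "w * u ^ n = u ^ n * w" by (metis uw power_commuting_commutes)
    have "comm f0 (binom_op u v (Suc 0) (Suc n)) = u * (hb * (of_nat (d * n) * (u ^ (n - 1) * w))) + hb * (of_nat d * w) * u ^ n"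
      unfolding binom_op.simps comm_add_right comm_mult_right Suc u v binom_op_0 z[OF u] by simp
    also have "u * (hb * (of_nat (d * n) * (u ^ (n - 1) * w))) = hb * (of_nat (d * n) * (u * (u ^ (n - 1) * w)))"
      by (simp only: hb_central(2)[of u] of_nat_left[of u])
    also have "\<dots> = hb * (of_nat (d * n) * (u ^ n * w))"
      by (cases n) (simp_all add: mult.assoc)
    finally show ?case by (simp add: mult.assoc wu algebra_simps)
  qed simp
  have e: "comm f0 (binom_op op_x op_Y (Suc 0) d) = hb * (of_nat (d * d) * (op_x ^ (d - 1) * op_y ^ (d - 1)))"
    by (rule gen[OF comm_f0_xy(1) comm_f0(2)]) (use power_xy_commute[of 1] in simp)
  have e': "comm f0 (binom_op op_y op_X (Suc 0) d) = hb * (of_nat (d * d) * (op_y ^ (d - 1) * op_x ^ (d - 1)))"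
    by (rule gen[OF comm_f0_xy(2) comm_f0(1)]) (use power_xy_commute[of _ 1, symmetric] in simp)
  have q: "el_q ^ n = op_x ^ n * op_y ^ n" for n
  proof (induction n)
    case (Suc n)
    have "el_q ^ Suc n = el_q * (op_x ^ n * op_y ^ n)" by (simp only: power_Suc Suc)
    also have "\<dots> = op_x * (op_y * op_x ^ n) * op_y ^ n" by (simp add: el_q_def mult.assoc)
    also have "op_y * op_x ^ n = op_x ^ n * op_y" using power_xy_commute[of n 1, symmetric] by simp
    finally show ?case by (simp add: mult.assoc)
  qed simp
  have "comm (el_a 0) (el_a 1) = cc (1 / of_nat d) * (hb * (of_nat (d * d) * (el_q ^ (d - 1) + el_q ^ (d - 1))))"
    unfolding el_a_0 unfolding el_a_def One_nat_def comm_sc comm_add_right e e' q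
    by (simp add: power_xy_commute distrib_left)
  also have "\<dots> = hb * (cc (1 / of_nat d * of_nat (d * d) * 2) * el_q ^ (d - 1))"
  proof -
    have "of_nat (d * d) * (el_q ^ (d - 1) + el_q ^ (d - 1)) = cc (of_nat (d * d)) * (cc (of_nat 2) * el_q ^ (d - 1))"
      unfolding cc_of_nat by (simp add: mult_2)
    then show ?thesis by (simp only: cc_mult hb_central(2)[of "cc _"]) (simp add: mult.assoc)
  qed
  also have "1 / of_nat d * of_nat (d * d) * 2 = (of_nat (2 * d) :: complex)"
    using d_pos by simp
  finally show ?thesis .
qed

end

section \<open>The bracket polynomials\<close>

abbreviation "t0 \<equiv> var T0 :: tvar mpoly"
abbreviation "t1 \<equiv> var T1 :: tvar mpoly"
abbreviation "t2 \<equiv> var T2 :: tvar mpoly"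

text \<open>The invariant quadratic form of the copy of sl_2 spanned by q, eu, Q;
  \<open>bder\<close> kills it.\<close>

definition casimir :: "tvar mpoly" where
  "casimir = t0 ^ 2 - const 4 * (t1 * t2)"

text \<open>The derivation of \<open>\<complex>[T, T', T'']\<close> that corresponds to the bracket with \<open>Q\<close>.\<close>

definition bder :: "tvar mpoly \<Rightarrow> tvar mpoly" where
  "bder P = t0 * pderiv_var T1 P + const 2 * t2 * pderiv_var T0 P"

text \<open>With \<open>\<kappa>\<close> the constant in \<open>a_0 a_2 - a_1^2 = (eu^2 - 4qQ + \<kappa>) q^(d-2)\<close>, one has
  \<open>a_0 a_j - a_1 a_(j-1) = (eu^2 - 4qQ + \<kappa>) q^(d-j) U_j\<close> and
  \<open>{a_0, a_j} = q^(d-j) (V_j + \<kappa> V'_j)\<close>, where \<open>V_j\<close> and \<open>V'_j\<close> are \<open>Vpoly C\<close> for \<open>C = casimir\<close>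
  and \<open>C = 1\<close>.\<close>

fun Upoly :: "nat \<Rightarrow> tvar mpoly" where
  "Upoly 0 = 0"
| "Upoly (Suc 0) = 0"
| "Upoly (Suc (Suc 0)) = 1"
| "Upoly (Suc (Suc (Suc j))) = t0 * Upoly (Suc (Suc j)) - t1 * t2 * Upoly (Suc j)"

fun Vpoly :: "nat \<Rightarrow> tvar mpoly \<Rightarrow> complex \<Rightarrow> nat \<Rightarrow> tvar mpoly" where
  "Vpoly d C c 0 = 0"
| "Vpoly d C c (Suc 0) = const c"
| "Vpoly d C c (Suc (Suc j)) = t0 * Vpoly d C c (Suc j) - t1 * t2 * Vpoly d C c j
     + const (of_nat d) * C * Upoly (Suc j)"

text \<open>Solves the Leibniz rule {{a_i, a_j}, Q} = (d - i) {a_(i+1), a_j} + (d - j) {a_i,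
  a_(j+1)} for the first bracket on the right.\<close>

fun Bpoly :: "nat \<Rightarrow> tvar mpoly \<Rightarrow> complex \<Rightarrow> nat \<Rightarrow> nat \<Rightarrow> tvar mpoly" where
  "Bpoly d C c 0 j = t1 ^ (d - j) * Vpoly d C c j"
| "Bpoly d C c (Suc i) j = const (1 / of_nat (d - i)) *
     (bder (Bpoly d C c i j) - const (of_nat (d - j)) * Bpoly d C c i (Suc j))"

lemma homogeneous_Upoly: "homogeneous (int j - 2) (Upoly j)"
proof (induction j rule: Upoly.induct)
  case (4 j)
  have "homogeneous (1 + (int (Suc (Suc j)) - 2)) (t0 * Upoly (Suc (Suc j)))"
    by (rule homogeneous_mult[OF homogeneous_var 4(1)])
  moreover have "homogeneous (1 + 1 + (int (Suc j) - 2)) (t1 * t2 * Upoly (Suc j))"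
    by (rule homogeneous_mult[OF homogeneous_mult[OF homogeneous_var homogeneous_var] 4(2)])
  ultimately show ?case by (simp add: homogeneous_diff)
qed (use homogeneous_const[of 1] in simp_all)

text \<open>With the constant 1 in place of the quadratic \<open>casimir\<close>, the degree is two
  lower than the degree j - 1 of the main part. For \<open>j \<le> 2\<close> the polynomial is 0, as
  a negative degree demands.\<close>

lemma homogeneous_Vpoly: "homogeneous (int j - 3) (Vpoly d 1 0 j)"
proof (induction j rule: induct_nat_012)
  case (ge2 j)
  have "homogeneous (1 + (int (Suc j) - 3)) (t0 * Vpoly d 1 0 (Suc j))"
    by (rule homogeneous_mult[OF homogeneous_var ge2(2)])
  moreover have "homogeneous (1 + 1 + (int j - 3)) (t1 * t2 * Vpoly d 1 0 j)"
    by (rule homogeneous_mult[OF homogeneous_mult[OF homogeneous_var homogeneous_var] ge2(1)])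
  moreover have "homogeneous (int (Suc j) - 2) (const (of_nat d) * Upoly (Suc j))"
    by (rule homogeneous_const_mult[OF homogeneous_Upoly])
  ultimately show ?case by (simp add: homogeneous_diff homogeneous_add)
qed simp_all

lemma homogeneous_bder: "homogeneous n P \<Longrightarrow> homogeneous n (bder P)"
proof -
  assume P: "homogeneous n P"
  have "homogeneous (1 + (n - 1)) (t0 * pderiv_var T1 P)"
    by (rule homogeneous_mult[OF homogeneous_var homogeneous_pderiv_var[OF P]])
  moreover have "homogeneous (1 + (n - 1)) (t2 * pderiv_var T0 P)"
    by (rule homogeneous_mult[OF homogeneous_var homogeneous_pderiv_var[OF P]])
  ultimately show ?thesis
    unfolding bder_def by (simp add: mult.assoc homogeneous_add homogeneous_const_mult)
qed

lemma homogeneous_Bpoly: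
  assumes "j \<le> d"
  shows "homogeneous (int d - 3) (Bpoly d 1 0 i j)"
  using assms
proof (induction i arbitrary: j)
  case 0
  have "homogeneous (int (d - j) + (int j - 3)) (t1 ^ (d - j) * Vpoly d 1 0 j)"
    by (rule homogeneous_mult[OF homogeneous_var_power homogeneous_Vpoly])
  then show ?case using 0 by (simp add: of_nat_diff)
next
  case (Suc i)
  have "homogeneous (int d - 3) (const (of_nat (d - j)) * Bpoly d 1 0 i (Suc j))"
    using Suc by (cases "j = d") (simp_all add: homogeneous_const_mult)
  then show ?case
    using Suc by (simp add: homogeneous_const_mult homogeneous_diff homogeneous_bder)
qed

text \<open>The relations that determine the brackets; they hold both in the commutative algebra
  \<open>\<complex>[V \<times> V\<^sup>*]\<close> (with \<open>\<kappa> = 0\<close>) and in the center of \<open>H\<^sub>c\<close>.\<close>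

locale bracket_model =
  fixes ev :: "tvar mpoly \<Rightarrow> 'r::ring_1" and al :: "nat \<Rightarrow> 'r" and br :: "nat \<Rightarrow> nat \<Rightarrow> 'r"
    and D :: "'r \<Rightarrow> 'r" and d :: nat and \<kappa> :: complex
  assumes ev_add: "ev (P + P') = ev P + ev P'" and ev_mult: "ev (P * P') = ev P * ev P'"
    and ev_commute: "ev P * al i = al i * ev P" and al_commute: "al i * al j = al j * al i"
    and regular: "ev t1 * e = ev t1 * f \<Longrightarrow> e = f"
    and rec: "1 \<le> i \<Longrightarrow> i < d \<Longrightarrow> ev t0 * al i = ev t1 * al (Suc i) + ev t2 * al (i - 1)"
    and hessian: "2 \<le> d \<Longrightarrow> al 0 * al 2 - al 1 * al 1 = ev ((casimir + const \<kappa>) * t1 ^ (d - 2))"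
    and br_00: "br 0 0 = 0" and br_01: "br 0 1 = ev (const (of_nat (2 * d)) * t1 ^ (d - 1))"
    and br_0: "1 \<le> j \<Longrightarrow> j < d \<Longrightarrow> ev t1 * br 0 (Suc j) = ev t0 * br 0 j + ev (const (of_nat d)) * (al 0 * al j)
      - ev t2 * br 0 (j - 1) - ev (const (of_nat d)) * (al 1 * al (j - 1))"
    and D_br: "i \<le> d \<Longrightarrow> j \<le> d \<Longrightarrow> D (br i j) = ev (const (of_nat (d - i))) * br (Suc i) j + ev (const (of_nat (d - j))) * br i (Suc j)"
    and D_ev: "D (ev P) = ev (bder P)"
    and ev_1: "ev 1 = 1"
begin

lemma ev_0: "ev 0 = 0"
  using ev_add[of 0 0] by simp

lemma ev_diff: "ev (P - P') = ev P - ev P'"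
  using ev_add[of "P - P'" P'] by simp

text \<open>With \<open>al 0\<close> and \<open>al 1\<close> fixed, \<open>rec\<close> gives the
  minors the three-term recursion of \<open>Upoly\<close>; in each step one factor q cancels by
  \<open>regular\<close>.\<close>

lemma minors: "2 \<le> d \<Longrightarrow> j < d \<Longrightarrow> al 0 * al (Suc j) - al 1 * al j = ev ((casimir + const \<kappa>) * t1 ^ (d - Suc j) * Upoly (Suc j))"
proof (induction j rule: induct_nat_012)
  case 0
  show ?case by (simp add: al_commute ev_0)
next
  case 1
  then show ?case using hessian by (simp add: numeral_2_eq_2)
next
  case (ge2 j)
  have c: "ev P * (al i * e) = al i * (ev P * e)" for P i e by (metis ev_commute mult.assoc)
  have "ev t1 * (al 0 * al (Suc (Suc (Suc j))) - al 1 * al (Suc (Suc j)))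
      = al 0 * (ev t1 * al (Suc (Suc (Suc j)))) - al 1 * (ev t1 * al (Suc (Suc j)))"
    by (simp add: right_diff_distrib c)
  also have "\<dots> = al 0 * (ev t0 * al (Suc (Suc j)) - ev t2 * al (Suc j)) - al 1 * (ev t0 * al (Suc j) - ev t2 * al j)"
    using rec[of "Suc (Suc j)"] rec[of "Suc j"] ge2.prems by simp
  also have "\<dots> = ev t0 * (al 0 * al (Suc (Suc j)) - al 1 * al (Suc j)) - ev t2 * (al 0 * al (Suc j) - al 1 * al j)"
    by (simp add: right_diff_distrib c)
  also have "\<dots> = ev (t0 * ((casimir + const \<kappa>) * t1 ^ (d - Suc (Suc j)) * Upoly (Suc (Suc j)))
      - t2 * ((casimir + const \<kappa>) * t1 ^ (d - Suc j) * Upoly (Suc j)))"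
    using ge2 by (simp add: ev_diff ev_mult)
  also have "t0 * ((casimir + const \<kappa>) * t1 ^ (d - Suc (Suc j)) * Upoly (Suc (Suc j)))
      - t2 * ((casimir + const \<kappa>) * t1 ^ (d - Suc j) * Upoly (Suc j))
      = t1 * ((casimir + const \<kappa>) * t1 ^ (d - Suc (Suc (Suc j))) * Upoly (Suc (Suc (Suc j))))"
  proof -
    obtain m where m: "d = Suc (Suc (Suc (j + m)))" using ge2.prems by (metis add_Suc less_iff_Suc_add)
    show ?thesis by (simp add: m algebra_simps)
  qed
  finally show ?case unfolding ev_mult[of t1] by (rule regular)
qed

text \<open>The brackets with a_0 obey the recursion of \<open>rec\<close> with a source term, which
  \<open>minors\<close> evaluates; the factor q cancels again in each step.\<close>

lemma br_0_eq: "j \<le> d \<Longrightarrow> br 0 j = ev (t1 ^ (d - j) * Vpoly d (casimir + const \<kappa>) (of_nat (2 * d)) j)"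
proof (induction j rule: induct_nat_012)
  case (ge2 j)
  let ?C = "casimir + const \<kappa>" let ?V = "Vpoly d (casimir + const \<kappa>) (of_nat (2 * d))"
  have "ev t1 * br 0 (Suc (Suc j)) = ev t0 * br 0 (Suc j) - ev t2 * br 0 j
      + ev (const (of_nat d)) * (al 0 * al (Suc j) - al 1 * al j)"
    using br_0[of "Suc j"] ge2.prems by (simp add: algebra_simps)
  also have "\<dots> = ev (t0 * (t1 ^ (d - Suc j) * ?V (Suc j)) - t2 * (t1 ^ (d - j) * ?V j)
      + const (of_nat d) * (?C * t1 ^ (d - Suc j) * Upoly (Suc j)))"
    using ge2 minors[of j] by (simp add: ev_diff ev_mult ev_add)
  also have "t0 * (t1 ^ (d - Suc j) * ?V (Suc j)) - t2 * (t1 ^ (d - j) * ?V j)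
      + const (of_nat d) * (?C * t1 ^ (d - Suc j) * Upoly (Suc j))
      = t1 * (t1 ^ (d - Suc (Suc j)) * ?V (Suc (Suc j)))"
  proof -
    obtain m where m: "d = Suc (Suc (j + m))" using ge2.prems by (metis add_Suc le_Suc_ex)
    have "d - j = Suc (Suc m)" "d - Suc j = Suc m" "d - Suc (Suc j) = m" using m by simp_all
    then show ?thesis by (simp add: algebra_simps)
  qed
  finally show ?case unfolding ev_mult[of t1] by (rule regular)
qed (simp_all add: br_00 br_01[simplified] ev_0 mult.commute)

lemma br_eq: "i \<le> j \<Longrightarrow> j \<le> d \<Longrightarrow> br i j = ev (Bpoly d (casimir + const \<kappa>) (of_nat (2 * d)) i j)"
proof (induction i arbitrary: j)
  case 0
  then show ?case by (simp add: br_0_eq)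
next
  case (Suc i)
  let ?P = "Bpoly d (casimir + const \<kappa>) (of_nat (2 * d)) i"
  have i: "i < d" using Suc.prems by simp
  \<comment> \<open>At \<open>j = d\<close> the bracket with index d + 1 is not covered by the
    induction hypothesis, but its coefficient is 0.\<close>
  have nxt: "ev (const (of_nat (d - j))) * br i (Suc j) = ev (const (of_nat (d - j)) * ?P (Suc j))"
    using Suc by (cases "j = d") (simp_all add: ev_mult ev_0)
  have "ev (bder (?P j)) = D (br i j)"
    using Suc by (simp add: D_ev)
  also have "\<dots> = ev (const (of_nat (d - i))) * br (Suc i) j + ev (const (of_nat (d - j))) * br i (Suc j)"
    using Suc.prems by (intro D_br) simp_all
  finally have "ev (bder (?P j)) = ev (const (of_nat (d - i))) * br (Suc i) j + ev (const (of_nat (d - j)) * ?P (Suc j))"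
    unfolding nxt .
  then have "ev (const (of_nat (d - i))) * br (Suc i) j = ev (bder (?P j) - const (of_nat (d - j)) * ?P (Suc j))"
    by (simp add: ev_diff)
  then have "ev (const (1 / of_nat (d - i))) * (ev (const (of_nat (d - i))) * br (Suc i) j)
      = ev (const (1 / of_nat (d - i)) * (bder (?P j) - const (of_nat (d - j)) * ?P (Suc j)))"
    by (simp add: ev_mult)
  moreover have "ev (const (1 / of_nat (d - i))) * ev (const (of_nat (d - i))) = 1"
    using i by (simp add: ev_1 flip: ev_mult const_mult)
  ultimately show ?case by (simp flip: mult.assoc)
qed

end

lemma bder_simps: "bder (P + P') = bder P + bder P'" "bder (P * P') = bder P * P' + P * bder P'"
  "bder (const c) = 0" "bder (const c * P) = const c * bder P"
  "bder t0 = const 2 * t2" "bder t1 = t0" "bder t2 = 0"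
  by (simp_all add: bder_def pderiv_var_add pderiv_var_mult pderiv_var_var algebra_simps)

text \<open>\<open>Vpoly\<close> is linear in the pair (C, c), and (C + \<kappa>, c) = (C, c) +
  \<kappa> (1, 0). This is where the brackets become affine in \<kappa>.\<close>

lemma Vpoly_split: "Vpoly d (C + const \<kappa>) c j = Vpoly d C c j + const \<kappa> * Vpoly d 1 0 j"
  by (induction j rule: induct_nat_012) (simp_all add: algebra_simps)

lemma Bpoly_split: "Bpoly d (C + const \<kappa>) c i j = Bpoly d C c i j + const \<kappa> * Bpoly d 1 0 i j"
  by (induction i arbitrary: j) (simp_all add: Vpoly_split bder_simps algebra_simps)

subsection \<open>The commutative model\<close>

definition tvar_eval :: "(tvar \<Rightarrow> 'r) \<Rightarrow> (complex \<Rightarrow> 'r) \<Rightarrow> tvar mpoly \<Rightarrow> 'r::ring_1" where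
  "tvar_eval f c = pm_eval c (\<lambda>m. f T0 ^ Poly_Mapping.lookup m T0 * f T1 ^ Poly_Mapping.lookup m T1
     * f T2 ^ Poly_Mapping.lookup m T2)"

locale tvar_eval_hom =
  fixes f :: "tvar \<Rightarrow> 'r::ring_1" and c :: "complex \<Rightarrow> 'r"
  assumes c_hom: "c 0 = 0" "c 1 = 1" "c (b + b') = c b + c b'" "c (b * b') = c b * c b'"
    and c_commute: "e * c b = c b * e" and f_commute: "f i * f j = f j * f i"
begin

lemma pm_hom: "pm_hom c (\<lambda>m. f T0 ^ Poly_Mapping.lookup m T0 * f T1 ^ Poly_Mapping.lookup m T1
     * f T2 ^ Poly_Mapping.lookup m T2)"
proof unfold_locales
  fix i j :: "tvar \<Rightarrow>\<^sub>0 nat"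
  have pc: "f v ^ k * f w ^ l = f w ^ l * f v ^ k" for v w k l
    by (metis f_commute power_commuting_commutes)
  have pc': "f v ^ k * (f w ^ l * e) = f w ^ l * (f v ^ k * e)" for v w k l e
    by (metis pc mult.assoc)
  show "f T0 ^ Poly_Mapping.lookup (i + j) T0 * f T1 ^ Poly_Mapping.lookup (i + j) T1 * f T2 ^ Poly_Mapping.lookup (i + j) T2
      = f T0 ^ Poly_Mapping.lookup i T0 * f T1 ^ Poly_Mapping.lookup i T1 * f T2 ^ Poly_Mapping.lookup i T2
      * (f T0 ^ Poly_Mapping.lookup j T0 * f T1 ^ Poly_Mapping.lookup j T1 * f T2 ^ Poly_Mapping.lookup j T2)"
    by (simp add: lookup_add power_add mult.assoc pc' [of T1 _ T0] pc'[of T2 _ T0] pc'[of T2 _ T1])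
qed (simp_all add: c_hom, rule c_commute)

lemma eval_simps: "tvar_eval f c 0 = 0" "tvar_eval f c 1 = 1" "tvar_eval f c (P + P') = tvar_eval f c P + tvar_eval f c P'"
  "tvar_eval f c (P * P') = tvar_eval f c P * tvar_eval f c P'" "tvar_eval f c (P ^ n) = tvar_eval f c P ^ n"
  "tvar_eval f c (const b) = c b" "tvar_eval f c (var v) = f v"
proof -
  interpret pm_hom c "\<lambda>m. f T0 ^ Poly_Mapping.lookup m T0 * f T1 ^ Poly_Mapping.lookup m T1
     * f T2 ^ Poly_Mapping.lookup m T2" by (rule pm_hom)
  show "tvar_eval f c 0 = 0" "tvar_eval f c 1 = 1" "tvar_eval f c (P + P') = tvar_eval f c P + tvar_eval f c P'"
    "tvar_eval f c (P * P') = tvar_eval f c P * tvar_eval f c P'" "tvar_eval f c (P ^ n) = tvar_eval f c P ^ n"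
    "tvar_eval f c (const b) = c b"
    by (simp_all add: tvar_eval_def pm_eval_add pm_eval_mult pm_eval_power const_def)
  show "tvar_eval f c (var v) = f v"
    by (cases v) (simp_all add: tvar_eval_def var_def lookup_single c_hom)
qed

lemma eval_diff: "tvar_eval f c (P - P') = tvar_eval f c P - tvar_eval f c P'"
  using eval_simps(3)[of "P - P'" P'] by simp

text \<open>Both sides are derivations along the evaluation, so the generators suffice. The
  prescribed values are those of {-, Q} on eu, q, Q, in the commutative algebra as in the
  center.\<close>

lemma eval_derivation:
  assumes add: "\<And>P P'. D (tvar_eval f c P + tvar_eval f c P') = D (tvar_eval f c P) + D (tvar_eval f c P')"
    and mult: "\<And>P P'. D (tvar_eval f c P * tvar_eval f c P')
      = tvar_eval f c P * D (tvar_eval f c P') + D (tvar_eval f c P) * tvar_eval f c P'"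
    and "\<And>b. D (c b) = 0" "D (f T0) = c 2 * f T2" "D (f T1) = f T0" "D (f T2) = 0"
  shows "D (tvar_eval f c P) = tvar_eval f c (bder P)"
proof (induction P rule: mpoly_induct)
  case (var v)
  then show ?case using assms(4-6) by (cases v) (simp_all add: eval_simps bder_simps)
qed (simp_all add: eval_simps bder_simps assms add.commute)

end

abbreviation "vx \<equiv> var cx :: coord mpoly"
abbreviation "vy \<equiv> var cy :: coord mpoly"
abbreviation "vX \<equiv> var cX :: coord mpoly"
abbreviation "vY \<equiv> var cY :: coord mpoly"

lemma const_of_nat: "const (of_nat n) = of_nat n"
  by (induction n) (simp_all add: const_add)

lemma const_numeral: "const (numeral n) = numeral n"
  using const_of_nat[of "numeral n"] by simp

lemma poisson0_simps:
  "poisson0 f f = 0" "poisson0 (f + f') g = poisson0 f g + poisson0 f' g"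
  "poisson0 g (f + f') = poisson0 g f + poisson0 g f'"
  "poisson0 g (f - f') = poisson0 g f - poisson0 g f'"
  "poisson0 (f * f') g = f * poisson0 f' g + poisson0 f g * f'"
  "poisson0 g (f * f') = f * poisson0 g f' + poisson0 g f * f'"
  "poisson0 (const c) g = 0" "poisson0 g (const c) = 0"
  by (simp_all add: poisson0_def pderiv_var_add pderiv_var_mult pderiv_var_diff algebra_simps)

lemma poisson0_Q: "poisson0 f (vX * vY) = vY * pderiv_var cx f + vX * pderiv_var cy f"
  by (simp add: poisson0_def pderiv_var_mult pderiv_var_var algebra_simps)

lemma poisson0_jacobi_Q:
  "poisson0 (poisson0 f g) (vX * vY) = poisson0 (poisson0 f (vX * vY)) g + poisson0 f (poisson0 g (vX * vY))"
  unfolding poisson0_Q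
  by (simp add: poisson0_def pderiv_var_mult pderiv_var_var pderiv_var_add pderiv_var_diff
      pderiv_var_commute[of cy cx] pderiv_var_commute[of cX cx] pderiv_var_commute[of cY cx]
      pderiv_var_commute[of cX cy] pderiv_var_commute[of cY cy] pderiv_var_commute[of cY cX] algebra_simps)

lemma var_regular:
  assumes "var v * f = var v * g"
  shows "f = (g :: 'v mpoly)"
proof (rule poly_mapping_eqI)
  fix e
  have "Poly_Mapping.lookup (var v * f) (Poly_Mapping.single v 1 + e) = Poly_Mapping.lookup f e" for f :: "'v mpoly"
    by (induction f rule: poly_mapping_induct_single)
      (auto simp: var_def mult_single lookup_single when_def lookup_add distrib_left)
  then show "Poly_Mapping.lookup f e = Poly_Mapping.lookup g e" using assms by metis
qed

definition tcoord :: "tvar \<Rightarrow> coord mpoly" where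
  "tcoord v = (case v of T0 \<Rightarrow> eu0 | T1 \<Rightarrow> vx * vy | T2 \<Rightarrow> vX * vY)"

abbreviation "cev \<equiv> tvar_eval tcoord const"

lemma cev_hom: "tvar_eval_hom tcoord const"
  by unfold_locales (simp_all add: const_add const_mult mult.commute)

lemmas cev_simps = tvar_eval_hom.eval_simps[OF cev_hom] tvar_eval_hom.eval_diff[OF cev_hom]

lemma eval0_eq_cev: "eval0 P eu0 (vx * vy) (vX * vY) = cev P"
  by (simp add: eval0_def tvar_eval_def pm_eval_def tcoord_def mult.assoc)

lemma a0_rec:
  assumes "1 \<le> i" "i < d"
  shows "eu0 * a0 d i = vx * vy * a0 d (Suc i) + vX * vY * a0 d (i - 1)"
proof -
  obtain k where k: "i = Suc k" using assms(1) by (cases i) auto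
  obtain m where m: "d = Suc (i + m)" using assms(2) less_iff_Suc_add by auto
  have "d - i = Suc m" "d - Suc i = m" "d - (i - 1) = Suc (Suc m)" "i - 1 = k" using k m by simp_all
  then show ?thesis by (simp add: a0_def eu0_def k algebra_simps)
qed

lemma a0_hessian:
  assumes "2 \<le> d"
  shows "a0 d 0 * a0 d 2 - a0 d 1 * a0 d 1 = (eu0 ^ 2 - const 4 * (vx * vy * (vX * vY))) * (vx * vy) ^ (d - 2)"
proof -
  obtain m where m: "d = Suc (Suc m)" using assms by (metis add_2_eq_Suc le_Suc_ex)
  show ?thesis
    by (simp add: m a0_def eu0_def const_numeral power2_eq_square power_mult_distrib algebra_simps)
qed

lemma pderiv_a0:
  "pderiv_var cx (a0 d i) = of_nat (d - i) * vx ^ (d - i - 1) * vY ^ i"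
  "pderiv_var cy (a0 d i) = of_nat (d - i) * vy ^ (d - i - 1) * vX ^ i"
  "pderiv_var cX (a0 d i) = of_nat i * vX ^ (i - 1) * vy ^ (d - i)"
  "pderiv_var cY (a0 d i) = of_nat i * vY ^ (i - 1) * vx ^ (d - i)"
  by (simp_all add: a0_def pderiv_var_add pderiv_var_mult pderiv_var_power pderiv_var_var)

lemma poisson0_a0_Q: "poisson0 (a0 d i) (vX * vY) = of_nat (d - i) * a0 d (Suc i)"
  unfolding poisson0_Q pderiv_a0 by (simp add: a0_def algebra_simps)

lemma poisson0_a00:
  assumes "d \<ge> 1"
  shows "poisson0 (a0 d 0) eu0 = of_nat d * a0 d 0" "poisson0 (a0 d 0) (vx * vy) = 0"
    "poisson0 (a0 d 0) (a0 d 1) = of_nat (2 * d) * (vx * vy) ^ (d - 1)"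
proof -
  obtain m where m: "d = Suc m" using assms by (cases d) auto
  show "poisson0 (a0 d 0) eu0 = of_nat d * a0 d 0" "poisson0 (a0 d 0) (vx * vy) = 0"
    "poisson0 (a0 d 0) (a0 d 1) = of_nat (2 * d) * (vx * vy) ^ (d - 1)"
    unfolding poisson0_def pderiv_a0
    by (simp_all add: m a0_def eu0_def pderiv_var_add pderiv_var_mult pderiv_var_var power_mult_distrib algebra_simps)
qed

lemma classical_model:
  assumes d: "d \<ge> 1"
  shows "bracket_model cev (a0 d) (\<lambda>i j. poisson0 (a0 d i) (a0 d j)) (\<lambda>f. poisson0 f (vX * vY)) d 0"
proof unfold_locales
  have CN: "const (of_nat n) = (of_nat n :: coord mpoly)" for n by (rule const_of_nat)
  show "cev t1 * e = cev t1 * f \<Longrightarrow> e = f" for e f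
    unfolding cev_simps tcoord_def by (auto dest!: var_regular simp: mult.assoc)
  show "cev t0 * a0 d i = cev t1 * a0 d (Suc i) + cev t2 * a0 d (i - 1)" if "1 \<le> i" "i < d" for i
    using a0_rec[OF that] by (simp add: cev_simps tcoord_def)
  show "a0 d 0 * a0 d 2 - a0 d 1 * a0 d 1 = cev ((casimir + const 0) * t1 ^ (d - 2))" if "2 \<le> d"
    unfolding a0_hessian[OF that] by (simp add: cev_simps tcoord_def casimir_def)
  show "poisson0 (a0 d 0) (a0 d 1) = cev (const (of_nat (2 * d)) * t1 ^ (d - 1))"
  proof -
    have "cev (const c * t1 ^ n) = const c * (vx * vy) ^ n" for c n
      by (simp add: cev_simps tcoord_def)
    from this[of "of_nat (2 * d)" "d - 1"] show ?thesis
      unfolding poisson0_a00(3)[OF d] by (simp only: CN[of "2 * d"])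
  qed
  show "cev t1 * poisson0 (a0 d 0) (a0 d (Suc j)) = cev t0 * poisson0 (a0 d 0) (a0 d j)
      + cev (const (of_nat d)) * (a0 d 0 * a0 d j) - cev t2 * poisson0 (a0 d 0) (a0 d (j - 1))
      - cev (const (of_nat d)) * (a0 d 1 * a0 d (j - 1))" if "1 \<le> j" "j < d" for j
  proof -
    \<comment> \<open>The recursion for the brackets with a_0 comes from bracketing
      \<open>a0_rec\<close> with a_0, whose brackets with q, eu, Q are 0, d a_0 and d a_1.\<close>
    have "poisson0 (a0 d 0) (eu0 * a0 d j) = poisson0 (a0 d 0) (vx * vy * a0 d (Suc j) + vX * vY * a0 d (j - 1))"
      unfolding a0_rec[OF that] ..
    then have "eu0 * poisson0 (a0 d 0) (a0 d j) + of_nat d * a0 d 0 * a0 d j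
        = vx * vy * poisson0 (a0 d 0) (a0 d (Suc j)) + vX * vY * poisson0 (a0 d 0) (a0 d (j - 1))
          + of_nat d * a0 d 1 * a0 d (j - 1)"
      unfolding poisson0_simps(3) poisson0_simps(6)[of _ eu0] poisson0_simps(6)[of _ "vx * vy"]
        poisson0_simps(6)[of _ "vX * vY"] poisson0_a00[OF d] poisson0_a0_Q by simp
    then show ?thesis unfolding cev_simps CN by (simp add: tcoord_def algebra_simps)
  qed
  show "poisson0 (poisson0 (a0 d i) (a0 d j)) (vX * vY) = cev (const (of_nat (d - i))) * poisson0 (a0 d (Suc i)) (a0 d j)
      + cev (const (of_nat (d - j))) * poisson0 (a0 d i) (a0 d (Suc j))" for i j
  proof -
    have z: "poisson0 (of_nat k) g = 0" "poisson0 g (of_nat k) = 0" for k g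
      using poisson0_simps(7)[of "of_nat k" g] poisson0_simps(8)[of g "of_nat k"] by (simp_all only: CN)
    have m: "poisson0 (of_nat k * f) g = of_nat k * poisson0 f g" "poisson0 g (of_nat k * f) = of_nat k * poisson0 g f"
      for k f g
      by (simp_all add: poisson0_simps(5,6) z)
    show ?thesis by (simp only: poisson0_jacobi_Q poisson0_a0_Q m cev_simps CN)
  qed
  show "poisson0 (cev P) (vX * vY) = cev (bder P)" for P
    by (rule tvar_eval_hom.eval_derivation[OF cev_hom])
      (simp_all add: poisson0_simps(2,5,7) tcoord_def,
       simp_all add: poisson0_Q eu0_def pderiv_var_add pderiv_var_mult pderiv_var_var const_numeral algebra_simps)
qed (simp_all add: cev_simps mult.commute poisson0_simps(1))

subsection \<open>Algebraic independence\<close>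

definition e4 :: "nat \<Rightarrow> nat \<Rightarrow> nat \<Rightarrow> nat \<Rightarrow> coord \<Rightarrow>\<^sub>0 nat" where
  "e4 i j k l = Poly_Mapping.single cx i + Poly_Mapping.single cy j + Poly_Mapping.single cX k + Poly_Mapping.single cY l"

lemma e4_inject: "e4 i j k l = e4 i' j' k' l' \<longleftrightarrow> i = i' \<and> j = j' \<and> k = k' \<and> l = l'"
proof
  assume eq: "e4 i j k l = e4 i' j' k' l'"
  have "Poly_Mapping.lookup (e4 i j k l) c = Poly_Mapping.lookup (e4 i' j' k' l') c" for c
    by (simp add: eq)
  from this[of cx] this[of cy] this[of cX] this[of cY]
  show "i = i' \<and> j = j' \<and> k = k' \<and> l = l'" by (simp add: e4_def lookup_add lookup_single)
qed simp

lemma monomial_e4: "vx ^ i * vy ^ j * vX ^ k * vY ^ l = Poly_Mapping.single (e4 i j k l) 1"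
  by (simp add: var_power mult_single e4_def)

text \<open>Among the monomials of \<open>eu^n q^b Q^c\<close> with \<open>n \<le> N\<close>, the monomial \<open>x^(N+B) y^B X^(N+C) Y^C\<close> occurs
  only for \<open>(n, b, c) = (N, B, C)\<close>.\<close>

lemma lookup_leading:
  assumes "n \<le> N"
  shows "Poly_Mapping.lookup (eu0 ^ n * (vx * vy) ^ b * (vX * vY) ^ c) (e4 (N + B) B (N + C) C)
    = (if n = N \<and> b = B \<and> c = C then 1 else 0)"
proof -
  have "eu0 ^ n * (vx * vy) ^ b * (vX * vY) ^ c
      = (\<Sum>k\<le>n. of_nat (n choose k) * (vx ^ (k + b) * vy ^ (n - k + b) * vX ^ (k + c) * vY ^ (n - k + c)))"
    unfolding eu0_def binomial_ring sum_distrib_right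
  proof (intro sum.cong refl)
    fix k assume "k \<in> {..n}"
    show "of_nat (n choose k) * (vx * vX) ^ k * (vy * vY) ^ (n - k) * (vx * vy) ^ b * (vX * vY) ^ c
        = of_nat (n choose k) * (vx ^ (k + b) * vy ^ (n - k + b) * vX ^ (k + c) * vY ^ (n - k + c))"
      by (simp only: power_mult_distrib power_add mult.assoc mult.commute mult.left_commute)
  qed
  then have "Poly_Mapping.lookup (eu0 ^ n * (vx * vy) ^ b * (vX * vY) ^ c) (e4 (N + B) B (N + C) C)
      = (\<Sum>k\<le>n. Poly_Mapping.lookup (of_nat (n choose k) * Poly_Mapping.single (e4 (k + b) (n - k + b) (k + c) (n - k + c)) 1)
          (e4 (N + B) B (N + C) C))"
    by (simp only: monomial_e4 lookup_sum)
  also have "\<dots> = (\<Sum>k\<le>n. if k = N \<and> n = N \<and> b = B \<and> c = C then 1 else 0)"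
  proof (intro sum.cong refl)
    fix k assume k: "k \<in> {..n}"
    have "k + b = N + B \<and> n - k + b = B \<and> k + c = N + C \<and> n - k + c = C \<longleftrightarrow> k = N \<and> n = N \<and> b = B \<and> c = C"
      using k assms by auto
    moreover have "Poly_Mapping.lookup (of_nat l * Poly_Mapping.single e 1) e' = (if e = e' then of_nat l else 0 :: complex)"
      for l and e e' :: "coord \<Rightarrow>\<^sub>0 nat"
      by (simp add: mult_single lookup_single when_def flip: single_of_nat)
    ultimately show "Poly_Mapping.lookup (of_nat (n choose k) * Poly_Mapping.single (e4 (k + b) (n - k + b) (k + c) (n - k + c)) 1)
        (e4 (N + B) B (N + C) C) = (if k = N \<and> n = N \<and> b = B \<and> c = C then 1 else (0 :: complex))"
      by (simp only: e4_inject) auto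
  qed
  finally have "Poly_Mapping.lookup (eu0 ^ n * (vx * vy) ^ b * (vX * vY) ^ c) (e4 (N + B) B (N + C) C)
      = (\<Sum>k\<le>n. if k = N \<and> n = N \<and> b = B \<and> c = C then 1 else 0)" .
  then show ?thesis
    by (cases "n = N \<and> b = B \<and> c = C") auto
qed

text \<open>Algebraic independence, hence uniqueness in the definition of \<open>Pi_poly\<close>. In
  a nonzero difference a monomial with the greatest exponent of T has, by
  \<open>lookup_leading\<close>, a contribution that no other term can cancel.\<close>

lemma cev_injective:
  assumes "cev P = cev P'"
  shows "P = P'"
proof (rule ccontr)
  define D where "D = P - P'"
  assume "P \<noteq> P'"
  then have ne: "Poly_Mapping.keys D \<noteq> {}" by (simp add: D_def)
  have zero: "cev D = 0" using assms by (simp add: D_def cev_simps)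
  define N where "N = Max ((\<lambda>m. Poly_Mapping.lookup m T0) ` Poly_Mapping.keys D)"
  have "N \<in> (\<lambda>m. Poly_Mapping.lookup m T0) ` Poly_Mapping.keys D"
    unfolding N_def by (rule Max_in) (use ne in auto)
  then obtain m where m: "m \<in> Poly_Mapping.keys D" "Poly_Mapping.lookup m T0 = N" by auto
  have le: "Poly_Mapping.lookup m' T0 \<le> N" if "m' \<in> Poly_Mapping.keys D" for m'
    using that by (simp add: N_def)
  let ?b = "Poly_Mapping.lookup m T1" and ?c = "Poly_Mapping.lookup m T2"
  let ?e = "e4 (N + ?b) ?b (N + ?c) ?c"
  have lc: "Poly_Mapping.lookup (const c * f) e = c * Poly_Mapping.lookup f e" for c f and e :: "coord \<Rightarrow>\<^sub>0 nat"
    by (simp add: const_def flip: mult_map_scale_conv_mult smult_pm_def)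
  have "Poly_Mapping.lookup (cev D) ?e = (\<Sum>m'\<in>Poly_Mapping.keys D. if m' = m then Poly_Mapping.lookup D m else 0)"
    unfolding tvar_eval_def pm_eval_def lookup_sum lc tcoord_def tvar.case
  proof (rule sum.cong[OF refl])
    fix m' assume m': "m' \<in> Poly_Mapping.keys D"
    have "m' = m \<longleftrightarrow> Poly_Mapping.lookup m' T0 = N \<and> Poly_Mapping.lookup m' T1 = ?b \<and> Poly_Mapping.lookup m' T2 = ?c"
    proof
      assume eq: "Poly_Mapping.lookup m' T0 = N \<and> Poly_Mapping.lookup m' T1 = ?b \<and> Poly_Mapping.lookup m' T2 = ?c"
      have "Poly_Mapping.lookup m' v = Poly_Mapping.lookup m v" for v using eq m(2) by (cases v) auto
      then show "m' = m" by (rule poly_mapping_eqI)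
    qed (use m in auto)
    then show "Poly_Mapping.lookup D m' * Poly_Mapping.lookup (eu0 ^ Poly_Mapping.lookup m' T0 * (vx * vy) ^ Poly_Mapping.lookup m' T1
        * (vX * vY) ^ Poly_Mapping.lookup m' T2) ?e = (if m' = m then Poly_Mapping.lookup D m else 0)"
      by (subst lookup_leading[OF le[OF m']]) auto
  qed
  also have "\<dots> = Poly_Mapping.lookup D m" using m by simp
  finally show False using zero m by (simp add: in_keys_iff)
qed

text \<open>The brackets of the undeformed elements obey the same recursion with \<kappa> = 0, which
  turns the definite description into a recursively computed polynomial.\<close>

lemma Pi_poly_eq:
  assumes "d \<ge> 1" "i \<le> j" "j \<le> d"
  shows "Pi_poly d i j = Bpoly d casimir (of_nat (2 * d)) i j"
proof -
  interpret bracket_model cev "a0 d" "\<lambda>i j. poisson0 (a0 d i) (a0 d j)" "\<lambda>f. poisson0 f (vX * vY)" d 0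
    by (rule classical_model[OF assms(1)])
  have "poisson0 (a0 d i) (a0 d j) = cev (Bpoly d casimir (of_nat (2 * d)) i j)"
    using br_eq[OF assms(2,3)] by simp
  then show ?thesis
    unfolding Pi_poly_def eval0_eq_cev using cev_injective by (intro the_equality) auto
qed

section \<open>The center of \<open>H\<^sub>c\<close>\<close>

context cherednik
begin

abbreviation "zq \<equiv> red el_q"
abbreviation "zQ \<equiv> red el_Q"
abbreviation "zeu \<equiv> red el_eu"
abbreviation "za j \<equiv> red (el_a j)"

lemma red_commute:
  assumes "comm e f = hb * g"
  shows "red e * red f = red f * red e"
  using arg_cong[OF assms, of red] by simp

lemma red_commute_0: "comm e f = 0 \<Longrightarrow> red e * red f = red f * red e"
  using red_commute[of e f 0] by simp

lemma el_SS: "zq \<in> SS" "zQ \<in> SS" "zeu \<in> SS" "za j \<in> SS"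
  using el_Sh by (auto simp: SS_eq)

lemma zq_Z0: "zq \<in> Z0"
proof (rule Z0_I[OF el_SS(1)])
  show "zq * red (s \<beta>) = red (s \<beta>) * zq" if "\<beta> \<in> B" for \<beta>
  proof -
    have "s \<beta> * el_q = el_q * s \<beta>"
      using B_nonzero[OF that]
      by (simp add: el_q_def op_g_xy_assoc op_g_y sc_simps mult.assoc) (simp add: op_xy_commute flip: mult.assoc)
    then show ?thesis by (simp flip: red_simps)
  qed
qed (use red_commute[OF comm_q(1)] red_commute[OF comm_q(2)] red_commute_0[OF comm_q(3)] red_commute_0[OF comm_q(4)] in simp_all)

lemma zQ_Z0: "zQ \<in> Z0"
proof (rule Z0_I[OF el_SS(2)])
  show "zQ * red (s \<beta>) = red (s \<beta>) * zQ" if "\<beta> \<in> B" for \<beta>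
  proof -
    have "s \<beta> * el_Q = cc \<beta> * op_Y * (s \<beta> * op_Y)"
      by (simp add: el_Q_def refl_X[OF that] mult.assoc flip: mult.assoc[of "s \<beta>"])
    also have "\<dots> = el_Q * s \<beta>"
      using B_nonzero[OF that] by (simp add: refl_Y[OF that] sc_simps mult.assoc el_Q_def) (simp add: op_XY_commute flip: mult.assoc)
    finally show ?thesis by (simp flip: red_simps)
  qed
qed (use red_commute[OF comm_Q(1)] red_commute[OF comm_Q(2)] red_commute_0[OF comm_Q(3)] red_commute_0[OF comm_Q(4)] in simp_all)

lemma pb_q_Q: "pb zq zQ = zeu"
  by (rule pb_eqI) (use el_Sh zq_Z0 zQ_Z0 comm_elements in auto)

text \<open>Central as the bracket {q, Q}; no check on generators is made.\<close>

lemma zeu_Z0: "zeu \<in> Z0"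
  using pb_closed[OF zq_Z0 zQ_Z0] by (simp add: pb_q_Q)

lemma za_0_Z0: "za 0 \<in> Z0"
proof (rule Z0_I[OF el_SS(4)])
  show "za 0 * red (s \<beta>) = red (s \<beta>) * za 0" if "\<beta> \<in> B" for \<beta>
  proof -
    have "\<beta> ^ d = 1" "inverse \<beta> ^ d = 1" using that by (simp_all add: unity_roots_def power_inverse)
    then have "s \<beta> * el_a 0 = el_a 0 * s \<beta>"
      by (simp add: el_a_0 distrib_left distrib_right refl_power add.commute)
    then show ?thesis by (simp flip: red_simps)
  qed
qed (use red_commute[OF comm_f0(1)] red_commute[OF comm_f0(2)] red_commute_0[OF comm_f0_xy(1)] red_commute_0[OF comm_f0_xy(2)] in
    \<open>simp_all add: el_a_0\<close>)

lemma el_a_large: "d < j \<Longrightarrow> el_a j = 0"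
  by (simp add: el_a_def binom_op_large)

lemma pb_a_Q_aux: "za j \<in> Z0 \<Longrightarrow> j \<le> d \<Longrightarrow> pb (za j) zQ = sc (of_nat (d - j)) * za (Suc j)"
  using pb_eqI[of "el_a j" el_Q "cc (of_nat (d - j)) * el_a (Suc j)"] el_Sh zQ_Z0 comm_a_Q
  by (simp add: Sh_closed Sh_gens)

text \<open>Only a_0 is checked on generators. Below \<open>d\<close> each next element is a nonzero
  multiple of {a_j, Q}, and brackets of central elements are central; beyond \<open>d\<close> the
  elements are 0.\<close>

lemma za_Z0: "za j \<in> Z0"
proof (induction j)
  case (Suc j)
  show ?case
  proof (cases "j < d")
    case True
    have "sc (1 / of_nat (d - j)) * pb (za j) zQ \<in> Z0"
      using Suc zQ_Z0 by (intro Z0_closed Z0_sc pb_closed)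
    moreover have "sc (1 / of_nat (d - j)) * pb (za j) zQ = za (Suc j)"
      using True by (simp add: pb_a_Q_aux[OF Suc] flip: mult.assoc sc_mult)
    ultimately show ?thesis by simp
  next
    case False
    then show ?thesis using Z0_sc[of 0] by (simp add: el_a_large)
  qed
qed (rule za_0_Z0)

lemmas el_Z0 = zq_Z0 zQ_Z0 zeu_Z0 za_Z0

lemma Z0_mult_commute: "z \<in> Z0 \<Longrightarrow> z' \<in> Z0 \<Longrightarrow> z * z' = z' * z"
  by (rule Z0_commute[OF _ Z0_SS])

lemma pb_a_Q: "j \<le> d \<Longrightarrow> pb (za j) zQ = sc (of_nat (d - j)) * za (Suc j)"
  by (rule pb_a_Q_aux[OF za_Z0])

lemma red_numeral [simp]: "red (numeral n) = sc (numeral n)"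
proof -
  have "red (of_nat k) = of_nat k" for k by (induction k) simp_all
  from this[of "numeral n"] show ?thesis
    using sc_of_nat[of "numeral n", where 'a = complex] by simp
qed

lemma pb_table:
  "pb zeu zQ = sc 2 * zQ" "pb zq zeu = sc 2 * zq" "pb zq (za 0) = 0"
  "0 < j \<Longrightarrow> j \<le> d \<Longrightarrow> pb zq (za j) = sc (of_nat j) * za (j - 1)"
  "pb (za 0) zeu = sc (of_nat d) * za 0" "pb (za 0) zq = 0"
  "pb (za 0) (za 1) = sc (of_nat (2 * d)) * zq ^ (d - 1)"
proof -
  have two: "(2 :: complex poly operator) \<in> Sh" using Sh_closed(1)[OF Sh_one Sh_one] by simp
  show "pb zeu zQ = sc 2 * zQ" "pb zq zeu = sc 2 * zq"
    using pb_eqI[of el_eu el_Q "2 * el_Q"] pb_eqI[of el_q el_eu "2 * el_q"] el_Sh el_Z0 comm_elements two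
    by (simp_all add: Sh_closed)
  have zero: "(0 :: complex poly operator) \<in> Sh" using Sh_gens(1)[of 0] by simp
  show "pb zq (za 0) = 0"
    using pb_eqI[of el_q "el_a 0" 0] el_Sh el_Z0 zero comm_q_a(1)[of 0] by simp
  show "pb (za 0) zq = 0"
    using pb_eqI[of "el_a 0" el_q 0] el_Sh el_Z0 zero comm_f0_q by simp
  show "0 < j \<Longrightarrow> j \<le> d \<Longrightarrow> pb zq (za j) = sc (of_nat j) * za (j - 1)"
    using pb_eqI[of el_q "el_a j" "cc (of_nat j) * el_a (j - 1)"] el_Sh el_Z0 comm_q_a(2)[of j]
    by (simp add: Sh_closed Sh_gens)
  show "pb (za 0) zeu = sc (of_nat d) * za 0"
    using pb_eqI[of "el_a 0" el_eu "cc (of_nat d) * el_a 0"] el_Sh el_Z0 comm_f0_eu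
    by (simp add: Sh_closed Sh_gens)
  show "pb (za 0) (za 1) = sc (of_nat (2 * d)) * zq ^ (d - 1)"
    using pb_eqI[of "el_a 0" "el_a 1" "cc (of_nat (2 * d)) * el_q ^ (d - 1)"] el_Sh el_Z0 comm_a0_a1
    by (simp add: Sh_closed Sh_gens Sh_power)
qed

lemma pb_sc_right: "z \<in> Z0 \<Longrightarrow> pb z (sc c) = 0"
  using pb_anti[OF Z0_sc, of z c] pb_sc[of z c] by simp

lemma pb_sc_mult:
  assumes "z \<in> Z0" "w \<in> Z0"
  shows "pb (sc c * z) w = sc c * pb z w" "pb w (sc c * z) = sc c * pb w z"
proof -
  have "pb w (sc c) = 0" using pb_anti[OF Z0_sc assms(2), of c] pb_sc[OF assms(2), of c] by simp
  then show "pb (sc c * z) w = sc c * pb z w" "pb w (sc c * z) = sc c * pb w z"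
    using pb_mult[OF Z0_sc assms] pb_right(3)[OF Z0_sc assms(1,2)] pb_sc[OF assms(2)] by simp_all
qed

subsection \<open>Symbols and weights of the distinguished elements\<close>

lemma sym_0: "filt D k (0 :: complex operator) \<Longrightarrow> sym D k 0 0"
  by (simp add: sym_def)

lemma sym_binom:
  assumes "sym 1 0 f (red u)" "sym (-1) 1 g (red v)"
  shows "sym (int n - 2 * int j) (int j) (binom_op f g j n) (red (binom_op u v j n))"
proof (induction n arbitrary: j)
  case 0
  show ?case by (cases j) (simp_all add: sym_one sym_0)
next
  case (Suc n)
  have u: "sym (1 + (int n - 2 * int j)) (0 + int j) (f * binom_op f g j n) (red u * red (binom_op u v j n))" for j
    by (rule sym_mult[OF assms(1) Suc])
  have v: "sym (-1 + (int n - 2 * int j)) (1 + int j) (g * binom_op f g j n) (red v * red (binom_op u v j n))" for j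
    by (rule sym_mult[OF assms(2) Suc])
  show ?case
  proof (cases j)
    case 0
    then show ?thesis using u[of 0] by (simp add: add.commute)
  next
    case (Suc i)
    have "sym (int (Suc n) - 2 * int (Suc i)) (int (Suc i)) (f * binom_op f g (Suc i) n) (red u * red (binom_op u v (Suc i) n))"
      "sym (int (Suc n) - 2 * int (Suc i)) (int (Suc i)) (g * binom_op f g i n) (red v * red (binom_op u v i n))"
      using u[of "Suc i"] v[of i] by (simp_all add: algebra_simps)
    then show ?thesis unfolding Suc by (simp add: sym_add)
  qed
qed

lemma sym_q: "sym 2 0 (vx * vy) zq" and sym_Q: "sym (-2) 2 (vX * vY) zQ" and sym_eu: "sym 0 1 eu0 zeu"
  using sym_mult[OF sym_x sym_y] sym_mult[OF sym_X sym_Y]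
    sym_add[of 0 1 "vx * vX" "op_x * red op_X" "vY * vy" "red op_Y * op_y"]
    sym_mult[OF sym_x sym_X] sym_mult[OF sym_Y sym_y]
  by (simp_all add: el_q_def el_Q_def el_eu_def eu0_def mult.commute)

lemma sym_a:
  assumes "j \<le> d"
  shows "sym (int d - 2 * int j) (int j) (a0 d j) (za j)"
proof -
  have "sym (0 + (int d - 2 * int j)) (0 + int j) (const (1 / of_nat (d choose j)) * (binom_op vx vY j d + binom_op vy vX j d))
      (sc (1 / of_nat (d choose j)) * (red (binom_op op_x op_Y j d) + red (binom_op op_y op_X j d)))"
    by (intro sym_mult sym_sc sym_add sym_binom) (simp_all add: sym_x sym_y sym_X sym_Y)
  moreover have "const (1 / of_nat (d choose j)) * (binom_op vx vY j d + binom_op vy vX j d) = a0 d j"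
  proof -
    have "of_nat (d choose j) \<noteq> (0 :: complex)" using assms by (simp add: zero_less_binomial)
    then have "const (1 / of_nat (d choose j)) * of_nat (d choose j) = (1 :: coord mpoly)"
      by (simp flip: const_of_nat const_mult)
    moreover have "const (1 / of_nat (d choose j)) * (binom_op vx vY j d + binom_op vy vX j d)
        = (const (1 / of_nat (d choose j)) * of_nat (d choose j)) * a0 d j"
      by (simp add: binom_op_comm a0_def algebra_simps)
    ultimately show ?thesis by simp
  qed
  ultimately show ?thesis by (simp add: el_a_def)
qed

text \<open>Conjugation by \<open>diag_mat \<eta>\<close> with \<open>\<eta>\<^sup>2 = \<zeta>\<close> and \<open>\<eta>^d = -1\<close> permutes the reflections; it fixes \<open>q\<close>, \<open>Q\<close>
  and \<open>eu\<close> and changes the sign of every \<open>a_j\<close>.\<close>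

definition eta :: complex where
  "eta = (SOME \<eta>. \<eta>\<^sup>2 = \<zeta> \<and> \<eta> ^ d = -1 \<and> (\<forall>k. \<eta> ^ k = 1 \<longrightarrow> 2 * d dvd k))"

lemma eta: "eta\<^sup>2 = \<zeta>" "eta ^ d = -1" "eta ^ k = 1 \<Longrightarrow> 2 * d dvd k" "eta \<noteq> 0" "eta\<^sup>2 \<in> B"
proof -
  have "\<exists>\<eta>. \<eta>\<^sup>2 = \<zeta> \<and> \<eta> ^ d = -1 \<and> (\<forall>k. \<eta> ^ k = 1 \<longrightarrow> 2 * d dvd k)"
    using obtain_sqrt by metis
  from someI_ex[OF this] show e: "eta\<^sup>2 = \<zeta>" "eta ^ d = -1" "eta ^ k = 1 \<Longrightarrow> 2 * d dvd k"
    unfolding eta_def[symmetric] by auto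
  show "eta \<noteq> 0" using e(1) \<zeta>_nonzero by auto
  show "eta\<^sup>2 \<in> B" using \<zeta>_power_in_B[of 1] e(1) by simp
qed

definition parity :: "complex \<Rightarrow> complex poly operator \<Rightarrow> bool" where
  "parity \<epsilon> e \<longleftrightarrow> op_g (diag_mat eta) * e = cc \<epsilon> * (e * op_g (diag_mat eta))"

lemma parity_mult: "parity \<epsilon> e \<Longrightarrow> parity \<epsilon>' f \<Longrightarrow> parity (\<epsilon> * \<epsilon>') (e * f)"
proof -
  assume e: "parity \<epsilon> e" and f: "parity \<epsilon>' f"
  let ?g = "op_g (diag_mat eta)"
  have "?g * (e * f) = cc \<epsilon> * (e * (?g * f))" using e by (simp add: parity_def mult.assoc flip: mult.assoc[of ?g])
  also have "\<dots> = cc \<epsilon> * (e * (cc \<epsilon>' * (f * ?g)))" using f by (simp add: parity_def)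
  also have "e * (cc \<epsilon>' * (f * ?g)) = cc \<epsilon>' * (e * (f * ?g))" by (metis mult.assoc sc_central)
  finally show ?thesis by (simp add: parity_def cc_mult mult.assoc)
qed

lemma parity_add: "parity \<epsilon> e \<Longrightarrow> parity \<epsilon> f \<Longrightarrow> parity \<epsilon> (e + f)"
  and parity_diff: "parity \<epsilon> e \<Longrightarrow> parity \<epsilon> f \<Longrightarrow> parity \<epsilon> (e - f)"
  by (simp_all add: parity_def algebra_simps)

lemma parity_cc: "parity 1 (cc c)"
  by (simp add: parity_def sc_central)

lemma parity_one: "parity 1 1"
  by (simp add: parity_def)

lemma parity_power: "parity \<epsilon> e \<Longrightarrow> parity (\<epsilon> ^ n) (e ^ n)"
  by (induction n) (simp_all add: parity_one parity_mult)

lemma parity_letters: "parity eta op_x" "parity (inverse eta) op_y" "parity (inverse eta) op_X" "parity eta op_Y"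
  using eta diag_XY[OF eta(5)] by (simp_all add: parity_def op_g_x op_g_y mult.assoc)

lemma parity_binom: "parity \<epsilon> u \<Longrightarrow> parity \<epsilon> v \<Longrightarrow> parity (\<epsilon> ^ n) (binom_op u v j n)"
proof (induction u v j n rule: binom_op.induct)
  case (4 u v j n)
  then have "parity (\<epsilon> * \<epsilon> ^ n) (u * binom_op u v (Suc j) n)" "parity (\<epsilon> * \<epsilon> ^ n) (v * binom_op u v j n)"
    by (simp_all only: parity_mult)
  then show ?case by (simp add: parity_add)
qed (simp_all add: parity_one parity_mult, simp add: parity_def)

lemma parity_elements: "parity 1 el_q" "parity 1 el_Q" "parity 1 el_eu" "parity (-1) (el_a j)"
proof -
  have "eta * inverse eta = 1" "inverse eta * eta = 1" using eta(4) by simp_all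
  then show "parity 1 el_q" "parity 1 el_Q" "parity 1 el_eu"
    using parity_mult[OF parity_letters(1,2)] parity_mult[OF parity_letters(3,4)]
      parity_mult[OF parity_letters(1,3)] parity_mult[OF parity_letters(4,2)]
    by (simp_all add: el_q_def el_Q_def el_eu_def parity_add)
  have "inverse eta ^ d = -1" by (simp add: power_inverse eta(2))
  then have "parity (-1) (binom_op op_x op_Y j d + binom_op op_y op_X j d)"
    using parity_binom[OF parity_letters(1,4), of d j] parity_binom[OF parity_letters(2,3), of d j] eta(2)
    by (simp add: parity_add)
  then show "parity (-1) (el_a j)"
    unfolding el_a_def using parity_mult[OF parity_cc] by fastforce
qed

lemma weight:
  assumes "parity \<epsilon> e" "e \<in> Sh" "Poly_Mapping.lookup (col (red e) b0) (m, n, p, r, mat 1) \<noteq> 0"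
  shows "eta ^ (m + r) * inverse eta ^ (n + p) = \<epsilon>"
proof (rule weight_of_eigen[OF _ eta(4) _ assms(3)])
  show "red e \<in> SS" using assms(2) by (simp add: SS_eq)
  have "red (op_g (diag_mat eta) * e) = red (cc \<epsilon> * (e * op_g (diag_mat eta)))"
    using assms(1) by (simp add: parity_def)
  then show "red (op_g (diag_mat eta)) * red e = sc \<epsilon> * red e * red (op_g (diag_mat eta))"
    by (simp add: mult.assoc)
qed

lemma eta_power_eq:
  assumes "eta ^ i = eta ^ j" "i \<le> j"
  shows "2 * d dvd j - i"
proof (rule eta(3))
  have "eta ^ j = eta ^ i * eta ^ (j - i)" using assms(2) by (simp flip: power_add)
  then show "eta ^ (j - i) = 1" using assms(1) eta(4) by simp
qed

text \<open>Here \<open>i\<close> counts the letters x, Y and \<open>j\<close> the letters y, X. As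
  \<open>eta\<close> has order 2d and -1 is its d-th power, i - j is congruent to d modulo 2d. So a
  monomial on which the automorphism acts by -1 has total degree at least d, with equality only if
  \<open>i\<close> or \<open>j\<close> is 0.\<close>

lemma odd_weight:
  assumes "eta ^ i * inverse eta ^ j = -1"
  shows "d \<le> i + j" "i + j = d \<Longrightarrow> i = 0 \<or> j = 0"
proof -
  have eq: "eta ^ i = eta ^ (j + d)"
    using assms eta(2,4) by (simp add: power_add power_inverse field_simps)
  have "i = 0 \<or> j = 0" "i + j = d" if le: "i + j \<le> d"
  proof -
    obtain k where k: "j + d - i = 2 * d * k" using eta_power_eq[OF eq] le by auto
    have "j + d - i \<le> 2 * d" using le by simp
    then have "d * k \<le> d" using k by simp
    then have "k = 0 \<or> k = 1" using d_pos by (cases k) auto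
    then show "i = 0 \<or> j = 0" "i + j = d" using k le d_pos by auto
  qed
  then show "d \<le> i + j" "i + j = d \<Longrightarrow> i = 0 \<or> j = 0" by (cases "i + j \<le> d"; simp)+
qed

text \<open>The difference of \<open>i\<close> and \<open>j\<close> is divisible by 2d and smaller
  than 2d in absolute value.\<close>

lemma even_weight:
  assumes "eta ^ i * inverse eta ^ j = 1" "i + j < 2 * d"
  shows "i = j"
proof -
  have eq: "eta ^ i = eta ^ j"
    using assms eta(4) by (simp add: power_inverse field_simps)
  have "2 * d dvd j - i" "2 * d dvd i - j"
    using eta_power_eq[OF eq] eta_power_eq[OF eq[symmetric]] by (cases "i \<le> j"; simp)+
  then show ?thesis using assms(2) by (auto dest!: dvd_imp_le)
qed

lemma swap_Z0:
  assumes "z \<in> Z0"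
  shows "Poly_Mapping.lookup (col z b0) (m, n, p, r, mat 1) = Poly_Mapping.lookup (col z b0) (n, m, r, p, mat 1)"
proof (rule swap_symmetric[OF Z0_SS[OF assms]])
  have "red (op_g (refl_mat 1)) \<in> SS" using Sh_gens(6)[OF B_1] by (simp add: SS_eq)
  then show "red (op_g (refl_mat 1)) * z = z * red (op_g (refl_mat 1))" using Z0_commute[OF assms] by simp
qed

subsection \<open>Truncations\<close>

abbreviation "tr e \<equiv> trunc (col e b0)"

lemma exps_e4: "exps (e4 m n p r) w = (m, n, p, r, w)"
  by (simp add: exps_def e4_def lookup_add lookup_single)

lemma e4_exhaust: obtains m n p r where "e = e4 m n p r"
proof -
  have "exps e (mat 1) = exps (e4 (Poly_Mapping.lookup e cx) (Poly_Mapping.lookup e cy)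
      (Poly_Mapping.lookup e cX) (Poly_Mapping.lookup e cY)) (mat 1)"
    unfolding exps_e4 by (simp add: exps_def)
  then show ?thesis unfolding exps_inj using that by blast
qed

lemma lookup_tr: "Poly_Mapping.lookup (tr e) (e4 m n p r) = Poly_Mapping.lookup (col e b0) (m, n, p, r, mat 1)"
  by (simp add: exps_e4)

lemma trunc_single4: "trunc (Poly_Mapping.single (m, n, p, r, w) c) = (if w = mat 1 then Poly_Mapping.single (e4 m n p r) c else 0)"
  using trunc_single[of "e4 m n p r" w c] by (simp add: exps_e4)

lemma tr_add: "tr (e + f) = tr e + tr f" and tr_sc: "tr (sc c * e) = const c * tr e"
  by (simp_all add: trunc_add trunc_smult)

lemma tr_diff: "tr (e - f) = tr e - tr f"
  using tr_add[of "e - f" f] by simp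

lemma e4_Suc: "e4 (Suc m) n p r = Poly_Mapping.single cx 1 + e4 m n p r"
    "e4 m (Suc n) p r = Poly_Mapping.single cy 1 + e4 m n p r"
  by (auto intro!: poly_mapping_eqI simp: e4_def lookup_add lookup_single when_def)

lemma tr_xy: "tr (op_x * e) = vx * tr e" "tr (op_y * e) = vy * tr e"
proof -
  have "trunc (app op_x \<mu>) = vx * trunc \<mu> \<and> trunc (app op_y \<mu>) = vy * trunc \<mu>" for \<mu>
  proof (induction \<mu> rule: poly_mapping_induct_single)
    case (single b c)
    obtain m n p r w where [simp]: "b = (m, n, p, r, w)" by (cases b)
    show ?case
      by (simp add: trunc_single4 var_def mult_single e4_Suc)
  qed (simp_all add: app_add trunc_add distrib_left)
  then show "tr (op_x * e) = vx * tr e" "tr (op_y * e) = vy * tr e" by simp_all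
qed

lemma tr_one: "tr 1 = 1"
  using trunc_single4[of 0 0 0 0 "mat 1" 1] by (simp add: e4_def)

lemma tr_q_power: "tr (zq ^ n * e) = (vx * vy) ^ n * tr e"
proof (induction n)
  case (Suc n)
  have "tr (zq ^ Suc n * e) = tr (op_x * (op_y * (zq ^ n * e)))" by (simp add: el_q_def mult.assoc)
  then show ?case unfolding tr_xy Suc by (simp add: mult.assoc)
qed simp

lemma tr_eu: "tr zeu = eu0"
proof -
  \<comment> \<open>In PBW order the element differs from xX + yY by \<hbar> and reflection terms;
    the former vanishes on reduction, the latter under truncation.\<close>
  have eu: "el_eu = op_x * op_X + (op_y * op_Y - (hb - cc a * S0))"
    by (simp add: el_eu_def op_y_Y)
  have S0: "col S0 b0 = (\<Sum>\<beta>\<in>B. bas (0, 0, 0, 0, refl_mat \<beta>))"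
    unfolding refl_op_def col_sum by (intro sum.cong refl) (simp flip: one_pCons)
  have "tr (red S0) = 0"
    by (simp add: S0 red_pm_sum trunc_sum trunc_single4)
  moreover have "tr (red op_X) = vX" "tr (red op_Y) = vY"
    by (simp_all add: trunc_single4 e4_def var_def)
  ultimately show ?thesis
    unfolding eu by (simp add: tr_add tr_diff tr_xy tr_sc eu0_def del: col_simps col_red)
qed

lemma a0_single: "a0 d j = Poly_Mapping.single (e4 (d - j) 0 0 j) 1 + Poly_Mapping.single (e4 0 (d - j) j 0) 1"
  using monomial_e4[of "d - j" 0 0 j] monomial_e4[of 0 "d - j" j 0] by (simp add: a0_def)

lemma filt_keys:
  assumes "filt D k e" "Poly_Mapping.lookup (col e b0) (m, n, p, r, w) \<noteq> 0"
  shows "int m + int n - int p - int r = D" "int p + int r \<le> k"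
  using filt_D[OF assms(1), of "(m, n, p, r, w)" b0] assms(2) by (simp_all add: in_keys_iff)

text \<open>A correction to the leading term has fewer than j letters X, Y and degree d - 2j, so its
  total degree is below d. Weight -1 excludes this.\<close>

lemma tr_a:
  assumes "j \<le> d"
  shows "tr (za j) = a0 d j"
proof (rule poly_mapping_eqI, rule ccontr)
  fix e assume ne: "Poly_Mapping.lookup (tr (za j)) e \<noteq> Poly_Mapping.lookup (a0 d j) e"
  obtain m n p r where e: "e = e4 m n p r" by (rule e4_exhaust)
  have "Poly_Mapping.lookup (tr (za j)) e \<noteq> Poly_Mapping.lookup (tr (mult_op (a0 d j))) e"
    unfolding trunc_mult_op by (rule ne)
  then have "Poly_Mapping.lookup (col (za j - mult_op (a0 d j)) b0) (m, n, p, r, mat 1) \<noteq> 0"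
    unfolding e lookup_tr col_simps lookup_minus by simp
  then have deg: "int m + int n - int p - int r = int d - 2 * int j" "int p + int r \<le> int j - 1"
    using filt_keys[of "int d - 2 * int j" "int j - 1"] sym_a[OF assms] unfolding sym_def by blast+
  have "Poly_Mapping.lookup (a0 d j) e = 0"
    using deg(2) by (auto simp: a0_single e lookup_add lookup_single when_def e4_inject)
  then have "Poly_Mapping.lookup (col (za j) b0) (m, n, p, r, mat 1) \<noteq> 0"
    using ne by (simp add: e exps_e4)
  from odd_weight(1)[OF weight[OF parity_elements(4) el_Sh(4) this]] deg show False by simp
qed

text \<open>The difference commutes with x, so \<open>central_trunc_zero\<close> applies. Relations
  between central elements thus reduce to comparing coefficients of truncations.\<close>

lemma Z0_eqI:
  assumes "z \<in> Z0" "z' \<in> Z0" "tr z = tr z'"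
  shows "z = z'"
proof -
  have "z - z' \<in> Z0" using assms by auto
  moreover have "op_x \<in> SS" using image_eqI[of op_x red op_x Sh] Sh_gens(2) by (simp add: SS_eq)
  ultimately have "z - z' = 0"
    using central_trunc_zero[of "z - z'"] Z0_SS Z0_commute assms(3) by (simp add: trunc_add tr_diff del: col_simps)
  then show ?thesis by simp
qed

subsection \<open>The relations of the center\<close>

lemma const_mult_eq_0: "const c * f = 0 \<Longrightarrow> f \<noteq> 0 \<Longrightarrow> c = 0"
proof (rule ccontr)
  assume 0: "const c * f = 0" and f: "f \<noteq> 0" and "c \<noteq> 0"
  have "f = const (1 / c) * (const c * f)" using \<open>c \<noteq> 0\<close> by (simp flip: mult.assoc const_mult)
  then show False using 0 f by simp
qed

lemma a0_nonzero: "a0 d 0 \<noteq> 0"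
proof
  assume "a0 d 0 = 0"
  then have "Poly_Mapping.lookup (a0 d 0) (e4 d 0 0 0) = 0" by simp
  then show False using d_pos by (simp add: a0_single lookup_add lookup_single when_def e4_inject)
qed

lemma q_power_nonzero: "(vx * vy) ^ n \<noteq> 0"
  using monomial_e4[of n n 0 0] by (simp add: power_mult_distrib flip: keys_eq_empty)

lemma sc_mult_za_0:
  assumes "sc c * za 0 = 0"
  shows "c = 0"
proof -
  have "tr (sc c * za 0) = 0" unfolding assms by simp
  then have "const c * a0 d 0 = 0" unfolding tr_sc tr_a[OF le0] .
  then show ?thesis by (rule const_mult_eq_0[OF _ a0_nonzero])
qed

lemma sc_mult_zq:
  assumes "sc c * zq ^ n = 0"
  shows "c = 0"
proof -
  have "tr (sc c * (zq ^ n * 1)) = 0" using assms by simp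
  then have "const c * (vx * vy) ^ n = 0" unfolding tr_sc tr_q_power tr_one by simp
  then show ?thesis by (rule const_mult_eq_0[OF _ q_power_nonzero])
qed

lemma keys_two:
  fixes f :: "'i \<Rightarrow>\<^sub>0 'c::comm_monoid_add"
  assumes "Poly_Mapping.keys f \<subseteq> {i, j}" "i \<noteq> j"
  shows "f = Poly_Mapping.single i (Poly_Mapping.lookup f i) + Poly_Mapping.single j (Poly_Mapping.lookup f j)"
  using poly_mapping_sum_single[OF _ assms(1)] assms(2) by simp

lemma keys_three:
  fixes f :: "'i \<Rightarrow>\<^sub>0 'c::comm_monoid_add"
  assumes "Poly_Mapping.keys f \<subseteq> {i, j, k}" "i \<noteq> j" "i \<noteq> k" "j \<noteq> k"
  shows "f = Poly_Mapping.single i (Poly_Mapping.lookup f i)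
    + (Poly_Mapping.single j (Poly_Mapping.lookup f j) + Poly_Mapping.single k (Poly_Mapping.lookup f k))"
  using poly_mapping_sum_single[OF _ assms(1)] assms(2-4) by simp

lemma sym_zero:
  assumes "sym D k f e" "f = 0"
  shows "filt D (k - 1) e" "a = 0 \<longrightarrow> e = 0"
  using assms by (simp_all add: sym_def)

definition rel1 :: "nat \<Rightarrow> complex operator" where
  "rel1 i = zeu * za i - zq * za (Suc i) - zQ * za (i - 1)"

lemma pb_Z0_closed: "z \<in> Z0 \<Longrightarrow> w \<in> Z0 \<Longrightarrow> z * w \<in> Z0" "z \<in> Z0 \<Longrightarrow> w \<in> Z0 \<Longrightarrow> z - w \<in> Z0" "z \<in> Z0 \<Longrightarrow> w \<in> Z0 \<Longrightarrow> z + w \<in> Z0"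
  by auto

lemmas Z0s = el_Z0 pb_Z0_closed Z0_sc Z0_power

lemma rel1_Z0: "rel1 i \<in> Z0"
  unfolding rel1_def by (intro Z0s)

lemma sc_left0: "e * (sc c * f) = sc c * (e * f :: complex operator)"
  by (metis mult.assoc sc_central)

lemma sc_2_mult: "sc 2 * e = e + (e :: complex operator)"
proof -
  have "sc (1 + 1) * e = e + (e :: complex operator)" by (simp only: sc_add sc_1 distrib_right mult_1_left)
  then show ?thesis by simp
qed

lemma sc_mult_eq_0:
  assumes "sc c * e = 0" "c \<noteq> 0"
  shows "e = (0 :: complex operator)"
proof -
  have "e = sc (1 / c) * (sc c * e)" using assms(2) by (simp flip: mult.assoc sc_mult)
  then show ?thesis using assms(1) by simp
qed

text \<open>The leading terms cancel by \<open>a0_rec\<close>, so at most one letter X, Y remains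
  and the total degree is at most d. With weight -1 and the symmetry under the swap this leaves
  multiples of a_1, which bracketing with q removes.\<close>

lemma rel1_1:
  assumes "2 \<le> d"
  shows "rel1 1 = 0"
proof -
  let ?l = "el_eu * el_a 1 - el_q * el_a 2 - el_Q * el_a 0"
  have z: "rel1 1 = red ?l" by (simp add: rel1_def numeral_2_eq_2)
  have sym: "sym (int d - 2) 2 (eu0 * a0 d 1 - vx * vy * a0 d 2 - vX * vY * a0 d 0) (zeu * za 1 - zq * za 2 - zQ * za 0)"
    using sym_mult[OF sym_eu sym_a[of 1]] sym_mult[OF sym_q sym_a[of 2]] sym_mult[OF sym_Q sym_a[of 0]] assms
    by (intro sym_diff) (simp_all add: algebra_simps)
  have "eu0 * a0 d 1 - vx * vy * a0 d 2 - vX * vY * a0 d 0 = 0"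
    using a0_rec[of 1 d] assms by (simp add: numeral_2_eq_2)
  from sym_zero(1)[OF sym this] have filt: "filt (int d - 2) 1 (rel1 1)"
    unfolding z by simp
  have par: "parity (-1) ?l"
    using parity_mult[OF parity_elements(3,4), of 1] parity_mult[OF parity_elements(1,4), of 2]
      parity_mult[OF parity_elements(2,4), of 0] by (simp add: parity_diff)
  have Sh: "?l \<in> Sh" by (intro Sh_closed el_Sh)
  let ?e1 = "e4 (d - 1) 0 0 1" and ?e2 = "e4 0 (d - 1) 1 0"
  define c where "c = Poly_Mapping.lookup (tr (rel1 1)) ?e1"
  \<comment> \<open>Degree d - 2, at most one letter X, Y and total degree at least d admit only
    x^(d-1) Y and y^(d-1) X.\<close>
  have keys: "Poly_Mapping.keys (tr (rel1 1)) \<subseteq> {?e1, ?e2}"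
  proof
    fix e assume e: "e \<in> Poly_Mapping.keys (tr (rel1 1))"
    obtain m n p r where e4: "e = e4 m n p r" by (rule e4_exhaust)
    have ne: "Poly_Mapping.lookup (col (rel1 1) b0) (m, n, p, r, mat 1) \<noteq> 0"
      using e unfolding e4 in_keys_iff lookup_tr .
    note w = odd_weight[OF weight[OF par Sh ne[unfolded z]]]
    have "int m + int n - int p - int r = int d - 2" "int p + int r \<le> 1"
      using filt_keys[OF filt ne] by simp_all
    moreover from this w(1) have "m + r + (n + p) = d" by simp
    moreover from w(2)[OF this] have "m + r = 0 \<or> n + p = 0" .
    ultimately show "e \<in> {?e1, ?e2}" using assms by (auto simp: e4 e4_inject)
  qed
  have c2: "Poly_Mapping.lookup (tr (rel1 1)) ?e2 = c"
    unfolding c_def lookup_tr by (rule swap_Z0[OF rel1_Z0])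
  have "?e1 \<noteq> ?e2" by (simp add: e4_inject)
  from keys_two[OF keys this] have "tr (rel1 1) = Poly_Mapping.single ?e1 c + Poly_Mapping.single ?e2 c"
    unfolding c_def[symmetric] c2 .
  also have "\<dots> = const c * a0 d 1"
    by (simp add: a0_single const_def distrib_left mult_single)
  also have "\<dots> = tr (sc c * za 1)"
    by (simp only: tr_sc tr_a[OF d_pos])
  finally have eq: "rel1 1 = sc c * za 1"
    by (intro Z0_eqI rel1_Z0 Z0s)
  \<comment> \<open>The terms cancel in pairs, whereas {q, a_1} = a_0; hence \<open>c\<close>
    vanishes.\<close>
  have "pb zq (rel1 1) = (zeu * za 0 + sc 2 * zq * za 1) - (zq * (sc 2 * za 1) + 0 * za 2) - (zQ * 0 + zeu * za 0)"
    unfolding rel1_def using assms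
    by (simp add: pb_right Z0s pb_table pb_q_Q pb_self numeral_2_eq_2)
  then have "pb zq (rel1 1) = 0" by (simp add: sc_left0 mult.assoc)
  then have "sc c * za 0 = 0"
    unfolding eq using d_pos by (simp add: pb_sc_mult Z0s pb_table)
  then have "c = 0" by (rule sc_mult_za_0)
  then show ?thesis using eq by simp
qed

text \<open>{-, Q} sends \<open>rel1 i\<close> to d - i - 1 times \<open>rel1 (Suc i)\<close>, and
  this factor is nonzero as long as i + 1 < d.\<close>

lemma rel1_zero:
  assumes "1 \<le> i" "i < d"
  shows "rel1 i = 0"
  using assms
proof (induction i rule: dec_induct)
  case base
  then show ?case by (intro rel1_1) simp
next
  case (step i)
  have c: "of_nat (d - Suc i) = of_nat d - of_nat i - (1 :: complex)" "of_nat (d - i) = of_nat d - (of_nat i :: complex)"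
    "of_nat (d - (i - 1)) = of_nat d - of_nat i + (1 :: complex)" using step by (simp_all add: of_nat_diff)
  have "pb (rel1 i) zQ = (zeu * (sc (of_nat (d - i)) * za (Suc i)) + sc 2 * zQ * za i)
      - (zq * (sc (of_nat (d - Suc i)) * za (Suc (Suc i))) + zeu * za (Suc i))
      - (zQ * (sc (of_nat (d - (i - 1))) * za (Suc (i - 1))) + 0 * za (i - 1))"
    unfolding rel1_def using step by (simp add: pb_diff pb_mult Z0s pb_table pb_q_Q pb_self pb_a_Q)
  also have "\<dots> = sc (of_nat (d - Suc i)) * rel1 (Suc i)"
    using step(1) unfolding rel1_def c by (simp add: sc_left0 sc_diff sc_add algebra_simps flip: mult_2) (simp add: sc_2_mult mult_2)
  \<comment> \<open>0 is written as \<open>sc 0 * rel1 i\<close>, so that linearity of the bracket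
    shows the bracket of 0 to be 0.\<close>
  finally have "sc (of_nat (d - Suc i)) * rel1 (Suc i) = pb (sc 0 * rel1 i) zQ"
    using step by simp
  also have "\<dots> = 0" by (simp only: pb_sc_mult Z0s rel1_Z0) simp
  finally have "sc (of_nat (d - Suc i)) * rel1 (Suc i) = 0" .
  moreover have "complex_of_nat (d - Suc i) \<noteq> 0"
    using step.prems unfolding of_nat_eq_0_iff by simp
  ultimately show ?case by (rule sc_mult_eq_0)
qed

text \<open>The same method in weight 1. The difference has total degree below 2d, so its truncation
  is a combination of q^(d-2) and q^(d-2) eu. Bracketing with q removes the second summand but
  cannot detect the first, which is the origin of \<kappa>.\<close>

lemma hessian_relation:
  assumes "2 \<le> d"
  obtains \<kappa> where "a = 0 \<longrightarrow> \<kappa> = 0"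
    "za 0 * za 2 - za 1 * za 1 = (zeu * zeu - sc 4 * (zq * zQ)) * zq ^ (d - 2) + sc \<kappa> * zq ^ (d - 2)"
proof -
  let ?n = "d - 2"
  let ?l = "el_a 0 * el_a 2 - el_a 1 * el_a 1 - (el_eu * el_eu - cc 4 * (el_q * el_Q)) * el_q ^ ?n"
  define z where "z = za 0 * za 2 - za 1 * za 1 - (zeu * zeu - sc 4 * (zq * zQ)) * zq ^ ?n"
  have z: "z = red ?l" by (simp add: z_def)
  have Z0: "z \<in> Z0" unfolding z_def by (intro Z0s)
  let ?f = "a0 d 0 * a0 d 2 - a0 d 1 * a0 d 1 - (eu0 * eu0 - const 4 * (vx * vy * (vX * vY))) * (vx * vy) ^ ?n"
  have sym: "sym (2 * int d - 4) 2 ?f z"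
  proof -
    have "sym 0 2 (eu0 * eu0 - const 4 * (vx * vy * (vX * vY))) (zeu * zeu - sc 4 * (zq * zQ))"
      using sym_mult[OF sym_eu sym_eu] sym_mult[OF sym_sc sym_mult[OF sym_q sym_Q], of 4]
      by (intro sym_diff) simp_all
    from sym_mult[OF this sym_power[OF sym_q, of ?n]]
    have "sym (2 * int d - 4) 2 ((eu0 * eu0 - const 4 * (vx * vy * (vX * vY))) * (vx * vy) ^ ?n)
      ((zeu * zeu - sc 4 * (zq * zQ)) * zq ^ ?n)"
      using assms by (simp add: of_nat_diff algebra_simps)
    then show ?thesis unfolding z_def
      using sym_mult[OF sym_a[of 0] sym_a[of 2]] sym_mult[OF sym_a[of 1] sym_a[of 1]] assms
      by (intro sym_diff) (simp_all add: algebra_simps)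
  qed
  have "?f = 0" using a0_hessian[OF assms] by (simp add: power2_eq_square)
  from sym_zero[OF sym this] have filt: "filt (2 * int d - 4) 1 z" and a_0: "a = 0 \<longrightarrow> z = 0"
    by simp_all
  have par: "parity 1 ?l"
  proof -
    have "parity 1 (el_eu * el_eu)" "parity 1 (cc 4 * (el_q * el_Q))" "parity 1 (el_q ^ ?n)"
      using parity_mult[OF parity_elements(3,3)] parity_power[OF parity_elements(1), of ?n]
        parity_mult[OF parity_cc parity_mult[OF parity_elements(1,2)], of 4] by simp_all
    then have "parity 1 ((el_eu * el_eu - cc 4 * (el_q * el_Q)) * el_q ^ ?n)"
      using parity_mult[OF parity_diff] by fastforce
    moreover have "parity 1 (el_a 0 * el_a 2)" "parity 1 (el_a 1 * el_a 1)"
      using parity_mult[OF parity_elements(4,4), of 0 2] parity_mult[OF parity_elements(4,4), of 1 1] by simp_all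
    ultimately show ?thesis by (intro parity_diff)
  qed
  have Sh: "?l \<in> Sh" by (intro Sh_closed el_Sh Sh_gens Sh_power)
  let ?e0 = "e4 ?n ?n 0 0" and ?e1 = "e4 (d - 1) ?n 1 0" and ?e2 = "e4 ?n (d - 1) 0 1"
  define \<kappa> where "\<kappa> = Poly_Mapping.lookup (tr z) ?e0"
  define c where "c = Poly_Mapping.lookup (tr z) ?e1"
  \<comment> \<open>Weight 1 makes the number of x, Y equal to the number of y, X; the degree is 2d
    - 4, with at most one letter X, Y.\<close>
  have keys: "Poly_Mapping.keys (tr z) \<subseteq> {?e0, ?e1, ?e2}"
  proof
    fix e assume e: "e \<in> Poly_Mapping.keys (tr z)"
    obtain m n p r where e4: "e = e4 m n p r" by (rule e4_exhaust)
    have ne: "Poly_Mapping.lookup (col z b0) (m, n, p, r, mat 1) \<noteq> 0"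
      using e unfolding e4 in_keys_iff lookup_tr .
    have deg: "int m + int n - int p - int r = 2 * int d - 4" "int p + int r \<le> 1"
      using filt_keys[OF filt ne] by simp_all
    then have "m + r + (n + p) < 2 * d" by simp
    from even_weight[OF weight[OF par Sh ne[unfolded z]] this] have "m + r = n + p" .
    with deg assms have "m = ?n \<and> n = ?n \<and> p = 0 \<and> r = 0 \<or> m = d - 1 \<and> n = ?n \<and> p = 1 \<and> r = 0
        \<or> m = ?n \<and> n = d - 1 \<and> p = 0 \<and> r = 1" by linarith
    then show "e \<in> {?e0, ?e1, ?e2}" by (auto simp: e4)
  qed
  have c2: "Poly_Mapping.lookup (tr z) ?e2 = c"
    unfolding c_def lookup_tr by (rule swap_Z0[OF Z0])
  have "?e0 \<noteq> ?e1" "?e0 \<noteq> ?e2" "?e1 \<noteq> ?e2" by (simp_all add: e4_inject)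
  from keys_three[OF keys this] have "tr z = Poly_Mapping.single ?e0 \<kappa> + (Poly_Mapping.single ?e1 c + Poly_Mapping.single ?e2 c)"
    unfolding c_def[symmetric] \<kappa>_def[symmetric] c2 .
  also have "\<dots> = const \<kappa> * (vx * vy) ^ ?n + const c * ((vx * vy) ^ ?n * eu0)"
  proof -
    have "d - 1 = Suc ?n" using assms by simp
    then have "Poly_Mapping.single ?e0 1 = (vx * vy) ^ ?n"
      "Poly_Mapping.single ?e1 1 + Poly_Mapping.single ?e2 1 = (vx * vy) ^ ?n * eu0"
      by (simp_all add: eu0_def power_mult_distrib algebra_simps flip: monomial_e4)
    moreover have "Poly_Mapping.single e c' = const c' * Poly_Mapping.single e 1" for e :: "coord \<Rightarrow>\<^sub>0 nat" and c'
      by (simp add: const_def mult_single)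
    ultimately show ?thesis by (metis distrib_left)
  qed
  also have "\<dots> = tr (sc \<kappa> * zq ^ ?n + sc c * (zq ^ ?n * zeu))"
    using tr_q_power[of ?n 1] unfolding mult_1_right tr_one by (simp only: tr_add tr_sc tr_q_power tr_eu)
  finally have eq: "z = sc \<kappa> * zq ^ ?n + sc c * (zq ^ ?n * zeu)"
    by (intro Z0_eqI Z0 Z0s)
  have pbq: "pb zq (zq ^ n) = 0" for n
  proof (induction n)
    case 0
    then show ?case using pb_anti[OF Z0_sc zq_Z0, of 1] pb_sc[OF zq_Z0, of 1] by simp
  next
    case (Suc n)
    then show ?case by (simp add: pb_right Z0s pb_self)
  qed
  \<comment> \<open>The brackets of q with a_0, a_1, a_2 are 0, a_0, 2 a_1, and {q, -} kills eu^2 -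
    4qQ. Since {q, eu} = 2q, the coefficient \<open>c\<close> has to vanish.\<close>
  have "pb zq z = (za 0 * (sc 2 * za 1) + 0 * za 2) - (za 1 * za 0 + za 0 * za 1)
      - ((zeu * zeu - sc 4 * (zq * zQ)) * 0 + (zeu * (sc 2 * zq) + sc 2 * zq * zeu - sc 4 * (zq * zeu + 0 * zQ)) * zq ^ ?n)"
    unfolding z_def using assms
    by (simp add: pb_right pb_sc_mult pb_sc_right Z0s pb_table pb_q_Q pb_self pbq numeral_2_eq_2)
  also have "\<dots> = 0"
  proof -
    have "za 1 * za 0 = za 0 * za 1" "zeu * zq = zq * zeu" by (intro Z0_mult_commute Z0s)+
    moreover have "sc 4 * e = e + e + (e + e)" for e :: "complex operator"
    proof -
      have "sc (2 * 2) * e = sc 2 * (sc 2 * e)" by (simp only: sc_mult mult.assoc)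
      then show ?thesis by (simp add: sc_2_mult)
    qed
    ultimately show ?thesis by (simp add: sc_left0 distrib_left distrib_right mult.assoc sc_2_mult)
  qed
  finally have "pb zq z = 0" .
  moreover have "pb zq z = sc c * (zq ^ ?n * (sc 2 * zq))"
  proof -
    have "pb zq (sc \<kappa> * zq ^ ?n + sc c * (zq ^ ?n * zeu)) = sc \<kappa> * pb zq (zq ^ ?n) + sc c * pb zq (zq ^ ?n * zeu)"
      by (subst pb_right(1), (intro Z0s)+, subst pb_sc_mult(2), (intro Z0s)+, subst pb_sc_mult(2), (intro Z0s)+, rule refl)
    also have "pb zq (zq ^ ?n * zeu) = pb zq (zq ^ ?n) * zeu + zq ^ ?n * pb zq zeu"
      by (subst pb_right(3)) (simp_all add: Z0s add.commute)
    finally show ?thesis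
      by (simp only: eq[symmetric] pbq pb_table(2) mult_zero_left mult_zero_right add_0_left)
  qed
  moreover have "sc c * (zq ^ ?n * (sc 2 * zq)) = sc (c * 2) * zq ^ Suc ?n"
    by (simp only: sc_left0[of "zq ^ ?n"] sc_mult mult.assoc power_Suc2)
  ultimately have "sc (c * 2) * zq ^ Suc ?n = 0" by simp
  then have "c * 2 = 0" by (rule sc_mult_zq)
  then have zk: "z = sc \<kappa> * zq ^ ?n" using eq by simp
  show ?thesis
  proof (rule that)
    \<comment> \<open>At a = 0 an element equals its leading part exactly, and the leading part of
      \<open>z\<close> is 0.\<close>
    show "a = 0 \<longrightarrow> \<kappa> = 0" using a_0 zk sc_mult_zq by metis
    show "za 0 * za 2 - za 1 * za 1 = (zeu * zeu - sc 4 * (zq * zQ)) * zq ^ ?n + sc \<kappa> * zq ^ ?n"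
      using zk unfolding z_def by (simp add: algebra_simps)
  qed
qed

definition telt :: "tvar \<Rightarrow> complex operator" where
  "telt v = (case v of T0 \<Rightarrow> zeu | T1 \<Rightarrow> zq | T2 \<Rightarrow> zQ)"

abbreviation "qev \<equiv> tvar_eval telt sc"

lemma telt_Z0: "telt v \<in> Z0"
  by (cases v) (simp_all add: telt_def el_Z0)

lemma qev_hom: "tvar_eval_hom telt sc"
proof unfold_locales
  show "e * sc b = sc b * e" for e :: "complex operator" and b by (rule sc_central)
  show "telt v * telt w = telt w * telt v" for v w by (intro Z0_mult_commute telt_Z0)
qed (simp_all add: sc_add sc_mult)

lemmas qev_simps = tvar_eval_hom.eval_simps[OF qev_hom] tvar_eval_hom.eval_diff[OF qev_hom]

lemma qev_Z0: "qev P \<in> Z0"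
  by (induction P rule: mpoly_induct) (auto simp: qev_simps telt_Z0)

text \<open>Multiplication by x or y shifts exponents without loss; this permits cancelling q in the
  recursions.\<close>

lemma op_xy_regular: "op_x * e = op_x * f \<Longrightarrow> e = f" "op_y * e = op_y * f \<Longrightarrow> e = (f :: complex operator)"
proof -
  have x: "Poly_Mapping.lookup (app op_x \<mu>) (Suc m, n, p, r, w) = Poly_Mapping.lookup \<mu> (m, n, p, r, w)"
    and y: "Poly_Mapping.lookup (app op_y \<mu>) (m, Suc n, p, r, w) = Poly_Mapping.lookup \<mu> (m, n, p, r, w)"
    for \<mu> :: "pbw_index \<Rightarrow>\<^sub>0 complex" and m n p r w
  proof -
    show "Poly_Mapping.lookup (app op_x \<mu>) (Suc m, n, p, r, w) = Poly_Mapping.lookup \<mu> (m, n, p, r, w)"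
      by (simp add: lookup_op_x)
    show "Poly_Mapping.lookup (app op_y \<mu>) (m, Suc n, p, r, w) = Poly_Mapping.lookup \<mu> (m, n, p, r, w)"
    proof (induction \<mu> rule: poly_mapping_induct_single)
      case (single b c)
      obtain m' n' p' r' w' where "b = (m', n', p', r', w')" by (cases b)
      then show ?case by (auto simp: lookup_single when_def)
    qed (simp_all add: app_add lookup_add)
  qed
  show "op_x * e = op_x * f \<Longrightarrow> e = f" "op_y * e = op_y * f \<Longrightarrow> e = f"
    by (intro operator_eqI poly_mapping_eqI; metis col_simps(6) x y prod_cases5)+
qed

lemma quantum_model:
  obtains \<kappa> where "a = 0 \<longrightarrow> \<kappa> = 0"
    "bracket_model qev za (\<lambda>i j. pb (za i) (za j)) (\<lambda>z. pb z zQ) d \<kappa>"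
proof -
  obtain \<kappa> where \<kappa>: "a = 0 \<longrightarrow> \<kappa> = 0"
    "2 \<le> d \<Longrightarrow> za 0 * za 2 - za 1 * za 1 = (zeu * zeu - sc 4 * (zq * zQ)) * zq ^ (d - 2) + sc \<kappa> * zq ^ (d - 2)"
  proof (cases "2 \<le> d")
    case True
    then show thesis using that by (rule hessian_relation)
  next
    case False
    \<comment> \<open>For \<open>d = 1\<close> the Hessian relation is vacuous, and 0 serves as
      \<kappa>.\<close>
    then show thesis using that[of 0] by simp
  qed
  have "bracket_model qev za (\<lambda>i j. pb (za i) (za j)) (\<lambda>z. pb z zQ) d \<kappa>"
  proof unfold_locales
    show "qev P * za i = za i * qev P" for P i by (intro Z0_mult_commute qev_Z0 el_Z0)
    show "za i * za j = za j * za i" for i j by (intro Z0_mult_commute el_Z0)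
    show "qev t1 * e = qev t1 * f \<Longrightarrow> e = f" for e f
      by (simp add: qev_simps telt_def el_q_def mult.assoc) (blast dest: op_xy_regular)
    show rec: "qev t0 * za i = qev t1 * za (Suc i) + qev t2 * za (i - 1)" if "1 \<le> i" "i < d" for i
      using rel1_zero[OF that] by (simp add: qev_simps telt_def rel1_def algebra_simps)
    show "za 0 * za 2 - za 1 * za 1 = qev ((casimir + const \<kappa>) * t1 ^ (d - 2))" if "2 \<le> d"
      unfolding \<kappa>(2)[OF that] by (simp add: qev_simps telt_def casimir_def power2_eq_square distrib_right)
    show "pb (za 0) (za 1) = qev (const (of_nat (2 * d)) * t1 ^ (d - 1))"
      unfolding pb_table(7) qev_simps by (simp add: telt_def)
    show "qev t1 * pb (za 0) (za (Suc j)) = qev t0 * pb (za 0) (za j) + qev (const (of_nat d)) * (za 0 * za j)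
        - qev t2 * pb (za 0) (za (j - 1)) - qev (const (of_nat d)) * (za 1 * za (j - 1))" if "1 \<le> j" "j < d" for j
    proof -
      have "zeu * za j = zq * za (Suc j) + zQ * za (j - 1)"
        using rec[OF that] by (simp add: qev_simps telt_def)
      then have "pb (za 0) (zeu * za j) = pb (za 0) (zq * za (Suc j) + zQ * za (j - 1))" by simp
      then have "zeu * pb (za 0) (za j) + sc (of_nat d) * za 0 * za j
          = zq * pb (za 0) (za (Suc j)) + (zQ * pb (za 0) (za (j - 1)) + sc (of_nat d) * za 1 * za (j - 1))"
        using pb_a_Q[of 0] by (simp add: pb_right Z0s pb_table)
      then show ?thesis by (simp add: qev_simps telt_def algebra_simps)
    qed
    show "pb (pb (za i) (za j)) zQ = qev (const (of_nat (d - i))) * pb (za (Suc i)) (za j)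
        + qev (const (of_nat (d - j))) * pb (za i) (za (Suc j))" if "i \<le> d" "j \<le> d" for i j
      using that by (simp add: pb_jacobi el_Z0 pb_a_Q pb_sc_mult qev_simps)
    show "pb (qev P) zQ = qev (bder P)" for P
      by (rule tvar_eval_hom.eval_derivation[OF qev_hom])
        (simp_all add: pb_add pb_mult pb_sc qev_Z0 el_Z0 telt_def pb_table pb_q_Q pb_self)
    show "pb (za 0) (za 0) = 0" by (rule pb_self[OF za_Z0])
  qed (simp_all add: qev_simps)
  with \<kappa>(1) show ?thesis by (rule that)
qed

section \<open>The bracket of the elements \<open>a_i\<close>\<close>

text \<open>Resolves the definite descriptions of \<open>eu\<close> and \<open>aelt\<close>: the
  class of a lift of the operator has the required properties, and \<open>Z0_eqI\<close> with
  \<open>Psi_inj\<close> makes it unique.\<close>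

lemma central_elt:
  assumes l: "l \<in> Sh" "red l \<in> Z0" and f: "tr (red l) = f"
  shows "(THE z. z \<in> Zc d \<zeta> a \<and> Trunc d \<zeta> a z = f) \<in> Zc d \<zeta> a"
    "Psi (THE z. z \<in> Zc d \<zeta> a \<and> Trunc d \<zeta> a z = f) = red l"
proof -
  obtain F where F: "F \<in> carrier R" "l = phi F" using l by (auto simp: Sh_def)
  have z: "\<rho> F \<in> Zc d \<zeta> a \<and> Trunc d \<zeta> a (\<rho> F) = f"
    using F l f by (simp add: Zc_iff Trunc_eq)
  have "(THE z. z \<in> Zc d \<zeta> a \<and> Trunc d \<zeta> a z = f) = \<rho> F"
  proof (rule the_equality)
    show "\<rho> F \<in> Zc d \<zeta> a \<and> Trunc d \<zeta> a (\<rho> F) = f" by (rule z)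
  next
    fix z assume "z \<in> Zc d \<zeta> a \<and> Trunc d \<zeta> a z = f"
    then have "z \<in> carrier C" "Psi z \<in> Z0" "tr (Psi z) = f" by (auto simp: Zc_iff Trunc_eq)
    then have "Psi z = red l" using l f by (intro Z0_eqI) auto
    then show "z = \<rho> F" using \<open>z \<in> carrier C\<close> F by (intro Psi_inj) auto
  qed
  then show "(THE z. z \<in> Zc d \<zeta> a \<and> Trunc d \<zeta> a z = f) \<in> Zc d \<zeta> a"
    "Psi (THE z. z \<in> Zc d \<zeta> a \<and> Trunc d \<zeta> a z = f) = red l"
    using z F by simp_all
qed

lemma eu_elt: "eu d \<zeta> a \<in> Zc d \<zeta> a" "Psi (eu d \<zeta> a) = zeu"
  unfolding eu_def by (rule central_elt[OF el_Sh(3) zeu_Z0 tr_eu])+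

lemma aelt_elt:
  assumes "j \<le> d"
  shows "aelt d \<zeta> a j \<in> Zc d \<zeta> a" "Psi (aelt d \<zeta> a j) = za j"
  unfolding aelt_def by (rule central_elt[OF el_Sh(4) za_Z0 tr_a[OF assms]])+

lemma qQ_elt: "qelt d \<zeta> a \<in> carrier C" "Psi (qelt d \<zeta> a) = zq" "Qelt d \<zeta> a \<in> carrier C" "Psi (Qelt d \<zeta> a) = zQ"
proof -
  interpret ring C by (rule ring_C)
  show "qelt d \<zeta> a \<in> carrier C" "Psi (qelt d \<zeta> a) = zq" "Qelt d \<zeta> a \<in> carrier C" "Psi (Qelt d \<zeta> a) = zQ"
    by (simp_all add: qelt_def Qelt_def gen_def Psi_mult el_q_def el_Q_def)
qed

lemma evalc_elt:
  "evalc d \<zeta> a P (eu d \<zeta> a) (qelt d \<zeta> a) (Qelt d \<zeta> a) \<in> carrier C"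
  "Psi (evalc d \<zeta> a P (eu d \<zeta> a) (qelt d \<zeta> a) (Qelt d \<zeta> a)) = qev P"
proof -
  interpret ring C by (rule ring_C)
  have eu: "eu d \<zeta> a \<in> carrier C" using eu_elt by (simp add: Zc_iff)
  show "evalc d \<zeta> a P (eu d \<zeta> a) (qelt d \<zeta> a) (Qelt d \<zeta> a) \<in> carrier C"
    unfolding evalc_def by (rule finsum_closed) (simp add: eu qQ_elt)
  show "Psi (evalc d \<zeta> a P (eu d \<zeta> a) (qelt d \<zeta> a) (Qelt d \<zeta> a)) = qev P"
    unfolding evalc_def tvar_eval_def pm_eval_def
    by (subst Psi_finsum)
      (simp_all add: eu qQ_elt eu_elt Psi_mult Psi_pow telt_def mult.assoc)
qed

end

theorem proposition2p10:
  fixes d i j :: nat and \<zeta> a :: complex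
  assumes "d \<ge> 1" and "primitive_root_of_unity d \<zeta>" and "i < j" and "j \<le> d"
  shows "\<exists>\<Phi> :: tvar mpoly. homogeneous (int d - 3) \<Phi> \<and>
    poisson d \<zeta> a (aelt d \<zeta> a i) (aelt d \<zeta> a j) =
      evalc d \<zeta> a (Pi_poly d i j) (eu d \<zeta> a) (qelt d \<zeta> a) (Qelt d \<zeta> a)
      \<oplus>\<^bsub>Hc d \<zeta> a\<^esub>
      scalar d \<zeta> a (a\<^sup>2) \<otimes>\<^bsub>Hc d \<zeta> a\<^esub>
        evalc d \<zeta> a \<Phi> (eu d \<zeta> a) (qelt d \<zeta> a) (Qelt d \<zeta> a)"
proof -
  interpret cherednik d \<zeta> a by unfold_locales (fact assms)+
  interpret C: ring C by (rule ring_C)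
  obtain \<kappa> where \<kappa>: "a = 0 \<longrightarrow> \<kappa> = 0"
    and model: "bracket_model qev za (\<lambda>i j. pb (za i) (za j)) (\<lambda>z. pb z zQ) d \<kappa>"
    by (rule quantum_model)
  \<comment> \<open>The quotient \<open>\<kappa> / a\<^sup>2\<close> cancels against the factor
    \<open>a\<^sup>2\<close> of the statement. For \<open>a = 0\<close> also \<kappa> = 0, so both
    sides of that cancellation are 0.\<close>
  define \<Phi> where "\<Phi> = const (\<kappa> / a\<^sup>2) * Bpoly d 1 0 i j"
  have "homogeneous (int d - 3) \<Phi>"
    unfolding \<Phi>_def by (rule homogeneous_const_mult[OF homogeneous_Bpoly[OF assms(4)]])
  moreover have "poisson d \<zeta> a (aelt d \<zeta> a i) (aelt d \<zeta> a j) =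
      evalc d \<zeta> a (Pi_poly d i j) (eu d \<zeta> a) (qelt d \<zeta> a) (Qelt d \<zeta> a)
      \<oplus>\<^bsub>C\<^esub> scalar d \<zeta> a (a\<^sup>2) \<otimes>\<^bsub>C\<^esub> evalc d \<zeta> a \<Phi> (eu d \<zeta> a) (qelt d \<zeta> a) (Qelt d \<zeta> a)"
    (is "?l = ?r")
  proof (rule Psi_inj)
    have ij: "i \<le> d" "i \<le> j" using assms by simp_all
    note z = aelt_elt(1)[OF ij(1)] aelt_elt(1)[OF assms(4)]
    show "?l \<in> carrier C" by (rule poisson_eq(1)[OF z])
    show "?r \<in> carrier C" by (simp add: evalc_elt)
    have "Psi ?l = pb (za i) (za j)"
      using poisson_eq(2)[OF z] aelt_elt(2) ij assms by simp
    also have "\<dots> = qev (Bpoly d (casimir + const \<kappa>) (of_nat (2 * d)) i j)"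
      by (rule bracket_model.br_eq[OF model ij(2) assms(4)])
    also have "\<dots> = qev (Pi_poly d i j) + sc \<kappa> * qev (Bpoly d 1 0 i j)"
      unfolding Bpoly_split Pi_poly_eq[OF assms(1) ij(2) assms(4)] by (simp add: qev_simps)
    also have "sc \<kappa> * qev (Bpoly d 1 0 i j) = sc (a\<^sup>2) * qev \<Phi>"
      using \<kappa> by (cases "a = 0") (simp_all add: \<Phi>_def qev_simps flip: mult.assoc sc_mult)
    also have "qev (Pi_poly d i j) + sc (a\<^sup>2) * qev \<Phi> = Psi ?r"
      by (simp add: Psi_add Psi_mult evalc_elt)
    finally show "Psi ?l = Psi ?r" .
  qed
  ultimately show ?thesis by blast
qed

end
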